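(* Let $D\subset\mathbb R^d$ be a bounded Lipschitz domain, and let $b:D\to[0,\infty)$ be bounded and Borel with $\int_D b\,dm>0$, such that there is a Lipschitz domain $D_0\subset D$ with $\{b=0\}=\overline{D_0}$ and $\inf_{K}b>0$ for every compact $K\subset D\setminus\overline{D_0}$. Let $c:D\to[0,\infty)$ be bounded and Borel, and let $\{q_k\}_{k\ge1}$ be an increasing sequence of bounded nonnegative Borel functions on $D$ such that $\mathrm{supp}[q_k]\subset D\setminus\overline{D_0}$ for every $k\ge1$ and, for every compact $K\subset D\setminus\overline{D_0}$, $\inf_{x\in K}q_k(x)\nearrow\infty$ as $k\to\infty$. Let $\psi^c_k$ be the principal eigenfunction of $-(\Delta^\alpha)_{|D}+c+q_k$ and let $\psi^c$ be the principal eigenfunction of $-(\Delta^\alpha)_{|D_0}+c$. Then $$\lambda_1^D[c+q_k]\nearrow\lambda_1^{D_0}[c]\quad\text{as }k\to\infty,$$ and there exists a subsequence $\{k_n\}$ such that $\psi^c_{k_n}(x)\to\psi^c(x)$ for q.e. $x\in D_0$.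
   Context: $d\ge2$, $\alpha\in(0,1)$, $m$ is Lebesgue measure. $\mathcal E(u,v)=\int_{\mathbb R^d}|\xi|^{2\alpha}\hat u(\xi)\overline{\hat v(\xi)}\,d\xi$ (unitary Fourier transform) on $H^\alpha(\mathbb R^d)=\{u\in L^2(\mathbb R^d):\int|\xi|^{2\alpha}|\hat u|^2d\xi<\infty\}$. For a bounded open set $V\subset\mathbb R^d$, $H^\alpha_0(V)$ is the closure of $C_c^\infty(V)$ in $H^\alpha(\mathbb R^d)$ (functions extended by zero), $\mathcal E_V$ is the restriction of $\mathcal E$ to $H_0^\alpha(V)$, and $(\Delta^\alpha)_{|V}$ (Dirichlet fractional Laplacian) is the self-adjoint operator on $L^2(V;m)$ with domain contained in $H_0^\alpha(V)$ and $\mathcal E_V(u,v)=(-(\Delta^\alpha)_{|V}u,v)_{L^2}$ for $u$ in its domain and $v\in H^\alpha_0(V)$. For bounded Borel $q\ge0$, $\lambda_1^V[q]$ is the principal (first) eigenvalue of $-(\Delta^\alpha)_{|V}+q$ (with $q$ restricted to $V$), i.e. $\lambda^V_1[q]=\inf\{\mathcal E_V(u,u)+(qu,u):u\in H_0^\alpha(V),\|u\|_{L^2(V)}=1\}$. The principal eigenfunction is the unique strictly positive continuous eigenfunction for $\lambda_1^V[q]$ with $L^2(V;m)$-norm $1$. "q.e." means outside a set of zero capacity, where $\mathrm{Cap}(U)=\inf\{\mathcal E(u,u)+\|u\|_{L^2}^2:u\in H^\alpha(\mathbb R^d),u\ge1\text{ a.e. on }U\}$ for $U$ open, and $\mathrm{Cap}(B)=\inf\{\mathrm{Cap}(U):U\supset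 B\text{ open}\}$. *)

theory Defs
  imports "HOL-Analysis.Analysis"
begin

text \<open>
  The ambient space \<open>\<real>\<^sup>d\<close> is a type of class \<open>euclidean_space\<close>. Elements of \<open>L\<^sup>2\<close> are represented by
  real-valued Borel functions (not by classes modulo null sets); every notion below that is meant for
  classes is invariant under changing a function on a Lebesgue null set. Functions on a subset of
  \<open>\<real>\<^sup>d\<close> are extended by zero.
\<close>

text \<open>
  Near each boundary point, the set is the part of a ball lying above the graph of a Lipschitz
  function on the hyperplane orthogonal to some unit vector \<open>e\<close>.
\<close>

definition lipschitz_domain :: "'a::euclidean_space set \<Rightarrow> bool" where
  "lipschitz_domain V \<longleftrightarrow> open V \<and> connected V \<and> V \<noteq> {} \<and>
     (\<forall>z\<in>frontier V. \<exists>r>0. \<exists>L e. \<exists>g :: 'a \<Rightarrow> real.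
        norm e = 1 \<and> L-lipschitz_on {y. y \<bullet> e = 0} g \<and>
        V \<inter> ball z r = {x \<in> ball z r. x \<bullet> e > g (x - (x \<bullet> e) *\<^sub>R e)})"

fun C_k :: "nat \<Rightarrow> ('a::euclidean_space \<Rightarrow> real) \<Rightarrow> bool" where
  "C_k 0 f \<longleftrightarrow> continuous_on UNIV f"
| "C_k (Suc k) f \<longleftrightarrow> (\<forall>x. f differentiable (at x)) \<and>
     (\<forall>h. C_k k (\<lambda>x. frechet_derivative f (at x) h))"

definition test_functions :: "'a::euclidean_space set \<Rightarrow> ('a \<Rightarrow> real) set" where
  "test_functions V = {\<phi>. (\<forall>k. C_k k \<phi>) \<and>
     compact (closure {x. \<phi> x \<noteq> 0}) \<and> closure {x. \<phi> x \<noteq> 0} \<subseteq> V}"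

definition L2_space :: "('a::euclidean_space \<Rightarrow> real) set" where
  "L2_space = {u \<in> borel_measurable lborel. integrable lborel (\<lambda>x. (u x)\<^sup>2)}"

definition fourier_L1 :: "('a::euclidean_space \<Rightarrow> real) \<Rightarrow> 'a \<Rightarrow> complex" where
  "fourier_L1 u \<xi> = complex_of_real ((2 * pi) powr (- real DIM('a) / 2)) *
     (LINT x|lborel. exp (- (\<i> * complex_of_real (x \<bullet> \<xi>))) * complex_of_real (u x))"

text \<open>
  For \<open>u \<in> L\<^sup>2\<close>, the Plancherel transform is the \<open>L\<^sup>2\<close>-limit of the transforms of the truncations of \<open>u\<close>
  to balls; \<open>SOME\<close> selects a representative of this limit, which is unique almost everywhere.
\<close>

definition fourier :: "('a::euclidean_space \<Rightarrow> real) \<Rightarrow> 'a \<Rightarrow> complex" where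
  "fourier u = (SOME g. g \<in> borel_measurable lborel \<and>
     integrable lborel (\<lambda>\<xi>. (cmod (g \<xi>))\<^sup>2) \<and>
     (\<lambda>n. \<integral>\<^sup>+ \<xi>. ennreal ((cmod (fourier_L1 (\<lambda>x. indicator (ball 0 (real n)) x * u x) \<xi> - g \<xi>))\<^sup>2) \<partial>lborel)
       \<longlonglongrightarrow> 0)"

definition frac_form :: "real \<Rightarrow> ('a::euclidean_space \<Rightarrow> real) \<Rightarrow> ('a \<Rightarrow> real) \<Rightarrow> complex" where
  "frac_form \<alpha> u v =
     (LINT \<xi>|lborel. complex_of_real (norm \<xi> powr (2 * \<alpha>)) * fourier u \<xi> * cnj (fourier v \<xi>))"

definition H_frac :: "real \<Rightarrow> ('a::euclidean_space \<Rightarrow> real) set" where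
  "H_frac \<alpha> = {u \<in> L2_space.
     integrable lborel (\<lambda>\<xi>. norm \<xi> powr (2 * \<alpha>) * (cmod (fourier u \<xi>))\<^sup>2)}"

text \<open>The squared Hilbert norm \<open>\<E>(u,u) + \<parallel>u\<parallel>\<^sup>2\<close> of \<open>H\<^sup>\<alpha>(\<real>\<^sup>d)\<close>; \<open>\<E>(u,u)\<close> is real and nonnegative.\<close>

definition H_frac_normsq :: "real \<Rightarrow> ('a::euclidean_space \<Rightarrow> real) \<Rightarrow> real" where
  "H_frac_normsq \<alpha> u = Re (frac_form \<alpha> u u) + (LINT x|lborel. (u x)\<^sup>2)"

definition H0_frac :: "real \<Rightarrow> 'a::euclidean_space set \<Rightarrow> ('a \<Rightarrow> real) set" where
  "H0_frac \<alpha> V = {u \<in> H_frac \<alpha>. \<exists>\<phi>. (\<forall>n. \<phi> n \<in> test_functions V) \<and>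
     (\<lambda>n. H_frac_normsq \<alpha> (\<lambda>x. u x - \<phi> n x)) \<longlonglongrightarrow> 0}"

definition L2_on :: "'a::euclidean_space set \<Rightarrow> ('a \<Rightarrow> real) set" where
  "L2_on V = {u \<in> L2_space. AE x in lborel. x \<notin> V \<longrightarrow> u x = 0}"

definition L2_inner :: "'a::euclidean_space set \<Rightarrow> ('a \<Rightarrow> real) \<Rightarrow> ('a \<Rightarrow> real) \<Rightarrow> real" where
  "L2_inner V u v = (LINT x:V|lborel. u x * v x)"

text \<open>
  Unbounded operators on \<open>L\<^sup>2(V)\<close> are given by their graphs; self-adjoint means densely defined and
  equal to the adjoint. The graph is saturated under almost everywhere equality, and it is
  single-valued up to almost everywhere equality because of the density of the domain.
\<close>

definition self_adjoint_graph :: "'a::euclidean_space set \<Rightarrow> (('a \<Rightarrow> real) \<times> ('a \<Rightarrow> real)) set \<Rightarrow> bool" where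
  "self_adjoint_graph V A \<longleftrightarrow>
     A \<subseteq> L2_on V \<times> L2_on V \<and>
     (\<forall>u\<in>L2_on V. \<forall>\<epsilon>>0. \<exists>w\<in>Domain A. L2_inner V (\<lambda>x. u x - w x) (\<lambda>x. u x - w x) < \<epsilon>) \<and>
     A = {(v, g). v \<in> L2_on V \<and> g \<in> L2_on V \<and> (\<forall>(u, f)\<in>A. L2_inner V f v = L2_inner V u g)}"

text \<open>
  \<open>(u, f) \<in> dirichlet_frac_laplacian \<alpha> V\<close> means that \<open>u\<close> is in the domain of \<open>(\<Delta>\<^sup>\<alpha>)|V\<close> and is mapped
  to \<open>f\<close>.
\<close>

definition dirichlet_frac_laplacian ::
    "real \<Rightarrow> 'a::euclidean_space set \<Rightarrow> (('a \<Rightarrow> real) \<times> ('a \<Rightarrow> real)) set" where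
  "dirichlet_frac_laplacian \<alpha> V = (THE A. self_adjoint_graph V A \<and>
     Domain A \<subseteq> H0_frac \<alpha> V \<and>
     (\<forall>(u, f)\<in>A. \<forall>v\<in>H0_frac \<alpha> V.
        frac_form \<alpha> u v = complex_of_real (L2_inner V (\<lambda>x. - f x) v)))"

definition principal_eigenvalue :: "real \<Rightarrow> 'a::euclidean_space set \<Rightarrow> ('a \<Rightarrow> real) \<Rightarrow> real" where
  "principal_eigenvalue \<alpha> V q =
     Inf {Re (frac_form \<alpha> u u) + L2_inner V (\<lambda>x. q x * u x) u | u.
            u \<in> H0_frac \<alpha> V \<and> L2_inner V u u = 1}"

definition eigenfunction ::
    "real \<Rightarrow> 'a::euclidean_space set \<Rightarrow> ('a \<Rightarrow> real) \<Rightarrow> real \<Rightarrow> ('a \<Rightarrow> real) \<Rightarrow> bool" where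
  "eigenfunction \<alpha> V q \<mu> u \<longleftrightarrow> \<not> (AE x in lborel. u x = 0) \<and>
     (\<exists>f. (u, f) \<in> dirichlet_frac_laplacian \<alpha> V \<and>
        (AE x in lborel. x \<in> V \<longrightarrow> - f x + q x * u x = \<mu> * u x))"

definition is_principal_eigenfunction ::
    "real \<Rightarrow> 'a::euclidean_space set \<Rightarrow> ('a \<Rightarrow> real) \<Rightarrow> ('a \<Rightarrow> real) \<Rightarrow> bool" where
  "is_principal_eigenfunction \<alpha> V q \<psi> \<longleftrightarrow>
     eigenfunction \<alpha> V q (principal_eigenvalue \<alpha> V q) \<psi> \<and>
     continuous_on V \<psi> \<and> (\<forall>x\<in>V. \<psi> x > 0) \<and> (\<forall>x. x \<notin> V \<longrightarrow> \<psi> x = 0) \<and>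
     L2_inner V \<psi> \<psi> = 1"

text \<open>The infimum is taken in \<open>[0,\<infinity>]\<close>, so that it is \<open>\<infinity>\<close> when there is no admissible \<open>u\<close>.\<close>

definition Cap_open :: "real \<Rightarrow> 'a::euclidean_space set \<Rightarrow> ennreal" where
  "Cap_open \<alpha> U =
     (INF u\<in>{u \<in> H_frac \<alpha>. AE x in lborel. x \<in> U \<longrightarrow> u x \<ge> 1}. ennreal (H_frac_normsq \<alpha> u))"

definition Cap :: "real \<Rightarrow> 'a::euclidean_space set \<Rightarrow> ennreal" where
  "Cap \<alpha> B = (INF U\<in>{U. open U \<and> B \<subseteq> U}. Cap_open \<alpha> U)"

definition quasi_everywhere :: "real \<Rightarrow> 'a::euclidean_space set \<Rightarrow> ('a \<Rightarrow> bool) \<Rightarrow> bool" where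
  "quasi_everywhere \<alpha> S P \<longleftrightarrow> (\<exists>N. Cap \<alpha> N = 0 \<and> (\<forall>x\<in>S - N. P x))"

text \<open>Only the values on \<open>V\<close> matter.\<close>

definition bounded_borel_nonneg_on :: "'a::euclidean_space set \<Rightarrow> ('a \<Rightarrow> real) \<Rightarrow> bool" where
  "bounded_borel_nonneg_on V f \<longleftrightarrow>
     f \<in> borel_measurable (restrict_space borel V) \<and> bounded (f ` V) \<and> (\<forall>x\<in>V. f x \<ge> 0)"

text \<open>The closure is relative to \<open>V\<close>: the support may touch the boundary of \<open>V\<close>.\<close>

definition support_in :: "'a::euclidean_space set \<Rightarrow> ('a \<Rightarrow> real) \<Rightarrow> 'a set" where
  "support_in V f = V \<inter> closure {x \<in> V. f x \<noteq> 0}"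

end

theory Submission
  imports Defs "HOL-Probability.Probability" "HOL-Complex_Analysis.Great_Picard"
begin

text \<open>
  Write \<open>\<lambda>\<^sub>k\<close> for the eigenvalue with potential \<open>c + q\<^sub>k\<close> on \<open>D\<close> and \<open>\<lambda>\<^sub>0\<close> for the one with potential \<open>c\<close> on \<open>D\<^sub>0\<close>. As
  \<open>q\<^sub>k\<close> vanishes on \<open>D\<^sub>0\<close> and increases with \<open>k\<close>, comparing Rayleigh quotients gives \<open>\<lambda>\<^sub>k \<le> \<lambda>\<^sub>k\<^sub>+\<^sub>1 \<le> \<lambda>\<^sub>0\<close>. The
  converse is a compactness argument (\<open>minimising_compactness\<close>). Unit vectors of \<open>H\<^sub>0\<^sup>\<alpha>(D)\<close> with bounded Rayleigh
  quotients have bounded energy, so a subsequence converges in \<open>L\<^sup>2\<close> (\<open>rellich\<close>). Since \<open>q\<^sub>k\<close> blows up on the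
  compact subsets of \<open>D - closure D\<^sub>0\<close>, the limit \<open>w\<close> vanishes off \<open>closure D\<^sub>0\<close>, and since \<open>D\<^sub>0\<close> is a Lipschitz
  domain, \<open>w\<close> lies in \<open>H\<^sub>0\<^sup>\<alpha>(D\<^sub>0)\<close> (\<open>lipschitz_domain_H0\<close>). The energy is lower semicontinuous
  (\<open>energy_lower_semicontinuous\<close>), so \<open>w\<close> is admissible for \<open>\<lambda>\<^sub>0\<close> and its Rayleigh quotient is at most the limit
  of the given ones.

  Applied to near-minimisers this proves \<open>\<lambda>\<^sub>k \<longlonglongrightarrow> \<lambda>\<^sub>0\<close>. Applied to the eigenfunctions \<open>\<psi>\<^sub>k\<close> it yields a nonnegative unit
  minimiser for \<open>\<lambda>\<^sub>0\<close>, which is \<open>\<psi>\<close> because the ground state is simple (\<open>ground_state_unique\<close>); the energies also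
  converge, which upgrades convergence in \<open>L\<^sup>2\<close> to convergence in \<open>H\<^sup>\<alpha>\<close> (\<open>energy_strong_convergence\<close>). Along a subsequence
  whose squared distances to \<open>\<psi>\<close> are at most \<open>8\<^sup>-\<^sup>n\<close>, a Borel--Cantelli argument for the capacity gives pointwise
  convergence quasi-everywhere (\<open>quasi_everywhere_tendsto_zero\<close>); continuity of the eigenfunctions on \<open>D\<^sub>0\<close> makes
  the sets whose capacity is estimated open.

  Everything about the energy rests on one identity (\<open>jump_energy\<close>): up to a finite positive constant,
  \<open>\<integral>|\<xi>|\<^sup>2\<^sup>\<alpha> |(fourier u)(\<xi>)|\<^sup>2 d\<xi>\<close> is the integral of \<open>\<parallel>u(\<cdot> + h) - u\<parallel>\<^sup>2\<close> over a measure of displacements \<open>h\<close>. In this form it is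
  evident that passing to \<open>|u|\<close>, to suprema, to Lipschitz cutoffs and to mollifications keeps the energy under
  control. All functions that occur have bounded support, so their transforms are absolutely convergent integrals
  (\<open>fourier_eq_fourier_L1\<close>).
\<close>

section \<open>Square integrable functions\<close>

definition l2sq :: "('a::euclidean_space \<Rightarrow> 'b::real_normed_vector) \<Rightarrow> ennreal" where
  "l2sq f = (\<integral>\<^sup>+x. ennreal ((norm (f x))\<^sup>2) \<partial>lborel)"

lemma ennreal_dense_pos:
  fixes a :: ennreal
  assumes "0 < a"
  obtains e where "0 < e" "ennreal e < a"
proof -
  obtain b where b: "0 < b" "b < a"
    using dense[OF assms] by auto
  then have bt: "b < top" by (meson order_less_le_trans top_greatest)
  then have "ennreal (enn2real b) = b" by simp
  with b show thesis
    by (intro that[of "enn2real b"]) (use bt in \<open>auto simp: enn2real_positive_iff\<close>)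
qed

lemma nn_integral_affine:
  fixes f :: "'a::euclidean_space \<Rightarrow> ennreal"
  assumes [measurable]: "f \<in> borel_measurable borel" and c: "c \<noteq> 0"
  shows "(\<integral>\<^sup>+x. f x \<partial>lborel) = ennreal (\<bar>c\<bar> ^ DIM('a)) * (\<integral>\<^sup>+x. f (t + c *\<^sub>R x) \<partial>lborel)"
  by (subst lborel_affine[OF c, of t])
     (simp add: nn_integral_density nn_integral_distr nn_integral_cmult)

lemma integral_affine:
  fixes f :: "'a::euclidean_space \<Rightarrow> 'b::{banach, second_countable_topology}"
  assumes [measurable]: "f \<in> borel_measurable borel" and c: "c \<noteq> 0"
  shows "(LINT x|lborel. f x) = (\<bar>c\<bar> ^ DIM('a)) *\<^sub>R (LINT x|lborel. f (t + c *\<^sub>R x))"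
  by (subst lborel_affine[OF c, of t])
     (simp add: integral_density integral_distr)

lemma nn_integral_translate:
  fixes f :: "'a::euclidean_space \<Rightarrow> ennreal"
  assumes [measurable]: "f \<in> borel_measurable borel"
  shows "(\<integral>\<^sup>+x. f (x + h) \<partial>lborel) = (\<integral>\<^sup>+x. f x \<partial>lborel)"
  using nn_integral_affine[OF assms, of 1 h] by (simp add: add.commute)

lemma AE_affine:
  fixes P :: "'a::euclidean_space \<Rightarrow> bool"
  assumes "AE x in lborel. P x" "c \<noteq> 0"
  shows "AE x in lborel. P (t + c *\<^sub>R x)"
proof -
  obtain N where N: "N \<in> null_sets lborel" "{x. \<not> P x} \<subseteq> N"
    using assms(1) by (auto simp: eventually_ae_filter)
  then have [measurable]: "N \<in> sets borel" and N0: "emeasure lborel N = 0"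
    by auto
  have "0 = (\<integral>\<^sup>+x. indicator N x \<partial>lborel)"
    using N0 by simp
  also have "\<dots> = ennreal (\<bar>c\<bar> ^ DIM('a)) * (\<integral>\<^sup>+x. indicator N (t + c *\<^sub>R x) \<partial>lborel)"
    by (rule nn_integral_affine) (use assms in auto)
  finally have "(\<integral>\<^sup>+x. indicator N (t + c *\<^sub>R x) \<partial>lborel) = 0"
    using zero_less_power[of "\<bar>c\<bar>" "DIM('a)"] assms(2)
    by (metis ennreal_eq_0_iff mult_eq_0_iff not_le zero_less_abs_iff)
  then have "AE x in lborel. (indicator N (t + c *\<^sub>R x) :: ennreal) = 0"
    by (subst (asm) nn_integral_0_iff_AE) auto
  then show ?thesis
    by (rule AE_mp) (use N(2) in \<open>auto simp: indicator_def intro!: AE_I2 split: if_splits\<close>)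
qed

lemma l2sq_translate:
  fixes f :: "'a::euclidean_space \<Rightarrow> 'b::{real_normed_vector, second_countable_topology}"
  assumes [measurable]: "f \<in> borel_measurable borel"
  shows "l2sq (\<lambda>x. f (x + h)) = l2sq f"
  unfolding l2sq_def by (rule nn_integral_translate[of "\<lambda>x. ennreal ((norm (f x))\<^sup>2)"]) simp

lemma l2sq_cong_AE:
  assumes "AE x in lborel. f x = g x"
  shows "l2sq f = l2sq g"
  unfolding l2sq_def using assms by (intro nn_integral_cong_AE) auto

lemma l2sq_mono_AE:
  assumes "AE x in lborel. norm (f x) \<le> norm (g x)"
  shows "l2sq f \<le> l2sq g"
  unfolding l2sq_def
  by (rule nn_integral_mono_AE) (use assms in \<open>auto intro!: ennreal_leI power_mono\<close>)

lemma l2sq_minus: "l2sq (\<lambda>x. f x - g x) = l2sq (\<lambda>x. g x - f x)"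
  unfolding l2sq_def by (simp add: norm_minus_commute)

lemma l2sq_zero[simp]: "l2sq (\<lambda>x. 0) = 0"
  by (simp add: l2sq_def)

lemma norm_add_square_le:
  fixes a b :: "'b::real_normed_vector"
  shows "(norm (a + b))\<^sup>2 \<le> 2 * (norm a)\<^sup>2 + 2 * (norm b)\<^sup>2"
proof -
  have "(norm (a + b))\<^sup>2 \<le> (norm a + norm b)\<^sup>2"
    by (intro power_mono norm_triangle_ineq) auto
  also have "\<dots> \<le> 2 * (norm a)\<^sup>2 + 2 * (norm b)\<^sup>2"
    using sum_squares_bound[of "norm a" "norm b"] by (simp add: power2_sum)
  finally show ?thesis .
qed

lemma l2sq_add_le:
  fixes f g :: "'a::euclidean_space \<Rightarrow> 'b::{real_normed_vector, second_countable_topology}"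
  assumes [measurable]: "f \<in> borel_measurable borel" "g \<in> borel_measurable borel"
  shows "l2sq (\<lambda>x. f x + g x) \<le> 2 * l2sq f + 2 * l2sq g"
proof -
  have "l2sq (\<lambda>x. f x + g x) \<le> (\<integral>\<^sup>+x. 2 * ennreal ((norm (f x))\<^sup>2) + 2 * ennreal ((norm (g x))\<^sup>2) \<partial>lborel)"
    unfolding l2sq_def
  proof (rule nn_integral_mono)
    fix x
    have "ennreal ((norm (f x + g x))\<^sup>2) \<le> ennreal (2 * (norm (f x))\<^sup>2 + 2 * (norm (g x))\<^sup>2)"
      by (intro ennreal_leI norm_add_square_le)
    then show "ennreal ((norm (f x + g x))\<^sup>2) \<le> 2 * ennreal ((norm (f x))\<^sup>2) + 2 * ennreal ((norm (g x))\<^sup>2)"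
      by (simp add: ennreal_mult)
  qed
  also have "\<dots> = 2 * l2sq f + 2 * l2sq g"
    unfolding l2sq_def by (simp add: nn_integral_add nn_integral_cmult)
  finally show ?thesis .
qed

lemma l2sq_triangle:
  fixes f g h :: "'a::euclidean_space \<Rightarrow> 'b::{real_normed_vector, second_countable_topology}"
  assumes [measurable]: "f \<in> borel_measurable borel" "g \<in> borel_measurable borel" "h \<in> borel_measurable borel"
  shows "l2sq (\<lambda>x. f x - h x) \<le> 2 * l2sq (\<lambda>x. f x - g x) + 2 * l2sq (\<lambda>x. g x - h x)"
  using l2sq_add_le[of "\<lambda>x. f x - g x" "\<lambda>x. g x - h x"] by simp

lemma l2sq_diff_le:
  fixes f g :: "'a::euclidean_space \<Rightarrow> 'b::{real_normed_vector, second_countable_topology}"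
  assumes [measurable]: "f \<in> borel_measurable borel" "g \<in> borel_measurable borel"
  shows "l2sq (\<lambda>x. f x - g x) \<le> 2 * l2sq f + 2 * l2sq g"
  using l2sq_triangle[of f "\<lambda>x. 0" g] l2sq_minus[of g "\<lambda>x. 0"] l2sq_minus[of "\<lambda>x. 0" g] by simp

lemma l2sq_cmult:
  fixes f :: "'a::euclidean_space \<Rightarrow> real"
  assumes [measurable]: "f \<in> borel_measurable borel"
  shows "l2sq (\<lambda>x. c * f x) = ennreal (c\<^sup>2) * l2sq f"
  unfolding l2sq_def by (simp add: abs_mult power_mult_distrib ennreal_mult nn_integral_cmult)

lemma l2sq_eq_0_iff:
  fixes f :: "'a::euclidean_space \<Rightarrow> 'b::{real_normed_vector, second_countable_topology}"
  assumes [measurable]: "f \<in> borel_measurable borel"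
  shows "l2sq f = 0 \<longleftrightarrow> (AE x in lborel. f x = 0)"
  unfolding l2sq_def by (subst nn_integral_0_iff_AE) auto

lemma l2sq_dominated:
  fixes f :: "nat \<Rightarrow> 'a::euclidean_space \<Rightarrow> 'b::{real_normed_vector, second_countable_topology}"
  assumes [measurable]: "\<And>n. f n \<in> borel_measurable borel" "w \<in> borel_measurable borel"
    and "\<And>n. AE x in lborel. norm (f n x) \<le> norm (w x :: real)" "l2sq w < \<infinity>"
    and "AE x in lborel. (\<lambda>n. f n x) \<longlonglongrightarrow> 0"
  shows "(\<lambda>n. l2sq (f n)) \<longlonglongrightarrow> 0"
proof -
  have "(\<lambda>n. \<integral>\<^sup>+x. ennreal ((norm (f n x))\<^sup>2) \<partial>lborel) \<longlonglongrightarrow> (\<integral>\<^sup>+x. 0 \<partial>(lborel :: 'a measure))"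
  proof (rule nn_integral_dominated_convergence)
    show "AE x in lborel. ennreal ((norm (f n x))\<^sup>2) \<le> ennreal ((norm (w x))\<^sup>2)" for n
      using assms(3)[of n] by eventually_elim (rule ennreal_leI, rule power_mono, auto)
    show "(\<integral>\<^sup>+ x. ennreal ((norm (w x))\<^sup>2) \<partial>lborel) < \<infinity>"
      using assms(4) by (simp add: l2sq_def)
    show "AE x in lborel. (\<lambda>n. ennreal ((norm (f n x))\<^sup>2)) \<longlonglongrightarrow> 0"
      using assms(5)
    proof eventually_elim
      case (elim x)
      have "(\<lambda>n. ennreal ((norm (f n x))\<^sup>2)) \<longlonglongrightarrow> ennreal ((norm (0::'b))\<^sup>2)"
        by (intro tendsto_ennrealI tendsto_intros elim)
      then show ?case by simp
    qed
  qed auto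
  then show ?thesis
    by (simp add: l2sq_def)
qed

lemma L2_space_iff: "u \<in> L2_space \<longleftrightarrow> u \<in> borel_measurable borel \<and> l2sq u < \<infinity>"
  by (auto simp: L2_space_def l2sq_def integrable_iff_bounded)

lemma L2_spaceD: "u \<in> L2_space \<Longrightarrow> u \<in> borel_measurable borel" "u \<in> L2_space \<Longrightarrow> l2sq u < \<infinity>"
  by (auto simp: L2_space_iff)

lemma L2_space_lincomb:
  assumes "u \<in> L2_space" "v \<in> L2_space"
  shows "(\<lambda>x. a * u x + b * v x) \<in> L2_space"
proof -
  have [measurable]: "u \<in> borel_measurable borel" "v \<in> borel_measurable borel"
    using assms by (auto simp: L2_spaceD)
  have "l2sq (\<lambda>x. a * u x + b * v x) \<le> 2 * (ennreal (a\<^sup>2) * l2sq u) + 2 * (ennreal (b\<^sup>2) * l2sq v)"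
    using l2sq_add_le[of "\<lambda>x. a * u x" "\<lambda>x. b * v x"] by (simp add: l2sq_cmult)
  also have "\<dots> < \<infinity>"
    using assms by (auto simp: L2_space_iff ennreal_mult_less_top ennreal_add_eq_top less_top[symmetric] ennreal_mult_eq_top_iff)
  finally show ?thesis
    by (simp add: L2_space_iff)
qed

lemma L2_space_add: "u \<in> L2_space \<Longrightarrow> v \<in> L2_space \<Longrightarrow> (\<lambda>x. u x + v x) \<in> L2_space"
  and L2_space_diff: "u \<in> L2_space \<Longrightarrow> v \<in> L2_space \<Longrightarrow> (\<lambda>x. u x - v x) \<in> L2_space"
  and L2_space_cmult: "u \<in> L2_space \<Longrightarrow> (\<lambda>x. a * u x) \<in> L2_space"
  using L2_space_lincomb[of u v 1 1] L2_space_lincomb[of u v 1 "-1"] L2_space_lincomb[of u u a 0] by auto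

lemma L2_space_translate: "u \<in> L2_space \<Longrightarrow> (\<lambda>x. u (x + h)) \<in> L2_space"
  by (auto simp: L2_space_iff l2sq_translate)

lemma L2_space_dominated:
  assumes "u \<in> L2_space" "v \<in> borel_measurable borel" "AE x in lborel. \<bar>v x\<bar> \<le> \<bar>u x\<bar>"
  shows "v \<in> L2_space"
  using l2sq_mono_AE[of v u] assms by (auto simp: L2_space_iff)

lemma L2_integrable_mult:
  assumes "u \<in> L2_space" "v \<in> L2_space"
  shows "integrable lborel (\<lambda>x. u x * v x)"
proof (rule Bochner_Integration.integrable_bound)
  show "integrable lborel (\<lambda>x. (u x)\<^sup>2 + (v x)\<^sup>2)"
    using assms by (auto simp: L2_space_def)
  show "(\<lambda>x. u x * v x) \<in> borel_measurable lborel"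
    using assms by (auto simp: L2_space_def)
  have "\<bar>u x * v x\<bar> \<le> (u x)\<^sup>2 + (v x)\<^sup>2" for x
  proof -
    have "0 \<le> (\<bar>u x\<bar> - \<bar>v x\<bar>)\<^sup>2" by simp
    then have "2 * \<bar>u x * v x\<bar> \<le> (u x)\<^sup>2 + (v x)\<^sup>2"
      by (simp add: power2_eq_square algebra_simps abs_mult)
    then show ?thesis by simp
  qed
  then show "AE x in lborel. norm (u x * v x) \<le> norm ((u x)\<^sup>2 + (v x)\<^sup>2)"
    by (auto intro!: AE_I2)
qed

lemma integral_square_eq_l2sq:
  assumes "u \<in> L2_space"
  shows "ennreal (LINT x|lborel. (u x)\<^sup>2) = l2sq u" "(LINT x|lborel. (u x)\<^sup>2) = enn2real (l2sq u)"
proof -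
  show "ennreal (LINT x|lborel. (u x)\<^sup>2) = l2sq u"
    using assms unfolding l2sq_def by (subst nn_integral_eq_integral) (auto simp: L2_space_def)
  from this[symmetric] show "(LINT x|lborel. (u x)\<^sup>2) = enn2real (l2sq u)"
    by simp
qed

text \<open>
  This is \<open>|u| \<le> t u\<^sup>2 + 1/t\<close> integrated over \<open>A\<close>. The parameter \<open>t\<close> stays free, so that the right-hand side can be made small
  when \<open>l2sq u\<close> is small and the measure of \<open>A\<close> is finite.
\<close>

lemma nn_integral_abs_le_l2sq:
  fixes u :: "'a::euclidean_space \<Rightarrow> real"
  assumes [measurable]: "u \<in> borel_measurable borel" "A \<in> sets borel" and "t > 0"
  shows "(\<integral>\<^sup>+x. ennreal \<bar>u x\<bar> * indicator A x \<partial>lborel) \<le> ennreal t * l2sq u + ennreal (1 / t) * emeasure lborel A"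
proof -
  have "(\<integral>\<^sup>+x. ennreal \<bar>u x\<bar> * indicator A x \<partial>lborel)
      \<le> (\<integral>\<^sup>+x. ennreal t * ennreal ((norm (u x))\<^sup>2) + ennreal (1 / t) * indicator A x \<partial>lborel)"
  proof (rule nn_integral_mono)
    fix x
    have "0 \<le> (t * \<bar>u x\<bar> - 1)\<^sup>2" by simp
    then have "2 * t * \<bar>u x\<bar> \<le> t\<^sup>2 * (u x)\<^sup>2 + 1"
      by (simp add: power2_diff power_mult_distrib)
    moreover have "0 \<le> t * \<bar>u x\<bar>" using assms by simp
    ultimately have "t * \<bar>u x\<bar> \<le> t\<^sup>2 * (u x)\<^sup>2 + 1" by linarith
    then have "\<bar>u x\<bar> \<le> t * (u x)\<^sup>2 + 1 / t"
      using assms(3) by (simp add: field_simps power2_eq_square)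
    then have "ennreal \<bar>u x\<bar> \<le> ennreal t * ennreal ((norm (u x))\<^sup>2) + ennreal (1/t)"
      using assms(3) by (simp flip: ennreal_mult ennreal_plus)
    then show "ennreal \<bar>u x\<bar> * indicator A x \<le> ennreal t * ennreal ((norm (u x))\<^sup>2) + ennreal (1 / t) * indicator A x"
      by (auto simp: indicator_def)
  qed
  also have "\<dots> = ennreal t * l2sq u + ennreal (1 / t) * emeasure lborel A"
    unfolding l2sq_def by (simp add: nn_integral_add nn_integral_cmult)
  finally show ?thesis .
qed

text \<open>
  A square integrable function with bounded support is integrable, so its Fourier integral converges absolutely.
\<close>

definition L2_bd :: "('a::euclidean_space \<Rightarrow> real) set" where
  "L2_bd = {u \<in> L2_space. \<exists>R>0. AE x in lborel. x \<notin> ball 0 R \<longrightarrow> u x = 0}"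

lemma L2_bd_L2: "u \<in> L2_bd \<Longrightarrow> u \<in> L2_space"
  by (simp add: L2_bd_def)

lemma L2_on_bd: "bounded V \<Longrightarrow> u \<in> L2_on V \<Longrightarrow> u \<in> L2_bd"
proof -
  assume V: "bounded V" and u: "u \<in> L2_on V"
  obtain R where R: "R > 0" "V \<subseteq> ball 0 R"
    using bounded_subset_ballD[OF V, of 0] by auto
  have "AE x in lborel. x \<notin> V \<longrightarrow> u x = 0" "u \<in> L2_space"
    using u by (auto simp: L2_on_def)
  then show "u \<in> L2_bd"
    unfolding L2_bd_def using R by (auto intro!: exI[of _ R] elim!: eventually_mono)
qed

lemma L2_bd_dominated:
  assumes "u \<in> L2_bd" "v \<in> borel_measurable borel" "AE x in lborel. \<bar>v x\<bar> \<le> \<bar>u x\<bar>"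
  shows "v \<in> L2_bd"
proof -
  obtain R where "R > 0" "AE x in lborel. x \<notin> ball 0 R \<longrightarrow> u x = 0"
    using assms(1) by (auto simp: L2_bd_def)
  with assms(3) have "AE x in lborel. x \<notin> ball 0 R \<longrightarrow> v x = 0"
    by (auto elim: eventually_elim2)
  then show ?thesis
    using L2_space_dominated[OF _ assms(2,3)] assms(1) \<open>R > 0\<close> by (auto simp: L2_bd_def)
qed

lemma L2_bd_lincomb:
  assumes "u \<in> L2_bd" "v \<in> L2_bd"
  shows "(\<lambda>x. a * u x + b * v x) \<in> L2_bd"
proof -
  obtain R S where "R > 0" "AE x in lborel. x \<notin> ball 0 R \<longrightarrow> u x = 0"
    "S > 0" "AE x in lborel. x \<notin> ball 0 S \<longrightarrow> v x = 0"
    using assms by (auto simp: L2_bd_def)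
  then have "max R S > 0" "AE x in lborel. x \<notin> ball 0 (max R S) \<longrightarrow> a * u x + b * v x = 0"
    by (auto elim!: eventually_elim2)
  then show ?thesis
    using assms L2_space_lincomb by (auto simp: L2_bd_def)
qed

lemma L2_bd_add: "u \<in> L2_bd \<Longrightarrow> v \<in> L2_bd \<Longrightarrow> (\<lambda>x. u x + v x) \<in> L2_bd"
  and L2_bd_diff: "u \<in> L2_bd \<Longrightarrow> v \<in> L2_bd \<Longrightarrow> (\<lambda>x. u x - v x) \<in> L2_bd"
  and L2_bd_cmult: "u \<in> L2_bd \<Longrightarrow> (\<lambda>x. a * u x) \<in> L2_bd"
  using L2_bd_lincomb[of u v 1 1] L2_bd_lincomb[of u v 1 "-1"] L2_bd_lincomb[of u u a 0] by auto

lemma L2_bd_translate: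
  assumes "u \<in> L2_bd"
  shows "(\<lambda>x. u (x + h)) \<in> L2_bd"
proof -
  obtain R where R: "R > 0" "AE x in lborel. x \<notin> ball 0 R \<longrightarrow> u x = 0"
    using assms by (auto simp: L2_bd_def)
  have "AE x in lborel. h + 1 *\<^sub>R x \<notin> ball 0 R \<longrightarrow> u (h + 1 *\<^sub>R x) = 0"
    by (rule AE_affine[OF R(2)]) simp
  then have "AE x in lborel. x \<notin> ball 0 (R + norm h) \<longrightarrow> u (x + h) = 0"
  proof eventually_elim
    case (elim x)
    have "norm x \<le> norm (h + x) + norm h"
      by (metis add.commute add_diff_cancel norm_triangle_ineq4)
    then show ?case using elim by (auto simp: add.commute)
  qed
  then show ?thesis
    using assms R(1) L2_space_translate[of u h] unfolding L2_bd_def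
    by (auto intro!: exI[of _ "R + norm h"] add_pos_nonneg)
qed

lemma L2_bd_integrable:
  assumes "u \<in> L2_bd"
  shows "integrable lborel u"
proof -
  obtain R where R: "R > 0" "AE x in lborel. x \<notin> ball 0 R \<longrightarrow> u x = 0"
    using assms by (auto simp: L2_bd_def)
  have m[measurable]: "u \<in> borel_measurable borel" and f: "l2sq u < \<infinity>"
    using assms by (auto simp: L2_bd_def L2_space_iff)
  have "(\<integral>\<^sup>+x. ennreal (norm (u x)) \<partial>lborel) = (\<integral>\<^sup>+x. ennreal \<bar>u x\<bar> * indicator (ball 0 R) x \<partial>lborel)"
    by (rule nn_integral_cong_AE) (use R(2) in \<open>auto simp: indicator_def elim!: eventually_mono\<close>)
  also have "\<dots> \<le> ennreal 1 * l2sq u + ennreal (1/1) * emeasure lborel (ball 0 R :: 'a set)"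
    by (rule nn_integral_abs_le_l2sq) auto
  also have "\<dots> < \<infinity>"
    using f emeasure_lborel_ball_finite[of "0::'a" R] by simp
  finally show ?thesis
    by (simp add: integrable_iff_bounded)
qed

text \<open>
  Completeness: on a bounded set an \<open>L\<^sup>2\<close>-Cauchy sequence is \<open>L\<^sup>1\<close>-Cauchy, hence has an almost
  everywhere convergent subsequence; Fatou's lemma turns this into convergence in \<open>L\<^sup>2\<close>.
\<close>

lemma L2_complete:
  fixes s :: "nat \<Rightarrow> 'a::euclidean_space \<Rightarrow> real"
  assumes s: "\<And>n. s n \<in> L2_space" and R: "\<And>n. AE x in lborel. x \<notin> ball 0 R \<longrightarrow> s n x = 0"
    and cauchy: "\<And>e. e > 0 \<Longrightarrow> \<exists>N. \<forall>m\<ge>N. \<forall>n\<ge>N. l2sq (\<lambda>x. s m x - s n x) < ennreal e"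
  obtains u where "u \<in> L2_space" "(\<lambda>n. l2sq (\<lambda>x. s n x - u x)) \<longlonglongrightarrow> 0"
proof -
  have [measurable]: "s n \<in> borel_measurable borel" for n
    using s by (simp add: L2_spaceD)
  have int: "integrable lborel (s n)" for n
  proof -
    have "R \<le> max R 1" "max R 1 > 0" by auto
    then have "s n \<in> L2_bd" using s R[of n] unfolding L2_bd_def
      by (auto intro!: exI[of _ "max R 1"] elim: eventually_mono)
    then show ?thesis by (rule L2_bd_integrable)
  qed
  obtain r where r: "strict_mono r" "AE x in lborel. Cauchy (\<lambda>i. s (r i) x)"
  proof (rule cauchy_L1_AE_cauchy_subseq[of lborel s])
    fix e :: real assume e: "e > 0"
    define m where "m = measure lborel (ball 0 R :: 'a set) + 1"
    have m: "m > 0" "emeasure lborel (ball 0 R :: 'a set) \<le> ennreal m"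
      using emeasure_lborel_ball_finite[of "0::'a" R]
      by (auto simp: m_def emeasure_eq_ennreal_measure add_nonneg_pos)
    \<comment> \<open>With this \<open>t\<close> the term \<open>m / t\<close> is \<open>e / 2\<close>, and \<open>d\<close> makes the other term \<open>e / 4\<close>.\<close>
    define t where "t = 2 * m / e"
    have t: "t > 0" using m e by (simp add: t_def)
    define d where "d = e / (4 * t)"
    have d: "d > 0" using e t by (simp add: d_def)
    obtain N where N: "\<And>i j. i \<ge> N \<Longrightarrow> j \<ge> N \<Longrightarrow> l2sq (\<lambda>x. s i x - s j x) < ennreal d"
      using cauchy[OF d] by auto
    show "\<exists>N. \<forall>i\<ge>N. \<forall>j\<ge>N. (LINT x|lborel. norm (s i x - s j x)) < e"
    proof (intro exI allI impI)
      fix i j assume ij: "i \<ge> N" "j \<ge> N"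
      have "ennreal (LINT x|lborel. norm (s i x - s j x)) = (\<integral>\<^sup>+x. ennreal (norm (s i x - s j x)) \<partial>lborel)"
        by (rule nn_integral_eq_integral[symmetric]) (use int in auto)
      also have "\<dots> = (\<integral>\<^sup>+x. ennreal \<bar>s i x - s j x\<bar> * indicator (ball 0 R) x \<partial>lborel)"
        by (rule nn_integral_cong_AE) (use R[of i] R[of j] in \<open>auto simp: indicator_def\<close>)
      also have "\<dots> \<le> ennreal t * l2sq (\<lambda>x. s i x - s j x) + ennreal (1/t) * emeasure lborel (ball 0 R :: 'a set)"
        by (rule nn_integral_abs_le_l2sq) (use t in auto)
      also have "\<dots> \<le> ennreal t * ennreal d + ennreal (1/t) * ennreal m"
        using N[OF ij] m by (intro add_mono mult_left_mono) auto
      also have "\<dots> = ennreal (t * d + m / t)"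
        using t d m by (simp add: ennreal_mult ennreal_plus divide_inverse mult.commute)
      also have "t * d + m / t = e / 4 + e / 2"
        using t e m by (simp add: d_def t_def)
      finally show "(LINT x|lborel. norm (s i x - s j x)) < e"
        using e by (subst (asm) ennreal_le_iff) auto
    qed
  qed (use int in auto)
  define u where "u x = (if Cauchy (\<lambda>i. s (r i) x) then lim (\<lambda>i. s (r i) x) else 0)" for x
  have [measurable]: "u \<in> borel_measurable borel"
    unfolding u_def by measurable
  have conv: "AE x in lborel. (\<lambda>i. s (r i) x) \<longlonglongrightarrow> u x"
    using r(2) by eventually_elim (simp add: u_def Cauchy_convergent_iff convergent_LIMSEQ_iff)
  have fatou: "l2sq (\<lambda>x. s n x - u x) \<le> ennreal e"
    if N: "\<forall>m\<ge>N. \<forall>n\<ge>N. l2sq (\<lambda>x. s m x - s n x) < ennreal e" and n: "n \<ge> N" for n N e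
  proof -
    have "l2sq (\<lambda>x. s n x - u x) = (\<integral>\<^sup>+x. liminf (\<lambda>i. ennreal ((norm (s n x - s (r i) x))\<^sup>2)) \<partial>lborel)"
      unfolding l2sq_def
    proof (rule nn_integral_cong_AE)
      show "AE x in lborel. ennreal ((norm (s n x - u x))\<^sup>2) = liminf (\<lambda>i. ennreal ((norm (s n x - s (r i) x))\<^sup>2))"
        using conv
      proof eventually_elim
        case (elim x)
        have "(\<lambda>i. ennreal ((norm (s n x - s (r i) x))\<^sup>2)) \<longlonglongrightarrow> ennreal ((norm (s n x - u x))\<^sup>2)"
          by (intro tendsto_ennrealI tendsto_intros elim)
        then show ?case
          by (intro lim_imp_Liminf[symmetric]) auto
      qed
    qed
    also have "\<dots> \<le> liminf (\<lambda>i. l2sq (\<lambda>x. s n x - s (r i) x))"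
      unfolding l2sq_def by (rule nn_integral_liminf) measurable
    also have "\<dots> \<le> liminf (\<lambda>i::nat. ennreal e)"
    proof (rule Liminf_mono)
      have "\<forall>\<^sub>F i in sequentially. i \<ge> N" by (rule eventually_ge_at_top)
      then show "\<forall>\<^sub>F i in sequentially. l2sq (\<lambda>x. s n x - s (r i) x) \<le> ennreal e"
      proof eventually_elim
        case (elim i)
        then have "r i \<ge> N" using seq_suble[OF r(1), of i] by simp
        then show ?case using N n by (auto intro: less_imp_le)
      qed
    qed
    finally show ?thesis by (simp add: Liminf_const)
  qed
  have lim: "(\<lambda>n. l2sq (\<lambda>x. s n x - u x)) \<longlonglongrightarrow> 0"
  proof (rule order_tendstoI)
    fix a :: ennreal assume "0 < a"
    then obtain e where e: "0 < e" "ennreal e < a"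
      using ennreal_dense_pos by blast
    then obtain N where "\<forall>m\<ge>N. \<forall>n\<ge>N. l2sq (\<lambda>x. s m x - s n x) < ennreal e"
      using cauchy by blast
    then have "\<forall>n\<ge>N. l2sq (\<lambda>x. s n x - u x) < a"
      using fatou e(2) by (meson order_le_less_trans)
    then show "\<forall>\<^sub>F n in sequentially. l2sq (\<lambda>x. s n x - u x) < a"
      by (auto simp: eventually_sequentially)
  qed simp
  have "u \<in> L2_space"
  proof -
    obtain N where N: "\<forall>m\<ge>N. \<forall>n\<ge>N. l2sq (\<lambda>x. s m x - s n x) < ennreal 1"
      using cauchy[of 1] by auto
    have "l2sq (\<lambda>x. s N x - u x) < \<infinity>"
      using fatou[OF N, of N] by (auto simp: less_top[symmetric] top_unique)
    then have "(\<lambda>x. s N x - u x) \<in> L2_space" by (simp add: L2_space_iff)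
    from L2_space_diff[OF s[of N] this] show ?thesis by simp
  qed
  with lim show thesis by (rule that[rotated])
qed

text \<open>
  Translation is continuous in \<open>L\<^sup>2\<close>: clipped to a large ball and a large range, a function is an
  almost everywhere, hence dominated, limit of continuous functions with compact support.
\<close>

lemma L2_translate_continuous_closed:
  fixes u :: "'a::euclidean_space \<Rightarrow> real"
  assumes [measurable]: "u \<in> borel_measurable borel"
    and meas[measurable]: "\<And>n. v n \<in> borel_measurable borel"
    and lim: "(\<lambda>n. l2sq (\<lambda>x. v n x - u x)) \<longlonglongrightarrow> 0"
    and v: "\<And>n. (\<lambda>k. l2sq (\<lambda>x. v n (x + h k) - v n x)) \<longlonglongrightarrow> 0"
  shows "(\<lambda>k. l2sq (\<lambda>x. u (x + h k) - u x)) \<longlonglongrightarrow> 0"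
proof (rule order_tendstoI)
  fix a :: ennreal assume "0 < a"
  then obtain e where e: "0 < e" "ennreal e < a"
    by (rule ennreal_dense_pos)
  have e': "0 < ennreal (e / 12)" using e by simp
  from order_tendstoD(2)[OF lim e'] obtain n where n: "l2sq (\<lambda>x. v n x - u x) < ennreal (e / 12)"
    by (auto simp: eventually_sequentially)
  show "\<forall>\<^sub>F k in sequentially. l2sq (\<lambda>x. u (x + h k) - u x) < a"
    using order_tendstoD(2)[OF v[of n] e']
  proof eventually_elim
    case (elim k)
    have "l2sq (\<lambda>x. v n (x + h k) - u (x + h k)) = l2sq (\<lambda>x. v n x - u x)"
      using l2sq_translate[of "\<lambda>x. v n x - u x" "h k"] by simp
    then have 1: "l2sq (\<lambda>x. u (x + h k) - v n (x + h k)) < ennreal (e / 12)"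
      using n by (subst l2sq_minus) simp
    have "l2sq (\<lambda>x. u (x + h k) - u x) \<le> 2 * l2sq (\<lambda>x. u (x + h k) - v n (x + h k)) + 2 * l2sq (\<lambda>x. v n (x + h k) - u x)"
      by (rule l2sq_triangle) auto
    also have "l2sq (\<lambda>x. v n (x + h k) - u x) \<le> 2 * l2sq (\<lambda>x. v n (x + h k) - v n x) + 2 * l2sq (\<lambda>x. v n x - u x)"
      by (rule l2sq_triangle) auto
    also have "2 * l2sq (\<lambda>x. u (x + h k) - v n (x + h k)) + 2 * (2 * l2sq (\<lambda>x. v n (x + h k) - v n x) + 2 * l2sq (\<lambda>x. v n x - u x))
        \<le> 2 * ennreal (e / 12) + 2 * (2 * ennreal (e / 12) + 2 * ennreal (e / 12))"
      using 1 elim n by (intro add_mono mult_left_mono) auto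
    also have "\<dots> = ennreal (2 * (e / 12) + 2 * (2 * (e / 12) + 2 * (e / 12)))"
    proof -
      have "2 * x + 2 * (2 * x + 2 * x) = (2 + 2 * (2 + 2)) * x" for x :: ennreal
        by (simp only: distrib_left distrib_right mult.assoc)
      from this[of "ennreal (e / 12)"] show ?thesis
        using e ennreal_mult'[of 10 "e / 12"] by simp
    qed
    also have "2 * (e / 12) + 2 * (2 * (e / 12) + 2 * (e / 12)) = 5 / 6 * e" by simp
    also have "ennreal (5 / 6 * e) \<le> ennreal e" using e by (intro ennreal_leI) simp
    also have "\<dots> < a" by fact
    finally show ?case by (simp add: mult_left_mono)
  qed
qed simp

lemma L2_translate_continuous_compact:
  fixes u :: "'a::euclidean_space \<Rightarrow> real"
  assumes cont: "continuous_on UNIV u" and supp: "\<And>x. x \<notin> ball 0 R \<Longrightarrow> u x = 0"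
    and bd: "\<And>x. \<bar>u x\<bar> \<le> B" and h: "h \<longlonglongrightarrow> 0"
  shows "(\<lambda>k. l2sq (\<lambda>x. u (x + h k) - u x)) \<longlonglongrightarrow> 0"
proof -
  have [measurable]: "u \<in> borel_measurable borel"
    by (rule borel_measurable_continuous_onI) fact
  obtain C where C: "\<And>k. norm (h k) \<le> C"
    using convergent_imp_bounded[OF h] by (auto simp: bounded_iff)
  let ?w = "\<lambda>x::'a. 2 * B * indicator (ball 0 (R + C)) x :: real"
  have B: "B \<ge> 0" using bd[of 0] by linarith
  have C0: "0 \<le> C" using C[of 0] by (meson norm_ge_zero order_trans)
  have [measurable]: "?w \<in> borel_measurable borel"
    by (intro borel_measurable_times borel_measurable_const borel_measurable_indicator) auto
  show ?thesis
  proof (rule l2sq_dominated[where w = ?w])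
    show "AE x in lborel. norm (u (x + h n) - u x) \<le> norm (2 * B * indicator (ball 0 (R + C)) x :: real)" for n
    proof (rule AE_I2)
      fix x
      show "norm (u (x + h n) - u x) \<le> norm (2 * B * indicator (ball 0 (R + C)) x :: real)"
      proof (cases "x \<in> ball 0 (R + C)")
        case True
        then show ?thesis using bd[of x] bd[of "x + h n"] B by auto
      next
        case False
        have "norm x \<le> norm (x + h n) + norm (h n)"
          by (metis add_diff_cancel norm_triangle_ineq4)
        then have "x + h n \<notin> ball 0 R" using False C[of n] by auto
        moreover have "x \<notin> ball 0 R" using False C0 by auto
        ultimately show ?thesis using supp by simp
      qed
    qed
    have "l2sq ?w = (\<integral>\<^sup>+x. ennreal ((2 * B)\<^sup>2) * indicator (ball 0 (R + C)) (x::'a) \<partial>lborel)"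
      unfolding l2sq_def by (intro nn_integral_cong) (auto simp: indicator_def)
    also have "\<dots> < \<infinity>"
      using emeasure_lborel_ball_finite[of "0::'a" "R + C"] by (simp add: nn_integral_cmult_indicator ennreal_mult_less_top)
    finally show "l2sq ?w < \<infinity>" .
    have "(\<lambda>n. u (x + h n) - u x) \<longlonglongrightarrow> u (x + 0) - u x" for x
    proof -
      have "isCont u (x + 0)" using cont by (simp add: continuous_on_eq_continuous_at)
      moreover have "(\<lambda>n. x + h n) \<longlonglongrightarrow> x + 0" by (intro tendsto_intros h)
      ultimately show ?thesis by (intro tendsto_intros) (rule isCont_tendsto_compose)
    qed
    then show "AE x in lborel. (\<lambda>n. u (x + h n) - u x) \<longlonglongrightarrow> 0" by simp
  qed auto
qed

lemma L2_translate_continuous: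
  fixes u :: "'a::euclidean_space \<Rightarrow> real"
  assumes u: "u \<in> L2_space" and h: "h \<longlonglongrightarrow> 0"
  shows "(\<lambda>k. l2sq (\<lambda>x. u (x + h k) - u x)) \<longlonglongrightarrow> 0"
proof -
  have [measurable]: "u \<in> borel_measurable borel" and fin: "l2sq u < \<infinity>"
    using u by (auto simp: L2_space_iff)
  define clip where "clip M t = max (- M) (min M t)" for M t :: real
  define cut where "cut M x = max 0 (min 1 (M - norm x))" for M :: real and x :: 'a
  have clip_cont: "continuous_on UNIV (clip M)" for M
    unfolding clip_def by (intro continuous_intros)
  have cut_cont: "continuous_on UNIV (cut M)" for M
    unfolding cut_def by (intro continuous_intros)
  have [measurable]: "clip M \<in> borel_measurable borel" "cut M \<in> borel_measurable borel" for M
    using clip_cont cut_cont by (auto intro: borel_measurable_continuous_onI)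
  have clip_bd: "\<bar>clip M t\<bar> \<le> M" if "M \<ge> 0" for M t
    using that by (auto simp: clip_def)
  have cut_bd: "0 \<le> cut M x" "cut M x \<le> 1" for M x
    by (auto simp: cut_def)
  obtain N g where N: "negligible N" and g: "\<And>n. continuous_on UNIV (g n)"
    and conv: "\<And>x. x \<notin> N \<Longrightarrow> (\<lambda>n. g n x) \<longlonglongrightarrow> u x"
  proof -
    have "u measurable_on UNIV"
      by (rule lebesgue_measurable_imp_measurable_on) (auto intro: measurable_completion)
    then show thesis using that by (auto simp: measurable_on_def)
  qed
  have AEN: "AE x in lborel. x \<notin> N"
  proof -
    have "AE x in lebesgue. x \<notin> N"
      using N by (auto simp: negligible_iff_null_sets intro: AE_not_in)
    then show ?thesis by (simp add: AE_completion_iff)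
  qed
  have [measurable]: "g n \<in> borel_measurable borel" for n
    using g by (auto intro: borel_measurable_continuous_onI)
  have step1: "(\<lambda>k. l2sq (\<lambda>x. cut M (x + h k) * clip M (u (x + h k)) - cut M x * clip M (u x))) \<longlonglongrightarrow> 0" if M: "M > 0" for M
  proof (rule L2_translate_continuous_closed[where v = "\<lambda>n x. cut M x * clip M (g n x)"])
    let ?w = "\<lambda>x::'a. 2 * M * indicator (ball 0 M) x :: real"
    have [measurable]: "?w \<in> borel_measurable borel"
      by (intro borel_measurable_times borel_measurable_const borel_measurable_indicator) auto
    show "(\<lambda>n. l2sq (\<lambda>x. cut M x * clip M (g n x) - cut M x * clip M (u x))) \<longlonglongrightarrow> 0"
    proof (rule l2sq_dominated[where w = ?w])
      show "AE x in lborel. norm (cut M x * clip M (g n x) - cut M x * clip M (u x)) \<le> norm (?w x)" for n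
      proof (rule AE_I2)
        fix x
        have "\<bar>cut M x * (clip M (g n x) - clip M (u x))\<bar> \<le> cut M x * (2 * M)"
          unfolding abs_mult using cut_bd[of M x] clip_bd[of M "g n x"] clip_bd[of M "u x"] M
          by (intro mult_mono) auto
        also have "\<dots> \<le> \<bar>?w x\<bar>"
        proof (cases "norm x < M")
          case True
          then show ?thesis using cut_bd[of M x] M by simp
        qed (auto simp: cut_def)
        finally show "norm (cut M x * clip M (g n x) - cut M x * clip M (u x)) \<le> norm (?w x)"
          by (simp add: algebra_simps)
      qed
      have "l2sq ?w = (\<integral>\<^sup>+x. ennreal ((2 * M)\<^sup>2) * indicator (ball 0 M) (x::'a) \<partial>lborel)"
        unfolding l2sq_def by (intro nn_integral_cong) (auto simp: indicator_def)
      also have "\<dots> < \<infinity>"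
        using emeasure_lborel_ball_finite[of "0::'a" M] by (simp add: nn_integral_cmult_indicator ennreal_mult_less_top)
      finally show "l2sq ?w < \<infinity>" .
      show "AE x in lborel. (\<lambda>n. cut M x * clip M (g n x) - cut M x * clip M (u x)) \<longlonglongrightarrow> 0"
        using AEN
      proof eventually_elim
        case (elim x)
        have "(\<lambda>n. clip M (g n x)) \<longlonglongrightarrow> clip M (u x)"
          unfolding clip_def by (intro tendsto_intros conv elim)
        then have "(\<lambda>n. cut M x * clip M (g n x) - cut M x * clip M (u x)) \<longlonglongrightarrow> cut M x * clip M (u x) - cut M x * clip M (u x)"
          by (intro tendsto_intros)
        then show ?case by simp
      qed
    qed auto
    show "(\<lambda>k. l2sq (\<lambda>x. cut M (x + h k) * clip M (g n (x + h k)) - cut M x * clip M (g n x))) \<longlonglongrightarrow> 0" for n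
    proof (rule L2_translate_continuous_compact[OF _ _ _ h, where R = M and B = M])
      show "continuous_on UNIV (\<lambda>x. cut M x * clip M (g n x))"
        by (intro continuous_on_mult cut_cont continuous_on_compose2[OF clip_cont g]) auto
      show "\<bar>cut M x * clip M (g n x)\<bar> \<le> M" for x
        using mult_mono[of "cut M x" 1 "\<bar>clip M (g n x)\<bar>" M] cut_bd[of M x] clip_bd[of M "g n x"] M
        by (simp add: abs_mult)
    qed (auto simp: cut_def)
  qed auto
  show ?thesis
  proof (rule L2_translate_continuous_closed[where v = "\<lambda>n x. cut (real (Suc n)) x * clip (real (Suc n)) (u x)"])
    show "(\<lambda>n. l2sq (\<lambda>x. cut (real (Suc n)) x * clip (real (Suc n)) (u x) - u x)) \<longlonglongrightarrow> 0"
    proof (rule l2sq_dominated[where w = u])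
      show "AE x in lborel. norm (cut (real (Suc n)) x * clip (real (Suc n)) (u x) - u x) \<le> norm (u x)" for n
      proof (rule AE_I2)
        fix x
        define s where "s = cut (real (Suc n)) x"
        define t where "t = clip (real (Suc n)) (u x)"
        have s: "0 \<le> s" "s \<le> 1" using cut_bd by (auto simp: s_def)
        show "norm (cut (real (Suc n)) x * clip (real (Suc n)) (u x) - u x) \<le> norm (u x)"
        proof (cases "u x \<ge> 0")
          case True
          then have t: "0 \<le> t" "t \<le> u x" by (auto simp: t_def clip_def)
          then have "0 \<le> s * t" "s * t \<le> u x" using s mult_mono[of s 1 t "u x"] by auto
          then show ?thesis using True by (simp add: s_def t_def)
        next
          case False
          then have t: "0 \<le> - t" "- t \<le> - u x" by (auto simp: t_def clip_def)
          then have "0 \<le> s * - t" "s * - t \<le> - u x" using s mult_mono[of s 1 "-t" "- u x"] mult_nonneg_nonneg[of s "-t"] by auto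
          then show ?thesis using False by (simp add: s_def t_def)
        qed
      qed
      show "AE x in lborel. (\<lambda>n. cut (real (Suc n)) x * clip (real (Suc n)) (u x) - u x) \<longlonglongrightarrow> 0"
      proof (rule AE_I2, rule tendsto_eventually)
        fix x
        obtain m where m: "norm x + 1 + \<bar>u x\<bar> \<le> real m"
          using real_arch_simple by blast
        have "cut (real (Suc n)) x * clip (real (Suc n)) (u x) - u x = 0" if "n \<ge> m" for n
        proof -
          have "real n \<ge> real m" using that by simp
          then have b: "\<bar>u x\<bar> \<le> real (Suc n)" "1 \<le> real (Suc n) - norm x"
            using m norm_ge_zero[of x] by linarith+
          then have "cut (real (Suc n)) x = 1" "clip (real (Suc n)) (u x) = u x"
            by (simp_all add: cut_def clip_def abs_le_iff min_absorb1 max_absorb2 del: of_nat_Suc)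
          then show ?thesis by simp
        qed
        then show "\<forall>\<^sub>F n in sequentially. cut (real (Suc n)) x * clip (real (Suc n)) (u x) - u x = 0"
          by (auto simp: eventually_sequentially)
      qed
    qed (use fin in auto)
    show "(\<lambda>k. l2sq (\<lambda>x. cut (real (Suc n)) (x + h k) * clip (real (Suc n)) (u (x + h k)) -
        cut (real (Suc n)) x * clip (real (Suc n)) (u x))) \<longlonglongrightarrow> 0" for n
      by (rule step1) simp
  qed auto
qed

section \<open>Positive semidefinite forms and Riesz representation\<close>

text \<open>
  The first variation vanishes at a minimum of a quadratic function.
\<close>

lemma quadratic_nonneg_imp_linear_zero:
  fixes a b :: real
  assumes "\<And>t. 0 \<le> 2 * t * a + t\<^sup>2 * b" and "b \<ge> 0"
  shows "a = 0"
proof (rule ccontr)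
  assume a: "a \<noteq> 0"
  define t where "t = - a / (b + 1)"
  have "t * (b + 1) = - a"
    using assms(2) by (simp add: t_def)
  then have a_eq: "a = - (t * (b + 1))" by simp
  have "2 * t * a + t\<^sup>2 * b = - (t\<^sup>2 * (b + 2))"
    unfolding a_eq by (simp add: algebra_simps power2_eq_square)
  moreover have "t\<^sup>2 * (b + 2) > 0"
    using a a_eq assms(2) by (intro mult_pos_pos) auto
  ultimately show False using assms(1)[of t] by simp
qed

locale semi_inner =
  fixes S :: "('a \<Rightarrow> real) set" and B :: "('a \<Rightarrow> real) \<Rightarrow> ('a \<Rightarrow> real) \<Rightarrow> real"
  assumes lincomb: "u \<in> S \<Longrightarrow> v \<in> S \<Longrightarrow> (\<lambda>x. a * u x + b * v x) \<in> S"
    and sym: "u \<in> S \<Longrightarrow> v \<in> S \<Longrightarrow> B u v = B v u"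
    and bilin: "u \<in> S \<Longrightarrow> v \<in> S \<Longrightarrow> w \<in> S \<Longrightarrow> B (\<lambda>x. a * u x + b * v x) w = a * B u w + b * B v w"
    and nonneg: "u \<in> S \<Longrightarrow> 0 \<le> B u u"
begin

lemma diff_closed: "u \<in> S \<Longrightarrow> v \<in> S \<Longrightarrow> (\<lambda>x. u x - v x) \<in> S"
  and add_closed: "u \<in> S \<Longrightarrow> v \<in> S \<Longrightarrow> (\<lambda>x. u x + v x) \<in> S"
  and scale_closed: "u \<in> S \<Longrightarrow> (\<lambda>x. a * u x) \<in> S"
  using lincomb[of u v 1 "-1"] lincomb[of u v 1 1] lincomb[of u u a 0] by auto

lemma quad:
  assumes "u \<in> S" "v \<in> S"
  shows "B (\<lambda>x. a * u x + b * v x) (\<lambda>x. a * u x + b * v x) = a\<^sup>2 * B u u + 2 * a * b * B u v + b\<^sup>2 * B v v"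
proof -
  let ?w = "\<lambda>x. a * u x + b * v x"
  have w: "?w \<in> S" using assms by (rule lincomb)
  have "B ?w ?w = a * B u ?w + b * B v ?w"
    using assms w by (rule bilin)
  also have "B u ?w = a * B u u + b * B v u"
    using sym[OF assms(1) w] bilin[OF assms assms(1)] by simp
  also have "B v ?w = a * B u v + b * B v v"
    using sym[OF assms(2) w] bilin[OF assms assms(2)] by simp
  finally show ?thesis
    using sym[OF assms] by (simp add: algebra_simps power2_eq_square)
qed

lemma diff_left: "u \<in> S \<Longrightarrow> v \<in> S \<Longrightarrow> w \<in> S \<Longrightarrow> B (\<lambda>x. u x - v x) w = B u w - B v w"
  using bilin[of u v w 1 "-1"] by simp

lemma diff_quad:
  assumes "u \<in> S" "v \<in> S"
  shows "B (\<lambda>x. u x - v x) (\<lambda>x. u x - v x) = B u u - 2 * B u v + B v v"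
  using quad[OF assms, of 1 "-1"] by simp

lemma scale_quad: "u \<in> S \<Longrightarrow> B (\<lambda>x. a * u x) (\<lambda>x. a * u x) = a\<^sup>2 * B u u"
  using quad[of u u a 0] by simp

lemma Cauchy_Schwarz:
  assumes "u \<in> S" "v \<in> S"
  shows "(B u v)\<^sup>2 \<le> B u u * B v v"
proof (cases "B v v = 0")
  case True
  have "0 \<le> 2 * t * (- B u v * B u v) + t\<^sup>2 * 0 + B u u" for t
    using nonneg[OF lincomb[OF assms, of 1 "- t * B u v"]] quad[OF assms, of 1 "- t * B u v"] True
    by (simp add: mult_ac)
  note * = this[of "(B u u + 1) / (2 * (B u v)\<^sup>2)"]
  have "B u v = 0"
  proof (rule ccontr)
    assume "B u v \<noteq> 0"
    then have "2 * ((B u u + 1) / (2 * (B u v)\<^sup>2)) * (- B u v * B u v) = - (B u u + 1)"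
      by (simp add: power2_eq_square field_simps)
    with * show False by simp
  qed
  then show ?thesis using True by simp
next
  case False
  then have pos: "B v v > 0" using nonneg[OF assms(2)] by simp
  let ?b = "- B u v / B v v"
  have "0 \<le> B u u + 2 * ?b * B u v + ?b\<^sup>2 * B v v"
    using nonneg[OF lincomb[OF assms, of 1 ?b]] quad[OF assms, of 1 ?b] by simp
  also have "\<dots> = B u u - (B u v)\<^sup>2 / B v v"
    using pos by (simp add: power2_eq_square)
  finally show ?thesis using pos by (simp add: field_simps)
qed

lemma abs_le:
  assumes "u \<in> S" "v \<in> S"
  shows "\<bar>B u v\<bar> \<le> sqrt (B u u) * sqrt (B v v)"
  using real_sqrt_le_mono[OF Cauchy_Schwarz[OF assms]] by (simp add: real_sqrt_mult)

lemma tendsto_left: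
  assumes u: "\<And>n. u n \<in> S" "l \<in> S" "v \<in> S"
    and lim: "(\<lambda>n. B (\<lambda>x. u n x - l x) (\<lambda>x. u n x - l x)) \<longlonglongrightarrow> 0"
  shows "(\<lambda>n. B (u n) v) \<longlonglongrightarrow> B l v"
proof -
  have "(\<lambda>n. sqrt (B (\<lambda>x. u n x - l x) (\<lambda>x. u n x - l x)) * sqrt (B v v)) \<longlonglongrightarrow> sqrt 0 * sqrt (B v v)"
    by (intro tendsto_intros lim)
  then have z: "(\<lambda>n. sqrt (B (\<lambda>x. u n x - l x) (\<lambda>x. u n x - l x)) * sqrt (B v v)) \<longlonglongrightarrow> 0"
    by simp
  have "(\<lambda>n. B (\<lambda>x. u n x - l x) v) \<longlonglongrightarrow> 0"
    by (rule Lim_null_comparison[OF always_eventually z])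
       (use abs_le[OF diff_closed[OF u(1,2)] u(3)] in simp)
  from tendsto_add[OF this tendsto_const[of "B l v"]] show ?thesis
    using u by (simp add: diff_left)
qed

lemma tendsto_quad:
  assumes u: "\<And>n. u n \<in> S" "l \<in> S"
    and lim: "(\<lambda>n. B (\<lambda>x. u n x - l x) (\<lambda>x. u n x - l x)) \<longlonglongrightarrow> 0"
  shows "(\<lambda>n. B (u n) (u n)) \<longlonglongrightarrow> B l l"
proof -
  have "(\<lambda>n. B (\<lambda>x. u n x - l x) (\<lambda>x. u n x - l x) + 2 * B (u n) l - B l l) \<longlonglongrightarrow> 0 + 2 * B l l - B l l"
    by (intro tendsto_intros lim tendsto_left[OF u u(2) lim])
  then show ?thesis using u by (simp add: diff_quad)
qed

text \<open>
  The representing vector minimises \<open>B v v - 2 * l v\<close>. A minimising sequence is Cauchy by the parallelogram law, and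
  the limit \<open>v\<close> in the completeness hypothesis need only be one of many, as the form may be degenerate.
\<close>

lemma riesz:
  assumes T: "T \<subseteq> S" "z \<in> T" "\<And>u v a b. u \<in> T \<Longrightarrow> v \<in> T \<Longrightarrow> (\<lambda>x. a * u x + b * v x) \<in> T"
    and complete: "\<And>w. (\<And>n. w n \<in> T) \<Longrightarrow>
      (\<And>e. e > 0 \<Longrightarrow> \<exists>N. \<forall>m\<ge>N. \<forall>n\<ge>N. B (\<lambda>x. w m x - w n x) (\<lambda>x. w m x - w n x) < e) \<Longrightarrow>
      \<exists>v\<in>T. (\<lambda>n. B (\<lambda>x. w n x - v x) (\<lambda>x. w n x - v x)) \<longlonglongrightarrow> 0"
    and lin: "\<And>u v a b. u \<in> T \<Longrightarrow> v \<in> T \<Longrightarrow> l (\<lambda>x. a * u x + b * v x) = a * l u + b * (l v :: real)"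
    and bd: "\<And>v. v \<in> T \<Longrightarrow> \<bar>l v\<bar> \<le> C * sqrt (B v v)"
  obtains w where "w \<in> T" "\<And>v. v \<in> T \<Longrightarrow> B w v = l v"
proof -
  define J where "J v = B v v - 2 * l v" for v
  have S: "v \<in> T \<Longrightarrow> v \<in> S" for v using T by auto
  have lower: "J v \<ge> - (C\<^sup>2)" if "v \<in> T" for v
  proof -
    define s where "s = sqrt (B v v)"
    have s: "B v v = s\<^sup>2" using nonneg[OF S[OF that]] by (simp add: s_def)
    have "0 \<le> (s - C)\<^sup>2" by simp
    then have "s\<^sup>2 - 2 * (C * s) \<ge> - (C\<^sup>2)" by (simp add: power2_diff mult_ac)
    moreover have "l v \<le> C * s" using bd[OF that] by (simp add: s_def)
    ultimately show ?thesis unfolding J_def s by linarith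
  qed
  define m where "m = Inf (J ` T)"
  have bdd: "bdd_below (J ` T)" using lower by (auto simp: bdd_below_def)
  have m_le: "m \<le> J v" if "v \<in> T" for v
    unfolding m_def by (rule cInf_lower) (use bdd that in auto)
  have "\<exists>v\<in>T. J v < m + 1 / real (Suc n)" for n
  proof -
    have "\<exists>y\<in>J ` T. y < m + 1 / real (Suc n)"
      by (rule cInf_lessD) (use T(2) in \<open>auto simp: m_def\<close>)
    then show ?thesis by auto
  qed
  then obtain w where w: "\<And>n. w n \<in> T" "\<And>n. J (w n) < m + 1 / real (Suc n)"
    by metis
  have J_quad: "J (\<lambda>x. a * u x + b * v x) = a\<^sup>2 * B u u + 2 * a * b * B u v + b\<^sup>2 * B v v - 2 * a * l u - 2 * b * l v"
    if "u \<in> T" "v \<in> T" for u v a b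
    using quad[OF S[OF that(1)] S[OF that(2)], of a b] lin[OF that, of a b] by (simp add: J_def algebra_simps)
  have par: "B (\<lambda>x. w i x - w j x) (\<lambda>x. w i x - w j x) \<le> 2 / real (Suc i) + 2 / real (Suc j)" for i j
  proof -
    define c where "c = J (\<lambda>x. 1/2 * w i x + 1/2 * w j x)"
    define p where "p = 1 / real (Suc i)"
    define r where "r = 1 / real (Suc j)"
    have "B (\<lambda>x. w i x - w j x) (\<lambda>x. w i x - w j x) = 2 * J (w i) + 2 * J (w j) - 4 * c"
      unfolding c_def diff_quad[OF S[OF w(1)] S[OF w(1)]] J_quad[OF w(1) w(1)]
      by (simp add: J_def power2_eq_square)
    also have "\<dots> \<le> 2 * p + 2 * r"
    proof -
      have "J (w i) < m + p" "J (w j) < m + r" "m \<le> c"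
        unfolding c_def p_def r_def by (intro w(2) m_le T(3) w(1))+
      then show ?thesis by linarith
    qed
    also have "\<dots> = 2 / real (Suc i) + 2 / real (Suc j)"
      by (simp add: p_def r_def del: of_nat_Suc)
    finally show ?thesis .
  qed
  have "\<exists>v\<in>T. (\<lambda>n. B (\<lambda>x. w n x - v x) (\<lambda>x. w n x - v x)) \<longlonglongrightarrow> 0"
  proof (rule complete[OF w(1)])
    fix e :: real assume "e > 0"
    then obtain N where N: "N > 0" "1 / real N < e / 4"
      using reals_Archimedean[of "e / 4"] by (auto simp: inverse_eq_divide intro: that[of "Suc _"])
    show "\<exists>N. \<forall>m\<ge>N. \<forall>n\<ge>N. B (\<lambda>x. w m x - w n x) (\<lambda>x. w m x - w n x) < e"
    proof (intro exI[of _ N] allI impI)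
      fix i j assume ij: "N \<le> i" "N \<le> j"
      have "2 / real (Suc i) \<le> 2 / real N" "2 / real (Suc j) \<le> 2 / real N"
        using ij N by (auto intro!: divide_left_mono)
      then show "B (\<lambda>x. w i x - w j x) (\<lambda>x. w i x - w j x) < e"
        using par[of i j] N(2) by simp
    qed
  qed
  then obtain u where u: "u \<in> T" "(\<lambda>n. B (\<lambda>x. w n x - u x) (\<lambda>x. w n x - u x)) \<longlonglongrightarrow> 0"
    by auto
  have lconv: "(\<lambda>n. l (w n)) \<longlonglongrightarrow> l u"
  proof -
    have "(\<lambda>n. C * sqrt (B (\<lambda>x. w n x - u x) (\<lambda>x. w n x - u x))) \<longlonglongrightarrow> C * sqrt 0"
      by (intro tendsto_intros u(2))
    then have z: "(\<lambda>n. C * sqrt (B (\<lambda>x. w n x - u x) (\<lambda>x. w n x - u x))) \<longlonglongrightarrow> 0"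
      by simp
    have "\<bar>l (\<lambda>x. w n x - u x)\<bar> \<le> C * sqrt (B (\<lambda>x. w n x - u x) (\<lambda>x. w n x - u x))" for n
      by (rule bd) (use T(3)[OF w(1)[of n] u(1), of 1 "-1"] in simp)
    then have "(\<lambda>n. l (\<lambda>x. w n x - u x)) \<longlonglongrightarrow> 0"
      by (intro Lim_null_comparison[OF always_eventually z]) simp
    moreover have "l (\<lambda>x. w n x - u x) = l (w n) - l u" for n
      using lin[OF w(1)[of n] u(1), of 1 "-1"] by simp
    ultimately show ?thesis by (simp add: LIM_zero_iff)
  qed
  have "(\<lambda>n. J (w n)) \<longlonglongrightarrow> J u"
    unfolding J_def by (intro tendsto_intros tendsto_quad lconv u S w)
  moreover have "(\<lambda>n. m + 1 / real (Suc n)) \<longlonglongrightarrow> m + 0"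
    by (intro tendsto_intros LIMSEQ_Suc[OF lim_1_over_n])
  ultimately have "J u \<le> m"
    using w(2) by (intro LIMSEQ_le[of "\<lambda>n. J (w n)" _ "\<lambda>n. m + 1 / real (Suc n)"]) (auto intro: less_imp_le)
  have "B u v = l v" if v: "v \<in> T" for v
  proof -
    have "B u v - l v = 0"
    proof (rule quadratic_nonneg_imp_linear_zero)
      show "0 \<le> B v v" using nonneg S v by auto
      fix t
      have "J u \<le> J (\<lambda>x. 1 * u x + t * v x)"
        using \<open>J u \<le> m\<close> m_le[OF T(3)[OF u(1) v, of 1 t]] by linarith
      then show "0 \<le> 2 * t * (B u v - l v) + t\<^sup>2 * B v v"
        unfolding J_quad[OF u(1) v] by (simp add: J_def algebra_simps)
    qed
    then show ?thesis by simp
  qed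
  with u(1) show thesis by (rule that)
qed

end

lemma integral_mult_semi_inner: "semi_inner L2_space (\<lambda>u v. LINT x|lborel. u x * v x)"
proof
  fix u v w :: "'a \<Rightarrow> real" and a b :: real
  assume u: "u \<in> L2_space"
  show "0 \<le> (LINT x|lborel. u x * u x)" by (simp add: integral_nonneg)
  assume v: "v \<in> L2_space"
  show "(\<lambda>x. a * u x + b * v x) \<in> L2_space" using u v by (rule L2_space_lincomb)
  show "(LINT x|lborel. u x * v x) = (LINT x|lborel. v x * u x)" by (simp add: mult.commute)
  assume w: "w \<in> L2_space"
  have "(LINT x|lborel. (a * u x + b * v x) * w x) = (LINT x|lborel. a * (u x * w x) + b * (v x * w x))"
    by (simp add: algebra_simps)
  also have "\<dots> = a * (LINT x|lborel. u x * w x) + b * (LINT x|lborel. v x * w x)"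
    using L2_integrable_mult[OF u w] L2_integrable_mult[OF v w] by simp
  finally show "(LINT x|lborel. (a * u x + b * v x) * w x) = a * (LINT x|lborel. u x * w x) + b * (LINT x|lborel. v x * w x)" .
qed

lemma semi_inner_sum:
  assumes "semi_inner S B" "semi_inner S C" "t \<ge> 0"
  shows "semi_inner S (\<lambda>u v. B u v + t * C u v)"
proof -
  interpret B: semi_inner S B by fact
  interpret C: semi_inner S C by fact
  show ?thesis
  proof
    fix u v w a b
    assume u: "u \<in> S"
    show "0 \<le> B u u + t * C u u" using u B.nonneg C.nonneg assms(3) by simp
    assume v: "v \<in> S"
    show "(\<lambda>x. a * u x + b * v x) \<in> S" using u v by (rule B.lincomb)
    show "B u v + t * C u v = B v u + t * C v u" using B.sym[OF u v] C.sym[OF u v] by simp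
    assume w: "w \<in> S"
    show "B (\<lambda>x. a * u x + b * v x) w + t * C (\<lambda>x. a * u x + b * v x) w
        = a * (B u w + t * C u w) + b * (B v w + t * C v w)"
      unfolding B.bilin[OF u v w] C.bilin[OF u v w] by (simp add: algebra_simps)
  qed
qed

lemma semi_inner_subset:
  assumes "semi_inner S B" "T \<subseteq> S" "\<And>u v a b. u \<in> T \<Longrightarrow> v \<in> T \<Longrightarrow> (\<lambda>x. a * u x + b * v x) \<in> T"
  shows "semi_inner T B"
proof -
  interpret B: semi_inner S B by fact
  show ?thesis
    by unfold_locales (use assms(2,3) in \<open>auto intro: B.sym B.bilin B.nonneg\<close>)
qed

section \<open>The standard Gaussian\<close>

definition gauss :: "'a::euclidean_space \<Rightarrow> real" where
  "gauss z = (\<Prod>b\<in>Basis. std_normal_density (z \<bullet> b))"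

lemma gauss_eq: "gauss (z::'a::euclidean_space) = (2 * pi) powr (- real DIM('a) / 2) * exp (- (norm z)\<^sup>2 / 2)"
proof -
  have 1: "1 / sqrt (2 * pi) = (2 * pi) powr (- 1 / 2)"
    by (simp add: powr_minus powr_half_sqrt inverse_eq_divide)
  have "(norm z)\<^sup>2 = (\<Sum>b\<in>Basis. (z \<bullet> b)\<^sup>2)"
    by (subst power2_norm_eq_inner, subst euclidean_inner) (simp add: power2_eq_square)
  then have "exp (- (norm z)\<^sup>2 / 2) = (\<Prod>b\<in>Basis. exp (- (z \<bullet> b)\<^sup>2 / 2))"
    by (simp add: exp_sum[symmetric] sum_negf sum_divide_distrib)
  then show ?thesis
    unfolding gauss_def std_normal_density_def prod.distrib 1
    by (simp add: powr_realpow[symmetric] powr_powr prod_constant)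
qed

lemma gauss_pos: "gauss z > 0"
  by (simp add: gauss_eq)

lemma gauss_measurable[measurable]: "gauss \<in> borel_measurable borel"
  unfolding gauss_def by measurable

lemma gauss_integral_prod:
  fixes f :: "'a::euclidean_space \<Rightarrow> real \<Rightarrow> complex"
  assumes f: "\<And>b. b \<in> Basis \<Longrightarrow> integrable lborel (f b)"
  shows "integrable lborel (\<lambda>z::'a. \<Prod>b\<in>Basis. f b (z \<bullet> b))"
    "(LINT z|lborel. (\<Prod>b\<in>Basis. f b (z \<bullet> b))) = (\<Prod>b\<in>Basis. LINT x|lborel. f b x)"
proof -
  interpret product_sigma_finite "\<lambda>_::'a. lborel :: real measure" ..
  have [measurable]: "b \<in> Basis \<Longrightarrow> f b \<in> borel_measurable borel" for b
    using f[of b] by (auto dest: borel_measurable_integrable)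
  have m: "(\<lambda>z::'a. \<Prod>b\<in>Basis. f b (z \<bullet> b)) \<in> borel_measurable borel"
    by measurable
  have eq: "(\<Prod>b\<in>Basis. f b ((\<Sum>c\<in>Basis. x c *\<^sub>R c) \<bullet> b)) = (\<Prod>b\<in>Basis. f b (x b))" for x :: "'a \<Rightarrow> real"
    by (intro prod.cong refl) (simp add: inner_sum_left inner_Basis if_distrib sum.delta cong: if_cong)
  show "integrable lborel (\<lambda>z::'a. \<Prod>b\<in>Basis. f b (z \<bullet> b))"
    by (subst lborel_eq, subst integrable_distr_eq) (use m f in \<open>auto simp: eq intro!: product_integrable_prod\<close>)
  show "(LINT z|lborel. (\<Prod>b\<in>Basis. f b (z \<bullet> b))) = (\<Prod>b\<in>Basis. LINT x|lborel. f b x)"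
    by (subst lborel_eq, subst integral_distr) (use m f in \<open>auto simp: eq intro!: product_integral_prod\<close>)
qed

lemma char_std_normal_density:
  "integrable lborel (\<lambda>x. complex_of_real (std_normal_density x) * exp (\<i> * complex_of_real (t * x)))"
  "(LINT x|lborel. complex_of_real (std_normal_density x) * exp (\<i> * complex_of_real (t * x))) = complex_of_real (exp (- (t\<^sup>2) / 2))"
proof -
  show i: "integrable lborel (\<lambda>x. complex_of_real (std_normal_density x) * exp (\<i> * complex_of_real (t * x)))"
  proof (rule Bochner_Integration.integrable_bound)
    show "integrable lborel std_normal_density"
      using integrable_std_normal_moment[of 0] by simp
  qed (auto simp: norm_mult norm_exp_i_times)
  have "char std_normal_distribution t = complex_of_real (exp (- (t\<^sup>2) / 2))"
    by (simp add: char_std_normal_distribution)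
  then show "(LINT x|lborel. complex_of_real (std_normal_density x) * exp (\<i> * complex_of_real (t * x))) = complex_of_real (exp (- (t\<^sup>2) / 2))"
    unfolding char_def
    by (subst (asm) integral_density) (auto simp: scaleR_conv_of_real)
qed

lemma gauss_char:
  fixes t :: "'a::euclidean_space"
  shows "integrable lborel (\<lambda>z. complex_of_real (gauss z) * exp (\<i> * complex_of_real (t \<bullet> z)))"
    "(LINT z|lborel. complex_of_real (gauss z) * exp (\<i> * complex_of_real (t \<bullet> z))) = complex_of_real (exp (- ((norm t)\<^sup>2) / 2))"
proof -
  let ?f = "\<lambda>b x. complex_of_real (std_normal_density x) * exp (\<i> * complex_of_real ((t \<bullet> b) * x))"
  have eq: "complex_of_real (gauss z) * exp (\<i> * complex_of_real (t \<bullet> z)) = (\<Prod>b\<in>Basis. ?f b (z \<bullet> b))" for z :: 'a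
  proof -
    have "t \<bullet> z = (\<Sum>b\<in>Basis. (t \<bullet> b) * (z \<bullet> b))" by (rule euclidean_inner)
    then have "exp (\<i> * complex_of_real (t \<bullet> z)) = (\<Prod>b\<in>Basis. exp (\<i> * complex_of_real ((t \<bullet> b) * (z \<bullet> b))))"
      by (simp add: sum_distrib_left exp_sum)
    then show ?thesis by (simp add: gauss_def prod.distrib)
  qed
  show "integrable lborel (\<lambda>z. complex_of_real (gauss z) * exp (\<i> * complex_of_real (t \<bullet> z)))"
    unfolding eq by (intro gauss_integral_prod char_std_normal_density)
  have "(norm t)\<^sup>2 = (\<Sum>b\<in>Basis. (t \<bullet> b)\<^sup>2)"
    by (subst power2_norm_eq_inner, subst euclidean_inner) (simp add: power2_eq_square)
  then show "(LINT z|lborel. complex_of_real (gauss z) * exp (\<i> * complex_of_real (t \<bullet> z))) = complex_of_real (exp (- ((norm t)\<^sup>2) / 2))"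
    unfolding eq gauss_integral_prod(2)[of ?f, OF char_std_normal_density(1)] char_std_normal_density(2)
    by (simp add: exp_sum[symmetric] sum_negf sum_divide_distrib flip: of_real_prod)
qed

lemma gauss_integrable: "integrable lborel (gauss :: 'a::euclidean_space \<Rightarrow> real)"
  and gauss_integral: "(LINT z|lborel. gauss (z::'a)) = 1"
proof -
  show "integrable lborel (gauss :: 'a \<Rightarrow> real)"
    using gauss_char(1)[of "0::'a"] by (simp add: complex_of_real_integrable_eq)
  have "complex_of_real (LINT z|lborel. gauss (z::'a)) = 1"
    using gauss_char(2)[of "0::'a"] by simp
  then show "(LINT z|lborel. gauss (z::'a)) = 1"
    using of_real_eq_1_iff by blast
qed

lemma gauss_nn_integral: "(\<integral>\<^sup>+z. ennreal (gauss (z::'a::euclidean_space)) \<partial>lborel) = 1"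
  by (subst nn_integral_eq_integral) (auto simp: gauss_integrable gauss_integral less_imp_le gauss_pos)

lemma gauss_char_cos:
  fixes t :: "'a::euclidean_space"
  shows "integrable lborel (\<lambda>z. gauss z * cos (t \<bullet> z))"
    "(LINT z|lborel. gauss z * cos (t \<bullet> z)) = exp (- ((norm t)\<^sup>2) / 2)"
proof -
  have re: "Re (complex_of_real (gauss z) * exp (\<i> * complex_of_real (t \<bullet> z))) = gauss z * cos (t \<bullet> z)" for z
    by (simp add: Re_exp)
  show "integrable lborel (\<lambda>z. gauss z * cos (t \<bullet> z))"
    using integrable_Re[OF gauss_char(1)[of t]] unfolding re .
  show "(LINT z|lborel. gauss z * cos (t \<bullet> z)) = exp (- ((norm t)\<^sup>2) / 2)"
    using integral_Re[OF gauss_char(1)[of t]] unfolding re gauss_char(2) by simp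
qed

text \<open>
  Since \<open>s exp (- s / 2) \<le> 4 exp (- s / 4)\<close>, the factor \<open>s = |z|\<^sup>2\<close> is paid for by doubling the variance.
\<close>

lemma gauss_second_moment: "(\<integral>\<^sup>+z. ennreal (gauss z * (norm (z::'a::euclidean_space))\<^sup>2) \<partial>lborel) < \<infinity>"
proof -
  let ?K = "(2 * pi) powr (- real DIM('a) / 2)"
  let ?f = "\<lambda>z::'a. ennreal (4 * (?K * exp (- (norm z)\<^sup>2 / 4)))"
  have "(\<integral>\<^sup>+z. ennreal (gauss z * (norm (z::'a))\<^sup>2) \<partial>lborel) \<le> (\<integral>\<^sup>+z. ?f z \<partial>lborel)"
  proof (intro nn_integral_mono ennreal_leI)
    fix z :: 'a
    define s where "s = (norm z)\<^sup>2"
    have "s / 4 \<le> exp (s / 4)" using exp_ge_add_one_self[of "s / 4"] by linarith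
    then have "s * exp (- s / 4) \<le> 4" by (simp add: exp_minus field_simps)
    then have "s * exp (- s / 4) * exp (- s / 4) \<le> 4 * exp (- s / 4)"
      by (intro mult_right_mono) auto
    moreover have "exp (- s / 4) * exp (- s / 4) = exp (- s / 2)"
      by (simp add: exp_add[symmetric])
    ultimately have "s * exp (- s / 2) \<le> 4 * exp (- s / 4)" by (metis mult.assoc)
    then have "?K * (s * exp (- s / 2)) \<le> ?K * (4 * exp (- s / 4))"
      by (intro mult_left_mono) auto
    then show "gauss z * (norm z)\<^sup>2 \<le> 4 * (?K * exp (- (norm z)\<^sup>2 / 4))"
      unfolding gauss_eq s_def by (simp add: algebra_simps)
  qed
  also have "(\<integral>\<^sup>+z. ?f z \<partial>lborel) = ennreal (\<bar>sqrt 2\<bar> ^ DIM('a)) * (\<integral>\<^sup>+z. ?f (0 + sqrt 2 *\<^sub>R z) \<partial>lborel)"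
    by (rule nn_integral_affine) auto
  also have "(\<integral>\<^sup>+z. ?f (0 + sqrt 2 *\<^sub>R z) \<partial>lborel) = (\<integral>\<^sup>+z. 4 * ennreal (gauss (z::'a)) \<partial>lborel)"
    by (intro nn_integral_cong) (simp add: gauss_eq power_mult_distrib ennreal_mult'[symmetric] flip: ennreal_numeral)
  also have "\<dots> = 4"
    by (simp add: nn_integral_cmult gauss_nn_integral)
  finally show ?thesis
    by (simp add: ennreal_mult_less_top order_le_less_trans)
qed

section \<open>The Fourier transform of a square integrable function with bounded support\<close>

lemma integrable_product_bound:
  fixes f :: "'a::euclidean_space \<times> 'b::euclidean_space \<Rightarrow> 'c::{banach, second_countable_topology}"
  assumes [measurable]: "f \<in> borel_measurable (lborel \<Otimes>\<^sub>M lborel)"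
    and a: "integrable lborel a" and b: "integrable lborel b"
    and le: "\<And>x y. norm (f (x, y)) \<le> \<bar>a x\<bar> * \<bar>b y\<bar>"
  shows "integrable (lborel \<Otimes>\<^sub>M lborel) f"
proof (rule integrableI_bounded)
  have [measurable]: "a \<in> borel_measurable borel" "b \<in> borel_measurable borel"
    using a b by (auto dest: borel_measurable_integrable)
  have "(\<integral>\<^sup>+p. ennreal (norm (f p)) \<partial>(lborel \<Otimes>\<^sub>M lborel)) \<le> (\<integral>\<^sup>+p. ennreal (\<bar>a (fst p)\<bar>) * ennreal (\<bar>b (snd p)\<bar>) \<partial>(lborel \<Otimes>\<^sub>M lborel))"
    using le by (intro nn_integral_mono) (auto simp flip: ennreal_mult intro!: ennreal_leI)
  also have "\<dots> = (\<integral>\<^sup>+x. \<integral>\<^sup>+y. ennreal (\<bar>a x\<bar>) * ennreal (\<bar>b y\<bar>) \<partial>lborel \<partial>lborel)"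
    by (subst lborel.nn_integral_fst[symmetric]) auto
  also have "\<dots> = (\<integral>\<^sup>+x. ennreal (\<bar>a x\<bar>) \<partial>lborel) * (\<integral>\<^sup>+y. ennreal (\<bar>b y\<bar>) \<partial>lborel)"
    by (simp add: nn_integral_cmult nn_integral_multc)
  also have "\<dots> < \<infinity>"
    using a b by (auto simp: integrable_iff_bounded ennreal_mult_less_top)
  finally show "(\<integral>\<^sup>+p. ennreal (norm (f p)) \<partial>(lborel \<Otimes>\<^sub>M lborel)) < \<infinity>" .
qed simp

lemma fourier_integrand_integrable:
  assumes "integrable lborel u"
  shows "integrable lborel (\<lambda>x. exp (- (\<i> * complex_of_real (x \<bullet> \<xi>))) * complex_of_real (u x))"
proof (rule Bochner_Integration.integrable_bound[OF assms])
  show "(\<lambda>x. exp (- (\<i> * complex_of_real (x \<bullet> \<xi>))) * complex_of_real (u x)) \<in> borel_measurable lborel"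
    using borel_measurable_integrable[OF assms] by measurable
  show "AE x in lborel. norm (exp (- (\<i> * complex_of_real (x \<bullet> \<xi>))) * complex_of_real (u x)) \<le> norm (u x)"
    by (rule AE_I2) (simp add: norm_mult norm_exp_eq_Re)
qed

lemma fourier_L1_measurable[measurable]:
  assumes [measurable]: "u \<in> borel_measurable borel"
  shows "fourier_L1 u \<in> borel_measurable borel"
  unfolding fourier_L1_def by measurable

lemma fourier_L1_bound:
  assumes "integrable lborel (u :: 'a::euclidean_space \<Rightarrow> real)"
  shows "cmod (fourier_L1 u \<xi>) \<le> (2 * pi) powr (- real DIM('a) / 2) * (LINT x|lborel. \<bar>u x\<bar>)"
proof -
  have "cmod (LINT x|lborel. exp (- (\<i> * complex_of_real (x \<bullet> \<xi>))) * complex_of_real (u x))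
      \<le> (LINT x|lborel. norm (exp (- (\<i> * complex_of_real (x \<bullet> \<xi>))) * complex_of_real (u x)))"
    by (rule integral_norm_bound)
  also have "\<dots> = (LINT x|lborel. \<bar>u x\<bar>)"
    by (simp add: norm_mult norm_exp_eq_Re)
  finally show ?thesis
    unfolding fourier_L1_def by (simp add: norm_mult mult_left_mono)
qed

lemma fourier_L1_cong_AE:
  assumes "AE x in lborel. u x = v x" "u \<in> borel_measurable borel" "v \<in> borel_measurable borel"
  shows "fourier_L1 u = fourier_L1 v"
  unfolding fourier_L1_def using assms
  by (intro ext arg_cong2[where f = "(*)"] refl integral_cong_AE) (auto elim!: eventually_mono)

lemma integrable_affine:
  fixes f :: "'a::euclidean_space \<Rightarrow> 'b::{banach, second_countable_topology}"
  assumes f: "integrable lborel f" and c: "c \<noteq> 0"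
  shows "integrable lborel (\<lambda>x. f (t + c *\<^sub>R x))"
proof -
  have [measurable]: "f \<in> borel_measurable borel" using f by (auto dest: borel_measurable_integrable)
  have pos: "0 < \<bar>c\<bar> ^ DIM('a)" using c by simp
  have "(\<integral>\<^sup>+x. ennreal (norm (f x)) \<partial>lborel) = ennreal (\<bar>c\<bar> ^ DIM('a)) * (\<integral>\<^sup>+x. ennreal (norm (f (t + c *\<^sub>R x))) \<partial>lborel)"
    by (rule nn_integral_affine) (use c in auto)
  then have "(\<integral>\<^sup>+x. ennreal (norm (f (t + c *\<^sub>R x))) \<partial>lborel) < \<infinity>"
    using f pos by (auto simp: integrable_iff_bounded ennreal_mult_less_top)
  then show ?thesis by (simp add: integrable_iff_bounded)
qed

text \<open>
  Inserting a Gaussian factor into \<open>\<integral>|(fourier u)(\<xi>)|\<^sup>2 d\<xi>\<close> makes Fubini's theorem applicable. The Gaussian is its own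
  transform, so the other side is the correlation of \<open>u\<close> averaged over Gaussian shifts of size \<open>\<epsilon>\<close>.
\<close>

lemma gauss_regularised_plancherel:
  fixes u :: "'a::euclidean_space \<Rightarrow> real"
  assumes u: "u \<in> L2_bd" and e: "\<epsilon> > 0"
  shows "integrable lborel (\<lambda>\<xi>. exp (- (\<epsilon>\<^sup>2 * (norm \<xi>)\<^sup>2) / 2) * (cmod (fourier_L1 u \<xi>))\<^sup>2)"
    and "(LINT \<xi>|lborel. exp (- (\<epsilon>\<^sup>2 * (norm \<xi>)\<^sup>2) / 2) * (cmod (fourier_L1 u \<xi>))\<^sup>2)
      = (LINT z|lborel. gauss z * (LINT x|lborel. u x * u (x + \<epsilon> *\<^sub>R z)))"
proof -
  define K where "K = (2 * pi) powr (- real DIM('a) / 2)"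
  have K: "K > 0" by (simp add: K_def)
  have gK: "gauss z = K * exp (- (norm z)\<^sup>2 / 2)" for z :: 'a by (simp add: gauss_eq K_def)
  define E where "E t = exp (\<i> * complex_of_real t)" for t
  have E_norm[simp]: "cmod (E t) = 1" for t by (simp add: E_def norm_exp_i_times)
  have E_add: "E (s + t) = E s * E t" for s t by (simp add: E_def exp_add distrib_left)
  have E_cnj: "cnj (E t) = E (- t)" for t by (simp add: E_def exp_cnj)
  have [measurable]: "E \<in> borel_measurable borel" unfolding E_def by measurable
  define G where "G \<xi> = exp (- (\<epsilon>\<^sup>2 * (norm \<xi>)\<^sup>2) / 2)" for \<xi> :: 'a
  have G_gauss: "G \<xi> = gauss (\<epsilon> *\<^sub>R \<xi>) / K" for \<xi>
    using K by (simp add: G_def gK power_mult_distrib)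
  have G_pos: "G \<xi> > 0" for \<xi> by (simp add: G_def)
  have [measurable]: "G \<in> borel_measurable borel" unfolding G_def by measurable
  have G_int: "integrable lborel G"
  proof -
    have "integrable lborel (\<lambda>\<xi>::'a. gauss (0 + \<epsilon> *\<^sub>R \<xi>))"
      by (rule integrable_affine[OF gauss_integrable]) (use e in simp)
    then show ?thesis unfolding G_gauss by simp
  qed
  have ui: "integrable lborel u" by (rule L2_bd_integrable[OF u])
  have u2: "u \<in> L2_space" by (rule L2_bd_L2[OF u])
  have [measurable]: "u \<in> borel_measurable borel" using u2 by (rule L2_spaceD)
  have uc: "integrable lborel (\<lambda>x. complex_of_real (u x))" using ui by simp
  define F where "F \<xi> = (LINT x|lborel. E (- (x \<bullet> \<xi>)) * complex_of_real (u x))" for \<xi>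
  define V where "V \<xi> = (LINT x|lborel. E (x \<bullet> \<xi>) * complex_of_real (u x))" for \<xi>
  have [measurable]: "F \<in> borel_measurable borel" "V \<in> borel_measurable borel"
    unfolding F_def V_def by measurable
  have FK: "fourier_L1 u \<xi> = K * F \<xi>" for \<xi>
    by (simp add: fourier_L1_def F_def K_def E_def)
  have cnjF: "cnj (F \<xi>) = V \<xi>" for \<xi>
    unfolding F_def V_def by (subst Bochner_Integration.integral_cnj[symmetric]) (simp add: E_cnj)
  define C where "C = (LINT x|lborel. \<bar>u x\<bar>)"
  have V_bd: "cmod (V \<xi>) \<le> C" for \<xi>
    unfolding V_def C_def by (rule order_trans[OF integral_norm_bound]) (simp add: norm_mult)
  have F_bd: "cmod (F \<xi>) \<le> C" for \<xi>
    using V_bd[of \<xi>] cnjF[of \<xi>] by (metis complex_mod_cnj)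
  have C0: "C \<ge> 0" by (simp add: C_def)
  show int: "integrable lborel (\<lambda>\<xi>. exp (- (\<epsilon>\<^sup>2 * (norm \<xi>)\<^sup>2) / 2) * (cmod (fourier_L1 u \<xi>))\<^sup>2)"
  proof (rule Bochner_Integration.integrable_bound)
    show "integrable lborel (\<lambda>\<xi>. G \<xi> * (K * C)\<^sup>2)" using G_int by simp
    have "cmod (fourier_L1 u \<xi>) \<le> K * C" for \<xi>
      using F_bd[of \<xi>] K by (simp add: FK norm_mult)
    then have "(cmod (fourier_L1 u \<xi>))\<^sup>2 \<le> (K * C)\<^sup>2" for \<xi> by (intro power_mono) auto
    then show "AE \<xi> in lborel. norm (exp (- (\<epsilon>\<^sup>2 * (norm \<xi>)\<^sup>2) / 2) * (cmod (fourier_L1 u \<xi>))\<^sup>2) \<le> norm (G \<xi> * (K * C)\<^sup>2)"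
      unfolding G_def by (intro AE_I2) (simp add: abs_mult)
  qed measurable
  have k: "(LINT \<xi>|lborel. complex_of_real (G \<xi>) * E (t \<bullet> \<xi>)) = complex_of_real (inverse (\<epsilon> ^ DIM('a)) / K\<^sup>2 * gauss ((1 / \<epsilon>) *\<^sub>R t))" for t
  proof -
    let ?h = "\<lambda>z. complex_of_real (1 / K) * (complex_of_real (gauss z) * E (((1 / \<epsilon>) *\<^sub>R t) \<bullet> z))"
    have "(LINT z|lborel. ?h z) = (\<bar>\<epsilon>\<bar> ^ DIM('a)) *\<^sub>R (LINT \<xi>|lborel. ?h (0 + \<epsilon> *\<^sub>R \<xi>))"
      by (rule integral_affine) (use e in auto)
    also have "(\<lambda>\<xi>. ?h (0 + \<epsilon> *\<^sub>R \<xi>)) = (\<lambda>\<xi>. complex_of_real (G \<xi>) * E (t \<bullet> \<xi>))"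
      using e by (auto simp: G_gauss)
    finally have 1: "(LINT z|lborel. ?h z) = (\<bar>\<epsilon>\<bar> ^ DIM('a)) *\<^sub>R (LINT \<xi>|lborel. complex_of_real (G \<xi>) * E (t \<bullet> \<xi>))" .
    have "(LINT z|lborel. ?h z) = complex_of_real (1 / K) * complex_of_real (exp (- ((norm ((1 / \<epsilon>) *\<^sub>R t))\<^sup>2) / 2))"
      unfolding E_def using gauss_char(2)[of "(1 / \<epsilon>) *\<^sub>R t"] by simp
    also have "\<dots> = complex_of_real (1 / K\<^sup>2 * gauss ((1 / \<epsilon>) *\<^sub>R t))"
      unfolding gK using K by (simp add: power2_eq_square)
    finally have 2: "complex_of_real (1 / K\<^sup>2 * gauss ((1 / \<epsilon>) *\<^sub>R t)) = complex_of_real (\<epsilon> ^ DIM('a)) * (LINT \<xi>|lborel. complex_of_real (G \<xi>) * E (t \<bullet> \<xi>))"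
      using 1 e by (simp add: scaleR_conv_of_real)
    have "complex_of_real (inverse (\<epsilon> ^ DIM('a)) / K\<^sup>2 * gauss ((1 / \<epsilon>) *\<^sub>R t))
        = complex_of_real (inverse (\<epsilon> ^ DIM('a))) * complex_of_real (1 / K\<^sup>2 * gauss ((1 / \<epsilon>) *\<^sub>R t))"
      by simp
    also have "\<dots> = (LINT \<xi>|lborel. complex_of_real (G \<xi>) * E (t \<bullet> \<xi>))"
      unfolding 2 using e by (simp add: mult.assoc[symmetric] flip: of_real_mult)
    finally show ?thesis by simp
  qed
  define W where "W x = (LINT z|lborel. gauss z * u (x + \<epsilon> *\<^sub>R z))" for x
  have A: "(LINT \<xi>|lborel. complex_of_real (G \<xi>) * V \<xi> * E (- (x \<bullet> \<xi>))) = complex_of_real (W x / K\<^sup>2)" for x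
  proof -
    have "(LINT \<xi>|lborel. complex_of_real (G \<xi>) * V \<xi> * E (- (x \<bullet> \<xi>)))
        = (LINT \<xi>|lborel. LINT y|lborel. complex_of_real (u y) * (complex_of_real (G \<xi>) * E ((y - x) \<bullet> \<xi>)))"
    proof (rule Bochner_Integration.integral_cong[OF refl])
      fix \<xi>
      have "complex_of_real (G \<xi>) * V \<xi> * E (- (x \<bullet> \<xi>)) = (complex_of_real (G \<xi>) * E (- (x \<bullet> \<xi>))) * V \<xi>"
        by simp
      also have "\<dots> = (LINT y|lborel. (complex_of_real (G \<xi>) * E (- (x \<bullet> \<xi>))) * (E (y \<bullet> \<xi>) * complex_of_real (u y)))"
        unfolding V_def by simp
      also have "\<dots> = (LINT y|lborel. complex_of_real (u y) * (complex_of_real (G \<xi>) * E ((y - x) \<bullet> \<xi>)))"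
        by (intro Bochner_Integration.integral_cong refl)
           (simp add: inner_diff_left E_add[of "_ \<bullet> \<xi>" "- (x \<bullet> \<xi>)", simplified])
      finally show "complex_of_real (G \<xi>) * V \<xi> * E (- (x \<bullet> \<xi>)) = (LINT y|lborel. complex_of_real (u y) * (complex_of_real (G \<xi>) * E ((y - x) \<bullet> \<xi>)))" .
    qed
    also have "\<dots> = (LINT y|lborel. LINT \<xi>|lborel. complex_of_real (u y) * (complex_of_real (G \<xi>) * E ((y - x) \<bullet> \<xi>)))"
    proof (rule lborel_pair.Fubini_integral)
      show "integrable (lborel \<Otimes>\<^sub>M lborel) (\<lambda>(y, \<xi>). complex_of_real (u y) * (complex_of_real (G \<xi>) * E ((y - x) \<bullet> \<xi>)))"
        by (rule integrable_product_bound[OF _ ui G_int]) (auto simp: norm_mult)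
    qed
    also have "\<dots> = (LINT y|lborel. complex_of_real (u y * (inverse (\<epsilon> ^ DIM('a)) / K\<^sup>2 * gauss ((1 / \<epsilon>) *\<^sub>R (y - x)))))"
      by (simp add: k)
    also have "\<dots> = complex_of_real (LINT y|lborel. u y * (inverse (\<epsilon> ^ DIM('a)) / K\<^sup>2 * gauss ((1 / \<epsilon>) *\<^sub>R (y - x))))"
      by (rule integral_complex_of_real)
    also have "(LINT y|lborel. u y * (inverse (\<epsilon> ^ DIM('a)) / K\<^sup>2 * gauss ((1 / \<epsilon>) *\<^sub>R (y - x))))
      = (\<bar>\<epsilon>\<bar> ^ DIM('a)) *\<^sub>R (LINT z|lborel. u (x + \<epsilon> *\<^sub>R z) * (inverse (\<epsilon> ^ DIM('a)) / K\<^sup>2 * gauss ((1 / \<epsilon>) *\<^sub>R ((x + \<epsilon> *\<^sub>R z) - x))))"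
      by (rule integral_affine) (use e in auto)
    also have "\<dots> = (\<bar>\<epsilon>\<bar> ^ DIM('a)) *\<^sub>R (LINT z|lborel. (inverse (\<epsilon> ^ DIM('a)) / K\<^sup>2) * (gauss z * u (x + \<epsilon> *\<^sub>R z)))"
      using e by (intro arg_cong2[where f = scaleR] refl Bochner_Integration.integral_cong) simp
    also have "\<dots> = W x / K\<^sup>2"
      unfolding W_def using e by simp
    finally show ?thesis .
  qed
  have "complex_of_real (LINT \<xi>|lborel. G \<xi> * (cmod (fourier_L1 u \<xi>))\<^sup>2)
      = (LINT \<xi>|lborel. complex_of_real (G \<xi> * (cmod (fourier_L1 u \<xi>))\<^sup>2))"
    by (rule integral_complex_of_real[symmetric])
  also have "\<dots> = (LINT \<xi>|lborel. complex_of_real (K\<^sup>2) * (LINT x|lborel. complex_of_real (u x) * (complex_of_real (G \<xi>) * V \<xi> * E (- (x \<bullet> \<xi>)))))"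
  proof (rule Bochner_Integration.integral_cong[OF refl])
    fix \<xi>
    have "complex_of_real (G \<xi> * (cmod (fourier_L1 u \<xi>))\<^sup>2) = complex_of_real (G \<xi>) * (fourier_L1 u \<xi> * cnj (fourier_L1 u \<xi>))"
      by (subst complex_norm_square[symmetric]) simp
    also have "\<dots> = complex_of_real (K\<^sup>2) * ((complex_of_real (G \<xi>) * V \<xi>) * F \<xi>)"
      by (simp add: FK cnjF power2_eq_square)
    also have "(complex_of_real (G \<xi>) * V \<xi>) * F \<xi> = (LINT x|lborel. (complex_of_real (G \<xi>) * V \<xi>) * (E (- (x \<bullet> \<xi>)) * complex_of_real (u x)))"
      unfolding F_def by simp
    also have "\<dots> = (LINT x|lborel. complex_of_real (u x) * (complex_of_real (G \<xi>) * V \<xi> * E (- (x \<bullet> \<xi>))))"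
      by (intro Bochner_Integration.integral_cong refl) simp
    finally show "complex_of_real (G \<xi> * (cmod (fourier_L1 u \<xi>))\<^sup>2) = complex_of_real (K\<^sup>2) * (LINT x|lborel. complex_of_real (u x) * (complex_of_real (G \<xi>) * V \<xi> * E (- (x \<bullet> \<xi>))))" .
  qed
  also have "\<dots> = complex_of_real (K\<^sup>2) * (LINT \<xi>|lborel. LINT x|lborel. complex_of_real (u x) * (complex_of_real (G \<xi>) * V \<xi> * E (- (x \<bullet> \<xi>))))"
    by simp
  also have "(LINT \<xi>|lborel. LINT x|lborel. complex_of_real (u x) * (complex_of_real (G \<xi>) * V \<xi> * E (- (x \<bullet> \<xi>))))
      = (LINT x|lborel. LINT \<xi>|lborel. complex_of_real (u x) * (complex_of_real (G \<xi>) * V \<xi> * E (- (x \<bullet> \<xi>))))"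
  proof (rule lborel_pair.Fubini_integral)
    show "integrable (lborel \<Otimes>\<^sub>M lborel) (\<lambda>(x, \<xi>). complex_of_real (u x) * (complex_of_real (G \<xi>) * V \<xi> * E (- (x \<bullet> \<xi>))))"
    proof (rule integrable_product_bound[OF _ ui])
      show "integrable lborel (\<lambda>\<xi>. G \<xi> * C)" using G_int by simp
      show "norm (case (x, \<xi>) of (x, \<xi>) \<Rightarrow> complex_of_real (u x) * (complex_of_real (G \<xi>) * V \<xi> * E (- (x \<bullet> \<xi>)))) \<le> \<bar>u x\<bar> * \<bar>G \<xi> * C\<bar>" for x \<xi>
        using V_bd[of \<xi>] C0 G_pos[of \<xi>] by (auto simp: norm_mult abs_mult intro!: mult_left_mono)
    qed auto
  qed
  also have "\<dots> = (LINT x|lborel. complex_of_real (u x * (W x / K\<^sup>2)))"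
    by (simp add: A)
  also have "\<dots> = complex_of_real (LINT x|lborel. u x * (W x / K\<^sup>2))"
    by (rule integral_complex_of_real)
  finally have "complex_of_real (LINT \<xi>|lborel. G \<xi> * (cmod (fourier_L1 u \<xi>))\<^sup>2) = complex_of_real (K\<^sup>2 * (LINT x|lborel. u x * (W x / K\<^sup>2)))"
    by simp
  then have "(LINT \<xi>|lborel. G \<xi> * (cmod (fourier_L1 u \<xi>))\<^sup>2) = K\<^sup>2 * (LINT x|lborel. u x * (W x / K\<^sup>2))"
    unfolding of_real_eq_iff .
  also have "\<dots> = (LINT x|lborel. u x * W x)"
  proof -
    have "(LINT x|lborel. u x * (W x / K\<^sup>2)) = (LINT x|lborel. (1 / K\<^sup>2) * (u x * W x))"
      by (intro Bochner_Integration.integral_cong refl) simp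
    then show ?thesis using K by simp
  qed
  also have "\<dots> = (LINT x|lborel. LINT z|lborel. u x * (gauss z * u (x + \<epsilon> *\<^sub>R z)))"
    unfolding W_def by simp
  also have "\<dots> = (LINT z|lborel. LINT x|lborel. u x * (gauss z * u (x + \<epsilon> *\<^sub>R z)))"
  proof (rule lborel_pair.Fubini_integral[symmetric], rule integrableI_bounded)
    have "(\<integral>\<^sup>+ p. ennreal (norm (case p of (x, z) \<Rightarrow> u x * (gauss z * u (x + \<epsilon> *\<^sub>R z)))) \<partial>(lborel \<Otimes>\<^sub>M lborel))
      = (\<integral>\<^sup>+ z. \<integral>\<^sup>+ x. ennreal (norm (u x * (gauss z * u (x + \<epsilon> *\<^sub>R z)))) \<partial>lborel \<partial>lborel)"
      by (subst lborel_pair.nn_integral_snd[symmetric]) auto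
    also have "\<dots> \<le> (\<integral>\<^sup>+ z. ennreal (gauss (z::'a)) * (l2sq u + l2sq u) \<partial>lborel)"
    proof (rule nn_integral_mono)
      fix z :: 'a
      have "(\<integral>\<^sup>+ x. ennreal (norm (u x * (gauss z * u (x + \<epsilon> *\<^sub>R z)))) \<partial>lborel)
        \<le> (\<integral>\<^sup>+ x. ennreal (gauss z) * (ennreal ((norm (u x))\<^sup>2) + ennreal ((norm (u (x + \<epsilon> *\<^sub>R z)))\<^sup>2)) \<partial>lborel)"
      proof (rule nn_integral_mono)
        fix x
        have "2 * (\<bar>u x\<bar> * \<bar>u (x + \<epsilon> *\<^sub>R z)\<bar>) \<le> \<bar>u x\<bar>\<^sup>2 + \<bar>u (x + \<epsilon> *\<^sub>R z)\<bar>\<^sup>2"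
          using sum_squares_bound[of "\<bar>u x\<bar>" "\<bar>u (x + \<epsilon> *\<^sub>R z)\<bar>"] by simp
        moreover have "0 \<le> \<bar>u x\<bar> * \<bar>u (x + \<epsilon> *\<^sub>R z)\<bar>" by simp
        ultimately have "\<bar>u x\<bar> * \<bar>u (x + \<epsilon> *\<^sub>R z)\<bar> \<le> (norm (u x))\<^sup>2 + (norm (u (x + \<epsilon> *\<^sub>R z)))\<^sup>2"
          unfolding real_norm_def by linarith
        then have "gauss z * (\<bar>u x\<bar> * \<bar>u (x + \<epsilon> *\<^sub>R z)\<bar>) \<le> gauss z * ((norm (u x))\<^sup>2 + (norm (u (x + \<epsilon> *\<^sub>R z)))\<^sup>2)"
          using gauss_pos[of z] by (intro mult_left_mono) auto
        then show "ennreal (norm (u x * (gauss z * u (x + \<epsilon> *\<^sub>R z)))) \<le> ennreal (gauss z) * (ennreal ((norm (u x))\<^sup>2) + ennreal ((norm (u (x + \<epsilon> *\<^sub>R z)))\<^sup>2))"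
          using gauss_pos[of z]
          by (simp add: ennreal_plus[symmetric] ennreal_mult'[symmetric] abs_mult less_imp_le mult_ac del: ennreal_plus)
      qed
      also have "\<dots> = ennreal (gauss z) * (l2sq u + l2sq (\<lambda>x. u (x + \<epsilon> *\<^sub>R z)))"
        unfolding l2sq_def by (simp add: nn_integral_cmult nn_integral_add)
      finally show "(\<integral>\<^sup>+ x. ennreal (norm (u x * (gauss z * u (x + \<epsilon> *\<^sub>R z)))) \<partial>lborel) \<le> ennreal (gauss z) * (l2sq u + l2sq u)"
        by (simp add: l2sq_translate)
    qed
    also have "\<dots> = l2sq u + l2sq u"
      by (simp add: nn_integral_multc gauss_nn_integral)
    also have "\<dots> < \<infinity>" using u2 by (simp add: L2_space_iff)
    finally show "(\<integral>\<^sup>+ p. ennreal (norm (case p of (x, z) \<Rightarrow> u x * (gauss z * u (x + \<epsilon> *\<^sub>R z)))) \<partial>(lborel \<Otimes>\<^sub>M lborel)) < \<infinity>" .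
  qed auto
  also have "\<dots> = (LINT z|lborel. gauss z * (LINT x|lborel. u x * u (x + \<epsilon> *\<^sub>R z)))"
    by (subst integral_mult_right_zero[symmetric], intro Bochner_Integration.integral_cong refl) simp
  finally show "(LINT \<xi>|lborel. exp (- (\<epsilon>\<^sup>2 * (norm \<xi>)\<^sup>2) / 2) * (cmod (fourier_L1 u \<xi>))\<^sup>2)
      = (LINT z|lborel. gauss z * (LINT x|lborel. u x * u (x + \<epsilon> *\<^sub>R z)))"
    unfolding G_def .
qed

text \<open>
  As \<open>\<epsilon>\<close> tends to 0 in the regularised identity, the left side converges by monotone convergence. The right side
  converges by dominated convergence, because the correlation of \<open>u\<close> is continuous at 0 by continuity of translation.
\<close>

theorem plancherel:
  fixes u :: "'a::euclidean_space \<Rightarrow> real"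
  assumes u: "u \<in> L2_bd"
  shows "l2sq (fourier_L1 u) = l2sq u"
proof -
  have u2: "u \<in> L2_space" by (rule L2_bd_L2[OF u])
  have [measurable]: "u \<in> borel_measurable borel" using u2 by (rule L2_spaceD)
  interpret semi_inner L2_space "\<lambda>u v. LINT x|lborel. u x * v x" by (rule integral_mult_semi_inner)
  define \<rho> where "\<rho> h = (LINT x|lborel. u x * u (x + h))" for h
  have [measurable]: "\<rho> \<in> borel_measurable borel" unfolding \<rho>_def by measurable
  define N where "N = (LINT x|lborel. u x * u x)"
  have \<rho>_bd: "\<bar>\<rho> h\<bar> \<le> N" for h
  proof -
    have "(LINT x|lborel. u (x + h) * u (x + h)) = N"
      using integral_affine[of "\<lambda>x. u x * u x" 1 h] by (simp add: N_def add.commute)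
    then show ?thesis
      using abs_le[OF u2 L2_space_translate[OF u2], of h] nonneg[OF u2] by (simp add: \<rho>_def N_def)
  qed
  have \<rho>_cont: "(\<lambda>n. \<rho> (h n)) \<longlonglongrightarrow> N" if h: "h \<longlonglongrightarrow> 0" for h :: "nat \<Rightarrow> 'a"
  proof -
    have "(\<lambda>n. enn2real (l2sq (\<lambda>x. u (x + h n) - u x))) \<longlonglongrightarrow> 0"
      by (rule tendsto_enn2real) (use L2_translate_continuous[OF u2 h] in simp_all)
    moreover have "enn2real (l2sq (\<lambda>x. u (x + h n) - u x)) = (LINT x|lborel. (u (x + h n) - u x) * (u (x + h n) - u x))" for n
      using integral_square_eq_l2sq(2)[OF L2_space_diff[OF L2_space_translate[OF u2, of "h n"] u2]]
      by (simp add: power2_eq_square)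
    ultimately have "(\<lambda>n. LINT x|lborel. u (x + h n) * u x) \<longlonglongrightarrow> (LINT x|lborel. u x * u x)"
      by (intro tendsto_left[of "\<lambda>n x. u (x + h n)" u u]) (use u2 L2_space_translate in auto)
    then show ?thesis by (simp add: \<rho>_def N_def mult.commute)
  qed
  define e where "e n = 1 / real (Suc n)" for n
  have e: "e n > 0" "e \<longlonglongrightarrow> 0" for n
    unfolding e_def by (simp, rule LIMSEQ_Suc[OF lim_1_over_n])
  let ?f = "\<lambda>n \<xi>. exp (- ((e n)\<^sup>2 * (norm \<xi>)\<^sup>2) / 2) * (cmod (fourier_L1 u \<xi>))\<^sup>2"
  have "(\<lambda>n. LINT z|lborel. gauss z * \<rho> (e n *\<^sub>R z)) \<longlonglongrightarrow> (LINT z|lborel. gauss (z::'a) * N)"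
  proof (rule integral_dominated_convergence[where w = "\<lambda>z. gauss z * N"])
    show "integrable lborel (\<lambda>z. gauss (z::'a) * N)" by (simp add: gauss_integrable)
    show "AE z in lborel. (\<lambda>n. gauss z * \<rho> (e n *\<^sub>R z)) \<longlonglongrightarrow> gauss z * N"
    proof (rule AE_I2)
      fix z :: 'a
      have "(\<lambda>n. e n *\<^sub>R z) \<longlonglongrightarrow> 0 *\<^sub>R z" by (intro tendsto_intros e)
      then have "(\<lambda>n. \<rho> (e n *\<^sub>R z)) \<longlonglongrightarrow> N" by (intro \<rho>_cont) simp
      then show "(\<lambda>n. gauss z * \<rho> (e n *\<^sub>R z)) \<longlonglongrightarrow> gauss z * N" by (intro tendsto_intros)
    qed
    show "AE z in lborel. norm (gauss z * \<rho> (e n *\<^sub>R z)) \<le> gauss z * N" for n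
      using \<rho>_bd by (intro AE_I2) (auto simp: abs_mult gauss_pos less_imp_le[OF gauss_pos] intro!: mult_mono)
  qed auto
  then have lim1: "(\<lambda>n. LINT \<xi>|lborel. ?f n \<xi>) \<longlonglongrightarrow> N"
    unfolding gauss_regularised_plancherel(2)[OF u e(1)] \<rho>_def[symmetric] by (simp add: gauss_integral)
  have nn: "(\<integral>\<^sup>+\<xi>. ennreal (?f n \<xi>) \<partial>lborel) = ennreal (LINT \<xi>|lborel. ?f n \<xi>)" for n
    by (rule nn_integral_eq_integral[OF gauss_regularised_plancherel(1)[OF u e(1)]]) simp
  have "(\<lambda>n. \<integral>\<^sup>+\<xi>. ennreal (?f n \<xi>) \<partial>lborel) \<longlonglongrightarrow> (\<integral>\<^sup>+\<xi>. ennreal ((norm (fourier_L1 u \<xi>))\<^sup>2) \<partial>lborel)"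
  proof (rule nn_integral_LIMSEQ)
    show "incseq (\<lambda>n \<xi>. ennreal (?f n \<xi>))"
    proof (intro incseq_SucI le_funI ennreal_leI mult_right_mono)
      fix n and \<xi> :: 'a
      have "e (Suc n) \<le> e n" by (simp add: e_def field_simps)
      then have "(e (Suc n))\<^sup>2 \<le> (e n)\<^sup>2" using e(1)[of "Suc n"] by (intro power_mono) auto
      then have "(e (Suc n))\<^sup>2 * (norm \<xi>)\<^sup>2 \<le> (e n)\<^sup>2 * (norm \<xi>)\<^sup>2" by (intro mult_right_mono) auto
      then show "exp (- ((e n)\<^sup>2 * (norm \<xi>)\<^sup>2) / 2) \<le> exp (- ((e (Suc n))\<^sup>2 * (norm \<xi>)\<^sup>2) / 2)" by simp
    qed simp
    show "(\<lambda>n. ennreal (?f n \<xi>)) \<longlonglongrightarrow> ennreal ((norm (fourier_L1 u \<xi>))\<^sup>2)" for \<xi>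
    proof -
      have "(\<lambda>n. ?f n \<xi>) \<longlonglongrightarrow> exp (- (0\<^sup>2 * (norm \<xi>)\<^sup>2) / 2) * (cmod (fourier_L1 u \<xi>))\<^sup>2"
        by (intro tendsto_intros e(2)) simp
      then show ?thesis by (intro tendsto_ennrealI) simp
    qed
  qed measurable
  then have "(\<lambda>n. ennreal (LINT \<xi>|lborel. ?f n \<xi>)) \<longlonglongrightarrow> l2sq (fourier_L1 u)"
    unfolding nn l2sq_def .
  moreover have "(\<lambda>n. ennreal (LINT \<xi>|lborel. ?f n \<xi>)) \<longlonglongrightarrow> ennreal N"
    by (intro tendsto_ennrealI lim1)
  ultimately have "l2sq (fourier_L1 u) = ennreal N" by (rule LIMSEQ_unique)
  also have "\<dots> = l2sq u"
    using integral_square_eq_l2sq(1)[OF u2] by (simp add: N_def power2_eq_square)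
  finally show ?thesis .
qed

text \<open>
  The truncations of \<open>u\<close> to large balls agree with \<open>u\<close> almost everywhere, so the \<open>L\<^sup>2\<close>-limit that defines \<open>fourier u\<close> is attained
  from some index on.
\<close>

theorem fourier_eq_fourier_L1:
  fixes u :: "'a::euclidean_space \<Rightarrow> real"
  assumes u: "u \<in> L2_bd"
  shows "fourier u \<in> borel_measurable borel" "AE \<xi> in lborel. fourier u \<xi> = fourier_L1 u \<xi>"
proof -
  have u2: "u \<in> L2_space" by (rule L2_bd_L2[OF u])
  have [measurable]: "u \<in> borel_measurable borel" using u2 by (rule L2_spaceD)
  let ?P = "\<lambda>g. g \<in> borel_measurable lborel \<and> integrable lborel (\<lambda>\<xi>. (cmod (g \<xi>))\<^sup>2) \<and>
     (\<lambda>n. \<integral>\<^sup>+ \<xi>. ennreal ((cmod (fourier_L1 (\<lambda>x. indicator (ball 0 (real n)) x * u x) \<xi> - g \<xi>))\<^sup>2) \<partial>lborel) \<longlonglongrightarrow> 0"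
  obtain R where R: "R > 0" "AE x in lborel. x \<notin> ball 0 R \<longrightarrow> u x = 0"
    using u by (auto simp: L2_bd_def)
  have [measurable]: "ball (0::'a) (real n) \<in> sets borel" for n by simp
  obtain m where m: "R \<le> real m" using real_arch_simple by blast
  have trunc: "fourier_L1 (\<lambda>x. indicator (ball 0 (real n)) x * u x) = fourier_L1 u" if "n \<ge> m" for n
  proof (rule fourier_L1_cong_AE)
    have "real m \<le> real n" using that by simp
    then show "AE x in lborel. indicator (ball 0 (real n)) x * u x = u x"
      using R(2) m by (auto elim!: eventually_mono simp: indicator_def)
  qed measurable
  have ev: "(\<lambda>n. \<integral>\<^sup>+ \<xi>. ennreal ((cmod (fourier_L1 (\<lambda>x. indicator (ball 0 (real n)) x * u x) \<xi> - g \<xi>))\<^sup>2) \<partial>lborel)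
      \<longlonglongrightarrow> l2sq (\<lambda>\<xi>. fourier_L1 u \<xi> - g \<xi>)" for g
  proof (rule tendsto_eventually)
    show "\<forall>\<^sub>F n in sequentially. (\<integral>\<^sup>+ \<xi>. ennreal ((cmod (fourier_L1 (\<lambda>x. indicator (ball 0 (real n)) x * u x) \<xi> - g \<xi>))\<^sup>2) \<partial>lborel)
      = l2sq (\<lambda>\<xi>. fourier_L1 u \<xi> - g \<xi>)"
      using eventually_ge_at_top[of m] by eventually_elim (simp add: trunc l2sq_def)
  qed
  have "?P (fourier_L1 u)"
  proof (intro conjI)
    show "integrable lborel (\<lambda>\<xi>. (cmod (fourier_L1 u \<xi>))\<^sup>2)"
      using plancherel[OF u] u2 by (simp add: integrable_iff_bounded l2sq_def L2_space_iff)
    show "(\<lambda>n. \<integral>\<^sup>+ \<xi>. ennreal ((cmod (fourier_L1 (\<lambda>x. indicator (ball 0 (real n)) x * u x) \<xi> - fourier_L1 u \<xi>))\<^sup>2) \<partial>lborel) \<longlonglongrightarrow> 0"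
      using ev[of "fourier_L1 u"] by simp
  qed measurable
  then have P: "?P (fourier u)" unfolding fourier_def by (rule someI[of ?P])
  then show [measurable]: "fourier u \<in> borel_measurable borel" by simp
  have "l2sq (\<lambda>\<xi>. fourier_L1 u \<xi> - fourier u \<xi>) = 0"
    using P ev[of "fourier u"] LIMSEQ_unique by blast
  then show "AE \<xi> in lborel. fourier u \<xi> = fourier_L1 u \<xi>"
    by (subst (asm) l2sq_eq_0_iff) auto
qed

section \<open>The energy as an integral over jumps\<close>

definition energy :: "real \<Rightarrow> ('a::euclidean_space \<Rightarrow> real) \<Rightarrow> ennreal" where
  "energy \<alpha> u = (\<integral>\<^sup>+\<xi>. ennreal (norm \<xi> powr (2 * \<alpha>) * (cmod (fourier_L1 u \<xi>))\<^sup>2) \<partial>lborel)"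

definition jump_weight :: "real \<Rightarrow> real \<times> 'a::euclidean_space \<Rightarrow> ennreal" where
  "jump_weight \<alpha> p = ennreal (fst p powr (- 1 - 2 * \<alpha>) * gauss (snd p)) * indicator {0<..} (fst p)"

text \<open>
  The law of the displacement \<open>\<sigma> z\<close> for a scale \<open>\<sigma>\<close> with density \<open>\<sigma>\<^sup>-\<^sup>1\<^sup>-\<^sup>2\<^sup>\<alpha>\<close> and a standard Gaussian direction \<open>z\<close>: a
  mixture of Gaussians that is a multiple of \<open>|h|\<^sup>-\<^sup>d\<^sup>-\<^sup>2\<^sup>\<alpha> dh\<close>, in a form where integrals against characters are explicit.
\<close>

definition jump_measure :: "real \<Rightarrow> 'a::euclidean_space measure" where
  "jump_measure \<alpha> = distr (density lborel (jump_weight \<alpha>)) borel (\<lambda>p. fst p *\<^sub>R snd p)"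

text \<open>
  The value of \<open>\<integral> (2 - 2 cos (h \<bullet> \<xi>))\<close> over the jumps for a unit vector \<open>\<xi>\<close>.
\<close>

definition jump_const :: "real \<Rightarrow> ennreal" where
  "jump_const \<alpha> = (\<integral>\<^sup>+\<tau>. ennreal (\<tau> powr (- 1 - 2 * \<alpha>) * (2 - 2 * exp (- \<tau>\<^sup>2 / 2))) * indicator {0<..} \<tau> \<partial>lborel)"

lemma sets_jump_measure[simp, measurable_cong]: "sets (jump_measure \<alpha>) = sets borel"
  and space_jump_measure[simp]: "space (jump_measure \<alpha>) = UNIV"
  by (simp_all add: jump_measure_def)

lemma jump_weight_measurable[measurable]: "jump_weight \<alpha> \<in> borel_measurable borel"
proof -
  have [measurable]: "fst \<in> borel_measurable (borel :: (real \<times> 'a) measure)" "snd \<in> borel_measurable (borel :: (real \<times> 'a) measure)"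
    by (auto intro!: borel_measurable_continuous_onI continuous_intros)
  show ?thesis unfolding jump_weight_def by measurable
qed

lemma scale_pair_measurable[measurable]: "(\<lambda>p. fst p *\<^sub>R snd p :: 'a::euclidean_space) \<in> borel_measurable (borel :: (real \<times> 'a) measure)"
  by (intro borel_measurable_continuous_onI continuous_intros)

lemma nn_integral_jump_pair:
  fixes f :: "'a::euclidean_space \<Rightarrow> ennreal"
  assumes [measurable]: "f \<in> borel_measurable borel"
  shows "(\<integral>\<^sup>+h. f h \<partial>jump_measure \<alpha>) = (\<integral>\<^sup>+p. jump_weight \<alpha> p * f (fst p *\<^sub>R snd p) \<partial>lborel)"
  unfolding jump_measure_def by (simp add: nn_integral_distr nn_integral_density)

lemma nn_integral_jump:
  fixes f :: "'a::euclidean_space \<Rightarrow> ennreal"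
  assumes [measurable]: "f \<in> borel_measurable borel"
  shows "(\<integral>\<^sup>+h. f h \<partial>jump_measure \<alpha>) =
    (\<integral>\<^sup>+\<sigma>. ennreal (\<sigma> powr (- 1 - 2 * \<alpha>)) * indicator {0<..} \<sigma> * (\<integral>\<^sup>+z. ennreal (gauss z) * f (\<sigma> *\<^sub>R z) \<partial>lborel) \<partial>lborel)"
proof -
  let ?F = "\<lambda>p::real \<times> 'a. jump_weight \<alpha> p * f (fst p *\<^sub>R snd p)"
  have [measurable]: "?F \<in> borel_measurable borel" by measurable
  have "?F \<in> borel_measurable (lborel \<Otimes>\<^sub>M lborel)"
    unfolding lborel_prod by measurable
  then have "(\<integral>\<^sup>+p. ?F p \<partial>(lborel \<Otimes>\<^sub>M lborel)) = (\<integral>\<^sup>+\<sigma>. \<integral>\<^sup>+z. ?F (\<sigma>, z) \<partial>lborel \<partial>lborel)"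
    by (rule lborel.nn_integral_fst[symmetric])
  also have "\<dots> = (\<integral>\<^sup>+\<sigma>. \<integral>\<^sup>+z. (ennreal (\<sigma> powr (- 1 - 2 * \<alpha>)) * indicator {0<..} \<sigma>) * (ennreal (gauss z) * f (\<sigma> *\<^sub>R z)) \<partial>lborel \<partial>lborel)"
    by (intro nn_integral_cong) (simp add: jump_weight_def ennreal_mult' less_imp_le[OF gauss_pos] mult_ac)
  also have "\<dots> = (\<integral>\<^sup>+\<sigma>. ennreal (\<sigma> powr (- 1 - 2 * \<alpha>)) * indicator {0<..} \<sigma> * (\<integral>\<^sup>+z. ennreal (gauss z) * f (\<sigma> *\<^sub>R z) \<partial>lborel) \<partial>lborel)"
    by (intro nn_integral_cong nn_integral_cmult) measurable
  finally show ?thesis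
    unfolding nn_integral_jump_pair[OF assms] lborel_prod .
qed

lemma jump_Fubini:
  fixes F :: "'a::euclidean_space \<Rightarrow> 'b::euclidean_space \<Rightarrow> ennreal"
  assumes F[measurable]: "case_prod F \<in> borel_measurable (borel \<Otimes>\<^sub>M borel)"
  shows "(\<integral>\<^sup>+h. \<integral>\<^sup>+y. F h y \<partial>lborel \<partial>jump_measure \<alpha>) = (\<integral>\<^sup>+y. \<integral>\<^sup>+h. F h y \<partial>jump_measure \<alpha> \<partial>lborel)"
proof -
  have [measurable]: "(\<lambda>h. \<integral>\<^sup>+y. F h y \<partial>lborel) \<in> borel_measurable borel"
    by measurable
  have m: "(\<lambda>(p, y). jump_weight \<alpha> p * F (fst p *\<^sub>R snd p) y) \<in> borel_measurable ((borel :: (real \<times> 'a) measure) \<Otimes>\<^sub>M borel)"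
    by measurable
  have "(\<integral>\<^sup>+h. \<integral>\<^sup>+y. F h y \<partial>lborel \<partial>jump_measure \<alpha>) = (\<integral>\<^sup>+p. jump_weight \<alpha> p * (\<integral>\<^sup>+y. F (fst p *\<^sub>R snd p) y \<partial>lborel) \<partial>lborel)"
    by (rule nn_integral_jump_pair) measurable
  also have "\<dots> = (\<integral>\<^sup>+p. \<integral>\<^sup>+y. jump_weight \<alpha> p * F (fst p *\<^sub>R snd p) y \<partial>lborel \<partial>lborel)"
    by (intro nn_integral_cong nn_integral_cmult[symmetric]) measurable
  also have "\<dots> = (\<integral>\<^sup>+y. \<integral>\<^sup>+p. jump_weight \<alpha> p * F (fst p *\<^sub>R snd p) y \<partial>lborel \<partial>lborel)"
    by (rule lborel_pair.Fubini'[symmetric]) (use m in simp)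
  also have "\<dots> = (\<integral>\<^sup>+y. \<integral>\<^sup>+h. F h y \<partial>jump_measure \<alpha> \<partial>lborel)"
    by (intro nn_integral_cong nn_integral_jump_pair[symmetric]) measurable
  finally show ?thesis .
qed

text \<open>
  The restriction \<open>0 < \<alpha> < 1\<close> is what makes the scales integrable at infinity and, with the factor \<open>\<tau>\<^sup>2\<close>, at 0.
\<close>

lemma powr_min_square_integrable:
  assumes "0 < \<alpha>" "\<alpha> < 1"
  shows "(\<integral>\<^sup>+\<tau>. ennreal (\<tau> powr (- 1 - 2 * \<alpha>) * min 1 (\<tau>\<^sup>2)) * indicator {0<..} \<tau> \<partial>lborel) < \<infinity>"
proof -
  have 1: "(\<integral>\<^sup>+\<tau>. ennreal (indicator {0..1} \<tau> * \<tau> powr (1 - 2 * \<alpha>)) \<partial>lborel) = ennreal (1 powr (1 - 2 * \<alpha> + 1) / (1 - 2 * \<alpha> + 1))"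
    by (rule nn_integral_has_integral_lebesgue) (use assms has_integral_powr_from_0[of "1 - 2 * \<alpha>" 1] in auto)
  have 2: "(\<integral>\<^sup>+\<tau>. ennreal (indicator {1..} \<tau> * \<tau> powr (- 1 - 2 * \<alpha>)) \<partial>lborel) = ennreal (- (1 powr (- 1 - 2 * \<alpha> + 1) / (- 1 - 2 * \<alpha> + 1)))"
    by (rule nn_integral_has_integral_lebesgue) (use assms has_integral_powr_to_inf[of "- 1 - 2 * \<alpha>" 1] in \<open>auto simp: field_simps\<close>)
  have "(\<integral>\<^sup>+\<tau>. ennreal (\<tau> powr (- 1 - 2 * \<alpha>) * min 1 (\<tau>\<^sup>2)) * indicator {0<..} \<tau> \<partial>lborel)
    \<le> (\<integral>\<^sup>+\<tau>. ennreal (indicator {0..1} \<tau> * \<tau> powr (1 - 2 * \<alpha>)) + ennreal (indicator {1..} \<tau> * \<tau> powr (- 1 - 2 * \<alpha>)) \<partial>lborel)"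
  proof (rule nn_integral_mono)
    fix \<tau> :: real
    show "ennreal (\<tau> powr (- 1 - 2 * \<alpha>) * min 1 (\<tau>\<^sup>2)) * indicator {0<..} \<tau>
      \<le> ennreal (indicator {0..1} \<tau> * \<tau> powr (1 - 2 * \<alpha>)) + ennreal (indicator {1..} \<tau> * \<tau> powr (- 1 - 2 * \<alpha>))"
    proof (cases "\<tau> > 0")
      case \<tau>: True
      have "\<tau> powr (- 1 - 2 * \<alpha>) * min 1 (\<tau>\<^sup>2) \<le> indicator {0..1} \<tau> * \<tau> powr (1 - 2 * \<alpha>) + indicator {1..} \<tau> * \<tau> powr (- 1 - 2 * \<alpha>)"
      proof (cases "\<tau> < 1")
        case True
        have "\<tau> powr (- 1 - 2 * \<alpha>) * \<tau>\<^sup>2 = \<tau> powr (- 1 - 2 * \<alpha>) * \<tau> powr 2"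
          using \<tau> by (simp add: powr_numeral)
        also have "\<dots> = \<tau> powr (1 - 2 * \<alpha>)"
          by (simp add: powr_add[symmetric])
        finally have "\<tau> powr (- 1 - 2 * \<alpha>) * \<tau>\<^sup>2 = \<tau> powr (1 - 2 * \<alpha>)" .
        moreover have "\<tau> powr (- 1 - 2 * \<alpha>) * min 1 (\<tau>\<^sup>2) \<le> \<tau> powr (- 1 - 2 * \<alpha>) * \<tau>\<^sup>2"
          by (intro mult_left_mono) auto
        ultimately show ?thesis using True \<tau> by simp
      next
        case False
        have "\<tau> powr (- 1 - 2 * \<alpha>) * min 1 (\<tau>\<^sup>2) \<le> \<tau> powr (- 1 - 2 * \<alpha>) * 1"
          by (intro mult_left_mono) auto
        then show ?thesis using False by (auto intro: add_increasing)
      qed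
      then show ?thesis using \<tau> by (simp flip: ennreal_plus)
    qed simp
  qed
  also have "\<dots> < \<infinity>"
    by (subst nn_integral_add) (simp_all add: 1 2)
  finally show ?thesis .
qed

lemma one_minus_exp_le:
  fixes t :: real
  shows "0 \<le> 2 - 2 * exp (- t\<^sup>2 / 2)" "2 - 2 * exp (- t\<^sup>2 / 2) \<le> 2 * min 1 (t\<^sup>2)"
proof -
  show "0 \<le> 2 - 2 * exp (- t\<^sup>2 / 2)" by simp
  have "1 + - t\<^sup>2 / 2 \<le> exp (- t\<^sup>2 / 2)" by (rule exp_ge_add_one_self)
  moreover have "0 < exp (- t\<^sup>2 / 2)" by (rule exp_gt_zero)
  moreover have "0 \<le> t\<^sup>2" by simp
  ultimately have "2 - 2 * exp (- t\<^sup>2 / 2) \<le> 2 * 1" "2 - 2 * exp (- t\<^sup>2 / 2) \<le> 2 * t\<^sup>2"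
    by linarith+
  then show "2 - 2 * exp (- t\<^sup>2 / 2) \<le> 2 * min 1 (t\<^sup>2)"
    unfolding min_def by presburger
qed

lemma jump_const_finite:
  assumes "0 < \<alpha>" "\<alpha> < 1"
  shows "jump_const \<alpha> < \<infinity>"
proof -
  have "jump_const \<alpha> \<le> (\<integral>\<^sup>+\<tau>. 2 * (ennreal (\<tau> powr (- 1 - 2 * \<alpha>) * min 1 (\<tau>\<^sup>2)) * indicator {0<..} \<tau>) \<partial>lborel)"
    unfolding jump_const_def
  proof (rule nn_integral_mono)
    fix \<tau> :: real
    have "ennreal (\<tau> powr (- 1 - 2 * \<alpha>) * (2 - 2 * exp (- \<tau>\<^sup>2 / 2))) \<le> ennreal (2 * (\<tau> powr (- 1 - 2 * \<alpha>) * min 1 (\<tau>\<^sup>2)))"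
      using mult_left_mono[OF one_minus_exp_le(2), of "\<tau> powr (- 1 - 2 * \<alpha>)" \<tau>] by (intro ennreal_leI) (simp add: mult_ac)
    then show "ennreal (\<tau> powr (- 1 - 2 * \<alpha>) * (2 - 2 * exp (- \<tau>\<^sup>2 / 2))) * indicator {0<..} \<tau> \<le> 2 * (ennreal (\<tau> powr (- 1 - 2 * \<alpha>) * min 1 (\<tau>\<^sup>2)) * indicator {0<..} \<tau>)"
      by (auto simp: indicator_def ennreal_mult)
  qed
  also have "\<dots> < \<infinity>"
    using powr_min_square_integrable[OF assms] by (subst nn_integral_cmult) (auto simp: ennreal_mult_less_top)
  finally show ?thesis .
qed

lemma jump_const_pos: "jump_const \<alpha> > 0"
proof (rule ccontr)
  assume "\<not> ?thesis"
  then have "jump_const \<alpha> = 0" by simp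
  then have "AE \<tau> in lborel. ennreal (\<tau> powr (- 1 - 2 * \<alpha>) * (2 - 2 * exp (- \<tau>\<^sup>2 / 2))) * indicator {0<..} \<tau> = 0"
    unfolding jump_const_def by (subst (asm) nn_integral_0_iff_AE) auto
  then have "AE \<tau> in lborel. \<tau> \<notin> {0<..<1::real}"
  proof eventually_elim
    case (elim \<tau>)
    show ?case
    proof
      assume \<tau>: "\<tau> \<in> {0<..<1}"
      then have "0 < \<tau> powr (- 1 - 2 * \<alpha>) * (2 - 2 * exp (- \<tau>\<^sup>2 / 2))"
        by (intro mult_pos_pos) auto
      then show False using elim \<tau> by simp
    qed
  qed
  then have "emeasure lborel {0<..<1::real} = 0"
    by (subst (asm) AE_iff_measurable[of "{0<..<1}"]) auto
  then show False by simp
qed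

text \<open>
  For a fixed scale \<open>\<sigma>\<close> the Gaussian average is \<open>2 - 2 exp (- \<sigma>\<^sup>2 |\<xi>|\<^sup>2 / 2)\<close>; substituting \<open>\<tau> = \<sigma> |\<xi>|\<close> extracts the power
  of \<open>|\<xi>|\<close>.
\<close>

lemma jump_symbol:
  fixes \<xi> :: "'a::euclidean_space"
  assumes "0 < \<alpha>"
  shows "(\<integral>\<^sup>+h. ennreal (2 - 2 * cos (h \<bullet> \<xi>)) \<partial>jump_measure \<alpha>) = jump_const \<alpha> * ennreal (norm \<xi> powr (2 * \<alpha>))"
proof -
  have inner: "(\<integral>\<^sup>+z. ennreal (gauss z) * ennreal (2 - 2 * cos ((\<sigma> *\<^sub>R z) \<bullet> \<xi>)) \<partial>lborel) = ennreal (2 - 2 * exp (- (\<sigma> * norm \<xi>)\<^sup>2 / 2))" for \<sigma>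
  proof -
    have int: "integrable lborel (\<lambda>z. 2 * gauss z - 2 * (gauss z * cos ((\<sigma> *\<^sub>R \<xi>) \<bullet> z)))"
      by (intro Bochner_Integration.integrable_diff integrable_mult_right gauss_integrable gauss_char_cos)
    have "(\<integral>\<^sup>+z. ennreal (gauss z) * ennreal (2 - 2 * cos ((\<sigma> *\<^sub>R z) \<bullet> \<xi>)) \<partial>lborel)
      = (\<integral>\<^sup>+z. ennreal (2 * gauss z - 2 * (gauss z * cos ((\<sigma> *\<^sub>R \<xi>) \<bullet> z))) \<partial>lborel)"
      by (intro nn_integral_cong)
         (simp add: ennreal_mult'[symmetric] less_imp_le[OF gauss_pos] inner_commute algebra_simps)
    also have "\<dots> = ennreal (LINT z|lborel. 2 * gauss z - 2 * (gauss z * cos ((\<sigma> *\<^sub>R \<xi>) \<bullet> z)))"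
    proof (rule nn_integral_eq_integral[OF int])
      have "gauss z * cos ((\<sigma> *\<^sub>R \<xi>) \<bullet> z) \<le> gauss z * 1" for z :: 'a
        by (intro mult_left_mono) (auto simp: less_imp_le[OF gauss_pos])
      then show "AE z in lborel. 0 \<le> 2 * gauss z - 2 * (gauss z * cos ((\<sigma> *\<^sub>R \<xi>) \<bullet> z))"
        by (intro AE_I2) simp
    qed
    also have "(LINT z|lborel. 2 * gauss z - 2 * (gauss z * cos ((\<sigma> *\<^sub>R \<xi>) \<bullet> z))) = 2 * 1 - 2 * exp (- ((norm (\<sigma> *\<^sub>R \<xi>))\<^sup>2) / 2)"
      by (subst Bochner_Integration.integral_diff)
         (simp_all only: integrable_mult_right gauss_integrable gauss_char_cos integral_mult_right_zero gauss_integral)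
    finally show ?thesis by (simp add: power_mult_distrib)
  qed
  define r where "r = norm \<xi>"
  let ?f = "\<lambda>\<sigma>. ennreal (\<sigma> powr (- 1 - 2 * \<alpha>)) * indicator {0<..} \<sigma> * ennreal (2 - 2 * exp (- (\<sigma> * r)\<^sup>2 / 2))"
  have "(\<integral>\<^sup>+h. ennreal (2 - 2 * cos (h \<bullet> \<xi>)) \<partial>jump_measure \<alpha>) = (\<integral>\<^sup>+\<sigma>. ?f \<sigma> \<partial>lborel)"
    by (subst nn_integral_jump) (measurable, simp only: inner r_def)
  also have "\<dots> = jump_const \<alpha> * ennreal (r powr (2 * \<alpha>))"
  proof (cases "r = 0")
    case True
    then show ?thesis using assms by simp
  next
    case False
    then have r: "r > 0" by (simp add: r_def)
    have "(\<integral>\<^sup>+\<sigma>. ?f \<sigma> \<partial>lborel) = ennreal \<bar>1 / r\<bar> * (\<integral>\<^sup>+\<tau>. ?f (0 + 1 / r * \<tau>) \<partial>lborel)"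
      by (rule nn_integral_real_affine) (use r in auto)
    also have "\<dots> = (\<integral>\<^sup>+\<tau>. ennreal \<bar>1 / r\<bar> * ?f (0 + 1 / r * \<tau>) \<partial>lborel)"
      by (rule nn_integral_cmult[symmetric]) auto
    also have "\<dots> = (\<integral>\<^sup>+\<tau>. ennreal (\<tau> powr (- 1 - 2 * \<alpha>) * (2 - 2 * exp (- \<tau>\<^sup>2 / 2))) * indicator {0<..} \<tau> * ennreal (r powr (2 * \<alpha>)) \<partial>lborel)"
    proof (rule nn_integral_cong)
      fix \<tau> :: real
      show "ennreal \<bar>1 / r\<bar> * ?f (0 + 1 / r * \<tau>) = ennreal (\<tau> powr (- 1 - 2 * \<alpha>) * (2 - 2 * exp (- \<tau>\<^sup>2 / 2))) * indicator {0<..} \<tau> * ennreal (r powr (2 * \<alpha>))"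
      proof (cases "\<tau> > 0")
        case True
        have "(1 / r) * (\<tau> / r) powr (- 1 - 2 * \<alpha>) = \<tau> powr (- 1 - 2 * \<alpha>) * ((1 / r) * (1 / r) powr (- 1 - 2 * \<alpha>))"
          using powr_mult[of \<tau> "1 / r" "- 1 - 2 * \<alpha>"] r True by simp
        also have "(1 / r) * (1 / r) powr (- 1 - 2 * \<alpha>) = r powr (2 * \<alpha>)"
        proof -
          have "(1 / r) * (1 / r) powr (- 1 - 2 * \<alpha>) = (1 / r) powr (- (2 * \<alpha>))"
            using r by (subst powr_mult_base) auto
          also have "\<dots> = r powr (2 * \<alpha>)"
            using r by (simp add: powr_divide powr_minus inverse_eq_divide)
          finally show ?thesis .
        qed
        finally have "(1 / r) * (\<tau> / r) powr (- 1 - 2 * \<alpha>) = \<tau> powr (- 1 - 2 * \<alpha>) * r powr (2 * \<alpha>)" .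
        then have "ennreal (1 / r) * ennreal ((\<tau> / r) powr (- 1 - 2 * \<alpha>)) = ennreal (\<tau> powr (- 1 - 2 * \<alpha>)) * ennreal (r powr (2 * \<alpha>))"
          using r by (simp flip: ennreal_mult)
        then show ?thesis
          using True r by (simp add: ennreal_mult mult_ac, metis mult.assoc)
      next
        case False
        then show ?thesis using r by (auto simp: indicator_def zero_less_divide_iff)
      qed
    qed
    also have "\<dots> = jump_const \<alpha> * ennreal (r powr (2 * \<alpha>))"
      unfolding jump_const_def by (rule nn_integral_multc) measurable
    finally show ?thesis .
  qed
  finally show ?thesis by (simp add: r_def)
qed

lemma fourier_L1_translate:
  assumes [measurable]: "u \<in> borel_measurable borel"
  shows "fourier_L1 (\<lambda>x. u (x + h)) \<xi> = exp (\<i> * complex_of_real (h \<bullet> \<xi>)) * fourier_L1 u \<xi>"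
proof -
  have "(LINT x|lborel. exp (- (\<i> * complex_of_real (x \<bullet> \<xi>))) * complex_of_real (u (x + h)))
    = (LINT x|lborel. exp (\<i> * complex_of_real (h \<bullet> \<xi>)) * (exp (- (\<i> * complex_of_real ((x + h) \<bullet> \<xi>))) * complex_of_real (u (x + h))))"
    by (intro Bochner_Integration.integral_cong refl)
       (simp add: mult.assoc[symmetric] exp_add[symmetric] inner_add_left algebra_simps)
  also have "\<dots> = exp (\<i> * complex_of_real (h \<bullet> \<xi>)) * (LINT x|lborel. exp (- (\<i> * complex_of_real ((x + h) \<bullet> \<xi>))) * complex_of_real (u (x + h)))"
    by simp
  also have "(LINT x|lborel. exp (- (\<i> * complex_of_real ((x + h) \<bullet> \<xi>))) * complex_of_real (u (x + h)))
    = (LINT x|lborel. exp (- (\<i> * complex_of_real (x \<bullet> \<xi>))) * complex_of_real (u x))"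
    by (subst integral_affine[of "\<lambda>x. exp (- (\<i> * complex_of_real (x \<bullet> \<xi>))) * complex_of_real (u x)" 1 h]) (auto simp: add.commute)
  finally show ?thesis by (simp add: fourier_L1_def)
qed

lemma fourier_L1_lincomb:
  assumes "integrable lborel u" "integrable lborel v"
  shows "fourier_L1 (\<lambda>x. a * u x + b * v x) \<xi> = a * fourier_L1 u \<xi> + b * fourier_L1 v \<xi>"
proof -
  have "(LINT x|lborel. exp (- (\<i> * complex_of_real (x \<bullet> \<xi>))) * complex_of_real (a * u x + b * v x))
    = (LINT x|lborel. a * (exp (- (\<i> * complex_of_real (x \<bullet> \<xi>))) * complex_of_real (u x)) + b * (exp (- (\<i> * complex_of_real (x \<bullet> \<xi>))) * complex_of_real (v x)))"
    by (simp add: algebra_simps)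
  also have "\<dots> = a * (LINT x|lborel. exp (- (\<i> * complex_of_real (x \<bullet> \<xi>))) * complex_of_real (u x)) + b * (LINT x|lborel. exp (- (\<i> * complex_of_real (x \<bullet> \<xi>))) * complex_of_real (v x))"
    using fourier_integrand_integrable[OF assms(1)] fourier_integrand_integrable[OF assms(2)] by simp
  finally show ?thesis by (simp add: fourier_L1_def algebra_simps)
qed

lemma fourier_L1_diff:
  assumes "integrable lborel u" "integrable lborel v"
  shows "fourier_L1 (\<lambda>x. u x - v x) \<xi> = fourier_L1 u \<xi> - fourier_L1 v \<xi>"
  using fourier_L1_lincomb[OF assms, of 1 "-1"] by simp

lemma fourier_L1_cnj: "cnj (fourier_L1 u \<xi>) = fourier_L1 u (- \<xi>)"
proof -
  have "cnj (LINT x|lborel. exp (- (\<i> * complex_of_real (x \<bullet> \<xi>))) * complex_of_real (u x))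
    = (LINT x|lborel. exp (- (\<i> * complex_of_real (x \<bullet> (- \<xi>)))) * complex_of_real (u x))"
    by (subst Bochner_Integration.integral_cnj[symmetric]) (simp add: exp_cnj)
  then show ?thesis by (simp add: fourier_L1_def)
qed

lemma jump_l2sq_measurable[measurable]:
  assumes [measurable]: "u \<in> borel_measurable borel"
  shows "(\<lambda>h. l2sq (\<lambda>x::'a::euclidean_space. u (x + h) - u x :: real)) \<in> borel_measurable borel"
  unfolding l2sq_def by measurable

text \<open>
  By Plancherel, \<open>\<parallel>u(\<cdot> + h) - u\<parallel>\<^sup>2\<close> is the integral of \<open>(2 - 2 cos (h \<bullet> \<xi>)) |(fourier u)(\<xi>)|\<^sup>2\<close>; exchange the integrals and
  use \<open>jump_symbol\<close>.
\<close>

theorem jump_energy: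
  fixes u :: "'a::euclidean_space \<Rightarrow> real"
  assumes u: "u \<in> L2_bd" and \<alpha>: "0 < \<alpha>"
  shows "(\<integral>\<^sup>+h. l2sq (\<lambda>x. u (x + h) - u x) \<partial>jump_measure \<alpha>) = jump_const \<alpha> * energy \<alpha> u"
proof -
  have [measurable]: "u \<in> borel_measurable borel" using u by (intro L2_spaceD L2_bd_L2)
  have "l2sq (\<lambda>x. u (x + h) - u x) = (\<integral>\<^sup>+\<xi>. ennreal (2 - 2 * cos (h \<bullet> \<xi>)) * ennreal ((cmod (fourier_L1 u \<xi>))\<^sup>2) \<partial>lborel)" for h
  proof -
    have "l2sq (\<lambda>x. u (x + h) - u x) = l2sq (fourier_L1 (\<lambda>x. u (x + h) - u x))"
      by (rule plancherel[symmetric]) (intro L2_bd_diff L2_bd_translate u)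
    also have "\<dots> = (\<integral>\<^sup>+\<xi>. ennreal (2 - 2 * cos (h \<bullet> \<xi>)) * ennreal ((cmod (fourier_L1 u \<xi>))\<^sup>2) \<partial>lborel)"
      unfolding l2sq_def
    proof (rule nn_integral_cong)
      fix \<xi>
      define t where "t = h \<bullet> \<xi>"
      have "fourier_L1 (\<lambda>x. u (x + h) - u x) \<xi> = fourier_L1 (\<lambda>x. u (x + h)) \<xi> - fourier_L1 u \<xi>"
        by (intro fourier_L1_diff L2_bd_integrable L2_bd_translate u)
      also have "\<dots> = (exp (\<i> * complex_of_real t) - 1) * fourier_L1 u \<xi>"
        by (simp add: fourier_L1_translate t_def algebra_simps)
      finally have "(cmod (fourier_L1 (\<lambda>x. u (x + h) - u x) \<xi>))\<^sup>2 = (cmod (exp (\<i> * complex_of_real t) - 1))\<^sup>2 * (cmod (fourier_L1 u \<xi>))\<^sup>2"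
        by (simp add: norm_mult power_mult_distrib)
      also have "(cmod (exp (\<i> * complex_of_real t) - 1))\<^sup>2 = (cos t - 1)\<^sup>2 + (sin t)\<^sup>2"
        by (simp add: cmod_power2 Re_exp Im_exp)
      also have "\<dots> = 2 - 2 * cos t"
        using sin_cos_squared_add[of t] by (simp add: power2_diff algebra_simps)
      finally show "ennreal ((norm (fourier_L1 (\<lambda>x. u (x + h) - u x) \<xi>))\<^sup>2) = ennreal (2 - 2 * cos (h \<bullet> \<xi>)) * ennreal ((cmod (fourier_L1 u \<xi>))\<^sup>2)"
        by (simp add: ennreal_mult'' t_def)
    qed
    finally show ?thesis .
  qed
  then have "(\<integral>\<^sup>+h. l2sq (\<lambda>x. u (x + h) - u x) \<partial>jump_measure \<alpha>)
    = (\<integral>\<^sup>+h. \<integral>\<^sup>+\<xi>. ennreal (2 - 2 * cos (h \<bullet> \<xi>)) * ennreal ((cmod (fourier_L1 u \<xi>))\<^sup>2) \<partial>lborel \<partial>jump_measure \<alpha>)"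
    by simp
  also have "\<dots> = (\<integral>\<^sup>+\<xi>. \<integral>\<^sup>+h. ennreal (2 - 2 * cos (h \<bullet> \<xi>)) * ennreal ((cmod (fourier_L1 u \<xi>))\<^sup>2) \<partial>jump_measure \<alpha> \<partial>lborel)"
    by (rule jump_Fubini) measurable
  also have "\<dots> = (\<integral>\<^sup>+\<xi>. jump_const \<alpha> * ennreal (norm \<xi> powr (2 * \<alpha>)) * ennreal ((cmod (fourier_L1 u \<xi>))\<^sup>2) \<partial>lborel)"
    by (subst nn_integral_multc) (auto simp: jump_symbol[OF \<alpha>])
  also have "\<dots> = (\<integral>\<^sup>+\<xi>. jump_const \<alpha> * ennreal (norm \<xi> powr (2 * \<alpha>) * (cmod (fourier_L1 u \<xi>))\<^sup>2) \<partial>lborel)"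
    by (simp add: ennreal_mult mult.assoc)
  also have "\<dots> = jump_const \<alpha> * energy \<alpha> u"
    unfolding energy_def by (rule nn_integral_cmult) measurable
  finally show ?thesis .
qed

section \<open>The energy space\<close>

lemma borel_measurable_cnj[measurable]:
  "f \<in> borel_measurable M \<Longrightarrow> (\<lambda>x. cnj (f x)) \<in> borel_measurable M"
  by (rule measurable_compose[OF _ borel_measurable_continuous_onI]) (auto intro: continuous_intros)

lemma energy_cong_AE:
  assumes "AE x in lborel. u x = v x" "u \<in> borel_measurable borel" "v \<in> borel_measurable borel"
  shows "energy \<alpha> u = energy \<alpha> v"
  unfolding energy_def fourier_L1_cong_AE[OF assms] ..

lemma energy_lincomb_le:
  fixes u v :: "'a::euclidean_space \<Rightarrow> real"
  assumes u: "u \<in> L2_bd" and v: "v \<in> L2_bd"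
  shows "energy \<alpha> (\<lambda>x. a * u x + b * v x) \<le> 2 * (ennreal (a\<^sup>2) * energy \<alpha> u) + 2 * (ennreal (b\<^sup>2) * energy \<alpha> v)"
proof -
  have [measurable]: "u \<in> borel_measurable borel" "v \<in> borel_measurable borel"
    using u v by (auto intro!: L2_spaceD L2_bd_L2)
  have "energy \<alpha> (\<lambda>x. a * u x + b * v x)
    \<le> (\<integral>\<^sup>+\<xi>. 2 * (ennreal (a\<^sup>2) * ennreal (norm \<xi> powr (2 * \<alpha>) * (cmod (fourier_L1 u \<xi>))\<^sup>2)) + 2 * (ennreal (b\<^sup>2) * ennreal (norm \<xi> powr (2 * \<alpha>) * (cmod (fourier_L1 v \<xi>))\<^sup>2)) \<partial>lborel)"
    unfolding energy_def
  proof (rule nn_integral_mono)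
    fix \<xi> :: 'a
    have "(cmod (fourier_L1 (\<lambda>x. a * u x + b * v x) \<xi>))\<^sup>2 \<le> 2 * (a\<^sup>2 * (cmod (fourier_L1 u \<xi>))\<^sup>2) + 2 * (b\<^sup>2 * (cmod (fourier_L1 v \<xi>))\<^sup>2)"
      using norm_add_square_le[of "a * fourier_L1 u \<xi>" "b * fourier_L1 v \<xi>"]
      by (simp add: fourier_L1_lincomb L2_bd_integrable u v norm_mult power_mult_distrib)
    then have "norm \<xi> powr (2 * \<alpha>) * (cmod (fourier_L1 (\<lambda>x. a * u x + b * v x) \<xi>))\<^sup>2
      \<le> norm \<xi> powr (2 * \<alpha>) * (2 * (a\<^sup>2 * (cmod (fourier_L1 u \<xi>))\<^sup>2) + 2 * (b\<^sup>2 * (cmod (fourier_L1 v \<xi>))\<^sup>2))"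
      by (intro mult_left_mono) auto
    also have "\<dots> = 2 * (a\<^sup>2 * (norm \<xi> powr (2 * \<alpha>) * (cmod (fourier_L1 u \<xi>))\<^sup>2)) + 2 * (b\<^sup>2 * (norm \<xi> powr (2 * \<alpha>) * (cmod (fourier_L1 v \<xi>))\<^sup>2))"
      by (simp add: algebra_simps)
    finally have "ennreal (norm \<xi> powr (2 * \<alpha>) * (cmod (fourier_L1 (\<lambda>x. a * u x + b * v x) \<xi>))\<^sup>2)
      \<le> ennreal (2 * (a\<^sup>2 * (norm \<xi> powr (2 * \<alpha>) * (cmod (fourier_L1 u \<xi>))\<^sup>2)) + 2 * (b\<^sup>2 * (norm \<xi> powr (2 * \<alpha>) * (cmod (fourier_L1 v \<xi>))\<^sup>2)))"
      by (rule ennreal_leI)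
    also have "\<dots> = 2 * (ennreal (a\<^sup>2) * ennreal (norm \<xi> powr (2 * \<alpha>) * (cmod (fourier_L1 u \<xi>))\<^sup>2)) + 2 * (ennreal (b\<^sup>2) * ennreal (norm \<xi> powr (2 * \<alpha>) * (cmod (fourier_L1 v \<xi>))\<^sup>2))"
      by (simp add: ennreal_mult)
    finally show "ennreal (norm \<xi> powr (2 * \<alpha>) * (cmod (fourier_L1 (\<lambda>x. a * u x + b * v x) \<xi>))\<^sup>2)
      \<le> 2 * (ennreal (a\<^sup>2) * ennreal (norm \<xi> powr (2 * \<alpha>) * (cmod (fourier_L1 u \<xi>))\<^sup>2)) + 2 * (ennreal (b\<^sup>2) * ennreal (norm \<xi> powr (2 * \<alpha>) * (cmod (fourier_L1 v \<xi>))\<^sup>2))" .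
  qed
  also have "\<dots> = 2 * (ennreal (a\<^sup>2) * energy \<alpha> u) + 2 * (ennreal (b\<^sup>2) * energy \<alpha> v)"
    unfolding energy_def by (simp add: nn_integral_add nn_integral_cmult)
  finally show ?thesis .
qed

lemma energy_triangle:
  assumes "f \<in> L2_bd" "g \<in> L2_bd" "h \<in> L2_bd"
  shows "energy \<alpha> (\<lambda>x. f x - h x) \<le> 2 * energy \<alpha> (\<lambda>x. f x - g x) + 2 * energy \<alpha> (\<lambda>x. g x - h x)"
  using energy_lincomb_le[OF L2_bd_diff[OF assms(1,2)] L2_bd_diff[OF assms(2,3)], of \<alpha> 1 1] by simp

text \<open>
  The functions of \<open>H\<^sup>\<alpha>\<close> with bounded support; \<open>HF_iff_H_frac\<close> relates the two.
\<close>

definition HF :: "real \<Rightarrow> ('a::euclidean_space \<Rightarrow> real) set" where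
  "HF \<alpha> = {u \<in> L2_bd. energy \<alpha> u < \<infinity>}"

definition eform :: "real \<Rightarrow> ('a::euclidean_space \<Rightarrow> real) \<Rightarrow> ('a \<Rightarrow> real) \<Rightarrow> real" where
  "eform \<alpha> u v = Re (frac_form \<alpha> u v)"

lemma HF_L2_bd: "u \<in> HF \<alpha> \<Longrightarrow> u \<in> L2_bd"
  by (simp add: HF_def)

lemma HF_lincomb:
  assumes "u \<in> HF \<alpha>" "v \<in> HF \<alpha>"
  shows "(\<lambda>x. a * u x + b * v x) \<in> HF \<alpha>"
  unfolding HF_def mem_Collect_eq
proof
  have u: "u \<in> L2_bd" "v \<in> L2_bd" "energy \<alpha> u < \<infinity>" "energy \<alpha> v < \<infinity>"
    using assms by (auto simp: HF_def)
  show "(\<lambda>x. a * u x + b * v x) \<in> L2_bd" using u by (intro L2_bd_lincomb)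
  have "2 * (ennreal (a\<^sup>2) * energy \<alpha> u) + 2 * (ennreal (b\<^sup>2) * energy \<alpha> v) < \<infinity>"
    using u by (auto simp: ennreal_mult_less_top)
  then show "energy \<alpha> (\<lambda>x. a * u x + b * v x) < \<infinity>"
    using energy_lincomb_le[OF u(1,2)] by (rule order_le_less_trans[rotated])
qed

lemma fourier_product_integrable:
  fixes u v :: "'a::euclidean_space \<Rightarrow> real"
  assumes "u \<in> HF \<alpha>" "v \<in> HF \<alpha>"
  shows "integrable lborel (\<lambda>\<xi>. complex_of_real (norm \<xi> powr (2 * \<alpha>)) * fourier_L1 u \<xi> * cnj (fourier_L1 v \<xi>))"
proof (rule Bochner_Integration.integrable_bound)
  have [measurable]: "u \<in> borel_measurable borel" "v \<in> borel_measurable borel"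
    using assms by (auto intro!: L2_spaceD L2_bd_L2 HF_L2_bd)
  have "integrable lborel (\<lambda>\<xi>. norm \<xi> powr (2 * \<alpha>) * (cmod (fourier_L1 u \<xi>))\<^sup>2)" "integrable lborel (\<lambda>\<xi>. norm \<xi> powr (2 * \<alpha>) * (cmod (fourier_L1 v \<xi>))\<^sup>2)"
    using assms by (auto simp: HF_def energy_def integrable_iff_bounded)
  then show "integrable lborel (\<lambda>\<xi>. norm \<xi> powr (2 * \<alpha>) * (cmod (fourier_L1 u \<xi>))\<^sup>2 + norm \<xi> powr (2 * \<alpha>) * (cmod (fourier_L1 v \<xi>))\<^sup>2)"
    by (rule Bochner_Integration.integrable_add)
  show "(\<lambda>\<xi>. complex_of_real (norm \<xi> powr (2 * \<alpha>)) * fourier_L1 u \<xi> * cnj (fourier_L1 v \<xi>)) \<in> borel_measurable lborel"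
    by measurable
  have "cmod (fourier_L1 u \<xi>) * cmod (fourier_L1 v \<xi>) \<le> (cmod (fourier_L1 u \<xi>))\<^sup>2 + (cmod (fourier_L1 v \<xi>))\<^sup>2" for \<xi>
  proof -
    have "0 \<le> cmod (fourier_L1 u \<xi>) * cmod (fourier_L1 v \<xi>)" by simp
    then show ?thesis
      using sum_squares_bound[of "cmod (fourier_L1 u \<xi>)" "cmod (fourier_L1 v \<xi>)"] by linarith
  qed
  then have "norm \<xi> powr (2 * \<alpha>) * (cmod (fourier_L1 u \<xi>) * cmod (fourier_L1 v \<xi>)) \<le> norm \<xi> powr (2 * \<alpha>) * ((cmod (fourier_L1 u \<xi>))\<^sup>2 + (cmod (fourier_L1 v \<xi>))\<^sup>2)" for \<xi> :: 'a
    by (intro mult_left_mono) auto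
  then show "AE \<xi> in lborel. norm (complex_of_real (norm \<xi> powr (2 * \<alpha>)) * fourier_L1 u \<xi> * cnj (fourier_L1 v \<xi>))
    \<le> norm (norm \<xi> powr (2 * \<alpha>) * (cmod (fourier_L1 u \<xi>))\<^sup>2 + norm \<xi> powr (2 * \<alpha>) * (cmod (fourier_L1 v \<xi>))\<^sup>2)"
    by (intro AE_I2) (simp add: norm_mult distrib_left mult.assoc)
qed

lemma frac_form_L1:
  fixes u v :: "'a::euclidean_space \<Rightarrow> real"
  assumes u: "u \<in> L2_bd" and v: "v \<in> L2_bd"
  shows "frac_form \<alpha> u v = (LINT \<xi>|lborel. complex_of_real (norm \<xi> powr (2 * \<alpha>)) * fourier_L1 u \<xi> * cnj (fourier_L1 v \<xi>))"
  unfolding frac_form_def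
proof (rule integral_cong_AE)
  have [measurable]: "u \<in> borel_measurable borel" "v \<in> borel_measurable borel"
    using u v by (auto intro!: L2_spaceD L2_bd_L2)
  note fourier_eq_fourier_L1(1)[OF u, measurable] fourier_eq_fourier_L1(1)[OF v, measurable]
  show "(\<lambda>\<xi>. complex_of_real (norm \<xi> powr (2 * \<alpha>)) * fourier u \<xi> * cnj (fourier v \<xi>)) \<in> borel_measurable lborel"
    "(\<lambda>\<xi>. complex_of_real (norm \<xi> powr (2 * \<alpha>)) * fourier_L1 u \<xi> * cnj (fourier_L1 v \<xi>)) \<in> borel_measurable lborel"
    by measurable
  show "AE \<xi> in lborel. complex_of_real (norm \<xi> powr (2 * \<alpha>)) * fourier u \<xi> * cnj (fourier v \<xi>) = complex_of_real (norm \<xi> powr (2 * \<alpha>)) * fourier_L1 u \<xi> * cnj (fourier_L1 v \<xi>)"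
    using fourier_eq_fourier_L1(2)[OF u] fourier_eq_fourier_L1(2)[OF v] by eventually_elim simp
qed

lemma frac_form_cnj:
  fixes u v :: "'a::euclidean_space \<Rightarrow> real"
  assumes u: "u \<in> L2_bd" and v: "v \<in> L2_bd"
  shows "cnj (frac_form \<alpha> u v) = frac_form \<alpha> v u"
  unfolding frac_form_L1[OF u v] frac_form_L1[OF v u]
  by (subst Bochner_Integration.integral_cnj[symmetric]) (simp add: mult_ac)

text \<open>The transform of a real function is conjugation-symmetric, so the form takes real values.\<close>

lemma frac_form_real:
  fixes u v :: "'a::euclidean_space \<Rightarrow> real"
  assumes u: "u \<in> L2_bd" and v: "v \<in> L2_bd"
  shows "frac_form \<alpha> u v = complex_of_real (eform \<alpha> u v)"
proof -
  have [measurable]: "u \<in> borel_measurable borel" "v \<in> borel_measurable borel"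
    using u v by (auto intro!: L2_spaceD L2_bd_L2)
  let ?f = "\<lambda>\<xi>. complex_of_real (norm \<xi> powr (2 * \<alpha>)) * fourier_L1 u \<xi> * cnj (fourier_L1 v \<xi>)"
  have "cnj (frac_form \<alpha> u v) = (LINT \<xi>|lborel. ?f (0 + (-1) *\<^sub>R \<xi>))"
    unfolding frac_form_L1[OF u v]
    by (subst Bochner_Integration.integral_cnj[symmetric]) (simp flip: fourier_L1_cnj)
  also have "\<dots> = frac_form \<alpha> u v"
    unfolding frac_form_L1[OF u v] by (subst integral_affine[of ?f "-1" 0]) simp_all
  finally show ?thesis
    unfolding eform_def by (metis Reals_cnj_iff of_real_Re)
qed

lemma eform_energy:
  fixes u :: "'a::euclidean_space \<Rightarrow> real"
  assumes u: "u \<in> HF \<alpha>"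
  shows "ennreal (eform \<alpha> u u) = energy \<alpha> u" "eform \<alpha> u u = enn2real (energy \<alpha> u)" "0 \<le> eform \<alpha> u u"
proof -
  let ?f = "\<lambda>\<xi>. norm \<xi> powr (2 * \<alpha>) * (cmod (fourier_L1 u \<xi>))\<^sup>2"
  have [measurable]: "u \<in> borel_measurable borel"
    using u by (auto intro!: L2_spaceD L2_bd_L2 HF_L2_bd)
  have int: "integrable lborel ?f"
    using u by (auto simp: HF_def energy_def integrable_iff_bounded)
  have "frac_form \<alpha> u u = (LINT \<xi>|lborel. complex_of_real (?f \<xi>))"
    unfolding frac_form_L1[OF HF_L2_bd[OF u] HF_L2_bd[OF u]]
  proof (intro Bochner_Integration.integral_cong refl)
    fix \<xi> :: 'a
    show "complex_of_real (norm \<xi> powr (2 * \<alpha>)) * fourier_L1 u \<xi> * cnj (fourier_L1 u \<xi>) = complex_of_real (?f \<xi>)"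
      by (simp only: of_real_mult complex_norm_square mult.assoc)
  qed
  also have "\<dots> = complex_of_real (LINT \<xi>|lborel. ?f \<xi>)"
    by (rule integral_complex_of_real)
  finally have e: "eform \<alpha> u u = (LINT \<xi>|lborel. ?f \<xi>)" by (simp add: eform_def)
  then show "0 \<le> eform \<alpha> u u" by (simp add: integral_nonneg)
  show "ennreal (eform \<alpha> u u) = energy \<alpha> u"
    unfolding e energy_def by (rule nn_integral_eq_integral[symmetric, OF int]) simp
  from this[symmetric] show "eform \<alpha> u u = enn2real (energy \<alpha> u)"
    using \<open>0 \<le> eform \<alpha> u u\<close> by simp
qed

theorem eform_semi_inner: "semi_inner (HF \<alpha>) (eform \<alpha>)"
proof
  fix u v w :: "'a \<Rightarrow> real" and a b :: real
  assume u: "u \<in> HF \<alpha>"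
  show "0 \<le> eform \<alpha> u u" by (rule eform_energy(3)[OF u])
  assume v: "v \<in> HF \<alpha>"
  show uv: "(\<lambda>x. a * u x + b * v x) \<in> HF \<alpha>" using u v by (rule HF_lincomb)
  note L = HF_L2_bd[OF u] HF_L2_bd[OF v]
  show "eform \<alpha> u v = eform \<alpha> v u"
    unfolding eform_def frac_form_cnj[OF L, symmetric] by simp
  assume w: "w \<in> HF \<alpha>"
  note Lw = HF_L2_bd[OF w]
  have "frac_form \<alpha> (\<lambda>x. a * u x + b * v x) w
    = (LINT \<xi>|lborel. complex_of_real a * (complex_of_real (norm \<xi> powr (2 * \<alpha>)) * fourier_L1 u \<xi> * cnj (fourier_L1 w \<xi>))
      + complex_of_real b * (complex_of_real (norm \<xi> powr (2 * \<alpha>)) * fourier_L1 v \<xi> * cnj (fourier_L1 w \<xi>)))"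
    unfolding frac_form_L1[OF L2_bd_lincomb[OF L] Lw]
    by (intro Bochner_Integration.integral_cong refl)
       (simp add: fourier_L1_lincomb L2_bd_integrable L algebra_simps)
  also have "\<dots> = complex_of_real a * frac_form \<alpha> u w + complex_of_real b * frac_form \<alpha> v w"
    unfolding frac_form_L1[OF L(1) Lw] frac_form_L1[OF L(2) Lw]
    using fourier_product_integrable[OF u w] fourier_product_integrable[OF v w] by simp
  finally show "eform \<alpha> (\<lambda>x. a * u x + b * v x) w = a * eform \<alpha> u w + b * eform \<alpha> v w"
    by (simp add: eform_def)
qed

lemma HF_iff_H_frac:
  assumes u: "u \<in> L2_bd"
  shows "u \<in> HF \<alpha> \<longleftrightarrow> u \<in> H_frac \<alpha>"
proof -
  have [measurable]: "u \<in> borel_measurable borel" using u by (auto intro!: L2_spaceD L2_bd_L2)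
  note fourier_eq_fourier_L1(1)[OF u, measurable]
  have "energy \<alpha> u = (\<integral>\<^sup>+\<xi>. ennreal (norm \<xi> powr (2 * \<alpha>) * (cmod (fourier u \<xi>))\<^sup>2) \<partial>lborel)"
    unfolding energy_def using fourier_eq_fourier_L1(2)[OF u] by (intro nn_integral_cong_AE) auto
  then show ?thesis
    using u L2_bd_L2[OF u] by (auto simp: HF_def H_frac_def integrable_iff_bounded)
qed

definition Hn :: "real \<Rightarrow> ('a::euclidean_space \<Rightarrow> real) \<Rightarrow> ennreal" where
  "Hn \<alpha> u = energy \<alpha> u + l2sq u"

lemma H_frac_normsq_eq:
  assumes u: "u \<in> HF \<alpha>"
  shows "ennreal (H_frac_normsq \<alpha> u) = Hn \<alpha> u" "Hn \<alpha> u < \<infinity>" "H_frac_normsq \<alpha> u = enn2real (Hn \<alpha> u)"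
proof -
  have l: "u \<in> L2_space" by (intro L2_bd_L2 HF_L2_bd[OF u])
  show n: "ennreal (H_frac_normsq \<alpha> u) = Hn \<alpha> u"
    unfolding H_frac_normsq_def Hn_def eform_def[symmetric]
    using eform_energy[OF u] integral_square_eq_l2sq(1)[OF l] by (simp add: integral_nonneg)
  show "Hn \<alpha> u < \<infinity>" using n by (metis ennreal_less_top infinity_ennreal_def)
  have "0 \<le> H_frac_normsq \<alpha> u"
    unfolding H_frac_normsq_def eform_def[symmetric] using eform_energy(3)[OF u] by simp
  then show "H_frac_normsq \<alpha> u = enn2real (Hn \<alpha> u)" using n by (metis enn2real_ennreal)
qed

lemma H_frac_normsq_ge: "ennreal (LINT x|lborel. (u x)\<^sup>2) \<le> ennreal (H_frac_normsq \<alpha> u)"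
proof -
  have "frac_form \<alpha> u u = (LINT \<xi>|lborel. complex_of_real (norm \<xi> powr (2 * \<alpha>) * (cmod (fourier u \<xi>))\<^sup>2))"
    unfolding frac_form_def
    by (intro Bochner_Integration.integral_cong refl) (simp only: of_real_mult complex_norm_square mult.assoc)
  also have "\<dots> = complex_of_real (LINT \<xi>|lborel. norm \<xi> powr (2 * \<alpha>) * (cmod (fourier u \<xi>))\<^sup>2)"
    by (rule integral_complex_of_real)
  finally have "0 \<le> Re (frac_form \<alpha> u u)" by (simp add: integral_nonneg)
  then show ?thesis unfolding H_frac_normsq_def by (intro ennreal_leI) simp
qed

lemma Hn_triangle:
  assumes "f \<in> L2_bd" "g \<in> L2_bd" "h \<in> L2_bd"
  shows "Hn \<alpha> (\<lambda>x. f x - h x) \<le> 2 * Hn \<alpha> (\<lambda>x. f x - g x) + 2 * Hn \<alpha> (\<lambda>x. g x - h x)"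
proof -
  have "l2sq (\<lambda>x. f x - h x) \<le> 2 * l2sq (\<lambda>x. f x - g x) + 2 * l2sq (\<lambda>x. g x - h x)"
    by (rule l2sq_triangle) (use assms in \<open>auto intro!: L2_spaceD L2_bd_L2\<close>)
  then have "Hn \<alpha> (\<lambda>x. f x - h x) \<le> (2 * energy \<alpha> (\<lambda>x. f x - g x) + 2 * energy \<alpha> (\<lambda>x. g x - h x)) + (2 * l2sq (\<lambda>x. f x - g x) + 2 * l2sq (\<lambda>x. g x - h x))"
    unfolding Hn_def using energy_triangle[OF assms] by (intro add_mono)
  then show ?thesis by (simp add: Hn_def distrib_left ac_simps)
qed

section \<open>Consequences of the jump representation\<close>

context
  fixes \<alpha> :: real
  assumes \<alpha>: "0 < \<alpha>" "\<alpha> < 1"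
begin

lemma jump_const_cancel: "jump_const \<alpha> * a \<le> jump_const \<alpha> * b \<longleftrightarrow> a \<le> b"
  using jump_const_pos[of \<alpha>] jump_const_finite[OF \<alpha>]
  by (intro ennreal_mult_le_mult_iff) auto

lemma energy_leI:
  fixes u v :: "'a::euclidean_space \<Rightarrow> real"
  assumes "u \<in> L2_bd" "v \<in> L2_bd"
    and "\<And>h. l2sq (\<lambda>x. v (x + h) - v x) \<le> l2sq (\<lambda>x. u (x + h) - u x)"
  shows "energy \<alpha> v \<le> energy \<alpha> u"
  unfolding jump_const_cancel[symmetric, of "energy \<alpha> v"] jump_energy[OF assms(1) \<alpha>(1), symmetric] jump_energy[OF assms(2) \<alpha>(1), symmetric]
  by (intro nn_integral_mono assms)

lemma L2_bd_abs:
  assumes "u \<in> L2_bd"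
  shows "(\<lambda>x. \<bar>u x\<bar>) \<in> L2_bd"
proof (rule L2_bd_dominated[OF assms])
  have [measurable]: "u \<in> borel_measurable borel"
    using assms by (intro L2_spaceD L2_bd_L2)
  show "(\<lambda>x. \<bar>u x\<bar>) \<in> borel_measurable borel" by measurable
qed simp

text \<open>
  The increments of \<open>\<bar>u\<bar>\<close> are bounded by those of \<open>u\<close>.
\<close>

lemma energy_abs_le:
  fixes u :: "'a::euclidean_space \<Rightarrow> real"
  assumes "u \<in> L2_bd"
  shows "energy \<alpha> (\<lambda>x. \<bar>u x\<bar>) \<le> energy \<alpha> u"
proof (rule energy_leI)
  show "l2sq (\<lambda>x. \<bar>u (x + h)\<bar> - \<bar>u x\<bar>) \<le> l2sq (\<lambda>x. u (x + h) - u x)" for h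
    by (rule l2sq_mono_AE) (auto intro: abs_triangle_ineq3)
qed (use assms L2_bd_abs in auto)

lemma l2sq_tendsto:
  fixes u :: "'a::euclidean_space \<Rightarrow> real"
  assumes f: "\<And>n. f n \<in> L2_space" and u: "u \<in> L2_space" and lim: "(\<lambda>n. l2sq (\<lambda>x. f n x - u x)) \<longlonglongrightarrow> 0"
  shows "(\<lambda>n. l2sq (f n)) \<longlonglongrightarrow> l2sq u"
proof -
  interpret semi_inner L2_space "\<lambda>u v. LINT x|lborel. u x * v x" by (rule integral_mult_semi_inner)
  have eq: "l2sq v = ennreal (LINT x|lborel. v x * v x)" if "v \<in> L2_space" for v :: "'a \<Rightarrow> real"
    using integral_square_eq_l2sq(1)[OF that] by (simp add: power2_eq_square)
  have "(\<lambda>n. enn2real (l2sq (\<lambda>x. f n x - u x))) \<longlonglongrightarrow> 0"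
    by (rule tendsto_enn2real) (use lim in simp_all)
  then have "(\<lambda>n. LINT x|lborel. (f n x - u x) * (f n x - u x)) \<longlonglongrightarrow> 0"
    using integral_square_eq_l2sq(2)[OF L2_space_diff[OF f u]] by (simp add: power2_eq_square)
  then have "(\<lambda>n. LINT x|lborel. f n x * f n x) \<longlonglongrightarrow> (LINT x|lborel. u x * u x)"
    by (intro tendsto_quad f u)
  then show ?thesis
    unfolding eq[OF f] eq[OF u] by (rule tendsto_ennrealI)
qed

lemma l2sq_jump_tendsto:
  fixes u :: "'a::euclidean_space \<Rightarrow> real"
  assumes f: "\<And>n. f n \<in> L2_space" and u: "u \<in> L2_space" and lim: "(\<lambda>n. l2sq (\<lambda>x. f n x - u x)) \<longlonglongrightarrow> 0"
  shows "(\<lambda>n. l2sq (\<lambda>x. f n (x + h) - f n x)) \<longlonglongrightarrow> l2sq (\<lambda>x. u (x + h) - u x)"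
proof (rule l2sq_tendsto)
  have [measurable]: "f n \<in> borel_measurable borel" "u \<in> borel_measurable borel" for n
    using f u by (auto intro: L2_spaceD)
  have le: "l2sq (\<lambda>x. (f n (x + h) - f n x) - (u (x + h) - u x)) \<le> 4 * l2sq (\<lambda>x. f n x - u x)" for n
  proof -
    have "l2sq (\<lambda>x. (f n (x + h) - u (x + h)) - (f n x - u x)) \<le> 2 * l2sq (\<lambda>x. f n (x + h) - u (x + h)) + 2 * l2sq (\<lambda>x. f n x - u x)"
      by (rule l2sq_diff_le) auto
    moreover have "l2sq (\<lambda>x. f n (x + h) - u (x + h)) = l2sq (\<lambda>x. f n x - u x)"
      by (rule l2sq_translate[of "\<lambda>x. f n x - u x"]) auto
    ultimately show ?thesis by (simp add: algebra_simps distrib_right[symmetric])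
  qed
  have "(\<lambda>n. 4 * l2sq (\<lambda>x. f n x - u x)) \<longlonglongrightarrow> 4 * 0"
    by (intro ennreal_tendsto_cmult lim) simp
  then have "(\<lambda>n. 4 * l2sq (\<lambda>x. f n x - u x)) \<longlonglongrightarrow> 0" by simp
  then show "(\<lambda>n. l2sq (\<lambda>x. (f n (x + h) - f n x) - (u (x + h) - u x))) \<longlonglongrightarrow> 0"
    by (rule tendsto_sandwich[OF _ _ tendsto_const, rotated 2]) (use le in \<open>auto intro!: always_eventually\<close>)
qed (use f u in \<open>auto intro!: L2_space_diff L2_space_translate\<close>)

text \<open>
  For each \<open>h\<close> the increments converge in \<open>L\<^sup>2\<close>; the claim is Fatou's lemma for the jump measure.
\<close>

lemma energy_lower_semicontinuous:
  fixes u :: "'a::euclidean_space \<Rightarrow> real"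
  assumes f: "\<And>n. f n \<in> L2_bd" and u: "u \<in> L2_bd" and lim: "(\<lambda>n. l2sq (\<lambda>x. f n x - u x)) \<longlonglongrightarrow> 0"
    and le: "\<And>n. energy \<alpha> (f n) \<le> a n" and a: "a \<longlonglongrightarrow> b"
  shows "energy \<alpha> u \<le> b"
proof -
  have [measurable]: "f n \<in> borel_measurable borel" "u \<in> borel_measurable borel" for n
    using f u by (auto intro!: L2_spaceD L2_bd_L2)
  have "jump_const \<alpha> * energy \<alpha> u = (\<integral>\<^sup>+h. liminf (\<lambda>n. l2sq (\<lambda>x. f n (x + h) - f n x)) \<partial>jump_measure \<alpha>)"
    unfolding jump_energy[OF u \<alpha>(1), symmetric]
  proof (rule nn_integral_cong)
    fix h :: 'a
    have "(\<lambda>n. l2sq (\<lambda>x. f n (x + h) - f n x)) \<longlonglongrightarrow> l2sq (\<lambda>x. u (x + h) - u x)"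
      by (intro l2sq_jump_tendsto L2_bd_L2 f u lim)
    then show "l2sq (\<lambda>x. u (x + h) - u x) = liminf (\<lambda>n. l2sq (\<lambda>x. f n (x + h) - f n x))"
      by (intro lim_imp_Liminf[symmetric]) auto
  qed
  also have "\<dots> \<le> liminf (\<lambda>n. \<integral>\<^sup>+h. l2sq (\<lambda>x. f n (x + h) - f n x) \<partial>jump_measure \<alpha>)"
    by (rule nn_integral_liminf) measurable
  also have "\<dots> = liminf (\<lambda>n. jump_const \<alpha> * energy \<alpha> (f n))"
    by (simp add: jump_energy[OF f \<alpha>(1)])
  also have "\<dots> \<le> liminf (\<lambda>n. jump_const \<alpha> * a n)"
    by (intro Liminf_mono always_eventually allI mult_left_mono le) auto
  also have "\<dots> = jump_const \<alpha> * b"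
  proof (rule lim_imp_Liminf)
    show "(\<lambda>n. jump_const \<alpha> * a n) \<longlonglongrightarrow> jump_const \<alpha> * b"
      using a jump_const_finite[OF \<alpha>] by (intro ennreal_tendsto_cmult) auto
  qed simp
  finally show ?thesis unfolding jump_const_cancel .
qed

text \<open>
  The Gaussian has finite second moment, so \<open>min 1 |\<sigma> z|\<^sup>2 \<le> min 1 \<sigma>\<^sup>2 (1 + |z|\<^sup>2)\<close> reduces this to the integral over the scales.
\<close>

lemma jump_min_finite: "(\<integral>\<^sup>+h. ennreal (min 1 ((norm (h::'a::euclidean_space))\<^sup>2)) \<partial>jump_measure \<alpha>) < \<infinity>"
proof -
  define C where "C = (\<integral>\<^sup>+z. ennreal (gauss (z::'a)) + ennreal (gauss z * (norm z)\<^sup>2) \<partial>lborel)"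
  have C: "C < \<infinity>"
    unfolding C_def using gauss_second_moment[where 'a = 'a] by (subst nn_integral_add) (auto simp: gauss_nn_integral)
  have "(\<integral>\<^sup>+h. ennreal (min 1 ((norm (h::'a))\<^sup>2)) \<partial>jump_measure \<alpha>)
    = (\<integral>\<^sup>+\<sigma>. ennreal (\<sigma> powr (- 1 - 2 * \<alpha>)) * indicator {0<..} \<sigma> * (\<integral>\<^sup>+z. ennreal (gauss (z::'a)) * ennreal (min 1 ((norm (\<sigma> *\<^sub>R z))\<^sup>2)) \<partial>lborel) \<partial>lborel)"
    by (rule nn_integral_jump) measurable
  also have "\<dots> \<le> (\<integral>\<^sup>+\<sigma>. ennreal (\<sigma> powr (- 1 - 2 * \<alpha>)) * indicator {0<..} \<sigma> * (ennreal (min 1 (\<sigma>\<^sup>2)) * C) \<partial>lborel)"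
  proof (intro nn_integral_mono mult_left_mono)
    fix \<sigma> :: real
    have "(\<integral>\<^sup>+z. ennreal (gauss (z::'a)) * ennreal (min 1 ((norm (\<sigma> *\<^sub>R z))\<^sup>2)) \<partial>lborel)
      \<le> (\<integral>\<^sup>+z. ennreal (min 1 (\<sigma>\<^sup>2)) * (ennreal (gauss (z::'a)) + ennreal (gauss z * (norm z)\<^sup>2)) \<partial>lborel)"
    proof (rule nn_integral_mono)
      fix z :: 'a
      have "min 1 ((norm (\<sigma> *\<^sub>R z))\<^sup>2) \<le> min 1 (\<sigma>\<^sup>2) * (1 + (norm z)\<^sup>2)"
      proof (cases "\<sigma>\<^sup>2 \<le> 1")
        case True
        have "min 1 ((norm (\<sigma> *\<^sub>R z))\<^sup>2) \<le> \<sigma>\<^sup>2 * (norm z)\<^sup>2" by (simp add: power_mult_distrib)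
        also have "\<dots> \<le> \<sigma>\<^sup>2 * (1 + (norm z)\<^sup>2)" by (intro mult_left_mono) auto
        finally show ?thesis using True by simp
      next
        case False
        have "min 1 ((norm (\<sigma> *\<^sub>R z))\<^sup>2) \<le> 1" by simp
        then show ?thesis using False by (simp add: add_increasing2 min_absorb1)
      qed
      then have "gauss z * min 1 ((norm (\<sigma> *\<^sub>R z))\<^sup>2) \<le> gauss z * (min 1 (\<sigma>\<^sup>2) * (1 + (norm z)\<^sup>2))"
        by (intro mult_left_mono) (simp_all add: less_imp_le[OF gauss_pos])
      then have "ennreal (gauss z * min 1 ((norm (\<sigma> *\<^sub>R z))\<^sup>2)) \<le> ennreal (min 1 (\<sigma>\<^sup>2) * (gauss z + gauss z * (norm z)\<^sup>2))"
        by (intro ennreal_leI) (simp add: algebra_simps)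
      also have "\<dots> = ennreal (min 1 (\<sigma>\<^sup>2)) * (ennreal (gauss z) + ennreal (gauss z * (norm z)\<^sup>2))"
        by (subst ennreal_mult) (auto simp: less_imp_le[OF gauss_pos] intro!: add_nonneg_nonneg mult_nonneg_nonneg)
      finally show "ennreal (gauss z) * ennreal (min 1 ((norm (\<sigma> *\<^sub>R z))\<^sup>2)) \<le> ennreal (min 1 (\<sigma>\<^sup>2)) * (ennreal (gauss z) + ennreal (gauss z * (norm z)\<^sup>2))"
        by (subst ennreal_mult'[symmetric]) (auto simp: less_imp_le[OF gauss_pos])
    qed
    also have "\<dots> = ennreal (min 1 (\<sigma>\<^sup>2)) * C"
      unfolding C_def by (rule nn_integral_cmult) measurable
    finally show "(\<integral>\<^sup>+z. ennreal (gauss (z::'a)) * ennreal (min 1 ((norm (\<sigma> *\<^sub>R z))\<^sup>2)) \<partial>lborel) \<le> ennreal (min 1 (\<sigma>\<^sup>2)) * C" .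
  qed simp
  also have "\<dots> = (\<integral>\<^sup>+\<sigma>. (ennreal (\<sigma> powr (- 1 - 2 * \<alpha>) * min 1 (\<sigma>\<^sup>2)) * indicator {0<..} \<sigma>) * C \<partial>lborel)"
    by (intro nn_integral_cong) (simp add: ennreal_mult mult_ac)
  also have "\<dots> = (\<integral>\<^sup>+\<sigma>. ennreal (\<sigma> powr (- 1 - 2 * \<alpha>) * min 1 (\<sigma>\<^sup>2)) * indicator {0<..} \<sigma> \<partial>lborel) * C"
    by (rule nn_integral_multc) measurable
  also have "\<dots> < \<infinity>"
    using powr_min_square_integrable[OF \<alpha>] C by (auto simp: ennreal_mult_less_top)
  finally show ?thesis .
qed

lemma energy_finite_if_jump_le:
  fixes u :: "'a::euclidean_space \<Rightarrow> real"
  assumes u: "u \<in> L2_bd" and K: "K < \<infinity>" and f: "f \<in> borel_measurable borel" "(\<integral>\<^sup>+h. f h \<partial>jump_measure \<alpha>) < \<infinity>"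
    and le: "\<And>h. l2sq (\<lambda>x. u (x + h) - u x) \<le> f h + K * ennreal (min 1 ((norm h)\<^sup>2))"
  shows "energy \<alpha> u < \<infinity>"
proof -
  have "jump_const \<alpha> * energy \<alpha> u \<le> (\<integral>\<^sup>+h. f h + K * ennreal (min 1 ((norm h)\<^sup>2)) \<partial>jump_measure \<alpha>)"
    unfolding jump_energy[OF u \<alpha>(1), symmetric] by (intro nn_integral_mono le)
  also have "\<dots> = (\<integral>\<^sup>+h. f h \<partial>jump_measure \<alpha>) + K * (\<integral>\<^sup>+h. ennreal (min 1 ((norm (h::'a))\<^sup>2)) \<partial>jump_measure \<alpha>)"
  proof -
    have [measurable]: "f \<in> borel_measurable (jump_measure \<alpha>)"
      using f(1) by (simp cong: measurable_cong_sets)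
    have "(\<integral>\<^sup>+h. f h + K * ennreal (min 1 ((norm h)\<^sup>2)) \<partial>jump_measure \<alpha>)
      = (\<integral>\<^sup>+h. f h \<partial>jump_measure \<alpha>) + (\<integral>\<^sup>+h. K * ennreal (min 1 ((norm (h::'a))\<^sup>2)) \<partial>jump_measure \<alpha>)"
      by (rule nn_integral_add) measurable
    also have "(\<integral>\<^sup>+h. K * ennreal (min 1 ((norm (h::'a))\<^sup>2)) \<partial>jump_measure \<alpha>) = K * (\<integral>\<^sup>+h. ennreal (min 1 ((norm (h::'a))\<^sup>2)) \<partial>jump_measure \<alpha>)"
      by (rule nn_integral_cmult) measurable
    finally show ?thesis .
  qed
  also have "\<dots> < \<infinity>"
    using f K jump_min_finite[where 'a = 'a] by (auto simp: ennreal_mult_less_top)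
  finally show ?thesis
    using jump_const_pos[of \<alpha>] by (auto simp: ennreal_mult_less_top)
qed

text \<open>
  In \<open>\<eta>(x+h) u(x+h) - \<eta>(x) u(x) = \<eta>(x+h) (u(x+h) - u(x)) + (\<eta>(x+h) - \<eta>(x)) u(x)\<close> the first term is controlled by the
  energy of \<open>u\<close>, and the second contributes at most a multiple of \<open>min 1 |h|\<^sup>2\<close>, which the jump measure integrates.
\<close>

lemma HF_cutoff:
  fixes u :: "'a::euclidean_space \<Rightarrow> real"
  assumes u: "u \<in> HF \<alpha>" and L: "L-lipschitz_on UNIV \<eta>" and bd: "\<And>x. \<bar>\<eta> x\<bar> \<le> 1"
  shows "(\<lambda>x. \<eta> x * u x) \<in> HF \<alpha>"
proof -
  have [measurable]: "\<eta> \<in> borel_measurable borel"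
    using lipschitz_on_continuous_on[OF L] by (rule borel_measurable_continuous_onI)
  have m[measurable]: "u \<in> borel_measurable borel" and fin: "l2sq u < \<infinity>"
    using L2_bd_L2[OF HF_L2_bd[OF u]] by (auto simp: L2_space_iff)
  have ub: "(\<lambda>x. \<eta> x * u x) \<in> L2_bd"
  proof (rule L2_bd_dominated[OF HF_L2_bd[OF u]])
    show "AE x in lborel. \<bar>\<eta> x * u x\<bar> \<le> \<bar>u x\<bar>"
      using bd by (intro AE_I2) (auto simp: abs_mult intro: mult_left_le_one_le)
  qed measurable
  have "energy \<alpha> (\<lambda>x. \<eta> x * u x) < \<infinity>"
  proof (rule energy_finite_if_jump_le[OF ub])
    let ?C = "max 4 (L\<^sup>2)"
    show "2 * (ennreal ?C * l2sq u) < \<infinity>"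
      using fin by (auto simp: ennreal_mult_less_top)
    show "(\<integral>\<^sup>+h. 2 * l2sq (\<lambda>x. u (x + h) - u x) \<partial>jump_measure \<alpha>) < \<infinity>"
      using u jump_const_finite[OF \<alpha>]
      by (subst nn_integral_cmult) (auto simp: jump_energy[OF HF_L2_bd[OF u] \<alpha>(1)] HF_def ennreal_mult_less_top)
    fix h :: 'a
    let ?c = "?C * min 1 ((norm h)\<^sup>2)"
    have \<eta>h: "(\<eta> (x + h) - \<eta> x)\<^sup>2 \<le> ?c" for x
    proof -
      have "\<bar>\<eta> (x + h) - \<eta> x\<bar> \<le> L * norm h"
        using lipschitz_onD[OF L, of "x + h" x] by (simp add: dist_norm)
      then have 1: "(\<eta> (x + h) - \<eta> x)\<^sup>2 \<le> L\<^sup>2 * (norm h)\<^sup>2"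
        by (metis abs_ge_zero power2_abs power_mono power_mult_distrib)
      have "\<bar>\<eta> (x + h) - \<eta> x\<bar> \<le> 2" using bd[of x] bd[of "x + h"] by linarith
      then have 2: "(\<eta> (x + h) - \<eta> x)\<^sup>2 \<le> 4"
        using power_mono[of "\<bar>\<eta> (x + h) - \<eta> x\<bar>" 2 2] by simp
      show ?thesis
      proof (cases "(norm h)\<^sup>2 \<le> 1")
        case True
        have "L\<^sup>2 * (norm h)\<^sup>2 \<le> ?C * (norm h)\<^sup>2" by (intro mult_right_mono) auto
        then show ?thesis using 1 True by simp
      next
        case False
        then show ?thesis using 2 by (simp add: min_absorb1)
      qed
    qed
    have "l2sq (\<lambda>x. \<eta> (x + h) * u (x + h) - \<eta> x * u x)
      = l2sq (\<lambda>x. \<eta> (x + h) * (u (x + h) - u x) + (\<eta> (x + h) - \<eta> x) * u x)"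
      by (simp add: algebra_simps)
    also have "\<dots> \<le> 2 * l2sq (\<lambda>x. \<eta> (x + h) * (u (x + h) - u x)) + 2 * l2sq (\<lambda>x. (\<eta> (x + h) - \<eta> x) * u x)"
      by (rule l2sq_add_le) auto
    also have "\<dots> \<le> 2 * l2sq (\<lambda>x. u (x + h) - u x) + 2 * l2sq (\<lambda>x. sqrt ?c * u x)"
    proof (intro add_mono mult_left_mono)
      show "l2sq (\<lambda>x. \<eta> (x + h) * (u (x + h) - u x)) \<le> l2sq (\<lambda>x. u (x + h) - u x)"
        by (rule l2sq_mono_AE) (use bd in \<open>auto simp: abs_mult intro!: AE_I2 mult_left_le_one_le\<close>)
      show "l2sq (\<lambda>x. (\<eta> (x + h) - \<eta> x) * u x) \<le> l2sq (\<lambda>x. sqrt ?c * u x)"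
      proof (rule l2sq_mono_AE, rule AE_I2)
        fix x
        have "\<bar>\<eta> (x + h) - \<eta> x\<bar> \<le> sqrt ?c" using \<eta>h[of x] by (simp add: real_le_rsqrt)
        then show "norm ((\<eta> (x + h) - \<eta> x) * u x) \<le> norm (sqrt ?c * u x)"
          by (auto simp: abs_mult intro!: mult_right_mono)
      qed
    qed auto
    also have "l2sq (\<lambda>x. sqrt ?c * u x) = ennreal ?c * l2sq u"
      by (subst l2sq_cmult) auto
    also have "ennreal ?c = ennreal ?C * ennreal (min 1 ((norm h)\<^sup>2))"
      by (rule ennreal_mult) auto
    finally show "l2sq (\<lambda>x. \<eta> (x + h) * u (x + h) - \<eta> x * u x)
      \<le> 2 * l2sq (\<lambda>x. u (x + h) - u x) + 2 * (ennreal ?C * l2sq u) * ennreal (min 1 ((norm h)\<^sup>2))"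
      by (simp add: mult_ac)
  qed measurable
  with ub show ?thesis by (simp add: HF_def)
qed

text \<open>
  The increments are bounded by a multiple of \<open>min 1 |h|\<close> and live on two balls of radius \<open>R\<close>.
\<close>

lemma HF_lipschitz:
  fixes u :: "'a::euclidean_space \<Rightarrow> real"
  assumes L: "L-lipschitz_on UNIV u" and bd: "\<And>x. \<bar>u x\<bar> \<le> M" and supp: "\<And>x. x \<notin> ball 0 R \<Longrightarrow> u x = 0" and R: "R > 0"
  shows "u \<in> HF \<alpha>"
proof -
  have [measurable]: "u \<in> borel_measurable borel"
    using lipschitz_on_continuous_on[OF L] by (rule borel_measurable_continuous_onI)
  have [measurable]: "ball (0::'a) R \<in> sets borel" by simp
  let ?B = "emeasure lborel (ball (0::'a) R)"
  have B: "?B < \<infinity>" using emeasure_lborel_ball_finite[of "0::'a" R] by simp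
  have "l2sq u \<le> (\<integral>\<^sup>+x. ennreal (M\<^sup>2) * indicator (ball 0 R) (x::'a) \<partial>lborel)"
    unfolding l2sq_def
  proof (rule nn_integral_mono)
    fix x
    have "(norm (u x))\<^sup>2 \<le> M\<^sup>2" using bd[of x] by (intro power_mono) auto
    then show "ennreal ((norm (u x))\<^sup>2) \<le> ennreal (M\<^sup>2) * indicator (ball 0 R) x"
      using supp[of x] by (auto simp: indicator_def intro!: ennreal_leI)
  qed
  also have "\<dots> < \<infinity>"
    using B by (simp add: nn_integral_cmult_indicator ennreal_mult_less_top)
  finally have ub: "u \<in> L2_bd"
    using supp R by (auto simp: L2_bd_def L2_space_iff intro!: exI[of _ R] AE_I2)
  have "energy \<alpha> u < \<infinity>"
  proof (rule energy_finite_if_jump_le[OF ub])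
    let ?C = "max (4 * M\<^sup>2) (L\<^sup>2)"
    show "ennreal ?C * (?B + ?B) < \<infinity>" using B by (auto simp: ennreal_mult_less_top)
    show "(\<integral>\<^sup>+h. 0 \<partial>jump_measure \<alpha>) < \<infinity>" by simp
    fix h :: 'a
    let ?c = "?C * min 1 ((norm h)\<^sup>2)"
    have c0: "0 \<le> ?c" by (intro mult_nonneg_nonneg) (auto simp: le_max_iff_disj)
    have uh: "(u (x + h) - u x)\<^sup>2 \<le> ?c" for x
    proof -
      have "\<bar>u (x + h) - u x\<bar> \<le> L * norm h"
        using lipschitz_onD[OF L, of "x + h" x] by (simp add: dist_norm)
      then have 1: "(u (x + h) - u x)\<^sup>2 \<le> L\<^sup>2 * (norm h)\<^sup>2"
        by (metis abs_ge_zero power2_abs power_mono power_mult_distrib)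
      have "\<bar>u (x + h) - u x\<bar> \<le> 2 * M" using bd[of x] bd[of "x + h"] by linarith
      then have 2: "(u (x + h) - u x)\<^sup>2 \<le> 4 * M\<^sup>2"
        using power_mono[of "\<bar>u (x + h) - u x\<bar>" "2 * M" 2] by (simp add: power_mult_distrib)
      show ?thesis
      proof (cases "(norm h)\<^sup>2 \<le> 1")
        case True
        have "L\<^sup>2 * (norm h)\<^sup>2 \<le> ?C * (norm h)\<^sup>2" by (intro mult_right_mono) auto
        then show ?thesis using 1 True by simp
      next
        case False
        then show ?thesis using 2 by (simp add: min_absorb1)
      qed
    qed
    have "l2sq (\<lambda>x. u (x + h) - u x) \<le> (\<integral>\<^sup>+x. ennreal ?c * (indicator (ball 0 R) (x + h) + indicator (ball 0 R) x) \<partial>lborel)"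
      unfolding l2sq_def
    proof (rule nn_integral_mono)
      fix x
      have "ennreal ((norm (u (x + h) - u x))\<^sup>2) \<le> ennreal ?c" using uh[of x] by (intro ennreal_leI) simp
      moreover have "u (x + h) - u x = 0" if "x \<notin> ball 0 R" "x + h \<notin> ball 0 R" using that supp by simp
      moreover have "ennreal ?c * 1 \<le> ennreal ?c * (indicator (ball 0 R) (x + h) + indicator (ball 0 R) x)"
        if "x \<in> ball 0 R \<or> x + h \<in> ball 0 R"
        by (rule mult_left_mono) (use that in \<open>auto simp: indicator_def simp del: mem_ball\<close>)
      ultimately show "ennreal ((norm (u (x + h) - u x))\<^sup>2) \<le> ennreal ?c * (indicator (ball 0 R) (x + h) + indicator (ball 0 R) x)"
        by (cases "x \<in> ball 0 R \<or> x + h \<in> ball 0 R") (force, simp)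
    qed
    also have "\<dots> = ennreal ?c * ((\<integral>\<^sup>+x. indicator (ball 0 R) (x + h) \<partial>lborel) + (\<integral>\<^sup>+x. indicator (ball (0::'a) R) x \<partial>lborel))"
      by (simp add: nn_integral_cmult nn_integral_add)
    also have "(\<integral>\<^sup>+x. indicator (ball 0 R) (x + h) \<partial>lborel) = (\<integral>\<^sup>+x. indicator (ball (0::'a) R) x \<partial>lborel)"
      by (rule nn_integral_translate) measurable
    also have "(\<integral>\<^sup>+x. indicator (ball (0::'a) R) x \<partial>lborel) = ?B" by simp
    also have "ennreal ?c = ennreal ?C * ennreal (min 1 ((norm h)\<^sup>2))"
      by (rule ennreal_mult) (auto simp: le_max_iff_disj)
    finally show "l2sq (\<lambda>x. u (x + h) - u x) \<le> 0 + ennreal ?C * (?B + ?B) * ennreal (min 1 ((norm h)\<^sup>2))"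
      by (simp add: mult_ac)
  qed measurable
  with ub show ?thesis by (simp add: HF_def)
qed

end

section \<open>Translation and mollification in the energy norm\<close>

context
  fixes \<alpha> :: real
  assumes \<alpha>: "0 < \<alpha>" "\<alpha> < 1"
begin

lemma HF_translate:
  assumes u: "u \<in> HF \<alpha>"
  shows "(\<lambda>x. u (x + h)) \<in> HF \<alpha>"
proof -
  have [measurable]: "u \<in> borel_measurable borel" using u by (intro L2_spaceD L2_bd_L2 HF_L2_bd)
  have "energy \<alpha> (\<lambda>x. u (x + h)) \<le> energy \<alpha> u"
  proof (rule energy_leI[OF \<alpha> HF_L2_bd[OF u] L2_bd_translate[OF HF_L2_bd[OF u]]])
    fix k
    show "l2sq (\<lambda>x. u (x + k + h) - u (x + h)) \<le> l2sq (\<lambda>x. u (x + k) - u x)"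
      using l2sq_translate[of "\<lambda>x. u (x + k) - u x" h] by (simp add: ac_simps)
  qed
  then show ?thesis
    using u L2_bd_translate[OF HF_L2_bd[OF u]] by (auto simp: HF_def)
qed

lemma HF_diff: "u \<in> HF \<alpha> \<Longrightarrow> v \<in> HF \<alpha> \<Longrightarrow> (\<lambda>x. u x - v x) \<in> HF \<alpha>"
  using HF_lincomb[of u \<alpha> v 1 "-1"] by simp

text \<open>
  For each displacement \<open>h\<close> the increment of \<open>u\<close> is translated by \<open>y n\<close>, so its \<open>L\<^sup>2\<close>-change tends to 0 and is at most 4 times the
  squared norm of the increment; dominated convergence over the jump measure applies.
\<close>

lemma energy_translate_tendsto:
  fixes u :: "'a::euclidean_space \<Rightarrow> real"
  assumes u: "u \<in> HF \<alpha>" and y: "y \<longlonglongrightarrow> 0"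
  shows "(\<lambda>n. energy \<alpha> (\<lambda>x. u (x + y n) - u x)) \<longlonglongrightarrow> 0"
proof -
  have ub: "u \<in> L2_bd" by (rule HF_L2_bd[OF u])
  have [measurable]: "u \<in> borel_measurable borel" using ub by (intro L2_spaceD L2_bd_L2)
  have d: "(\<lambda>x. u (x + y n) - u x) \<in> L2_bd" for n by (intro L2_bd_diff L2_bd_translate ub)
  have "(\<lambda>n. \<integral>\<^sup>+h. l2sq (\<lambda>x. (u (x + h + y n) - u (x + h)) - (u (x + y n) - u x)) \<partial>jump_measure \<alpha>) \<longlonglongrightarrow> (\<integral>\<^sup>+(h::'a). 0 \<partial>jump_measure \<alpha>)"
  proof (rule nn_integral_dominated_convergence[where w = "\<lambda>h. 4 * l2sq (\<lambda>x. u (x + h) - u x)"])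
    show "(\<integral>\<^sup>+h. 4 * l2sq (\<lambda>x. u (x + h) - u x) \<partial>jump_measure \<alpha>) < \<infinity>"
      using u jump_const_finite[OF \<alpha>]
      by (subst nn_integral_cmult) (auto simp: jump_energy[OF ub \<alpha>(1)] HF_def ennreal_mult_less_top)
    have eq: "l2sq (\<lambda>x. (u (x + h + y n) - u (x + h)) - (u (x + y n) - u x)) = l2sq (\<lambda>x. (u ((x + y n) + h) - u (x + y n)) - (u (x + h) - u x))" for h n
      by (simp add: algebra_simps)
    show "AE h in jump_measure \<alpha>. l2sq (\<lambda>x. (u (x + h + y n) - u (x + h)) - (u (x + y n) - u x)) \<le> 4 * l2sq (\<lambda>x. u (x + h) - u x)" for n
    proof (rule AE_I2)
      fix h
      have "l2sq (\<lambda>x. (u ((x + y n) + h) - u (x + y n)) - (u (x + h) - u x)) \<le> 2 * l2sq (\<lambda>x. u ((x + y n) + h) - u (x + y n)) + 2 * l2sq (\<lambda>x. u (x + h) - u x)"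
        by (rule l2sq_diff_le) auto
      also have "l2sq (\<lambda>x. u ((x + y n) + h) - u (x + y n)) = l2sq (\<lambda>x. u (x + h) - u x)"
        by (rule l2sq_translate[of "\<lambda>x. u (x + h) - u x"]) auto
      finally show "l2sq (\<lambda>x. (u (x + h + y n) - u (x + h)) - (u (x + y n) - u x)) \<le> 4 * l2sq (\<lambda>x. u (x + h) - u x)"
        unfolding eq by (simp add: distrib_right[symmetric])
    qed
    show "AE h in jump_measure \<alpha>. (\<lambda>n. l2sq (\<lambda>x. (u (x + h + y n) - u (x + h)) - (u (x + y n) - u x))) \<longlonglongrightarrow> 0"
    proof (rule AE_I2)
      fix h
      show "(\<lambda>n. l2sq (\<lambda>x. (u (x + h + y n) - u (x + h)) - (u (x + y n) - u x))) \<longlonglongrightarrow> 0"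
        unfolding eq
        by (rule L2_translate_continuous[OF _ y, of "\<lambda>x. u (x + h) - u x"]) (intro L2_bd_L2 L2_bd_diff L2_bd_translate ub)
    qed
  qed (unfold l2sq_def, measurable)
  then have "(\<lambda>n. jump_const \<alpha> * energy \<alpha> (\<lambda>x. u (x + y n) - u x)) \<longlonglongrightarrow> 0"
    by (simp add: jump_energy[OF d \<alpha>(1), symmetric])
  then have "(\<lambda>n. (1 / jump_const \<alpha>) * (jump_const \<alpha> * energy \<alpha> (\<lambda>x. u (x + y n) - u x))) \<longlonglongrightarrow> (1 / jump_const \<alpha>) * 0"
    using jump_const_pos[of \<alpha>]
    by (intro ennreal_tendsto_cmult) (auto simp: ennreal_divide_eq_top_iff less_top[symmetric])
  moreover have "(1 / jump_const \<alpha>) * (jump_const \<alpha> * a) = a" for a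
  proof -
    have "(1 / jump_const \<alpha>) * jump_const \<alpha> = 1"
      using jump_const_pos[of \<alpha>] jump_const_finite[OF \<alpha>]
      by (simp add: ennreal_divide_times)
    then show ?thesis by (simp add: mult.assoc[symmetric])
  qed
  ultimately show ?thesis by simp
qed

lemma Hn_translate_tendsto:
  fixes u :: "'a::euclidean_space \<Rightarrow> real"
  assumes u: "u \<in> HF \<alpha>" and y: "y \<longlonglongrightarrow> 0"
  shows "(\<lambda>n. Hn \<alpha> (\<lambda>x. u (x + y n) - u x)) \<longlonglongrightarrow> 0"
  unfolding Hn_def
  using tendsto_add[OF energy_translate_tendsto[OF u y] L2_translate_continuous[OF L2_bd_L2[OF HF_L2_bd[OF u]] y]]
  by simp

end

lemma tendsto_zero_imp_small:
  fixes F :: "'a::euclidean_space \<Rightarrow> ennreal"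
  assumes F: "\<And>y. y \<longlonglongrightarrow> 0 \<Longrightarrow> (\<lambda>n. F (y n)) \<longlonglongrightarrow> 0" and e: "e > 0"
  obtains \<delta> where "\<delta> > 0" "\<And>y. norm y < \<delta> \<Longrightarrow> F y < e"
proof (rule ccontr)
  assume "\<not> thesis"
  then have "\<forall>\<delta>>0. \<exists>y. norm y < \<delta> \<and> \<not> F y < e" using that by blast
  then have "\<forall>n. \<exists>y. norm y < 1 / real (Suc n) \<and> \<not> F y < e"
    by (metis of_nat_0_less_iff zero_less_Suc zero_less_divide_1_iff)
  then obtain y where y: "\<And>n. norm (y n) < 1 / real (Suc n)" "\<And>n. \<not> F (y n) < e"
    by metis
  have "y \<longlonglongrightarrow> 0"
  proof (rule Lim_null_comparison)
    show "\<forall>\<^sub>F n in sequentially. norm (y n) \<le> 1 / real (Suc n)"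
      using y(1) by (intro always_eventually allI less_imp_le)
    show "(\<lambda>n. 1 / real (Suc n)) \<longlonglongrightarrow> 0" by (rule LIMSEQ_Suc[OF lim_1_over_n])
  qed
  from order_tendstoD(2)[OF F[OF this] e] y(2) show False
    by (auto simp: eventually_sequentially)
qed

definition conv :: "('a::euclidean_space \<Rightarrow> real) \<Rightarrow> ('a \<Rightarrow> real) \<Rightarrow> 'a \<Rightarrow> real" where
  "conv \<phi> u x = (LINT y|lborel. \<phi> y * u (x - y))"

definition mollifier :: "real \<Rightarrow> ('a::euclidean_space \<Rightarrow> real) \<Rightarrow> bool" where
  "mollifier \<delta> \<phi> \<longleftrightarrow> continuous_on UNIV \<phi> \<and> (\<forall>y. 0 \<le> \<phi> y) \<and> (\<forall>y. norm y \<ge> \<delta> \<longrightarrow> \<phi> y = 0) \<and> (LINT y|lborel. \<phi> y) = 1"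

lemma continuous_compact_support_bounded:
  fixes \<phi> :: "'a::euclidean_space \<Rightarrow> real"
  assumes "continuous_on UNIV \<phi>" "\<And>y. norm y \<ge> \<delta> \<Longrightarrow> \<phi> y = 0"
  obtains M where "\<And>y. \<bar>\<phi> y\<bar> \<le> M"
proof -
  have "compact (\<phi> ` cball 0 \<delta>)"
    by (intro compact_continuous_image continuous_on_subset[OF assms(1)]) auto
  then have "bounded (\<phi> ` cball 0 \<delta>)" by (rule compact_imp_bounded)
  then obtain M where "\<forall>t\<in>\<phi> ` cball 0 \<delta>. norm t \<le> M"
    unfolding bounded_iff by blast
  then have M: "\<bar>\<phi> y\<bar> \<le> M" if "y \<in> cball 0 \<delta>" for y
    using that by simp
  have "\<bar>\<phi> y\<bar> \<le> max M 0" for y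
    using M[of y] assms(2)[of y] by (cases "norm y \<le> \<delta>") (auto simp: le_max_iff_disj)
  then show thesis by (rule that)
qed

lemma continuous_compact_support_integrable:
  fixes \<phi> :: "'a::euclidean_space \<Rightarrow> real"
  assumes "continuous_on UNIV \<phi>" "\<And>y. norm y \<ge> \<delta> \<Longrightarrow> \<phi> y = 0"
  shows "integrable lborel \<phi>"
proof -
  obtain M where M: "\<And>y. \<bar>\<phi> y\<bar> \<le> M" using continuous_compact_support_bounded[OF assms] by blast
  have [measurable]: "\<phi> \<in> borel_measurable borel" by (rule borel_measurable_continuous_onI) fact
  have [measurable]: "cball (0::'a) \<delta> \<in> sets borel" by simp
  show ?thesis
  proof (rule Bochner_Integration.integrable_bound)
    show "integrable lborel (\<lambda>y::'a. M * indicator (cball 0 \<delta>) y :: real)"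
      using emeasure_lborel_cball_finite[of "0::'a" \<delta>] by (intro integrable_mult_right) (simp add: integrable_indicator_iff)
    show "AE y in lborel. norm (\<phi> y) \<le> norm (M * indicator (cball 0 \<delta>) y :: real)"
      using M assms(2) by (intro AE_I2) (auto simp: indicator_def intro: order_trans[OF _ abs_ge_self])
  qed simp
qed

lemma mollifierD:
  assumes "mollifier \<delta> \<phi>"
  shows "integrable lborel \<phi>" "\<phi> \<in> borel_measurable borel" "0 \<le> \<phi> y" "norm y \<ge> \<delta> \<Longrightarrow> \<phi> y = 0" "(LINT y|lborel. \<phi> y) = 1"
    "(\<integral>\<^sup>+y. ennreal (\<phi> y) \<partial>lborel) = 1"
proof -
  show i: "integrable lborel \<phi>" using assms by (intro continuous_compact_support_integrable) (auto simp: mollifier_def)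
  show "\<phi> \<in> borel_measurable borel" "0 \<le> \<phi> y" "norm y \<ge> \<delta> \<Longrightarrow> \<phi> y = 0" "(LINT y|lborel. \<phi> y) = 1"
    using assms by (auto simp: mollifier_def intro: borel_measurable_continuous_onI)
  then show "(\<integral>\<^sup>+y. ennreal (\<phi> y) \<partial>lborel) = 1"
    using assms by (subst nn_integral_eq_integral[OF i]) (auto simp: mollifier_def)
qed

lemma conv_integrable:
  fixes u :: "'a::euclidean_space \<Rightarrow> real"
  assumes "mollifier \<delta> \<phi>" "integrable lborel u"
  shows "integrable lborel (\<lambda>y. \<phi> y * u (x - y))"
proof -
  obtain M where M: "\<And>y. \<bar>\<phi> y\<bar> \<le> M"
    using assms(1) continuous_compact_support_bounded[of \<phi> \<delta>] by (auto simp: mollifier_def)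
  have [measurable]: "\<phi> \<in> borel_measurable borel" "u \<in> borel_measurable borel"
    using mollifierD(2)[OF assms(1)] assms(2) by (auto dest: borel_measurable_integrable)
  have "integrable lborel (\<lambda>y. u (x + (-1) *\<^sub>R y))"
    by (rule integrable_affine[OF assms(2)]) simp
  then have "integrable lborel (\<lambda>y. M * u (x - y))" by simp
  then show ?thesis
  proof (rule Bochner_Integration.integrable_bound)
    show "AE y in lborel. norm (\<phi> y * u (x - y)) \<le> norm (M * u (x - y))"
    proof (rule AE_I2)
      fix y
      have "\<bar>\<phi> y\<bar> \<le> \<bar>M\<bar>" using M[of y] by linarith
      then show "norm (\<phi> y * u (x - y)) \<le> norm (M * u (x - y))"
        by (auto simp: abs_mult intro: mult_right_mono)
    qed
  qed measurable
qed

text \<open>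
  The variance of \<open>f\<close> under the probability density \<open>\<phi>\<close> is nonnegative.
\<close>

lemma Jensen_square:
  fixes f \<phi> :: "'a::euclidean_space \<Rightarrow> real"
  assumes \<phi>: "integrable lborel \<phi>" "\<And>y. 0 \<le> \<phi> y" "(LINT y|lborel. \<phi> y) = 1" and f: "f \<in> borel_measurable borel"
  shows "ennreal ((LINT y|lborel. \<phi> y * f y)\<^sup>2) \<le> (\<integral>\<^sup>+y. ennreal (\<phi> y) * ennreal ((f y)\<^sup>2) \<partial>lborel)"
proof (cases "(\<integral>\<^sup>+y. ennreal (\<phi> y) * ennreal ((f y)\<^sup>2) \<partial>lborel) < \<infinity>")
  case True
  have [measurable]: "\<phi> \<in> borel_measurable borel" "f \<in> borel_measurable borel"
    using \<phi>(1) f by (auto dest: borel_measurable_integrable)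
  have eq: "ennreal (\<phi> y) * ennreal ((f y)\<^sup>2) = ennreal (\<phi> y * (f y)\<^sup>2)" for y
    using \<phi>(2) by (simp add: ennreal_mult)
  have i2: "integrable lborel (\<lambda>y. \<phi> y * (f y)\<^sup>2)"
    using True \<phi>(2) unfolding eq by (auto simp: integrable_iff_bounded)
  have i1: "integrable lborel (\<lambda>y. \<phi> y * f y)"
  proof (rule Bochner_Integration.integrable_bound[OF Bochner_Integration.integrable_add[OF \<phi>(1) i2]])
    show "AE y in lborel. norm (\<phi> y * f y) \<le> norm (\<phi> y + \<phi> y * (f y)\<^sup>2)"
    proof (rule AE_I2)
      fix y
      have "0 \<le> (\<bar>f y\<bar> - 1)\<^sup>2" by simp
      then have "\<bar>f y\<bar> \<le> 1 + (f y)\<^sup>2" using abs_ge_zero[of "f y"] by (simp add: power2_diff)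
      then have "\<phi> y * \<bar>f y\<bar> \<le> \<phi> y * (1 + (f y)\<^sup>2)" by (intro mult_left_mono \<phi>)
      then show "norm (\<phi> y * f y) \<le> norm (\<phi> y + \<phi> y * (f y)\<^sup>2)"
        using \<phi>(2)[of y] by (simp add: abs_mult distrib_left)
    qed
  qed measurable
  define m where "m = (LINT y|lborel. \<phi> y * f y)"
  have "0 \<le> (LINT y|lborel. \<phi> y * (f y - m)\<^sup>2)" using \<phi>(2) by (intro Bochner_Integration.integral_nonneg) simp
  also have "\<dots> = (LINT y|lborel. \<phi> y * (f y)\<^sup>2 - 2 * m * (\<phi> y * f y) + m\<^sup>2 * \<phi> y)"
    by (intro Bochner_Integration.integral_cong refl) (simp add: power2_diff algebra_simps)
  also have "\<dots> = (LINT y|lborel. \<phi> y * (f y)\<^sup>2) - 2 * m * m + m\<^sup>2 * 1"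
    using i1 i2 \<phi>(1,3) by (simp add: m_def)
  finally have "m\<^sup>2 \<le> (LINT y|lborel. \<phi> y * (f y)\<^sup>2)" by (simp add: power2_eq_square)
  then have "ennreal (m\<^sup>2) \<le> ennreal (LINT y|lborel. \<phi> y * (f y)\<^sup>2)" by (rule ennreal_leI)
  also have "\<dots> = (\<integral>\<^sup>+y. ennreal (\<phi> y) * ennreal ((f y)\<^sup>2) \<partial>lborel)"
    unfolding eq using \<phi>(2) by (intro nn_integral_eq_integral[symmetric] i2) simp
  finally show ?thesis by (simp add: m_def)
qed (simp add: not_less top_unique)

lemma conv_measurable[measurable]:
  assumes [measurable]: "\<phi> \<in> borel_measurable borel" "u \<in> borel_measurable borel"
  shows "conv \<phi> u \<in> borel_measurable borel"
  unfolding conv_def by measurable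

lemma conv_diff_eq:
  assumes \<phi>: "mollifier \<delta> \<phi>" and u: "integrable lborel u"
  shows "conv \<phi> u x - u x = (LINT y|lborel. \<phi> y * (u (x - y) - u x))"
proof -
  have "(LINT y|lborel. \<phi> y * (u (x - y) - u x)) = (LINT y|lborel. \<phi> y * u (x - y) - u x * \<phi> y)"
    by (simp add: algebra_simps)
  also have "\<dots> = conv \<phi> u x - u x * 1"
    using conv_integrable[OF \<phi> u] mollifierD(1,5)[OF \<phi>] by (simp add: conv_def)
  finally show ?thesis by simp
qed

text \<open>
  Mollification averages translates, and squared norms of averages are bounded by averages of squared norms.
\<close>

lemma l2sq_conv_diff_le:
  fixes u :: "'a::euclidean_space \<Rightarrow> real"
  assumes \<phi>: "mollifier \<delta> \<phi>" and u: "integrable lborel u"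
  shows "l2sq (\<lambda>x. conv \<phi> u x - u x) \<le> (\<integral>\<^sup>+y. ennreal (\<phi> y) * l2sq (\<lambda>x. u (x - y) - u x) \<partial>lborel)"
proof -
  note mollifierD(2)[OF \<phi>, measurable]
  have [measurable]: "u \<in> borel_measurable borel" using u by (auto dest: borel_measurable_integrable)
  have "l2sq (\<lambda>x. conv \<phi> u x - u x) \<le> (\<integral>\<^sup>+x. \<integral>\<^sup>+y. ennreal (\<phi> y) * ennreal ((u (x - y) - u x)\<^sup>2) \<partial>lborel \<partial>lborel)"
    unfolding l2sq_def conv_diff_eq[OF \<phi> u] real_norm_def power2_abs
    by (intro nn_integral_mono Jensen_square mollifierD[OF \<phi>]) measurable
  also have "\<dots> = (\<integral>\<^sup>+y. \<integral>\<^sup>+x. ennreal (\<phi> y) * ennreal ((u (x - y) - u x)\<^sup>2) \<partial>lborel \<partial>lborel)"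
    by (rule lborel_pair.Fubini'[symmetric]) measurable
  also have "\<dots> = (\<integral>\<^sup>+y. ennreal (\<phi> y) * l2sq (\<lambda>x. u (x - y) - u x) \<partial>lborel)"
    unfolding l2sq_def by (simp add: nn_integral_cmult)
  finally show ?thesis .
qed

lemma conv_jump:
  assumes \<phi>: "mollifier \<delta> \<phi>" and u: "integrable lborel (u :: 'a::euclidean_space \<Rightarrow> real)"
  shows "conv \<phi> u (x + h) - conv \<phi> u x = conv \<phi> (\<lambda>x. u (x + h) - u x) x"
  unfolding conv_def
  using conv_integrable[OF \<phi> u, of "x + h"] conv_integrable[OF \<phi> u, of x]
  by (subst Bochner_Integration.integral_diff[symmetric]) (auto simp: algebra_simps)

lemma conv_support:
  assumes \<phi>: "mollifier \<delta> \<phi>" and u: "AE y in lborel. y \<notin> K \<longrightarrow> u y = 0" and [measurable]: "u \<in> borel_measurable borel"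
    and x: "\<And>z. z \<in> K \<Longrightarrow> norm (x - z) \<ge> \<delta>"
  shows "conv \<phi> u x = (0::real)"
proof -
  note mollifierD(2)[OF \<phi>, measurable]
  have "AE y in lborel. x + (-1) *\<^sub>R y \<notin> K \<longrightarrow> u (x + (-1) *\<^sub>R y) = 0"
    by (rule AE_affine[OF u]) simp
  then have "AE y in lborel. \<phi> y * u (x - y) = 0"
  proof eventually_elim
    case (elim y)
    show ?case
    proof (cases "x - y \<in> K")
      case True
      from x[OF this] show ?thesis using mollifierD(4)[OF \<phi>, of y] by simp
    qed (use elim in simp)
  qed
  then have "conv \<phi> u x = (LINT y|lborel. 0 * u (x - y))"
    unfolding conv_def by (intro integral_cong_AE; (measurable; fail | simp))
  then show ?thesis by simp
qed

lemma conv_L2_bd: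
  fixes u :: "'a::euclidean_space \<Rightarrow> real"
  assumes \<phi>: "mollifier \<delta> \<phi>" and d: "\<delta> > 0" and u: "u \<in> L2_bd"
  shows "conv \<phi> u \<in> L2_bd"
proof -
  note mollifierD(2)[OF \<phi>, measurable]
  have u2: "u \<in> L2_space" by (rule L2_bd_L2[OF u])
  have [measurable]: "u \<in> borel_measurable borel" by (rule L2_spaceD[OF u2])
  have "l2sq (\<lambda>x. conv \<phi> u x - u x) \<le> (\<integral>\<^sup>+y. ennreal (\<phi> y) * l2sq (\<lambda>x. u (x - y) - u x) \<partial>lborel)"
    by (rule l2sq_conv_diff_le[OF \<phi> L2_bd_integrable[OF u]])
  also have "\<dots> \<le> (\<integral>\<^sup>+y. ennreal (\<phi> y) * (4 * l2sq u) \<partial>lborel)"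
  proof (intro nn_integral_mono mult_left_mono)
    fix y
    have "l2sq (\<lambda>x. u (x + - y) - u x) \<le> 2 * l2sq (\<lambda>x. u (x + - y)) + 2 * l2sq u"
      by (rule l2sq_diff_le) auto
    also have "l2sq (\<lambda>x. u (x + - y)) = l2sq u" by (rule l2sq_translate) auto
    finally show "l2sq (\<lambda>x. u (x - y) - u x) \<le> 4 * l2sq u" by (simp add: distrib_right[symmetric])
  qed simp
  also have "\<dots> = 4 * l2sq u"
    by (subst nn_integral_multc) (auto simp: mollifierD(6)[OF \<phi>])
  also have "\<dots> < \<infinity>" using L2_spaceD(2)[OF u2] by (auto simp: ennreal_mult_less_top)
  finally have "(\<lambda>x. conv \<phi> u x - u x) \<in> L2_space" by (simp add: L2_space_iff)
  from L2_space_add[OF this u2] have L: "conv \<phi> u \<in> L2_space" by simp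
  obtain R where R: "R > 0" "AE x in lborel. x \<notin> ball 0 R \<longrightarrow> u x = 0" using u by (auto simp: L2_bd_def)
  have "conv \<phi> u x = 0" if "x \<notin> ball 0 (R + \<delta>)" for x
  proof (rule conv_support[OF \<phi> R(2)])
    fix z :: 'a assume "z \<in> ball 0 R"
    then show "\<delta> \<le> norm (x - z)" using that norm_triangle_ineq2[of x z] by auto
  qed measurable
  then show ?thesis using L R(1) d by (auto simp: L2_bd_def intro!: exI[of _ "R + \<delta>"] AE_I2)
qed

text \<open>
  Increments commute with mollification, so the \<open>L\<^sup>2\<close>-estimate applies to each increment and integrates over the jumps.
\<close>

lemma energy_conv_diff_le:
  fixes u :: "'a::euclidean_space \<Rightarrow> real"
  assumes \<alpha>: "0 < \<alpha>" "\<alpha> < 1" and \<phi>: "mollifier \<delta> \<phi>" and d: "\<delta> > 0" and u: "u \<in> L2_bd"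
  shows "energy \<alpha> (\<lambda>x. conv \<phi> u x - u x) \<le> (\<integral>\<^sup>+y. ennreal (\<phi> y) * energy \<alpha> (\<lambda>x. u (x - y) - u x) \<partial>lborel)"
proof -
  note mollifierD(2)[OF \<phi>, measurable]
  have [measurable]: "u \<in> borel_measurable borel" using u by (intro L2_spaceD L2_bd_L2)
  have ui: "integrable lborel u" by (rule L2_bd_integrable[OF u])
  have tr: "(\<lambda>x. u (x - y)) \<in> L2_bd" for y using L2_bd_translate[OF u, of "- y"] by simp
  have c: "(\<lambda>x. conv \<phi> u x - u x) \<in> L2_bd" by (intro L2_bd_diff conv_L2_bd[OF \<phi> d] u)
  have "jump_const \<alpha> * energy \<alpha> (\<lambda>x. conv \<phi> u x - u x)
    \<le> (\<integral>\<^sup>+h. \<integral>\<^sup>+y. ennreal (\<phi> y) * l2sq (\<lambda>x. (u (x + h - y) - u (x + h)) - (u (x - y) - u x)) \<partial>lborel \<partial>jump_measure \<alpha>)"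
    unfolding jump_energy[OF c \<alpha>(1), symmetric]
  proof (rule nn_integral_mono)
    fix h :: 'a
    have "l2sq (\<lambda>x. (conv \<phi> u (x + h) - u (x + h)) - (conv \<phi> u x - u x)) = l2sq (\<lambda>x. conv \<phi> (\<lambda>x. u (x + h) - u x) x - (u (x + h) - u x))"
      by (simp add: conv_jump[OF \<phi> ui, symmetric] algebra_simps)
    also have "\<dots> \<le> (\<integral>\<^sup>+y. ennreal (\<phi> y) * l2sq (\<lambda>x. (u (x - y + h) - u (x - y)) - (u (x + h) - u x)) \<partial>lborel)"
      by (intro l2sq_conv_diff_le[OF \<phi>] L2_bd_integrable L2_bd_diff L2_bd_translate u)
    also have "\<dots> = (\<integral>\<^sup>+y. ennreal (\<phi> y) * l2sq (\<lambda>x. (u (x + h - y) - u (x + h)) - (u (x - y) - u x)) \<partial>lborel)"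
      by (simp add: algebra_simps)
    finally show "l2sq (\<lambda>x. (conv \<phi> u (x + h) - u (x + h)) - (conv \<phi> u x - u x))
      \<le> (\<integral>\<^sup>+y. ennreal (\<phi> y) * l2sq (\<lambda>x. (u (x + h - y) - u (x + h)) - (u (x - y) - u x)) \<partial>lborel)" .
  qed
  also have "\<dots> = (\<integral>\<^sup>+y. \<integral>\<^sup>+h. ennreal (\<phi> y) * l2sq (\<lambda>x. (u (x + h - y) - u (x + h)) - (u (x - y) - u x)) \<partial>jump_measure \<alpha> \<partial>lborel)"
    unfolding l2sq_def by (rule jump_Fubini) measurable
  also have "\<dots> = (\<integral>\<^sup>+y. jump_const \<alpha> * (ennreal (\<phi> y) * energy \<alpha> (\<lambda>x. u (x - y) - u x)) \<partial>lborel)"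
  proof (rule nn_integral_cong)
    fix y
    have "(\<integral>\<^sup>+h. ennreal (\<phi> y) * l2sq (\<lambda>x. (u (x + h - y) - u (x + h)) - (u (x - y) - u x)) \<partial>jump_measure \<alpha>)
      = ennreal (\<phi> y) * (\<integral>\<^sup>+h. l2sq (\<lambda>x. (u (x + h - y) - u (x + h)) - (u (x - y) - u x)) \<partial>jump_measure \<alpha>)"
      unfolding l2sq_def by (rule nn_integral_cmult) measurable
    then show "(\<integral>\<^sup>+h. ennreal (\<phi> y) * l2sq (\<lambda>x. (u (x + h - y) - u (x + h)) - (u (x - y) - u x)) \<partial>jump_measure \<alpha>)
      = jump_const \<alpha> * (ennreal (\<phi> y) * energy \<alpha> (\<lambda>x. u (x - y) - u x))"
      using jump_energy[OF L2_bd_diff[OF tr u] \<alpha>(1)] by (simp add: mult_ac)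
  qed
  also have "\<dots> = jump_const \<alpha> * (\<integral>\<^sup>+y. ennreal (\<phi> y) * energy \<alpha> (\<lambda>x. u (x - y) - u x) \<partial>lborel)"
  proof (rule nn_integral_cmult)
    show "(\<lambda>y. ennreal (\<phi> y) * energy \<alpha> (\<lambda>x. u (x - y) - u x)) \<in> borel_measurable lborel"
      unfolding energy_def fourier_L1_def by measurable
  qed
  finally show ?thesis unfolding jump_const_cancel[OF \<alpha>] .
qed

lemma mollifier_average_le:
  assumes \<phi>: "mollifier \<delta> \<phi>" and f: "\<And>y. norm y < \<delta> \<Longrightarrow> f y \<le> e"
  shows "(\<integral>\<^sup>+y. ennreal (\<phi> y) * f y \<partial>lborel) \<le> e"
proof -
  note mollifierD(2)[OF \<phi>, measurable]
  have "(\<integral>\<^sup>+y. ennreal (\<phi> y) * f y \<partial>lborel) \<le> (\<integral>\<^sup>+y. ennreal (\<phi> y) * e \<partial>lborel)"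
  proof (rule nn_integral_mono)
    fix y
    show "ennreal (\<phi> y) * f y \<le> ennreal (\<phi> y) * e"
      using f[of y] mollifierD(4)[OF \<phi>, of y] by (cases "norm y < \<delta>") (auto intro: mult_left_mono)
  qed
  also have "\<dots> = e" by (subst nn_integral_multc) (auto simp: mollifierD(6)[OF \<phi>])
  finally show ?thesis .
qed

lemma l2sq_conv_diff_small:
  fixes u :: "'a::euclidean_space \<Rightarrow> real"
  assumes \<phi>: "mollifier \<delta> \<phi>" and u: "integrable lborel u"
    and le: "\<And>y. norm y < \<delta> \<Longrightarrow> l2sq (\<lambda>x. u (x + y) - u x) \<le> e"
  shows "l2sq (\<lambda>x. conv \<phi> u x - u x) \<le> e"
  by (rule order_trans[OF l2sq_conv_diff_le[OF \<phi> u] mollifier_average_le[OF \<phi>]]) (use le[of "- _"] in simp)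

lemma energy_conv_diff_small:
  fixes u :: "'a::euclidean_space \<Rightarrow> real"
  assumes \<alpha>: "0 < \<alpha>" "\<alpha> < 1" and \<phi>: "mollifier \<delta> \<phi>" and d: "\<delta> > 0" and u: "u \<in> L2_bd"
    and le: "\<And>y. norm y < \<delta> \<Longrightarrow> energy \<alpha> (\<lambda>x. u (x + y) - u x) \<le> e"
  shows "energy \<alpha> (\<lambda>x. conv \<phi> u x - u x) \<le> e"
  by (rule order_trans[OF energy_conv_diff_le[OF \<alpha> \<phi> d u] mollifier_average_le[OF \<phi>]]) (use le[of "- _"] in simp)

section \<open>Smooth functions with compact support\<close>

text \<open>
  A class of differentiable functions that contains the directional derivatives of its members consists of smooth functions.
\<close>

lemma C_k_coinduct:
  assumes "\<And>f x. f \<in> S \<Longrightarrow> f differentiable (at x)"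
    and "\<And>f h. f \<in> S \<Longrightarrow> (\<lambda>x. frechet_derivative f (at x) h) \<in> S"
    and "f \<in> S"
  shows "C_k k f"
  using assms(3)
proof (induction k arbitrary: f)
  case 0
  then show ?case
    using assms(1) by (auto intro!: continuous_at_imp_continuous_on differentiable_imp_continuous_within)
next
  case (Suc k)
  then show ?case using assms(1,2) by simp
qed

text \<open>The flat function \<open>t \<mapsto> t\<^sup>-\<^sup>m exp (-1/t)\<close>, extended by zero to the negative half-line.\<close>

definition flat :: "nat \<Rightarrow> real \<Rightarrow> real" where
  "flat m t = (if t > 0 then exp (- (1 / t)) / t ^ m else 0)"

text \<open>
  The exponential beats every power of \<open>1/t\<close>, with a factor \<open>t\<^sup>2\<close> to spare that makes the derivative at 0 vanish.
\<close>

lemma flat_quadratic_bound: "\<bar>flat m t\<bar> \<le> real ((m + 2) ^ (m + 2)) * t\<^sup>2"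
proof (cases "t > 0")
  case True
  \<comment> \<open>\<open>(1 + x / n)\<^sup>n \<le> exp x\<close> at \<open>x = 1 / t\<close>.\<close>
  define n where "n = m + 2"
  have n: "n > 0" by (simp add: n_def)
  have "(1 / t / real n) ^ n \<le> (1 + 1 / t / real n) ^ n"
    using True by (intro power_mono) auto
  also have "\<dots> \<le> exp (1 / t)"
    using True n by (intro exp_ge_one_plus_x_over_n_power_n) (auto intro: order_trans[of _ 0])
  finally have "1 \<le> exp (1 / t) * (real n ^ n * t ^ n)"
    using True n by (simp add: field_simps power_mult_distrib)
  then have "exp (- (1 / t)) * 1 \<le> exp (- (1 / t)) * (exp (1 / t) * (real n ^ n * t ^ n))"
    by (intro mult_left_mono) auto
  also have "\<dots> = real n ^ n * t ^ n"
    by (simp add: mult.assoc[symmetric] exp_minus)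
  finally have "exp (- (1 / t)) \<le> real n ^ n * (t ^ m * t\<^sup>2)"
    by (simp add: n_def power_add power2_eq_square mult_ac)
  then have "exp (- (1 / t)) / t ^ m \<le> real n ^ n * t\<^sup>2"
    using True by (simp add: field_simps)
  moreover have eq: "real ((m + 2) ^ (m + 2)) = real n ^ n" unfolding n_def by (rule of_nat_power)
  ultimately show ?thesis unfolding eq using True by (simp add: flat_def)
qed (simp add: flat_def)

lemma flat_deriv: "(flat m has_field_derivative - real m * flat (m + 1) t + flat (m + 2) t) (at t)"
proof -
  consider "t > 0" | "t < 0" | "t = 0" by linarith
  then show ?thesis
  proof cases
    case 1
    have "((\<lambda>t. exp (- (1 / t)) / t ^ m) has_field_derivative - real m * flat (m + 1) t + flat (m + 2) t) (at t)"
    proof (cases m)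
      case 0
      then show ?thesis using 1
        by (auto intro!: derivative_eq_intros simp: flat_def field_simps power2_eq_square)
    next
      case (Suc k)
      then show ?thesis using 1
        by (auto intro!: derivative_eq_intros simp: flat_def)
           (simp add: field_simps power2_eq_square, cases k, auto)
    qed
    then show ?thesis
    proof (rule has_field_derivative_transform_within_open)
      show "open {(0::real)<..}" "t \<in> {0<..}" using 1 by auto
    qed (auto simp: flat_def)
  next
    case 2
    have "((\<lambda>t. 0) has_field_derivative 0) (at t)" by simp
    then have "(flat m has_field_derivative 0) (at t)"
    proof (rule has_field_derivative_transform_within_open)
      show "open {..<(0::real)}" "t \<in> {..<0}" using 2 by auto
    qed (auto simp: flat_def)
    then show ?thesis using 2 by (simp add: flat_def)
  next
    case 3
    let ?C = "real ((m + 2) ^ (m + 2))"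
    have z: "flat m 0 = 0" by (simp add: flat_def)
    have "(\<lambda>h. flat m h / h) \<midarrow>0\<rightarrow> 0"
    proof (rule Lim_null_comparison)
      show "\<forall>\<^sub>F h in at 0. norm (flat m h / h) \<le> ?C * \<bar>h\<bar>"
      proof (rule always_eventually, rule allI)
        fix h :: real
        show "norm (flat m h / h) \<le> ?C * \<bar>h\<bar>"
        proof (cases "h = 0")
          case False
          have "\<bar>flat m h\<bar> / \<bar>h\<bar> \<le> (?C * h\<^sup>2) / \<bar>h\<bar>"
            using flat_quadratic_bound[of m h] by (intro divide_right_mono) auto
          also have "\<dots> = ?C * \<bar>h\<bar>" using False by (simp add: power2_eq_square abs_if)
          finally show ?thesis by (simp add: abs_divide)
        qed simp
      qed
      have "((\<lambda>h. ?C * \<bar>h\<bar>) \<longlongrightarrow> ?C * \<bar>0\<bar>) (at 0)" by (intro tendsto_intros)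
      then show "((\<lambda>h. ?C * \<bar>h\<bar>) \<longlongrightarrow> 0) (at 0)" by simp
    qed
    then have "(flat m has_field_derivative 0) (at 0)"
      by (simp add: DERIV_def z)
    then show ?thesis using 3 by (simp add: flat_def)
  qed
qed

lemma real_polynomial_has_derivative:
  assumes "real_polynomial_function p"
  shows "\<exists>p'. (\<forall>x. (p has_derivative p' x) (at x)) \<and> (\<forall>h. real_polynomial_function (\<lambda>x. p' x h))"
  using assms
proof induction
  case (linear f)
  then show ?case
    by (intro exI[of _ "\<lambda>x. f"]) (auto intro: bounded_linear_imp_has_derivative real_polynomial_function.intros(2))
next
  case (const c)
  then show ?case by (intro exI[of _ "\<lambda>x h. 0"]) auto
next
  case (add f g)
  then obtain f' g' where
    "\<forall>x. (f has_derivative f' x) (at x)" "\<forall>h. real_polynomial_function (\<lambda>x. f' x h)"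
    "\<forall>x. (g has_derivative g' x) (at x)" "\<forall>h. real_polynomial_function (\<lambda>x. g' x h)" by blast
  then show ?case
    by (intro exI[of _ "\<lambda>x h. f' x h + g' x h"]) (auto intro: has_derivative_add)
next
  case (mult f g)
  then obtain f' g' where
    "\<forall>x. (f has_derivative f' x) (at x)" "\<forall>h. real_polynomial_function (\<lambda>x. f' x h)"
    "\<forall>x. (g has_derivative g' x) (at x)" "\<forall>h. real_polynomial_function (\<lambda>x. g' x h)" by blast
  then show ?case using mult.hyps
    by (intro exI[of _ "\<lambda>x h. f x * g' x h + f' x h * g x"]) (auto intro!: has_derivative_mult real_polynomial_function.intros(3,4))
qed

text \<open>
  The generators are polynomials times flat functions of \<open>r - |x|\<^sup>2\<close>. The polynomial factors absorb what the chain rule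
  produces, so the class is closed under differentiation.
\<close>

inductive_set bumps :: "real \<Rightarrow> ('a::euclidean_space \<Rightarrow> real) set" for r where
  base: "real_polynomial_function p \<Longrightarrow> (\<lambda>x. p x * flat m (r - x \<bullet> x)) \<in> bumps r"
| add: "f \<in> bumps r \<Longrightarrow> g \<in> bumps r \<Longrightarrow> (\<lambda>x. f x + g x) \<in> bumps r"

lemma bumps_derivative:
  assumes "f \<in> bumps r"
  shows "\<exists>f'. (\<forall>x. (f has_derivative f' x) (at x)) \<and> (\<forall>h. (\<lambda>x. f' x h) \<in> bumps r)"
  using assms
proof induction
  case (base p m)
  obtain p' where p': "\<And>x. (p has_derivative p' x) (at x)" "\<And>h. real_polynomial_function (\<lambda>x. p' x h)"
    using real_polynomial_has_derivative[OF base] by blast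
  let ?f' = "\<lambda>x h. p x * ((- real m * flat (m + 1) (r - x \<bullet> x) + flat (m + 2) (r - x \<bullet> x)) * (- 2 * (x \<bullet> h))) + p' x h * flat m (r - x \<bullet> x)"
  have d: "((\<lambda>x. p x * flat m (r - x \<bullet> x)) has_derivative ?f' x) (at x)" for x
  proof (rule has_derivative_mult[OF p'(1)])
    have "((\<lambda>x. r - x \<bullet> x) has_derivative (\<lambda>h. - 2 * (x \<bullet> h))) (at x)"
      by (auto intro!: derivative_eq_intros simp: inner_commute)
    moreover have "(flat m has_derivative (\<lambda>h. (- real m * flat (m + 1) (r - x \<bullet> x) + flat (m + 2) (r - x \<bullet> x)) * h)) (at (r - x \<bullet> x))"
      using flat_deriv[of m "r - x \<bullet> x"] by (simp add: has_field_derivative_def)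
    ultimately show "((\<lambda>x. flat m (r - x \<bullet> x)) has_derivative (\<lambda>h. (- real m * flat (m + 1) (r - x \<bullet> x) + flat (m + 2) (r - x \<bullet> x)) * (- 2 * (x \<bullet> h)))) (at x)"
      by (rule has_derivative_compose)
  qed
  have b: "(\<lambda>x. ?f' x h) \<in> bumps r" for h
  proof -
    have l: "real_polynomial_function (\<lambda>x. x \<bullet> h)"
      by (intro real_polynomial_function.intros(1) bounded_linear_inner_left)
    have 1: "(\<lambda>x. (p x * (2 * real m * (x \<bullet> h))) * flat (m + 1) (r - x \<bullet> x)) \<in> bumps r"
      by (intro bumps.base real_polynomial_function.intros(4) base real_polynomial_function.intros(2) l)
    have 2: "(\<lambda>x. (p x * (- 2 * (x \<bullet> h))) * flat (m + 2) (r - x \<bullet> x)) \<in> bumps r"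
      by (intro bumps.base real_polynomial_function.intros(4) base real_polynomial_function.intros(2) l)
    have 3: "(\<lambda>x. p' x h * flat m (r - x \<bullet> x)) \<in> bumps r"
      by (intro bumps.base p')
    from bumps.add[OF bumps.add[OF 1 2] 3] show ?thesis by (simp add: algebra_simps)
  qed
  show ?case by (rule exI[of _ ?f']) (intro conjI allI d b)
next
  case (add f g)
  then obtain f' g' where
    "\<forall>x. (f has_derivative f' x) (at x)" "\<forall>h. (\<lambda>x. f' x h) \<in> bumps r"
    "\<forall>x. (g has_derivative g' x) (at x)" "\<forall>h. (\<lambda>x. g' x h) \<in> bumps r" by blast
  then show ?case
    by (intro exI[of _ "\<lambda>x h. f' x h + g' x h"]) (auto intro: has_derivative_add bumps.add)
qed

lemma bumps_C_k:
  assumes "f \<in> bumps r"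
  shows "C_k k f"
proof (rule C_k_coinduct[where S = "bumps r"])
  fix f :: "'a \<Rightarrow> real" and x h assume "f \<in> bumps r"
  then obtain f' where f': "\<And>x. (f has_derivative f' x) (at x)" "\<And>h. (\<lambda>x. f' x h) \<in> bumps r"
    using bumps_derivative by blast
  show "f differentiable (at x)" using f'(1) by (auto simp: differentiable_def)
  have "frechet_derivative f (at x) = f' x" for x using frechet_derivative_at[OF f'(1)[of x]] by simp
  then show "(\<lambda>x. frechet_derivative f (at x) h) \<in> bumps r" using f'(2) by simp
qed fact

lemma open_AE_imp_empty:
  fixes U :: "'a::euclidean_space set"
  assumes "open U" "AE x in lborel. x \<notin> U"
  shows "U = {}"
proof (rule ccontr)
  assume "U \<noteq> {}"
  then obtain x where "x \<in> U" by blast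
  then obtain e where e: "e > 0" "ball x e \<subseteq> U" using assms(1) by (auto elim: openE)
  have "AE y in lborel. y \<notin> ball x e" using assms(2) e(2) by (auto elim!: eventually_mono)
  then have "emeasure lborel (ball x e) = 0" by (subst (asm) AE_iff_measurable[of "ball x e"]) auto
  then show False using content_ball_pos[OF e(1), of x] by (simp add: measure_def)
qed

lemma mollifier_exists:
  assumes \<delta>: "\<delta> > 0"
  obtains \<phi> :: "'a::euclidean_space \<Rightarrow> real" where "mollifier \<delta> \<phi>" "\<And>k. C_k k \<phi>"
proof -
  define f where "f x = flat 0 (\<delta>\<^sup>2 - x \<bullet> x)" for x :: 'a
  have sc: "(\<lambda>x. c * f x) \<in> bumps (\<delta>\<^sup>2)" for c
    unfolding f_def by (intro bumps.base real_polynomial_function.intros(2))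
  have C: "C_k k (\<lambda>x. c * f x)" for k c by (rule bumps_C_k[OF sc])
  have cont: "continuous_on UNIV f" using C[of 0 1] by simp
  have pos: "0 < f x" if "norm x < \<delta>" for x
  proof -
    have "(norm x)\<^sup>2 < \<delta>\<^sup>2" using that by (intro power_strict_mono) auto
    then show ?thesis by (simp add: f_def flat_def dot_square_norm)
  qed
  have zero: "f x = 0" if "norm x \<ge> \<delta>" for x
  proof -
    have "\<delta>\<^sup>2 \<le> (norm x)\<^sup>2" using that \<delta> by (intro power_mono) auto
    then show ?thesis by (simp add: f_def flat_def dot_square_norm)
  qed
  have nonneg: "0 \<le> f x" for x by (simp add: f_def flat_def)
  have int: "integrable lborel f"
    by (rule continuous_compact_support_integrable[OF cont zero])
  define c where "c = (LINT x|lborel. f x)"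
  have "c \<noteq> 0"
  proof
    assume "c = 0"
    then have "AE x in lborel. f x = 0"
      using integral_nonneg_eq_0_iff_AE[OF int] nonneg by (simp add: c_def)
    then have "AE x in lborel. x \<notin> ball (0::'a) \<delta>" by eventually_elim (use pos in force)
    then show False using open_AE_imp_empty[of "ball (0::'a) \<delta>"] \<delta> by simp
  qed
  moreover have "0 \<le> c" unfolding c_def by (intro Bochner_Integration.integral_nonneg nonneg)
  ultimately have c: "c > 0" by simp
  show thesis
  proof (rule that[of "\<lambda>x. (1 / c) * f x"])
    show "mollifier \<delta> (\<lambda>x. (1 / c) * f x)"
      unfolding mollifier_def using c zero nonneg
      by (auto intro!: continuous_intros cont simp: c_def[symmetric])
  qed (rule C)
qed

subsection \<open>Smoothness of convolutions\<close>

definition smooth_in_ball :: "real \<Rightarrow> ('a::euclidean_space \<Rightarrow> real) set" where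
  "smooth_in_ball R = {\<phi>. (\<forall>k. C_k k \<phi>) \<and> (\<forall>y. norm y > R \<longrightarrow> \<phi> y = 0)}"

lemma smooth_in_ballD:
  assumes \<phi>: "\<phi> \<in> smooth_in_ball R"
  shows "(\<phi> has_derivative frechet_derivative \<phi> (at x)) (at x)" "continuous_on UNIV \<phi>"
    "(\<lambda>x. frechet_derivative \<phi> (at x) h) \<in> smooth_in_ball R"
proof -
  have C: "C_k k \<phi>" for k using \<phi> by (simp add: smooth_in_ball_def)
  show "(\<phi> has_derivative frechet_derivative \<phi> (at x)) (at x)"
    using C[of "Suc 0"] frechet_derivative_works by auto
  show "continuous_on UNIV \<phi>" using C[of 0] by simp
  have "frechet_derivative \<phi> (at y) h = 0" if y: "norm y > R" for y
  proof -
    have "((\<lambda>x. 0) has_derivative (\<lambda>h. 0)) (at y)" by simp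
    then have "(\<phi> has_derivative (\<lambda>h. 0)) (at y)"
    proof (rule has_derivative_transform_within_open)
      show "open (- cball 0 R)" "y \<in> - cball 0 R" using y by auto
      show "\<And>x. x \<in> - cball 0 R \<Longrightarrow> 0 = \<phi> x" using \<phi> by (auto simp: smooth_in_ball_def)
    qed
    then show ?thesis using frechet_derivative_at by metis
  qed
  moreover have "C_k k (\<lambda>x. frechet_derivative \<phi> (at x) h)" for k using C[of "Suc k"] by simp
  ultimately show "(\<lambda>x. frechet_derivative \<phi> (at x) h) \<in> smooth_in_ball R"
    by (simp add: smooth_in_ball_def)
qed

lemma smooth_in_ball_bounded:
  assumes "\<phi> \<in> smooth_in_ball R"
  obtains M where "\<And>y. \<bar>\<phi> y\<bar> \<le> M"
  using continuous_compact_support_bounded[of \<phi> "R + 1"] smooth_in_ballD(2)[OF assms] assms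
  by (auto simp: smooth_in_ball_def)

lemma smooth_derivative_bound:
  fixes \<phi> :: "'a::euclidean_space \<Rightarrow> real"
  assumes \<phi>: "\<phi> \<in> smooth_in_ball R"
  obtains M where "M \<ge> 0" "\<And>x h. \<bar>frechet_derivative \<phi> (at x) h\<bar> \<le> M * norm h"
proof -
  let ?D = "\<lambda>x. frechet_derivative \<phi> (at x)"
  have "\<exists>M. \<forall>x. \<bar>?D x b\<bar> \<le> M" for b
    using smooth_in_ball_bounded[OF smooth_in_ballD(3)[OF \<phi>, of b]] by metis
  then obtain M where M: "\<And>b x. \<bar>?D x b\<bar> \<le> M b" by metis
  have M0: "0 \<le> M b" for b using M[of 0 b] by linarith
  have "\<bar>?D x h\<bar> \<le> (\<Sum>b\<in>Basis. M b) * norm h" for x h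
  proof -
    interpret linear "?D x" using smooth_in_ballD(1)[OF \<phi>, of x] by (rule has_derivative_linear)
    have "?D x h = ?D x (\<Sum>b\<in>Basis. (h \<bullet> b) *\<^sub>R b)" by (simp add: euclidean_representation)
    also have "\<dots> = (\<Sum>b\<in>Basis. (h \<bullet> b) * ?D x b)" by (simp add: sum scaleR)
    also have "\<bar>\<dots>\<bar> \<le> (\<Sum>b\<in>Basis. \<bar>(h \<bullet> b) * ?D x b\<bar>)" by (rule sum_abs)
    also have "\<dots> \<le> (\<Sum>b\<in>Basis. norm h * M b)"
      unfolding abs_mult by (intro sum_mono mult_mono M Basis_le_norm) auto
    also have "\<dots> = norm h * (\<Sum>b\<in>Basis. M b)" by (rule sum_distrib_left[symmetric])
    also have "\<dots> = (\<Sum>b\<in>Basis. M b) * norm h" by (rule mult.commute)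
    finally show ?thesis .
  qed
  then show thesis by (rule that[rotated]) (intro sum_nonneg M0)
qed

lemma smooth_lipschitz:
  fixes \<phi> :: "'a::euclidean_space \<Rightarrow> real"
  assumes \<phi>: "\<phi> \<in> smooth_in_ball R"
  obtains M where "M-lipschitz_on UNIV \<phi>"
proof -
  obtain M where M: "M \<ge> 0" "\<And>x h. \<bar>frechet_derivative \<phi> (at x) h\<bar> \<le> M * norm h"
    using smooth_derivative_bound[OF \<phi>] by blast
  have "M-lipschitz_on UNIV \<phi>"
    using smooth_in_ballD(1)[OF \<phi>] M by (intro bounded_derivative_imp_lipschitz[where f' = "\<lambda>x. frechet_derivative \<phi> (at x)"]) (auto intro!: onorm_le)
  then show thesis by (rule that)
qed

text \<open>
  The derivative is itself Lipschitz, with a constant uniform in the direction, because the second derivatives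
  are continuous with compact support.
\<close>

lemma smooth_taylor:
  fixes \<phi> :: "'a::euclidean_space \<Rightarrow> real"
  assumes \<phi>: "\<phi> \<in> smooth_in_ball R"
  obtains L where "L \<ge> 0" "\<And>z h. \<bar>\<phi> (z + h) - \<phi> z - frechet_derivative \<phi> (at z) h\<bar> \<le> L * (norm h)\<^sup>2"
proof -
  let ?D = "\<lambda>x. frechet_derivative \<phi> (at x)"
  have "\<exists>L. L-lipschitz_on UNIV (\<lambda>x. ?D x b)" for b
    using smooth_lipschitz[OF smooth_in_ballD(3)[OF \<phi>, of b]] by metis
  then obtain L where L: "\<And>b. (L b)-lipschitz_on UNIV (\<lambda>x. ?D x b)" by metis
  define K where "K = (\<Sum>b\<in>Basis. L b)"
  have L0: "0 \<le> L b" for b using L[of b] by (rule lipschitz_on_nonneg)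
  then have K0: "0 \<le> K" unfolding K_def by (intro sum_nonneg) auto
  have lin: "linear (?D x)" for x using smooth_in_ballD(1)[OF \<phi>, of x] by (rule has_derivative_linear)
  have D: "\<bar>?D x h - ?D z h\<bar> \<le> K * norm (x - z) * norm h" for x z h
  proof -
    have ex: "?D x h = (\<Sum>b\<in>Basis. (h \<bullet> b) * ?D x b)" for x
    proof -
      interpret linear "?D x" by (rule lin)
      have "?D x h = ?D x (\<Sum>b\<in>Basis. (h \<bullet> b) *\<^sub>R b)" by (simp add: euclidean_representation)
      also have "\<dots> = (\<Sum>b\<in>Basis. (h \<bullet> b) * ?D x b)" by (simp add: sum scaleR)
      finally show ?thesis .
    qed
    have "\<bar>?D x h - ?D z h\<bar> = \<bar>\<Sum>b\<in>Basis. (h \<bullet> b) * (?D x b - ?D z b)\<bar>"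
      unfolding ex[of x] ex[of z] by (simp add: sum_subtractf[symmetric] algebra_simps)
    also have "\<dots> \<le> (\<Sum>b\<in>Basis. \<bar>(h \<bullet> b) * (?D x b - ?D z b)\<bar>)" by (rule sum_abs)
    also have "\<dots> \<le> (\<Sum>b\<in>Basis. norm h * (L b * norm (x - z)))"
      unfolding abs_mult
    proof (intro sum_mono mult_mono Basis_le_norm)
      fix b :: 'a
      show "\<bar>?D x b - ?D z b\<bar> \<le> L b * norm (x - z)"
        using lipschitz_onD[OF L[of b], of x z] by (simp add: dist_norm)
    qed auto
    finally show ?thesis by (simp add: K_def sum_distrib_left sum_distrib_right mult_ac)
  qed
  have "\<bar>\<phi> (z + h) - \<phi> z - ?D z h\<bar> \<le> K * (norm h)\<^sup>2" for z h
  proof -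
    have "norm (\<phi> (z + h) - \<phi> z - ?D z ((z + h) - z)) \<le> norm ((z + h) - z) * (K * norm h)"
    proof (rule differentiable_bound_linearization[where S = "cball z (norm h)" and f' = ?D and ?x0.0 = z])
      show "z + t *\<^sub>R (z + h - z) \<in> cball z (norm h)" if "t \<in> {0..1}" for t
        using that by (auto simp: dist_norm intro!: mult_left_le_one_le)
      show "(\<phi> has_derivative ?D x) (at x within cball z (norm h))" for x
        using smooth_in_ballD(1)[OF \<phi>, of x] by (rule has_derivative_at_withinI)
      show "onorm (?D x - ?D z) \<le> K * norm h" if "x \<in> cball z (norm h)" for x
        unfolding fun_diff_def
      proof (rule onorm_le)
        fix y
        have "\<bar>?D x y - ?D z y\<bar> \<le> K * norm (x - z) * norm y" by (rule D)
        also have "\<dots> \<le> K * norm h * norm y"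
          using that K0 by (intro mult_right_mono mult_left_mono) (auto simp: dist_norm norm_minus_commute)
        finally show "norm (?D x y - ?D z y) \<le> K * norm h * norm y" by simp
      qed
    qed auto
    then show ?thesis by (simp add: power2_eq_square mult_ac)
  qed
  with K0 show thesis by (rule that)
qed

lemma smooth_conv_integrable:
  fixes u :: "'a::euclidean_space \<Rightarrow> real"
  assumes \<phi>: "\<phi> \<in> smooth_in_ball R" and u: "integrable lborel u"
  shows "integrable lborel (\<lambda>y. \<phi> (x - y) * u y)"
proof -
  obtain M where M: "\<And>y. \<bar>\<phi> y\<bar> \<le> M" using smooth_in_ball_bounded[OF \<phi>] by blast
  have [measurable]: "\<phi> \<in> borel_measurable borel" by (intro borel_measurable_continuous_onI smooth_in_ballD[OF \<phi>])
  have [measurable]: "u \<in> borel_measurable borel" using u by (auto dest: borel_measurable_integrable)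
  have "integrable lborel (\<lambda>y. M * u y)" using u by simp
  then show ?thesis
  proof (rule Bochner_Integration.integrable_bound)
    show "AE y in lborel. norm (\<phi> (x - y) * u y) \<le> norm (M * u y)"
    proof (rule AE_I2)
      fix y
      have "\<bar>\<phi> (x - y)\<bar> \<le> \<bar>M\<bar>" using M[of "x - y"] by linarith
      then show "norm (\<phi> (x - y) * u y) \<le> norm (M * u y)" by (auto simp: abs_mult intro: mult_right_mono)
    qed
  qed measurable
qed

lemma conv_flip:
  fixes u :: "'a::euclidean_space \<Rightarrow> real"
  assumes [measurable]: "\<phi> \<in> borel_measurable borel" "u \<in> borel_measurable borel"
  shows "conv \<phi> u x = (LINT y|lborel. \<phi> (x - y) * u y)"
  unfolding conv_def by (subst integral_affine[of "\<lambda>y. \<phi> y * u (x - y)" "-1" x]) auto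

text \<open>
  Taylor's formula with a uniform quadratic remainder may be integrated against \<open>u\<close>.
\<close>

lemma conv_has_derivative:
  fixes u :: "'a::euclidean_space \<Rightarrow> real"
  assumes \<phi>: "\<phi> \<in> smooth_in_ball R" and u: "integrable lborel u"
  shows "(conv \<phi> u has_derivative (\<lambda>h. conv (\<lambda>z. frechet_derivative \<phi> (at z) h) u x)) (at x)"
proof -
  let ?D = "\<lambda>x. frechet_derivative \<phi> (at x)"
  have meas: "\<psi> \<in> borel_measurable borel" if "\<psi> \<in> smooth_in_ball R" for \<psi> :: "'a \<Rightarrow> real"
    by (intro borel_measurable_continuous_onI smooth_in_ballD[OF that])
  have um: "u \<in> borel_measurable borel" using u by (auto dest: borel_measurable_integrable)
  have cD: "conv (\<lambda>z. ?D z h) u x = (LINT y|lborel. ?D (x - y) h * u y)" for h x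
    by (intro conv_flip meas smooth_in_ballD(3)[OF \<phi>] um)
  have c: "conv \<phi> u x = (LINT y|lborel. \<phi> (x - y) * u y)" for x
    by (intro conv_flip meas \<phi> um)
  note i = smooth_conv_integrable[OF \<phi> u]
  note iD = smooth_conv_integrable[OF smooth_in_ballD(3)[OF \<phi>] u]
  have lin: "linear (?D z)" for z using smooth_in_ballD(1)[OF \<phi>, of z] by (rule has_derivative_linear)
  obtain M where M: "M \<ge> 0" "\<And>x h. \<bar>?D x h\<bar> \<le> M * norm h"
    using smooth_derivative_bound[OF \<phi>] by blast
  obtain L where L: "L \<ge> 0" "\<And>z h. \<bar>\<phi> (z + h) - \<phi> z - ?D z h\<bar> \<le> L * (norm h)\<^sup>2"
    using smooth_taylor[OF \<phi>] by blast
  define U where "U = (LINT y|lborel. \<bar>u y\<bar>)"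
  have ua: "integrable lborel (\<lambda>y. \<bar>u y\<bar>)" using u by simp
  have U0: "U \<ge> 0" by (simp add: U_def)
  show ?thesis
  proof (rule has_derivativeI_sandwich[where e = 1 and H = "\<lambda>y. L * U * norm (y - x)"])
    show "bounded_linear (\<lambda>h. conv (\<lambda>z. ?D z h) u x)"
    proof (rule bounded_linear_intro)
      fix h k :: 'a and r :: real
      show "conv (\<lambda>z. ?D z (h + k)) u x = conv (\<lambda>z. ?D z h) u x + conv (\<lambda>z. ?D z k) u x"
        unfolding cD using iD[of x h] iD[of x k]
        by (subst Bochner_Integration.integral_add[symmetric]) (auto simp: linear_add[OF lin] algebra_simps)
      show "conv (\<lambda>z. ?D z (r *\<^sub>R h)) u x = r *\<^sub>R conv (\<lambda>z. ?D z h) u x"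
        unfolding cD by (simp add: linear_scale[OF lin] mult.assoc)
      have "\<bar>LINT y|lborel. ?D (x - y) h * u y\<bar> \<le> (LINT y|lborel. (M * norm h) * \<bar>u y\<bar>)"
      proof (rule order_trans[OF integral_abs_bound integral_mono])
        show "integrable lborel (\<lambda>y. \<bar>?D (x - y) h * u y\<bar>)" using iD by simp
        show "integrable lborel (\<lambda>y. M * norm h * \<bar>u y\<bar>)" using ua by simp
        show "\<bar>?D (x - y) h * u y\<bar> \<le> M * norm h * \<bar>u y\<bar>" for y
          unfolding abs_mult by (intro mult_right_mono M) auto
      qed
      then show "norm (conv (\<lambda>z. ?D z h) u x) \<le> norm h * (M * U)"
        unfolding cD U_def by (simp add: mult_ac)
    qed
    show "norm (conv \<phi> u y - conv \<phi> u x - conv (\<lambda>z. ?D z (y - x)) u x) / norm (y - x) \<le> L * U * norm (y - x)" if "y \<noteq> x" for y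
    proof -
      define h where "h = y - x"
      have h: "h \<noteq> 0" "y = x + h" using that by (auto simp: h_def)
      have "conv \<phi> u y - conv \<phi> u x - conv (\<lambda>z. ?D z h) u x = (LINT w|lborel. \<phi> (y - w) * u w - \<phi> (x - w) * u w - ?D (x - w) h * u w)"
        unfolding c cD using i[of y] i[of x] iD[of x h] by simp
      also have "\<bar>\<dots>\<bar> \<le> (LINT w|lborel. L * (norm h)\<^sup>2 * \<bar>u w\<bar>)"
      proof (rule order_trans[OF integral_abs_bound integral_mono])
        show "integrable lborel (\<lambda>w. \<bar>\<phi> (y - w) * u w - \<phi> (x - w) * u w - ?D (x - w) h * u w\<bar>)"
          using i iD by (intro integrable_abs Bochner_Integration.integrable_diff)
        show "integrable lborel (\<lambda>w. L * (norm h)\<^sup>2 * \<bar>u w\<bar>)" using ua by simp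
        fix w
        have "\<bar>\<phi> (y - w) * u w - \<phi> (x - w) * u w - ?D (x - w) h * u w\<bar> = \<bar>\<phi> ((x - w) + h) - \<phi> (x - w) - ?D (x - w) h\<bar> * \<bar>u w\<bar>"
          unfolding abs_mult[symmetric] h(2) by (simp add: algebra_simps)
        also have "\<dots> \<le> L * (norm h)\<^sup>2 * \<bar>u w\<bar>" by (intro mult_right_mono L) auto
        finally show "\<bar>\<phi> (y - w) * u w - \<phi> (x - w) * u w - ?D (x - w) h * u w\<bar> \<le> L * (norm h)\<^sup>2 * \<bar>u w\<bar>" .
      qed
      also have "\<dots> = L * U * norm h * norm h" by (simp add: U_def power2_eq_square)
      finally show ?thesis using h by (simp add: h_def[symmetric] divide_le_eq)
    qed
    have "((\<lambda>y. L * U * norm (y - x)) \<longlongrightarrow> L * U * norm (x - x)) (at x)" by (intro tendsto_intros)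
    then show "((\<lambda>y. L * U * norm (y - x)) \<longlongrightarrow> 0) (at x)" by simp
  qed simp
qed

lemma conv_C_k:
  fixes u :: "'a::euclidean_space \<Rightarrow> real"
  assumes \<phi>: "\<phi> \<in> smooth_in_ball R" and u: "integrable lborel u"
  shows "C_k k (conv \<phi> u)"
proof (rule C_k_coinduct[where S = "{conv \<psi> u | \<psi>. \<psi> \<in> smooth_in_ball R}"])
  fix f :: "'a \<Rightarrow> real" and x h assume "f \<in> {conv \<psi> u | \<psi>. \<psi> \<in> smooth_in_ball R}"
  then obtain \<psi> where \<psi>: "\<psi> \<in> smooth_in_ball R" and f: "f = conv \<psi> u" by blast
  note d = conv_has_derivative[OF \<psi> u]
  show "f differentiable (at x)" unfolding f using d[of x] by (auto simp: differentiable_def)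
  have "(\<lambda>x. frechet_derivative f (at x) h) = conv (\<lambda>z. frechet_derivative \<psi> (at z) h) u"
    unfolding f frechet_derivative_at[OF d, symmetric] ..
  then show "(\<lambda>x. frechet_derivative f (at x) h) \<in> {conv \<psi> u | \<psi>. \<psi> \<in> smooth_in_ball R}"
    using smooth_in_ballD(3)[OF \<psi>] by blast
qed (use \<phi> in blast)

section \<open>The space of functions vanishing outside an open set\<close>

lemma ennreal_squeeze_zero:
  fixes f g :: "nat \<Rightarrow> ennreal"
  assumes "\<And>n. f n \<le> g n" "g \<longlonglongrightarrow> 0"
  shows "f \<longlonglongrightarrow> 0"
  by (rule tendsto_sandwich[OF _ _ tendsto_const assms(2)]) (auto intro: always_eventually assms(1))

lemma C_k_lincomb:
  assumes "\<And>k. C_k k f" "\<And>k. C_k k g"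
  shows "C_k k (\<lambda>x. a * f x + b * g x)"
proof (rule C_k_coinduct[where S = "{\<lambda>x. a * f x + b * g x | f g. (\<forall>k. C_k k f) \<and> (\<forall>k. C_k k g)}"])
  fix w x h assume "w \<in> {\<lambda>x. a * f x + b * g x | f g. (\<forall>k. C_k k f) \<and> (\<forall>k. C_k k g)}"
  then obtain f g where w: "w = (\<lambda>x. a * f x + b * g x)" and C: "\<And>k. C_k k f" "\<And>k. C_k k g"
    by blast
  have d: "(w has_derivative (\<lambda>h. a * frechet_derivative f (at x) h + b * frechet_derivative g (at x) h)) (at x)" for x
    unfolding w using C(1)[of "Suc 0"] C(2)[of "Suc 0"]
    by (intro has_derivative_add has_derivative_mult_right) (auto simp: frechet_derivative_works)
  then show "w differentiable (at x)" by (auto simp: differentiable_def)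
  have "(\<lambda>x. frechet_derivative w (at x) h) = (\<lambda>x. a * frechet_derivative f (at x) h + b * frechet_derivative g (at x) h)"
    unfolding frechet_derivative_at[OF d, symmetric] ..
  moreover have "C_k k (\<lambda>x. frechet_derivative f (at x) h)" "C_k k (\<lambda>x. frechet_derivative g (at x) h)" for k
    using C(1)[of "Suc k"] C(2)[of "Suc k"] by auto
  ultimately show "(\<lambda>x. frechet_derivative w (at x) h) \<in> {\<lambda>x. a * f x + b * g x | f g. (\<forall>k. C_k k f) \<and> (\<forall>k. C_k k g)}"
    unfolding mem_Collect_eq
    by (intro exI[of _ "\<lambda>x. frechet_derivative f (at x) h"] exI[of _ "\<lambda>x. frechet_derivative g (at x) h"]) blast
qed (use assms in blast)

lemma test_functions_smooth:
  assumes "\<phi> \<in> test_functions V"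
  obtains R where "R > 0" "\<phi> \<in> smooth_in_ball R"
proof -
  have "bounded (closure {x. \<phi> x \<noteq> 0})" using assms by (intro compact_imp_bounded) (simp add: test_functions_def)
  then obtain R where R: "R > 0" "\<And>x. x \<in> closure {x. \<phi> x \<noteq> 0} \<Longrightarrow> norm x \<le> R"
    by (metis bounded_pos)
  have "\<phi> y = 0" if "norm y > R" for y
    using R(2)[of y] that closure_subset[of "{x. \<phi> x \<noteq> 0}"] by (auto simp: not_le[symmetric])
  then show thesis using assms R(1) by (intro that[of R]) (auto simp: test_functions_def smooth_in_ball_def)
qed

lemma test_functions_zero: "\<phi> \<in> test_functions V \<Longrightarrow> x \<notin> V \<Longrightarrow> \<phi> x = 0"
  using closure_subset[of "{x. \<phi> x \<noteq> 0}"] by (auto simp: test_functions_def)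

lemma test_functions_mono: "V \<subseteq> W \<Longrightarrow> test_functions V \<subseteq> test_functions W"
  by (auto simp: test_functions_def)

lemma test_functions_HF:
  assumes \<alpha>: "0 < \<alpha>" "\<alpha> < 1" and "\<phi> \<in> test_functions V"
  shows "\<phi> \<in> HF \<alpha>"
proof -
  obtain R where R: "R > 0" "\<phi> \<in> smooth_in_ball R" using test_functions_smooth[OF assms(3)] by blast
  obtain L where L: "L-lipschitz_on UNIV \<phi>" using smooth_lipschitz[OF R(2)] by blast
  obtain M where M: "\<And>y. \<bar>\<phi> y\<bar> \<le> M" using smooth_in_ball_bounded[OF R(2)] by blast
  show ?thesis
    by (rule HF_lipschitz[OF \<alpha> L M, of "R + 1"]) (use R in \<open>auto simp: smooth_in_ball_def\<close>)
qed

lemma test_functions_lincomb: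
  assumes "\<phi> \<in> test_functions V" "\<psi> \<in> test_functions V"
  shows "(\<lambda>x. a * \<phi> x + b * \<psi> x) \<in> test_functions V"
proof -
  let ?A = "closure {x. \<phi> x \<noteq> 0} \<union> closure {x. \<psi> x \<noteq> 0}"
  have A: "compact ?A" "?A \<subseteq> V" using assms by (auto simp: test_functions_def)
  have "{x. a * \<phi> x + b * \<psi> x \<noteq> 0} \<subseteq> {x. \<phi> x \<noteq> 0} \<union> {x. \<psi> x \<noteq> 0}"
    by auto
  also have "\<dots> \<subseteq> ?A" by (intro Un_mono closure_subset)
  finally have "{x. a * \<phi> x + b * \<psi> x \<noteq> 0} \<subseteq> ?A" .
  then have c: "closure {x. a * \<phi> x + b * \<psi> x \<noteq> 0} \<subseteq> ?A"
    by (rule closure_minimal) (intro closed_Un closed_closure)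
  have "compact (closure {x. a * \<phi> x + b * \<psi> x \<noteq> 0})"
    using A(1) c by (meson closed_closure compact_closure bounded_subset compact_imp_bounded compact_eq_bounded_closed)
  then show ?thesis
    using A(2) c assms by (auto simp: test_functions_def intro!: C_k_lincomb)
qed

lemma zero_test_function: "(\<lambda>x. 0) \<in> test_functions V"
proof -
  have "C_k k (\<lambda>x::'a. 0)" for k
    by (rule C_k_coinduct[where S = "{\<lambda>x. 0}"]) (auto simp: frechet_derivative_const)
  then show ?thesis by (simp add: test_functions_def)
qed

lemma conv_test_function:
  fixes u :: "'a::euclidean_space \<Rightarrow> real"
  assumes \<phi>: "mollifier \<delta> \<phi>" "\<And>k. C_k k \<phi>" and u: "integrable lborel u" "AE y in lborel. y \<notin> K \<longrightarrow> u y = 0"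
    and K: "compact K" "(\<Union>x\<in>K. cball x \<delta>) \<subseteq> V"
  shows "conv \<phi> u \<in> test_functions V"
proof -
  have um: "u \<in> borel_measurable borel" using u(1) by (auto dest: borel_measurable_integrable)
  have "\<phi> \<in> smooth_in_ball \<delta>"
    using \<phi> by (auto simp: smooth_in_ball_def mollifier_def)
  then have C: "C_k k (conv \<phi> u)" for k using u(1) by (rule conv_C_k)
  let ?T = "{x + y | x y. x \<in> K \<and> y \<in> cball 0 \<delta>}"
  have T: "compact ?T" using K(1) by (intro compact_sums) auto
  have "{x. conv \<phi> u x \<noteq> 0} \<subseteq> ?T"
  proof
    fix x assume "x \<in> {x. conv \<phi> u x \<noteq> 0}"
    then have "\<not> (\<forall>z\<in>K. \<delta> \<le> norm (x - z))"
      using conv_support[OF \<phi>(1) u(2) um, of x] by auto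
    then obtain z where z: "z \<in> K" "norm (x - z) < \<delta>"
      by (auto simp: not_le)
    then have "x = z + (x - z)" "x - z \<in> cball 0 \<delta>" by auto
    with z(1) show "x \<in> ?T" by blast
  qed
  then have c: "closure {x. conv \<phi> u x \<noteq> 0} \<subseteq> ?T"
    using T by (intro closure_minimal compact_imp_closed)
  have "?T \<subseteq> V" using K(2) by (fastforce simp: dist_norm)
  moreover have "compact (closure {x. conv \<phi> u x \<noteq> 0})"
    using T c by (meson bounded_closure bounded_subset closed_closure closure_subset compact_eq_bounded_closed)
  ultimately show ?thesis using C c by (auto simp: test_functions_def)
qed

lemma L2_on_L2: "u \<in> L2_on V \<Longrightarrow> u \<in> L2_space"
  by (simp add: L2_on_def)

lemma L2_on_lincomb:
  assumes "u \<in> L2_on V" "v \<in> L2_on V"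
  shows "(\<lambda>x. a * u x + b * v x) \<in> L2_on V"
  using assms L2_space_lincomb[of u v a b] by (auto simp: L2_on_def elim: eventually_elim2)

lemma L2_on_diff: "u \<in> L2_on V \<Longrightarrow> v \<in> L2_on V \<Longrightarrow> (\<lambda>x. u x - v x) \<in> L2_on V"
  using L2_on_lincomb[of u V v 1 "-1"] by simp

lemma L2_on_limit:
  fixes u :: "'a::euclidean_space \<Rightarrow> real"
  assumes V: "open V" and f: "\<And>n. f n \<in> L2_on V" and u: "u \<in> L2_space" and lim: "(\<lambda>n. l2sq (\<lambda>x. f n x - u x)) \<longlonglongrightarrow> 0"
  shows "u \<in> L2_on V"
proof -
  have [measurable]: "u \<in> borel_measurable borel" "V \<in> sets borel" using u V by (auto intro: L2_spaceD)
  have "l2sq (\<lambda>x. indicator (- V) x * u x) \<le> l2sq (\<lambda>x. f n x - u x)" for n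
  proof (rule l2sq_mono_AE)
    have "AE x in lborel. x \<notin> V \<longrightarrow> f n x = 0" using f[of n] by (simp add: L2_on_def)
    then show "AE x in lborel. norm (indicator (- V) x * u x) \<le> norm (f n x - u x)"
      by eventually_elim (auto simp: indicator_def)
  qed
  then have "l2sq (\<lambda>x. indicator (- V) x * u x) \<le> 0"
    by (intro LIMSEQ_le_const[OF lim]) auto
  then have "AE x in lborel. indicator (- V) x * u x = 0"
    by (subst l2sq_eq_0_iff[symmetric]) auto
  then show ?thesis using u by (auto simp: L2_on_def indicator_def elim!: eventually_mono split: if_splits)
qed

context
  fixes \<alpha> :: real and V :: "'a::euclidean_space set"
  assumes \<alpha>: "0 < \<alpha>" "\<alpha> < 1" and V: "open V" "bounded V"
begin

lemma test_functions_L2_on: "\<phi> \<in> test_functions V \<Longrightarrow> \<phi> \<in> L2_on V"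
  using test_functions_HF[OF \<alpha>, of \<phi> V] test_functions_zero[of \<phi> V]
  by (auto simp: L2_on_def intro: L2_bd_L2 HF_L2_bd)

text \<open>
  On a bounded open set the real-valued norm can be replaced by \<open>Hn\<close>, and convergence of a sequence of test functions by
  approximability. The first conjunct holds since each test function is supported in \<open>V\<close>.
\<close>

lemma H0_iff:
  "u \<in> H0_frac \<alpha> V \<longleftrightarrow> u \<in> L2_on V \<and> u \<in> HF \<alpha> \<and> (\<forall>e>0. \<exists>\<phi>\<in>test_functions V. Hn \<alpha> (\<lambda>x. u x - \<phi> x) < ennreal e)"
proof
  assume u: "u \<in> H0_frac \<alpha> V"
  then obtain \<phi> where \<phi>: "\<And>n. \<phi> n \<in> test_functions V" "(\<lambda>n. H_frac_normsq \<alpha> (\<lambda>x. u x - \<phi> n x)) \<longlonglongrightarrow> 0" "u \<in> H_frac \<alpha>"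
    by (auto simp: H0_frac_def)
  have u2: "u \<in> L2_space" using \<phi>(3) by (simp add: H_frac_def)
  have \<phi>V: "\<phi> n \<in> L2_on V" for n by (rule test_functions_L2_on[OF \<phi>(1)])
  have "l2sq (\<lambda>x. \<phi> n x - u x) \<le> ennreal (H_frac_normsq \<alpha> (\<lambda>x. u x - \<phi> n x))" for n
    using H_frac_normsq_ge[of "\<lambda>x. u x - \<phi> n x" \<alpha>] integral_square_eq_l2sq(1)[OF L2_space_diff[OF u2 L2_on_L2[OF \<phi>V[of n]]]]
    by (simp add: l2sq_minus[of "\<phi> n" u])
  moreover have "(\<lambda>n. ennreal (H_frac_normsq \<alpha> (\<lambda>x. u x - \<phi> n x))) \<longlonglongrightarrow> 0"
    using tendsto_ennrealI[OF \<phi>(2)] by simp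
  ultimately have "(\<lambda>n. l2sq (\<lambda>x. \<phi> n x - u x)) \<longlonglongrightarrow> 0"
    by (rule ennreal_squeeze_zero)
  then have uV: "u \<in> L2_on V" by (rule L2_on_limit[OF V(1) \<phi>V u2])
  then have uH: "u \<in> HF \<alpha>" using \<phi>(3) by (simp add: HF_iff_H_frac[OF L2_on_bd[OF V(2)]])
  have "\<exists>\<phi>\<in>test_functions V. Hn \<alpha> (\<lambda>x. u x - \<phi> x) < ennreal e" if e: "e > 0" for e
  proof -
    obtain n where n: "H_frac_normsq \<alpha> (\<lambda>x. u x - \<phi> n x) < e"
      using order_tendstoD(2)[OF \<phi>(2) e] by (auto simp: eventually_sequentially)
    have "Hn \<alpha> (\<lambda>x. u x - \<phi> n x) = ennreal (H_frac_normsq \<alpha> (\<lambda>x. u x - \<phi> n x))"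
      by (intro H_frac_normsq_eq(1)[symmetric] HF_diff[OF \<alpha>] uH test_functions_HF[OF \<alpha> \<phi>(1)])
    also have "\<dots> < ennreal e" using n e by (simp add: ennreal_lessI)
    finally show ?thesis using \<phi>(1) by blast
  qed
  with uV uH show "u \<in> L2_on V \<and> u \<in> HF \<alpha> \<and> (\<forall>e>0. \<exists>\<phi>\<in>test_functions V. Hn \<alpha> (\<lambda>x. u x - \<phi> x) < ennreal e)"
    by blast
next
  assume *: "u \<in> L2_on V \<and> u \<in> HF \<alpha> \<and> (\<forall>e>0. \<exists>\<phi>\<in>test_functions V. Hn \<alpha> (\<lambda>x. u x - \<phi> x) < ennreal e)"
  then have uV: "u \<in> L2_on V" and uH: "u \<in> HF \<alpha>" by auto
  have "\<forall>n. \<exists>\<phi>. \<phi> \<in> test_functions V \<and> Hn \<alpha> (\<lambda>x. u x - \<phi> x) < ennreal (1 / real (Suc n))"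
  proof
    fix n
    have "1 / real (Suc n) > 0" by simp
    then show "\<exists>\<phi>. \<phi> \<in> test_functions V \<and> Hn \<alpha> (\<lambda>x. u x - \<phi> x) < ennreal (1 / real (Suc n))"
      using * by blast
  qed
  then obtain \<phi> where \<phi>: "\<And>n. \<phi> n \<in> test_functions V" "\<And>n. Hn \<alpha> (\<lambda>x. u x - \<phi> n x) < ennreal (1 / real (Suc n))"
    by metis
  have le: "0 \<le> H_frac_normsq \<alpha> (\<lambda>x. u x - \<phi> n x) \<and> H_frac_normsq \<alpha> (\<lambda>x. u x - \<phi> n x) \<le> 1 / real (Suc n)" for n
  proof -
    have H: "(\<lambda>x. u x - \<phi> n x) \<in> HF \<alpha>" by (intro HF_diff[OF \<alpha>] uH test_functions_HF[OF \<alpha> \<phi>(1)])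
    show ?thesis
      using \<phi>(2)[of n] enn2real_mono[of "Hn \<alpha> (\<lambda>x. u x - \<phi> n x)" "ennreal (1 / real (Suc n))"]
      unfolding H_frac_normsq_eq(3)[OF H] by (simp del: of_nat_Suc)
  qed
  have "(\<lambda>n. H_frac_normsq \<alpha> (\<lambda>x. u x - \<phi> n x)) \<longlonglongrightarrow> 0"
    by (rule tendsto_sandwich[OF _ _ tendsto_const LIMSEQ_Suc[OF lim_1_over_n]]) (use le in auto)
  moreover have "u \<in> H_frac \<alpha>" using uH by (simp add: HF_iff_H_frac[OF L2_on_bd[OF V(2) uV], symmetric])
  ultimately show "u \<in> H0_frac \<alpha> V" using \<phi>(1) by (auto simp: H0_frac_def)
qed

lemma H0_D: "u \<in> H0_frac \<alpha> V \<Longrightarrow> u \<in> L2_on V" "u \<in> H0_frac \<alpha> V \<Longrightarrow> u \<in> HF \<alpha>"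
  by (auto simp: H0_iff)

lemma test_functions_H0: "\<phi> \<in> test_functions V \<Longrightarrow> \<phi> \<in> H0_frac \<alpha> V"
  unfolding H0_iff
  by (intro conjI allI impI bexI[of _ \<phi>]) (auto simp: test_functions_L2_on test_functions_HF[OF \<alpha>] Hn_def energy_def fourier_L1_def)

lemma H0_zero: "(\<lambda>x. 0) \<in> H0_frac \<alpha> V"
  by (intro test_functions_H0 zero_test_function)

lemma Hn_lincomb_le:
  assumes "u \<in> HF \<alpha>" "v \<in> (HF \<alpha> :: ('a \<Rightarrow> real) set)"
  shows "Hn \<alpha> (\<lambda>x. a * u x + b * v x) \<le> 2 * (ennreal (a\<^sup>2) * Hn \<alpha> u) + 2 * (ennreal (b\<^sup>2) * Hn \<alpha> v)"
proof -
  have [measurable]: "u \<in> borel_measurable borel" "v \<in> borel_measurable borel"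
    using assms by (auto intro!: L2_spaceD L2_bd_L2 HF_L2_bd)
  have "l2sq (\<lambda>x. a * u x + b * v x) \<le> 2 * (ennreal (a\<^sup>2) * l2sq u) + 2 * (ennreal (b\<^sup>2) * l2sq v)"
    using l2sq_add_le[of "\<lambda>x. a * u x" "\<lambda>x. b * v x"] by (simp add: l2sq_cmult)
  then have "Hn \<alpha> (\<lambda>x. a * u x + b * v x)
    \<le> (2 * (ennreal (a\<^sup>2) * energy \<alpha> u) + 2 * (ennreal (b\<^sup>2) * energy \<alpha> v)) + (2 * (ennreal (a\<^sup>2) * l2sq u) + 2 * (ennreal (b\<^sup>2) * l2sq v))"
    unfolding Hn_def using energy_lincomb_le[OF HF_L2_bd[OF assms(1)] HF_L2_bd[OF assms(2)]] by (intro add_mono)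
  then show ?thesis by (simp add: Hn_def distrib_left ac_simps)
qed

lemma H0_lincomb:
  assumes u: "u \<in> H0_frac \<alpha> V" and v: "v \<in> H0_frac \<alpha> V"
  shows "(\<lambda>x. a * u x + b * v x) \<in> H0_frac \<alpha> V"
  unfolding H0_iff
proof (intro conjI allI impI)
  show "(\<lambda>x. a * u x + b * v x) \<in> L2_on V" "(\<lambda>x. a * u x + b * v x) \<in> HF \<alpha>"
    using H0_D[OF u] H0_D[OF v] by (auto intro: L2_on_lincomb HF_lincomb)
  fix e :: real assume e: "e > 0"
  define t where "t = e / (4 * (a\<^sup>2 + b\<^sup>2 + 1))"
  have ab: "a\<^sup>2 + b\<^sup>2 + 1 > 0" by (intro add_nonneg_pos add_nonneg_nonneg) auto
  have t: "t > 0" using e ab by (simp add: t_def)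
  obtain \<phi> where \<phi>: "\<phi> \<in> test_functions V" "Hn \<alpha> (\<lambda>x. u x - \<phi> x) < ennreal t" using u t by (auto simp: H0_iff)
  obtain \<psi> where \<psi>: "\<psi> \<in> test_functions V" "Hn \<alpha> (\<lambda>x. v x - \<psi> x) < ennreal t" using v t by (auto simp: H0_iff)
  have "Hn \<alpha> (\<lambda>x. a * u x + b * v x - (a * \<phi> x + b * \<psi> x)) = Hn \<alpha> (\<lambda>x. a * (u x - \<phi> x) + b * (v x - \<psi> x))"
    by (simp add: algebra_simps)
  also have "\<dots> \<le> 2 * (ennreal (a\<^sup>2) * Hn \<alpha> (\<lambda>x. u x - \<phi> x)) + 2 * (ennreal (b\<^sup>2) * Hn \<alpha> (\<lambda>x. v x - \<psi> x))"
    by (rule Hn_lincomb_le[OF HF_diff[OF \<alpha> H0_D(2)[OF u] test_functions_HF[OF \<alpha> \<phi>(1)]]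
          HF_diff[OF \<alpha> H0_D(2)[OF v] test_functions_HF[OF \<alpha> \<psi>(1)]]])
  also have "\<dots> \<le> 2 * (ennreal (a\<^sup>2) * ennreal t) + 2 * (ennreal (b\<^sup>2) * ennreal t)"
    using \<phi>(2) \<psi>(2) by (intro add_mono mult_left_mono) auto
  also have "\<dots> = ennreal (2 * (a\<^sup>2 * t) + 2 * (b\<^sup>2 * t))"
    using t by (simp add: ennreal_mult)
  also have "\<dots> < ennreal e"
  proof (rule ennreal_lessI[OF e])
    have "2 * (a\<^sup>2 * t) + 2 * (b\<^sup>2 * t) < 4 * (a\<^sup>2 + b\<^sup>2 + 1) * t"
      using t ab zero_le_power2[of a] zero_le_power2[of b] by (simp add: algebra_simps add_pos_nonneg)
    also have "\<dots> = e" using ab by (simp add: t_def)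
    finally show "2 * (a\<^sup>2 * t) + 2 * (b\<^sup>2 * t) < e" .
  qed
  finally have "Hn \<alpha> (\<lambda>x. a * u x + b * v x - (a * \<phi> x + b * \<psi> x)) < ennreal e" .
  then show "\<exists>\<phi>\<in>test_functions V. Hn \<alpha> (\<lambda>x. a * u x + b * v x - \<phi> x) < ennreal e"
    using test_functions_lincomb[OF \<phi>(1) \<psi>(1)] by (rule bexI)
qed

lemma H0_closed:
  assumes u: "u \<in> L2_on V" "u \<in> HF \<alpha>"
    and ap: "\<And>e. e > 0 \<Longrightarrow> \<exists>w\<in>H0_frac \<alpha> V. Hn \<alpha> (\<lambda>x. u x - w x) < ennreal e"
  shows "u \<in> H0_frac \<alpha> V"
  unfolding H0_iff
proof (intro conjI allI impI u)
  fix e :: real assume e: "e > 0"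
  then have e4: "e / 4 > 0" by simp
  obtain w where w: "w \<in> H0_frac \<alpha> V" "Hn \<alpha> (\<lambda>x. u x - w x) < ennreal (e / 4)" using ap[OF e4] by blast
  obtain \<phi> where \<phi>: "\<phi> \<in> test_functions V" "Hn \<alpha> (\<lambda>x. w x - \<phi> x) < ennreal (e / 4)" using w(1) e4 unfolding H0_iff by blast
  have "Hn \<alpha> (\<lambda>x. u x - \<phi> x) \<le> 2 * Hn \<alpha> (\<lambda>x. u x - w x) + 2 * Hn \<alpha> (\<lambda>x. w x - \<phi> x)"
    by (intro Hn_triangle HF_L2_bd[of _ \<alpha>] u H0_D w test_functions_HF[OF \<alpha> \<phi>(1)])
  also have "\<dots> < 2 * ennreal (e / 4) + 2 * ennreal (e / 4)"
    using w(2) \<phi>(2) by (intro add_strict_mono ennreal_mult_strict_left_mono) auto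
  also have "\<dots> = ennreal e"
    using e by (simp add: ennreal_plus[symmetric] ennreal_mult'[symmetric] flip: ennreal_numeral)
  finally show "\<exists>\<phi>\<in>test_functions V. Hn \<alpha> (\<lambda>x. u x - \<phi> x) < ennreal e" using \<phi>(1) by blast
qed

lemma H0_cong_AE:
  assumes u: "u \<in> H0_frac \<alpha> V" and eq: "AE x in lborel. u x = v x" and v: "v \<in> borel_measurable borel"
  shows "v \<in> H0_frac \<alpha> V"
proof -
  have um: "u \<in> borel_measurable borel" using H0_D(1)[OF u] by (intro L2_spaceD L2_on_L2)
  have l: "v \<in> L2_space"
    by (rule L2_space_dominated[OF L2_on_L2[OF H0_D(1)[OF u]] v]) (use eq in \<open>auto elim: eventually_mono\<close>)
  have vV: "v \<in> L2_on V" using H0_D(1)[OF u] l eq by (auto simp: L2_on_def elim: eventually_elim2)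
  have vH: "v \<in> HF \<alpha>"
    using H0_D(2)[OF u] energy_cong_AE[OF eq um v, of \<alpha>] L2_on_bd[OF V(2) vV] by (simp add: HF_def)
  have z: "Hn \<alpha> (\<lambda>x. v x - u x) = 0"
  proof -
    note um[measurable] v[measurable]
    have 0: "AE x in lborel. v x - u x = 0" using eq by eventually_elim simp
    have "energy \<alpha> (\<lambda>x. v x - u x) = energy \<alpha> (\<lambda>x::'a. 0 :: real)"
      by (rule energy_cong_AE[OF 0]) measurable
    moreover have "l2sq (\<lambda>x. v x - u x) = l2sq (\<lambda>x::'a. 0 :: real)"
      by (rule l2sq_cong_AE[OF 0])
    ultimately show ?thesis by (simp add: Hn_def energy_def fourier_L1_def)
  qed
  show ?thesis
  proof (rule H0_closed[OF vV vH])
    fix e :: real assume "e > 0"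
    then show "\<exists>w\<in>H0_frac \<alpha> V. Hn \<alpha> (\<lambda>x. v x - w x) < ennreal e"
      using u z by (intro bexI[of _ u]) auto
  qed
qed

text \<open>Density of the test functions: exhaust by compact sets and mollify.\<close>

lemma test_functions_dense:
  assumes u: "u \<in> L2_on V" and e: "e > 0"
  obtains \<phi> where "\<phi> \<in> test_functions V" "l2sq (\<lambda>x. u x - \<phi> x) < ennreal e"
proof -
  have u2: "u \<in> L2_space" by (rule L2_on_L2[OF u])
  have [measurable]: "u \<in> borel_measurable borel" by (rule L2_spaceD[OF u2])
  obtain C where C: "\<And>n. compact (C n)" "\<And>n. C n \<subseteq> V" "\<Union>(range C) = V" "\<And>n. C n \<subseteq> interior (C (Suc n))"
    using open_Union_compact_subsets[OF V(1)] by metis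
  have mono: "incseq C" using C(4) interior_subset by (intro incseq_SucI) blast
  have [measurable]: "C n \<in> sets borel" for n using C(1) by (simp add: compact_imp_closed borel_closed)
  define v where "v n x = indicator (C n) x * u x" for n x
  have [measurable]: "v n \<in> borel_measurable borel" for n unfolding v_def by measurable
  have "(\<lambda>n. l2sq (\<lambda>x. v n x - u x)) \<longlonglongrightarrow> 0"
  proof (rule l2sq_dominated[where w = u])
    show "AE x in lborel. norm (v n x - u x) \<le> norm (u x)" for n by (auto simp: v_def indicator_def)
    show "AE x in lborel. (\<lambda>n. v n x - u x) \<longlonglongrightarrow> 0"
    proof -
      have "AE x in lborel. x \<notin> V \<longrightarrow> u x = 0" using u by (simp add: L2_on_def)
      then show ?thesis
      proof eventually_elim
        case (elim x)
        show ?case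
        proof (cases "x \<in> V")
          case True
          then obtain m where "x \<in> C m" using C(3) by auto
          then have "\<forall>n\<ge>m. v n x - u x = 0" using mono by (auto simp: v_def indicator_def dest: incseqD)
          then show ?thesis by (intro tendsto_eventually) (auto simp: eventually_sequentially)
        qed (use elim in \<open>simp add: v_def\<close>)
      qed
    qed
  qed (use L2_spaceD(2)[OF u2] in auto)
  then obtain n where n: "l2sq (\<lambda>x. v n x - u x) < ennreal (e / 8)"
    using order_tendstoD(2)[of _ 0 sequentially "ennreal (e / 8)"] e by (auto simp: eventually_sequentially)
  have v2: "v n \<in> L2_space" by (rule L2_space_dominated[OF u2]) (auto simp: v_def indicator_def)
  have vbd: "v n \<in> L2_bd"
    by (rule L2_bd_dominated[OF L2_on_bd[OF V(2) u]]) (auto simp: v_def indicator_def)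
  obtain d where d: "d > 0" "\<And>y. norm y < d \<Longrightarrow> l2sq (\<lambda>x. v n (x + y) - v n x) < ennreal (e / 8)"
  proof (rule tendsto_zero_imp_small[of "\<lambda>y. l2sq (\<lambda>x. v n (x + y) - v n x)" "ennreal (e / 8)"])
    show "(\<lambda>k. l2sq (\<lambda>x. v n (x + y k) - v n x)) \<longlonglongrightarrow> 0" if "y \<longlonglongrightarrow> 0" for y
      by (rule L2_translate_continuous[OF v2 that])
  qed (use e in auto)
  obtain r where r: "r > 0" "(\<Union>x\<in>C n. cball x r) \<subseteq> V"
    using compact_subset_open_imp_cball_epsilon_subset[OF C(1) V(1) C(2)] by blast
  define \<delta> where "\<delta> = min d r"
  have \<delta>: "\<delta> > 0" using d r by (simp add: \<delta>_def)
  obtain \<phi> :: "'a \<Rightarrow> real" where \<phi>: "mollifier \<delta> \<phi>" "\<And>k. C_k k \<phi>" using mollifier_exists[OF \<delta>] by blast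
  have "(\<Union>x\<in>C n. cball x \<delta>) \<subseteq> V" using r(2) by (fastforce simp: \<delta>_def)
  then have t: "conv \<phi> (v n) \<in> test_functions V"
    by (intro conv_test_function[OF \<phi> L2_bd_integrable[OF vbd] _ C(1)[of n]]) (auto simp: v_def)
  have [measurable]: "\<phi> \<in> borel_measurable borel" by (rule mollifierD[OF \<phi>(1)])
  have "l2sq (\<lambda>x. conv \<phi> (v n) x - v n x) \<le> ennreal (e / 8)"
    by (rule l2sq_conv_diff_small[OF \<phi>(1) L2_bd_integrable[OF vbd]]) (use d(2) in \<open>auto simp: \<delta>_def intro: less_imp_le\<close>)
  then have "l2sq (\<lambda>x. v n x - conv \<phi> (v n) x) \<le> ennreal (e / 8)" "l2sq (\<lambda>x. u x - v n x) \<le> ennreal (e / 8)"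
    using n by (auto simp: l2sq_minus[of u] l2sq_minus[of "v n" "conv \<phi> (v n)"])
  then have "2 * l2sq (\<lambda>x. u x - v n x) + 2 * l2sq (\<lambda>x. v n x - conv \<phi> (v n) x) \<le> 2 * ennreal (e / 8) + 2 * ennreal (e / 8)"
    by (intro add_mono mult_left_mono) auto
  then have "l2sq (\<lambda>x. u x - conv \<phi> (v n) x) \<le> 2 * ennreal (e / 8) + 2 * ennreal (e / 8)"
    by (intro order_trans[OF l2sq_triangle[of u "v n" "conv \<phi> (v n)"]]) auto
  also have "\<dots> = ennreal (e / 2)"
    using e by (simp add: ennreal_plus[symmetric] ennreal_mult'[symmetric] flip: ennreal_numeral)
  also have "\<dots> < ennreal e" using e by (intro ennreal_lessI) auto
  finally show thesis using t by (rule that[rotated])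
qed

text \<open>
  An \<open>L\<^sup>2\<close>-limit exists by completeness of \<open>L\<^sup>2\<close>; lower semicontinuity of the energy makes it a limit in energy.
\<close>

lemma H0_complete:
  assumes w: "\<And>n. w n \<in> H0_frac \<alpha> V"
    and cauchy: "\<And>e. e > 0 \<Longrightarrow> \<exists>N. \<forall>m\<ge>N. \<forall>n\<ge>N. Hn \<alpha> (\<lambda>x. w m x - w n x) < ennreal e"
  obtains u where "u \<in> H0_frac \<alpha> V" "(\<lambda>n. Hn \<alpha> (\<lambda>x. w n x - u x)) \<longlonglongrightarrow> 0"
proof -
  obtain R where R: "V \<subseteq> ball 0 R" using bounded_subset_ballD[OF V(2), of 0] by auto
  have wV: "w n \<in> L2_on V" for n by (rule H0_D[OF w])
  obtain u where u: "u \<in> L2_space" and lim: "(\<lambda>n. l2sq (\<lambda>x. w n x - u x)) \<longlonglongrightarrow> 0"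
  proof (rule L2_complete[of w R])
    show "w n \<in> L2_space" for n by (rule L2_on_L2[OF wV])
    show "AE x in lborel. x \<notin> ball 0 R \<longrightarrow> w n x = 0" for n
      using wV[of n] R by (auto simp: L2_on_def elim!: eventually_mono)
    fix e :: real assume "e > 0"
    then obtain N where "\<forall>m\<ge>N. \<forall>n\<ge>N. Hn \<alpha> (\<lambda>x. w m x - w n x) < ennreal e" using cauchy by blast
    moreover have "l2sq (\<lambda>x. w m x - w n x) \<le> Hn \<alpha> (\<lambda>x. w m x - w n x)" for m n by (simp add: Hn_def)
    ultimately show "\<exists>N. \<forall>m\<ge>N. \<forall>n\<ge>N. l2sq (\<lambda>x. w m x - w n x) < ennreal e" by (meson order_le_less_trans)
  qed
  have uV: "u \<in> L2_on V" by (rule L2_on_limit[OF V(1) wV u lim])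
  have en: "energy \<alpha> (\<lambda>x. w n x - u x) \<le> ennreal e"
    if N: "\<forall>m\<ge>N. \<forall>n\<ge>N. Hn \<alpha> (\<lambda>x. w m x - w n x) < ennreal e" and n: "n \<ge> N" for n N e
  proof (rule energy_lower_semicontinuous[OF \<alpha>, where f = "\<lambda>m x. w n x - w (m + N) x" and a = "\<lambda>m. ennreal e"])
    show "(\<lambda>x. w n x - w (m + N) x) \<in> L2_bd" for m by (intro L2_bd_diff L2_on_bd[OF V(2)] wV)
    show "(\<lambda>x. w n x - u x) \<in> L2_bd" by (intro L2_bd_diff L2_on_bd[OF V(2)] wV uV)
    have "l2sq (\<lambda>x. (w n x - w (m + N) x) - (w n x - u x)) = l2sq (\<lambda>x. w (m + N) x - u x)" for m
      by (subst l2sq_minus) simp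
    then show "(\<lambda>m. l2sq (\<lambda>x. (w n x - w (m + N) x) - (w n x - u x))) \<longlonglongrightarrow> 0"
      using LIMSEQ_ignore_initial_segment[OF lim, of N] by simp
    show "energy \<alpha> (\<lambda>x. w n x - w (m + N) x) \<le> ennreal e" for m
    proof -
      have "energy \<alpha> (\<lambda>x. w n x - w (m + N) x) \<le> Hn \<alpha> (\<lambda>x. w n x - w (m + N) x)" by (simp add: Hn_def)
      also have "\<dots> < ennreal e" using N n by auto
      finally show ?thesis by simp
    qed
  qed simp
  have "(\<lambda>n. energy \<alpha> (\<lambda>x. w n x - u x)) \<longlonglongrightarrow> 0"
  proof (rule order_tendstoI)
    fix a :: ennreal assume "0 < a"
    then obtain e where e: "0 < e" "ennreal e < a" by (rule ennreal_dense_pos)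
    then obtain N where "\<forall>m\<ge>N. \<forall>n\<ge>N. Hn \<alpha> (\<lambda>x. w m x - w n x) < ennreal e" using cauchy by blast
    then have "\<forall>n\<ge>N. energy \<alpha> (\<lambda>x. w n x - u x) < a" using en e(2) by (meson order_le_less_trans)
    then show "\<forall>\<^sub>F n in sequentially. energy \<alpha> (\<lambda>x. w n x - u x) < a" by (auto simp: eventually_sequentially)
  qed simp
  then have conv: "(\<lambda>n. Hn \<alpha> (\<lambda>x. w n x - u x)) \<longlonglongrightarrow> 0"
    unfolding Hn_def using tendsto_add[OF _ lim] by fastforce
  have uH: "u \<in> HF \<alpha>"
  proof -
    obtain N where N: "\<forall>m\<ge>N. \<forall>n\<ge>N. Hn \<alpha> (\<lambda>x. w m x - w n x) < ennreal 1" using cauchy[of 1] by auto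
    have "energy \<alpha> (\<lambda>x. w N x - u x) < \<infinity>" using en[OF N, of N] by (auto simp: less_top[symmetric] top_unique)
    then have "(\<lambda>x. w N x - u x) \<in> HF \<alpha>"
      by (simp add: HF_def L2_bd_diff L2_on_bd[OF V(2)] wV uV)
    from HF_diff[OF \<alpha> H0_D(2)[OF w[of N]] this] show ?thesis by simp
  qed
  have "u \<in> H0_frac \<alpha> V"
  proof (rule H0_closed[OF uV uH])
    fix e :: real assume e: "e > 0"
    then obtain n where n: "Hn \<alpha> (\<lambda>x. w n x - u x) < ennreal e"
      using order_tendstoD(2)[OF conv, of "ennreal e"] by (auto simp: eventually_sequentially)
    have "Hn \<alpha> (\<lambda>x. u x - w n x) = Hn \<alpha> (\<lambda>x. w n x - u x)"
    proof (rule antisym)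
      have d: "(\<lambda>x. w n x - u x) \<in> HF \<alpha>" "(\<lambda>x. u x - w n x) \<in> HF \<alpha>" by (intro HF_diff[OF \<alpha>] uH H0_D[OF w])+
      have sym: "energy \<alpha> (\<lambda>x. u x - w n x) = energy \<alpha> (\<lambda>x. w n x - u x)"
      proof -
        have "fourier_L1 (\<lambda>x. u x - w n x) \<xi> = - fourier_L1 (\<lambda>x. w n x - u x) \<xi>" for \<xi>
          by (simp add: fourier_L1_diff L2_bd_integrable HF_L2_bd[of _ \<alpha>] uH H0_D(2)[OF w])
        then show ?thesis by (simp add: energy_def)
      qed
      then show "Hn \<alpha> (\<lambda>x. u x - w n x) \<le> Hn \<alpha> (\<lambda>x. w n x - u x)" "Hn \<alpha> (\<lambda>x. w n x - u x) \<le> Hn \<alpha> (\<lambda>x. u x - w n x)"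
        by (simp_all add: Hn_def l2sq_minus[of u])
    qed
    with n show "\<exists>w\<in>H0_frac \<alpha> V. Hn \<alpha> (\<lambda>x. u x - w x) < ennreal e"
      by (intro bexI[OF _ w[of n]]) simp
  qed
  then show thesis using conv by (rule that)
qed

end

section \<open>Rellich compactness\<close>

lemma cmod_exp_diff_le: "cmod (exp (- (\<i> * complex_of_real a)) - exp (- (\<i> * complex_of_real b))) \<le> \<bar>a - b\<bar>"
proof -
  have "exp (- (\<i> * complex_of_real a)) - exp (- (\<i> * complex_of_real b)) = exp (- (\<i> * complex_of_real b)) * (exp (\<i> * complex_of_real (b - a)) - 1)"
    by (simp add: algebra_simps exp_diff exp_minus inverse_eq_divide)
  then have "cmod (exp (- (\<i> * complex_of_real a)) - exp (- (\<i> * complex_of_real b))) = cmod (exp (\<i> * complex_of_real (b - a)) - 1)"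
    by (simp add: norm_mult norm_exp_eq_Re)
  also have "\<dots> \<le> \<bar>b - a\<bar>" using iexp_approx1[of "b - a" 0] by simp
  finally show ?thesis by simp
qed

lemma fourier_L1_lipschitz:
  fixes u :: "'a::euclidean_space \<Rightarrow> real"
  assumes u: "integrable lborel u" and R: "AE x in lborel. x \<notin> ball 0 R \<longrightarrow> u x = 0" "R \<ge> 0"
  shows "cmod (fourier_L1 u \<xi> - fourier_L1 u \<zeta>) \<le> (2 * pi) powr (- real DIM('a) / 2) * (R * norm (\<xi> - \<zeta>) * (LINT x|lborel. \<bar>u x\<bar>))"
proof -
  let ?e = "\<lambda>\<xi> x. exp (- (\<i> * complex_of_real (x \<bullet> \<xi>))) * complex_of_real (u x)"
  note i = fourier_integrand_integrable[OF u]
  have "fourier_L1 u \<xi> - fourier_L1 u \<zeta> = complex_of_real ((2 * pi) powr (- real DIM('a) / 2)) * (LINT x|lborel. ?e \<xi> x - ?e \<zeta> x)"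
    unfolding fourier_L1_def using i by (simp add: right_diff_distrib)
  moreover have "cmod (LINT x|lborel. ?e \<xi> x - ?e \<zeta> x) \<le> (LINT x|lborel. R * norm (\<xi> - \<zeta>) * \<bar>u x\<bar>)"
  proof (rule order_trans[OF integral_norm_bound integral_mono_AE])
    show "integrable lborel (\<lambda>x. cmod (?e \<xi> x - ?e \<zeta> x))" using i by (intro integrable_norm Bochner_Integration.integrable_diff)
    show "integrable lborel (\<lambda>x. R * norm (\<xi> - \<zeta>) * \<bar>u x\<bar>)" using u by simp
    show "AE x in lborel. cmod (?e \<xi> x - ?e \<zeta> x) \<le> R * norm (\<xi> - \<zeta>) * \<bar>u x\<bar>"
      using R(1)
    proof eventually_elim
      case (elim x)
      show ?case
      proof (cases "x \<in> ball 0 R")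
        case True
        have "cmod (exp (- (\<i> * complex_of_real (x \<bullet> \<xi>))) - exp (- (\<i> * complex_of_real (x \<bullet> \<zeta>)))) \<le> \<bar>x \<bullet> \<xi> - x \<bullet> \<zeta>\<bar>"
          by (rule cmod_exp_diff_le)
        also have "\<dots> \<le> norm x * norm (\<xi> - \<zeta>)"
          unfolding inner_diff_right[symmetric] by (rule Cauchy_Schwarz_ineq2)
        also have "\<dots> \<le> R * norm (\<xi> - \<zeta>)" using True by (intro mult_right_mono) auto
        finally have "cmod (exp (- (\<i> * complex_of_real (x \<bullet> \<xi>))) - exp (- (\<i> * complex_of_real (x \<bullet> \<zeta>)))) * \<bar>u x\<bar> \<le> R * norm (\<xi> - \<zeta>) * \<bar>u x\<bar>"
          by (rule mult_right_mono) simp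
        then show ?thesis by (simp add: left_diff_distrib[symmetric] norm_mult)
      qed (use elim in simp)
    qed
  qed
  ultimately show ?thesis by (simp add: norm_mult mult_left_mono)
qed

text \<open>
  The transforms of functions with a common bounded support are bounded and equi-Lipschitz, so a diagonal argument gives a
  pointwise convergent subsequence. Frequencies in a ball are handled by dominated convergence; those outside a ball of
  radius \<open>\<rho>\<close> carry at most \<open>\<rho>\<^sup>-\<^sup>2\<^sup>\<alpha>\<close> times the energy.
\<close>

theorem rellich:
  fixes w :: "nat \<Rightarrow> 'a::euclidean_space \<Rightarrow> real"
  assumes \<alpha>: "0 < \<alpha>" "\<alpha> < 1" and V: "open V" "bounded V" and w: "\<And>n. w n \<in> L2_on V"
    and bd: "\<And>n. energy \<alpha> (w n) \<le> ennreal C" "\<And>n. l2sq (w n) \<le> ennreal C"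
  obtains r u where "strict_mono r" "u \<in> L2_on V" "(\<lambda>n. l2sq (\<lambda>x. w (r n) x - u x)) \<longlonglongrightarrow> 0"
proof -
  define C' where "C' = max C 0"
  have C': "C' \<ge> 0" "\<And>n. energy \<alpha> (w n) \<le> ennreal C'" "\<And>n. l2sq (w n) \<le> ennreal C'"
    using bd by (auto simp: C'_def max_def ennreal_neg intro: order_trans)
  obtain R where R: "R > 0" "V \<subseteq> ball 0 R" using bounded_subset_ballD[OF V(2), of 0] by auto
  have wR: "AE x in lborel. x \<notin> ball 0 R \<longrightarrow> w n x = 0" for n
    using w[of n] R by (auto simp: L2_on_def elim!: eventually_mono)
  have wb: "w n \<in> L2_bd" for n by (rule L2_on_bd[OF V(2) w])
  have [measurable]: "w n \<in> borel_measurable borel" for n by (intro L2_spaceD L2_bd_L2 wb)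
  have wi: "integrable lborel (w n)" for n by (rule L2_bd_integrable[OF wb])
  have [measurable]: "ball (0::'a) \<rho> \<in> sets borel" for \<rho> by simp
  \<comment> \<open>A common bound for the \<open>L\<^sup>1\<close>-norms, hence for the transforms and their Lipschitz constants.\<close>
  define A where "A = C' + measure lborel (ball (0::'a) R)"
  have A: "(LINT x|lborel. \<bar>w n x\<bar>) \<le> A" for n
  proof -
    have "ennreal (LINT x|lborel. \<bar>w n x\<bar>) = (\<integral>\<^sup>+x. ennreal \<bar>w n x\<bar> \<partial>lborel)"
      using wi by (intro nn_integral_eq_integral[symmetric]) auto
    also have "\<dots> = (\<integral>\<^sup>+x. ennreal \<bar>w n x\<bar> * indicator (ball 0 R) x \<partial>lborel)"
      by (rule nn_integral_cong_AE) (use wR[of n] in \<open>auto simp: indicator_def elim!: eventually_mono\<close>)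
    also have "\<dots> \<le> ennreal 1 * l2sq (w n) + ennreal (1 / 1) * emeasure lborel (ball (0::'a) R)"
      by (rule nn_integral_abs_le_l2sq) auto
    also have "\<dots> \<le> ennreal C' + ennreal (measure lborel (ball (0::'a) R))"
      using C'(3)[of n] emeasure_lborel_ball_finite[of "0::'a" R]
      by (intro add_mono) (auto simp: emeasure_eq_ennreal_measure)
    also have "\<dots> = ennreal A" using C'(1) by (simp add: A_def)
    finally show ?thesis using C'(1) by (subst (asm) ennreal_le_iff) (auto simp: A_def)
  qed
  have A0: "A \<ge> 0" using C'(1) by (simp add: A_def)
  define K where "K = (2 * pi) powr (- real DIM('a) / 2)"
  have K: "K > 0" by (simp add: K_def)
  define F where "F n = fourier_L1 (w n)" for n
  have [measurable]: "F n \<in> borel_measurable borel" for n unfolding F_def by measurable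
  have F_bd: "norm (F n \<xi>) \<le> K * A" for n \<xi>
    unfolding F_def K_def by (intro order_trans[OF fourier_L1_bound[OF wi]] mult_left_mono A) auto
  define L where "L = K * R * A + 1"
  have L: "L > 0" using K R A0 by (simp add: L_def add_nonneg_pos)
  have F_lip: "norm (F n \<xi> - F n \<zeta>) \<le> L * norm (\<xi> - \<zeta>)" for n \<xi> \<zeta>
  proof -
    have "norm (F n \<xi> - F n \<zeta>) \<le> K * (R * norm (\<xi> - \<zeta>) * (LINT x|lborel. \<bar>w n x\<bar>))"
      unfolding F_def K_def using R by (intro fourier_L1_lipschitz wi wR) auto
    also have "\<dots> \<le> K * (R * norm (\<xi> - \<zeta>) * A)"
      using K R by (intro mult_left_mono A) auto
    also have "\<dots> \<le> L * norm (\<xi> - \<zeta>)" by (simp add: L_def algebra_simps)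
    finally show ?thesis .
  qed
  obtain D :: "'a set" where D: "countable D" "\<And>X. open X \<Longrightarrow> X \<noteq> {} \<Longrightarrow> \<exists>d\<in>D. d \<in> X"
    by (rule countable_dense_setE) blast
  obtain r :: "nat \<Rightarrow> nat" where r: "strict_mono r" "\<And>\<xi>. \<xi> \<in> D \<Longrightarrow> \<exists>l. (\<lambda>n. F (r n) \<xi>) \<longlonglongrightarrow> l"
    using function_convergent_subsequence[OF D(1), of F "K * A"] F_bd by metis
  have "Cauchy (\<lambda>n. F (r n) \<xi>)" for \<xi>
  proof (rule metric_CauchyI)
    fix e :: real assume e: "e > 0"
    have "e / (3 * L) > 0" using e L by simp
    then obtain d where d: "d \<in> D" "dist \<xi> d < e / (3 * L)"
      using D(2)[of "ball \<xi> (e / (3 * L))"] by auto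
    have "L * norm (\<xi> - d) < e / 3"
      using d(2) L by (simp add: dist_norm field_simps)
    then have near: "dist (F n \<xi>) (F n d) < e / 3" for n
      using F_lip[of n \<xi> d] by (simp add: dist_norm)
    have "Cauchy (\<lambda>n. F (r n) d)" using r(2)[OF d(1)] by (auto intro: LIMSEQ_imp_Cauchy)
    then obtain M where M: "\<And>m n. m \<ge> M \<Longrightarrow> n \<ge> M \<Longrightarrow> dist (F (r m) d) (F (r n) d) < e / 3"
      using e metric_CauchyD[of "\<lambda>n. F (r n) d" "e / 3"] by auto
    show "\<exists>M. \<forall>m\<ge>M. \<forall>n\<ge>M. dist (F (r m) \<xi>) (F (r n) \<xi>) < e"
    proof (intro exI[of _ M] allI impI)
      fix m n assume mn: "m \<ge> M" "n \<ge> M"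
      have "dist (F (r m) \<xi>) (F (r n) \<xi>) \<le> dist (F (r m) \<xi>) (F (r m) d) + dist (F (r m) d) (F (r n) d) + dist (F (r n) d) (F (r n) \<xi>)"
        by (meson dist_triangle order_trans add_mono order_refl)
      also have "\<dots> < e / 3 + e / 3 + e / 3"
        using near[of "r m"] near[of "r n"] M[OF mn] by (simp add: dist_commute)
      finally show "dist (F (r m) \<xi>) (F (r n) \<xi>) < e" by simp
    qed
  qed
  then have "\<forall>\<xi>. \<exists>l. (\<lambda>n. F (r n) \<xi>) \<longlonglongrightarrow> l" by (auto simp: Cauchy_convergent_iff convergent_def)
  then obtain G where G: "\<And>\<xi>. (\<lambda>n. F (r n) \<xi>) \<longlonglongrightarrow> G \<xi>" by metis
  have [measurable]: "G \<in> borel_measurable borel"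
    by (rule borel_measurable_LIMSEQ_metric[of "\<lambda>n. F (r n)"]) (auto intro: G)
  have G_bd: "norm (G \<xi>) \<le> K * A" for \<xi>
    by (rule LIMSEQ_le_const2[OF tendsto_norm[OF G]]) (use F_bd in auto)
  let ?ind = "\<lambda>\<rho>. indicator (ball 0 \<rho>) :: 'a \<Rightarrow> real"
  have ball_lim: "(\<lambda>n. l2sq (\<lambda>\<xi>. ?ind \<rho> \<xi> *\<^sub>R (F (r n) \<xi> - G \<xi>))) \<longlonglongrightarrow> 0" for \<rho>
  proof (rule l2sq_dominated[where w = "\<lambda>\<xi>. 2 * (K * A) * ?ind \<rho> \<xi>"])
    show "(\<lambda>\<xi>. 2 * (K * A) * ?ind \<rho> \<xi>) \<in> borel_measurable borel" by measurable
    show "(\<lambda>\<xi>. ?ind \<rho> \<xi> *\<^sub>R (F (r n) \<xi> - G \<xi>)) \<in> borel_measurable borel" for n by measurable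
    show "AE \<xi> in lborel. norm (?ind \<rho> \<xi> *\<^sub>R (F (r n) \<xi> - G \<xi>)) \<le> norm (2 * (K * A) * ?ind \<rho> \<xi>)" for n
    proof (rule AE_I2)
      fix \<xi>
      have "norm (F (r n) \<xi> - G \<xi>) \<le> 2 * (K * A)"
        using norm_triangle_ineq4[of "F (r n) \<xi>" "G \<xi>"] F_bd[of "r n" \<xi>] G_bd[of \<xi>] by linarith
      then show "norm (?ind \<rho> \<xi> *\<^sub>R (F (r n) \<xi> - G \<xi>)) \<le> norm (2 * (K * A) * ?ind \<rho> \<xi>)"
        using K A0 by (auto simp: indicator_def)
    qed
    have "l2sq (\<lambda>\<xi>. 2 * (K * A) * ?ind \<rho> \<xi>) = (\<integral>\<^sup>+\<xi>. ennreal ((2 * (K * A))\<^sup>2) * indicator (ball 0 \<rho>) (\<xi>::'a) \<partial>lborel)"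
      unfolding l2sq_def by (intro nn_integral_cong) (auto simp: indicator_def)
    also have "\<dots> < \<infinity>"
      using emeasure_lborel_ball_finite[of "0::'a" \<rho>] by (simp add: nn_integral_cmult_indicator ennreal_mult_less_top)
    finally show "l2sq (\<lambda>\<xi>. 2 * (K * A) * ?ind \<rho> \<xi>) < \<infinity>" .
    show "AE \<xi> in lborel. (\<lambda>n. ?ind \<rho> \<xi> *\<^sub>R (F (r n) \<xi> - G \<xi>)) \<longlonglongrightarrow> 0"
    proof (rule AE_I2)
      fix \<xi>
      have "(\<lambda>n. ?ind \<rho> \<xi> *\<^sub>R (F (r n) \<xi> - G \<xi>)) \<longlonglongrightarrow> ?ind \<rho> \<xi> *\<^sub>R (G \<xi> - G \<xi>)"
        by (intro tendsto_intros G)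
      then show "(\<lambda>n. ?ind \<rho> \<xi> *\<^sub>R (F (r n) \<xi> - G \<xi>)) \<longlonglongrightarrow> 0" by simp
    qed
  qed
  have split: "l2sq (\<lambda>x. w m x - w n x)
    \<le> l2sq (\<lambda>\<xi>. ?ind \<rho> \<xi> *\<^sub>R (F m \<xi> - F n \<xi>)) + ennreal (\<rho> powr (- (2 * \<alpha>))) * (4 * ennreal C')" if \<rho>: "\<rho> > 0" for m n \<rho>
  proof -
    have Fd: "fourier_L1 (\<lambda>x. w m x - w n x) \<xi> = F m \<xi> - F n \<xi>" for \<xi>
      unfolding F_def by (rule fourier_L1_diff[OF wi wi])
    have "l2sq (\<lambda>x. w m x - w n x) = l2sq (\<lambda>\<xi>. F m \<xi> - F n \<xi>)"
      using plancherel[OF L2_bd_diff[OF wb[of m] wb[of n]]] unfolding Fd[abs_def] by simp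
    also have "\<dots> \<le> (\<integral>\<^sup>+\<xi>. ennreal ((norm (?ind \<rho> \<xi> *\<^sub>R (F m \<xi> - F n \<xi>)))\<^sup>2) + ennreal (\<rho> powr (- (2 * \<alpha>))) * ennreal (norm \<xi> powr (2 * \<alpha>) * (cmod (fourier_L1 (\<lambda>x. w m x - w n x) \<xi>))\<^sup>2) \<partial>lborel)"
      unfolding l2sq_def
    proof (rule nn_integral_mono)
      fix \<xi> :: 'a
      show "ennreal ((norm (F m \<xi> - F n \<xi>))\<^sup>2) \<le> ennreal ((norm (?ind \<rho> \<xi> *\<^sub>R (F m \<xi> - F n \<xi>)))\<^sup>2) + ennreal (\<rho> powr (- (2 * \<alpha>))) * ennreal (norm \<xi> powr (2 * \<alpha>) * (cmod (fourier_L1 (\<lambda>x. w m x - w n x) \<xi>))\<^sup>2)"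
      proof (cases "\<xi> \<in> ball 0 \<rho>")
        case True
        then show ?thesis by (simp add: add_increasing2)
      next
        case False
        then have "\<rho> powr (2 * \<alpha>) \<le> norm \<xi> powr (2 * \<alpha>)" using \<rho> \<alpha> by (intro powr_mono2) auto
        then have "\<rho> powr (- (2 * \<alpha>)) * \<rho> powr (2 * \<alpha>) \<le> \<rho> powr (- (2 * \<alpha>)) * norm \<xi> powr (2 * \<alpha>)" by (intro mult_left_mono) auto
        then have "1 \<le> \<rho> powr (- (2 * \<alpha>)) * norm \<xi> powr (2 * \<alpha>)" using \<rho> by (simp add: powr_add[symmetric])
        then have "1 * (norm (F m \<xi> - F n \<xi>))\<^sup>2 \<le> (\<rho> powr (- (2 * \<alpha>)) * norm \<xi> powr (2 * \<alpha>)) * (norm (F m \<xi> - F n \<xi>))\<^sup>2"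
          by (intro mult_right_mono) auto
        then have "ennreal ((norm (F m \<xi> - F n \<xi>))\<^sup>2) \<le> ennreal (\<rho> powr (- (2 * \<alpha>)) * (norm \<xi> powr (2 * \<alpha>) * (norm (F m \<xi> - F n \<xi>))\<^sup>2))"
          by (intro ennreal_leI) (simp add: mult.assoc)
        also have "\<dots> = ennreal (\<rho> powr (- (2 * \<alpha>))) * ennreal (norm \<xi> powr (2 * \<alpha>) * (norm (F m \<xi> - F n \<xi>))\<^sup>2)"
          by (rule ennreal_mult) auto
        finally show ?thesis unfolding Fd by (rule order_trans) (simp add: add_increasing)
      qed
    qed
    also have "\<dots> = l2sq (\<lambda>\<xi>. ?ind \<rho> \<xi> *\<^sub>R (F m \<xi> - F n \<xi>)) + ennreal (\<rho> powr (- (2 * \<alpha>))) * energy \<alpha> (\<lambda>x. w m x - w n x)"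
      unfolding l2sq_def energy_def by (subst nn_integral_add) (auto simp: nn_integral_cmult)
    also have "energy \<alpha> (\<lambda>x. w m x - w n x) \<le> 4 * ennreal C'"
    proof -
      have "energy \<alpha> (\<lambda>x. 1 * w m x + (-1) * w n x) \<le> 2 * (ennreal (1\<^sup>2) * energy \<alpha> (w m)) + 2 * (ennreal ((-1)\<^sup>2) * energy \<alpha> (w n))"
        by (rule energy_lincomb_le[OF wb wb])
      also have "\<dots> \<le> 2 * ennreal C' + 2 * ennreal C'"
        using C'(2) by (intro add_mono mult_left_mono) auto
      finally show ?thesis by (simp add: distrib_right[symmetric])
    qed
    finally show ?thesis by (simp add: mult_left_mono add_left_mono)
  qed
  obtain u where u: "u \<in> L2_space" "(\<lambda>n. l2sq (\<lambda>x. w (r n) x - u x)) \<longlonglongrightarrow> 0"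
  proof (rule L2_complete[of "\<lambda>n. w (r n)" R])
    show "w (r n) \<in> L2_space" for n by (rule L2_bd_L2[OF wb])
    show "AE x in lborel. x \<notin> ball 0 R \<longrightarrow> w (r n) x = 0" for n by (rule wR)
    fix e :: real assume e: "e > 0"
    define s where "s = 8 * C' / e + 1"
    have s: "s \<ge> 1" using C'(1) e by (simp add: s_def)
    \<comment> \<open>The radius is chosen so that the high frequencies contribute at most half of \<open>e\<close>.\<close>
    define \<rho> where "\<rho> = s powr (1 / (2 * \<alpha>))"
    have \<rho>: "\<rho> > 0" using s by (simp add: \<rho>_def)
    have "\<rho> powr (- (2 * \<alpha>)) = 1 / s"
      using \<alpha> s by (simp add: \<rho>_def powr_powr powr_minus inverse_eq_divide)
    moreover have "1 / s * (4 * C') \<le> e / 2"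
      using e C'(1) by (simp add: s_def field_simps)
    ultimately have tail: "ennreal (\<rho> powr (- (2 * \<alpha>))) * (4 * ennreal C') \<le> ennreal (e / 2)"
    proof -
      have "ennreal (\<rho> powr (- (2 * \<alpha>))) * (4 * ennreal C') = ennreal (1 / s * (4 * C'))"
        using \<open>\<rho> powr (- (2 * \<alpha>)) = 1 / s\<close> C'(1) s by (simp add: ennreal_mult''[symmetric] ennreal_mult'[symmetric] flip: ennreal_numeral)
      then show ?thesis using \<open>1 / s * (4 * C') \<le> e / 2\<close> by (simp add: ennreal_leI)
    qed
    have "\<forall>\<^sub>F n in sequentially. l2sq (\<lambda>\<xi>. ?ind \<rho> \<xi> *\<^sub>R (F (r n) \<xi> - G \<xi>)) < ennreal (e / 16)"
      using order_tendstoD(2)[OF ball_lim] e by simp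
    then obtain N where N: "\<And>n. n \<ge> N \<Longrightarrow> l2sq (\<lambda>\<xi>. ?ind \<rho> \<xi> *\<^sub>R (F (r n) \<xi> - G \<xi>)) < ennreal (e / 16)"
      by (auto simp: eventually_sequentially)
    show "\<exists>N. \<forall>m\<ge>N. \<forall>n\<ge>N. l2sq (\<lambda>x. w (r m) x - w (r n) x) < ennreal e"
    proof (intro exI[of _ N] allI impI)
      fix m n assume mn: "m \<ge> N" "n \<ge> N"
      have "l2sq (\<lambda>\<xi>. ?ind \<rho> \<xi> *\<^sub>R (F (r m) \<xi> - F (r n) \<xi>)) = l2sq (\<lambda>\<xi>. ?ind \<rho> \<xi> *\<^sub>R (F (r m) \<xi> - G \<xi>) - ?ind \<rho> \<xi> *\<^sub>R (F (r n) \<xi> - G \<xi>))"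
        by (simp add: scaleR_diff_right)
      also have "\<dots> \<le> 2 * l2sq (\<lambda>\<xi>. ?ind \<rho> \<xi> *\<^sub>R (F (r m) \<xi> - G \<xi>)) + 2 * l2sq (\<lambda>\<xi>. ?ind \<rho> \<xi> *\<^sub>R (F (r n) \<xi> - G \<xi>))"
        by (rule l2sq_diff_le) measurable
      also have "\<dots> \<le> 2 * ennreal (e / 16) + 2 * ennreal (e / 16)"
        using N[OF mn(1)] N[OF mn(2)] by (intro add_mono mult_left_mono) auto
      also have "\<dots> = ennreal (e / 4)"
        using e by (simp add: ennreal_plus[symmetric] ennreal_mult'[symmetric] flip: ennreal_numeral)
      finally have "l2sq (\<lambda>x. w (r m) x - w (r n) x) \<le> ennreal (e / 4) + ennreal (e / 2)"
        by (intro order_trans[OF split[OF \<rho>]] add_mono tail)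
      also have "\<dots> < ennreal e" using e by (simp add: ennreal_plus[symmetric] ennreal_lessI del: ennreal_plus)
      finally show "l2sq (\<lambda>x. w (r m) x - w (r n) x) < ennreal e" .
    qed
  qed
  show thesis
    by (rule that[OF r(1) L2_on_limit[OF V(1) w u] u(2)])
qed

section \<open>Functions vanishing outside a Lipschitz domain\<close>

context
  fixes \<alpha> :: real and V :: "'a::euclidean_space set"
  assumes \<alpha>: "0 < \<alpha>" "\<alpha> < 1" and V: "open V" "bounded V"
begin

lemma Hn_translate_small:
  fixes u :: "'a \<Rightarrow> real"
  assumes u: "u \<in> HF \<alpha>" and e: "e > 0"
  obtains d where "d > 0" "\<And>y. norm y < d \<Longrightarrow> Hn \<alpha> (\<lambda>x. u (x + y) - u x) < ennreal e"
proof (rule tendsto_zero_imp_small[of "\<lambda>y. Hn \<alpha> (\<lambda>x. u (x + y) - u x)" "ennreal e"])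
  show "(\<lambda>n. Hn \<alpha> (\<lambda>x. u (x + y n) - u x)) \<longlonglongrightarrow> 0" if "y \<longlonglongrightarrow> 0" for y
    by (rule Hn_translate_tendsto[OF \<alpha> u that])
qed (use e that in auto)

lemma H0_approxI:
  assumes u: "u \<in> HF \<alpha>" and ap: "\<And>e. e > 0 \<Longrightarrow> \<exists>w\<in>H0_frac \<alpha> V. Hn \<alpha> (\<lambda>x. u x - w x) < ennreal e"
  shows "u \<in> H0_frac \<alpha> V"
proof -
  have u2: "u \<in> L2_space" by (intro L2_bd_L2 HF_L2_bd[OF u])
  have "\<forall>n. \<exists>w. w \<in> H0_frac \<alpha> V \<and> Hn \<alpha> (\<lambda>x. u x - w x) < ennreal (1 / real (Suc n))"
  proof
    fix n
    have "1 / real (Suc n) > 0" by simp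
    from ap[OF this] show "\<exists>w. w \<in> H0_frac \<alpha> V \<and> Hn \<alpha> (\<lambda>x. u x - w x) < ennreal (1 / real (Suc n))" by blast
  qed
  then obtain w where w: "\<And>n. w n \<in> H0_frac \<alpha> V" "\<And>n. Hn \<alpha> (\<lambda>x. u x - w n x) < ennreal (1 / real (Suc n))"
    by metis
  have "l2sq (\<lambda>x. w n x - u x) \<le> ennreal (1 / real (Suc n))" for n
  proof -
    have "l2sq (\<lambda>x. w n x - u x) \<le> Hn \<alpha> (\<lambda>x. u x - w n x)" by (simp add: Hn_def l2sq_minus[of "w n" u])
    then show ?thesis using w(2)[of n] by simp
  qed
  moreover have "(\<lambda>n. ennreal (1 / real (Suc n))) \<longlonglongrightarrow> 0"
    using tendsto_ennrealI[OF LIMSEQ_Suc[OF lim_1_over_n]] by simp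
  ultimately have "(\<lambda>n. l2sq (\<lambda>x. w n x - u x)) \<longlonglongrightarrow> 0" by (rule ennreal_squeeze_zero)
  then have "u \<in> L2_on V" by (rule L2_on_limit[OF V(1) H0_D(1)[OF \<alpha> V w(1)] u2])
  then show ?thesis using u ap by (rule H0_closed[OF \<alpha> V])
qed

text \<open>
  Mollifications on a scale below the distance from \<open>K\<close> to the complement of \<open>V\<close> are test functions.
\<close>

lemma H0_compact_support:
  assumes u: "u \<in> HF \<alpha>" and K: "compact K" "K \<subseteq> V" "AE y in lborel. y \<notin> K \<longrightarrow> u y = 0"
  shows "u \<in> H0_frac \<alpha> V"
proof (rule H0_approxI[OF u])
  fix e :: real assume e: "e > 0"
  have ub: "u \<in> L2_bd" by (rule HF_L2_bd[OF u])
  have e4: "e / 4 > 0" using e by simp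
  obtain d where d: "d > 0" "\<And>y. norm y < d \<Longrightarrow> Hn \<alpha> (\<lambda>x. u (x + y) - u x) < ennreal (e / 4)"
    using Hn_translate_small[OF u e4] by blast
  obtain r where r: "r > 0" "(\<Union>x\<in>K. cball x r) \<subseteq> V"
    using compact_subset_open_imp_cball_epsilon_subset[OF K(1) V(1) K(2)] by blast
  define \<delta> where "\<delta> = min d r"
  have \<delta>: "\<delta> > 0" using d r by (simp add: \<delta>_def)
  obtain \<phi> :: "'a \<Rightarrow> real" where \<phi>: "mollifier \<delta> \<phi>" "\<And>k. C_k k \<phi>" using mollifier_exists[OF \<delta>] by blast
  have "(\<Union>x\<in>K. cball x \<delta>) \<subseteq> V" using r(2) by (fastforce simp: \<delta>_def)
  then have t: "conv \<phi> u \<in> test_functions V"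
    by (rule conv_test_function[OF \<phi> L2_bd_integrable[OF ub] K(3,1)])
  have small: "energy \<alpha> (\<lambda>x. u (x + y) - u x) \<le> ennreal (e / 4) \<and> l2sq (\<lambda>x. u (x + y) - u x) \<le> ennreal (e / 4)" if "norm y < \<delta>" for y
  proof -
    have "Hn \<alpha> (\<lambda>x. u (x + y) - u x) \<le> ennreal (e / 4)" using d(2)[of y] that by (simp add: \<delta>_def)
    then show ?thesis unfolding Hn_def by (meson add_increasing2 add_increasing order_refl order_trans zero_le)
  qed
  have "energy \<alpha> (\<lambda>x. conv \<phi> u x - u x) \<le> ennreal (e / 4)"
    by (rule energy_conv_diff_small[OF \<alpha> \<phi>(1) \<delta> ub]) (use small in blast)
  moreover have "l2sq (\<lambda>x. conv \<phi> u x - u x) \<le> ennreal (e / 4)"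
    by (rule l2sq_conv_diff_small[OF \<phi>(1) L2_bd_integrable[OF ub]]) (use small in blast)
  moreover have "energy \<alpha> (\<lambda>x. u x - conv \<phi> u x) = energy \<alpha> (\<lambda>x. conv \<phi> u x - u x)"
    by (simp add: energy_def fourier_L1_diff L2_bd_integrable ub conv_L2_bd[OF \<phi>(1) \<delta>] norm_minus_commute)
  ultimately have "Hn \<alpha> (\<lambda>x. u x - conv \<phi> u x) \<le> ennreal (e / 4) + ennreal (e / 4)"
    unfolding Hn_def l2sq_minus[of u] by (simp add: add_mono)
  also have "\<dots> < ennreal e" using e by (simp add: ennreal_plus[symmetric] ennreal_lessI del: ennreal_plus)
  finally show "\<exists>w\<in>H0_frac \<alpha> V. Hn \<alpha> (\<lambda>x. u x - w x) < ennreal e"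
    using test_functions_H0[OF \<alpha> V t] by (intro bexI)
qed

text \<open>
  If translating by small multiples of \<open>n\<close> moves \<open>F\<close> into \<open>V\<close>, then \<open>u\<close> is the limit of translates that have compact
  support inside \<open>V\<close>.
\<close>

lemma H0_push_inward:
  assumes u: "u \<in> HF \<alpha>" and F: "compact F" "AE y in lborel. y \<notin> F \<longrightarrow> u y = 0"
    and t: "t0 > 0" "\<And>t y. 0 < t \<Longrightarrow> t < t0 \<Longrightarrow> y \<in> F \<Longrightarrow> y + t *\<^sub>R n \<in> V"
  shows "u \<in> H0_frac \<alpha> V"
proof (rule H0_approxI[OF u])
  fix e :: real assume e: "e > 0"
  then obtain d where d: "d > 0" "\<And>y. norm y < d \<Longrightarrow> Hn \<alpha> (\<lambda>x. u (x + y) - u x) < ennreal e"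
    using Hn_translate_small[OF u] by blast
  have nn: "norm n + 1 > 0" by (simp add: add_nonneg_pos)
  define c where "c = d / (norm n + 1)"
  have c: "c > 0" using d nn by (simp add: c_def)
  define s where "s = min t0 c / 2"
  have s: "0 < s" "s < t0" "s < c" using t c by (auto simp: s_def min_def)
  have "s < d / (norm n + 1)" using s(3) by (simp add: c_def)
  then have "s * (norm n + 1) < d" using nn by (simp add: field_simps)
  then have sd: "norm (- s *\<^sub>R n) < d" using s by (simp add: distrib_left)
  define v where "v x = u (x + - s *\<^sub>R n)" for x
  have vH: "v \<in> HF \<alpha>" unfolding v_def by (rule HF_translate[OF \<alpha> u])
  have vV: "v \<in> H0_frac \<alpha> V"
  proof (rule H0_compact_support[OF vH])
    show "compact ((\<lambda>y. y + s *\<^sub>R n) ` F)" by (intro compact_continuous_image continuous_intros F)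
    show "(\<lambda>y. y + s *\<^sub>R n) ` F \<subseteq> V" using t(2)[OF s(1,2)] by auto
    have "AE y in lborel. - s *\<^sub>R n + 1 *\<^sub>R y \<notin> F \<longrightarrow> u (- s *\<^sub>R n + 1 *\<^sub>R y) = 0" by (rule AE_affine[OF F(2)]) simp
    then show "AE y in lborel. y \<notin> (\<lambda>y. y + s *\<^sub>R n) ` F \<longrightarrow> v y = 0"
    proof eventually_elim
      case (elim y)
      have "y \<in> (\<lambda>y. y + s *\<^sub>R n) ` F" if "y - s *\<^sub>R n \<in> F" using that by (intro image_eqI[of _ _ "y - s *\<^sub>R n"]) auto
      then show ?case using elim by (auto simp: v_def)
    qed
  qed
  have "energy \<alpha> (\<lambda>x. u x - v x) = energy \<alpha> (\<lambda>x. v x - u x)"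
    by (simp add: energy_def fourier_L1_diff L2_bd_integrable HF_L2_bd[OF u] HF_L2_bd[OF vH] norm_minus_commute)
  then have "Hn \<alpha> (\<lambda>x. u x - v x) = Hn \<alpha> (\<lambda>x. u (x + - s *\<^sub>R n) - u x)"
    using l2sq_minus[of u v] by (simp add: Hn_def v_def)
  also have "\<dots> < ennreal e" by (rule d(2)[OF sd])
  finally show "\<exists>w\<in>H0_frac \<alpha> V. Hn \<alpha> (\<lambda>x. u x - w x) < ennreal e" using vV by (intro bexI)
qed

text \<open>
  The claim of \<open>lipschitz_domain_H0\<close> for functions supported in \<open>B\<close>; in this form it can be patched together from balls.
\<close>

definition localisable :: "'a set \<Rightarrow> bool" where
  "localisable B \<longleftrightarrow> (\<forall>u F. u \<in> HF \<alpha> \<longrightarrow> compact F \<longrightarrow> F \<subseteq> B \<longrightarrow>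
     (AE y in lborel. y \<notin> F \<inter> closure V \<longrightarrow> u y = 0) \<longrightarrow> u \<in> H0_frac \<alpha> V)"

text \<open>
  Split \<open>u\<close> as \<open>\<eta> u + (1 - \<eta>) u\<close> for a Lipschitz cutoff \<open>\<eta>\<close> that is 1 near the part of the support that is not in \<open>A\<close>.
\<close>

lemma localisable_Un:
  assumes "open A" "open B" "localisable A" "localisable B"
  shows "localisable (A \<union> B)"
  unfolding localisable_def
proof (intro allI impI)
  fix u F assume u: "u \<in> HF \<alpha>" and F: "compact F" "F \<subseteq> A \<union> B" and z: "AE y in lborel. y \<notin> F \<inter> closure V \<longrightarrow> u y = 0"
  define K where "K = F - A"
  have K: "compact K" "K \<subseteq> B" using F assms(1) by (auto simp: K_def intro: compact_diff)
  show "u \<in> H0_frac \<alpha> V"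
  proof (cases "K = {}")
    case True
    then show ?thesis using assms(3) u F z unfolding localisable_def K_def by blast
  next
    case False
    obtain r where r: "r > 0" "(\<Union>x\<in>K. cball x r) \<subseteq> B"
      using compact_subset_open_imp_cball_epsilon_subset[OF K(1) assms(2) K(2)] by blast
    \<comment> \<open>\<open>\<eta>\<close> is 1 within distance \<open>r / 2\<close> of \<open>K\<close> and 0 beyond distance \<open>r\<close>.\<close>
    define \<eta> where "\<eta> x = max 0 (min 1 (2 - 2 / r * infdist x K))" for x
    have lip: "(2 / r)-lipschitz_on UNIV \<eta>"
    proof (rule lipschitz_onI)
      fix x y
      have "\<bar>max 0 (min 1 a) - max 0 (min 1 b)\<bar> \<le> \<bar>a - b\<bar>" for a b :: real by (auto simp: max_def min_def)
      then have "dist (\<eta> x) (\<eta> y) \<le> \<bar>(2 - 2 / r * infdist x K) - (2 - 2 / r * infdist y K)\<bar>"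
        unfolding \<eta>_def dist_real_def .
      also have "\<dots> = \<bar>2 / r * (infdist x K - infdist y K)\<bar>"
        by (subst abs_minus_cancel[symmetric]) (simp add: right_diff_distrib)
      also have "\<dots> = 2 / r * \<bar>infdist x K - infdist y K\<bar>"
        by (subst abs_mult) (use r in simp)
      also have "\<dots> \<le> 2 / r * dist x y" using r by (intro mult_left_mono infdist_triangle_abs) auto
      finally show "dist (\<eta> x) (\<eta> y) \<le> 2 / r * dist x y" .
    qed (use r in auto)
    have lip': "(2 / r)-lipschitz_on UNIV (\<lambda>x. 1 - \<eta> x)"
      using lip by (auto simp: lipschitz_on_def dist_real_def abs_minus_commute)
    have bd: "\<bar>\<eta> x\<bar> \<le> 1" "\<bar>1 - \<eta> x\<bar> \<le> 1" for x by (auto simp: \<eta>_def)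
    have cl: "closed {x. infdist x K \<le> r}" "closed {x. r / 2 \<le> infdist x K}"
      by (intro closed_Collect_le continuous_intros)+
    have 1: "(\<lambda>x. \<eta> x * u x) \<in> H0_frac \<alpha> V"
    proof (rule assms(4)[unfolded localisable_def, rule_format])
      show "(\<lambda>x. \<eta> x * u x) \<in> HF \<alpha>" by (rule HF_cutoff[OF \<alpha> u lip bd(1)])
      show "compact (F \<inter> {x. infdist x K \<le> r})" using F(1) cl(1) by (rule compact_Int_closed)
      show "F \<inter> {x. infdist x K \<le> r} \<subseteq> B"
      proof
        fix x assume x: "x \<in> F \<inter> {x. infdist x K \<le> r}"
        obtain y where "y \<in> K" "infdist x K = dist x y"
          using infdist_attains_inf[OF compact_imp_closed[OF K(1)] False, of x] by blast
        then have "x \<in> (\<Union>x\<in>K. cball x r)" using x by (auto simp: dist_commute)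
        then show "x \<in> B" using r(2) by blast
      qed
      show "AE y in lborel. y \<notin> F \<inter> {x. infdist x K \<le> r} \<inter> closure V \<longrightarrow> \<eta> y * u y = 0"
        using z
      proof eventually_elim
        case (elim y)
        have "\<eta> y = 0" if "infdist y K > r" using that r by (simp add: \<eta>_def field_simps)
        then show ?case using elim by (auto simp: not_le)
      qed
    qed
    have 2: "(\<lambda>x. (1 - \<eta> x) * u x) \<in> H0_frac \<alpha> V"
    proof (rule assms(3)[unfolded localisable_def, rule_format])
      show "(\<lambda>x. (1 - \<eta> x) * u x) \<in> HF \<alpha>" by (rule HF_cutoff[OF \<alpha> u lip' bd(2)])
      show "compact (F \<inter> {x. r / 2 \<le> infdist x K})" using F(1) cl(2) by (rule compact_Int_closed)
      show "F \<inter> {x. r / 2 \<le> infdist x K} \<subseteq> A"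
      proof
        fix x assume x: "x \<in> F \<inter> {x. r / 2 \<le> infdist x K}"
        show "x \<in> A"
        proof (rule ccontr)
          assume "x \<notin> A"
          then have "x \<in> K" using x by (auto simp: K_def)
          then show False using x r by simp
        qed
      qed
      show "AE y in lborel. y \<notin> F \<inter> {x. r / 2 \<le> infdist x K} \<inter> closure V \<longrightarrow> (1 - \<eta> y) * u y = 0"
        using z
      proof eventually_elim
        case (elim y)
        have "\<eta> y = 1" if "infdist y K < r / 2" using that r by (simp add: \<eta>_def field_simps)
        then show ?case using elim by (auto simp: not_le)
      qed
    qed
    have "u = (\<lambda>x. 1 * (\<eta> x * u x) + 1 * ((1 - \<eta> x) * u x))" by (auto simp: algebra_simps)
    then show ?thesis using H0_lincomb[OF \<alpha> V 1 2, of 1 1] by simp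
  qed
qed

text \<open>
  Inside \<open>V\<close> mollification suffices. Near a boundary point the closure of \<open>V\<close> lies on or above a Lipschitz graph, so moving
  upward in the direction \<open>e\<close> enters \<open>V\<close>.
\<close>

lemma localisable_ball:
  assumes lip: "lipschitz_domain V" and z: "z \<in> closure V"
  shows "\<exists>r>0. localisable (ball z r)"
proof (cases "z \<in> V")
  case True
  then obtain r where r: "r > 0" "ball z r \<subseteq> V" using V(1) by (auto elim: openE)
  have "localisable (ball z r)"
    unfolding localisable_def
  proof (intro allI impI)
    fix u F assume u: "u \<in> HF \<alpha>" and F: "compact F" "F \<subseteq> ball z r" and z: "AE y in lborel. y \<notin> F \<inter> closure V \<longrightarrow> u y = 0"
    show "u \<in> H0_frac \<alpha> V"
      by (rule H0_compact_support[OF u F(1)]) (use F r z in \<open>auto elim: eventually_mono\<close>)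
  qed
  with r(1) show ?thesis by blast
next
  case False
  then have "z \<in> frontier V" using z V(1) by (simp add: frontier_def interior_open)
  then have "\<exists>r>0. \<exists>L e. \<exists>g :: 'a \<Rightarrow> real. norm e = 1 \<and> L-lipschitz_on {y. y \<bullet> e = 0} g \<and>
      V \<inter> ball z r = {x \<in> ball z r. x \<bullet> e > g (x - (x \<bullet> e) *\<^sub>R e)}"
    using lip by (simp add: lipschitz_domain_def)
  then obtain r L e g where r: "r > 0" and e: "norm e = 1" and g: "L-lipschitz_on {y. y \<bullet> e = 0} (g :: 'a \<Rightarrow> real)"
    and eq: "V \<inter> ball z r = {x \<in> ball z r. x \<bullet> e > g (x - (x \<bullet> e) *\<^sub>R e)}"
    by blast
  have ee: "e \<bullet> e = 1" using e by (simp add: dot_square_norm)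
  define P where "P x = x - (x \<bullet> e) *\<^sub>R e" for x
  have P: "P x \<bullet> e = 0" for x by (simp add: P_def inner_diff_left ee)
  have gP: "continuous_on UNIV (\<lambda>x. g (P x))"
  proof (rule continuous_on_compose2[OF lipschitz_on_continuous_on[OF g]])
    show "continuous_on UNIV P" unfolding P_def by (intro continuous_intros)
  qed (use P in auto)
  have below: "g (P y) \<le> y \<bullet> e" if "y \<in> ball z r" "y \<in> closure V" for y
  proof -
    have "closed {x. g (P x) \<le> x \<bullet> e}" by (intro closed_Collect_le gP continuous_intros)
    moreover have "ball z r \<inter> V \<subseteq> {x. g (P x) \<le> x \<bullet> e}"
      unfolding Int_commute[of "ball z r"] eq by (auto simp: P_def)
    ultimately have "closure (ball z r \<inter> V) \<subseteq> {x. g (P x) \<le> x \<bullet> e}" by (rule closure_minimal[rotated])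
    moreover have "y \<in> closure (ball z r \<inter> V)" using open_Int_closure_subset[of "ball z r" V] that by auto
    ultimately show ?thesis by auto
  qed
  have "localisable (ball z r)"
    unfolding localisable_def
  proof (intro allI impI)
    fix u F assume u: "u \<in> HF \<alpha>" and F: "compact F" "F \<subseteq> ball z r" and z: "AE y in lborel. y \<notin> F \<inter> closure V \<longrightarrow> u y = 0"
    obtain \<delta> where \<delta>: "\<delta> > 0" "(\<Union>x\<in>F. cball x \<delta>) \<subseteq> ball z r"
      using compact_subset_open_imp_cball_epsilon_subset[OF F(1) open_ball F(2)] by blast
    show "u \<in> H0_frac \<alpha> V"
    proof (rule H0_push_inward[OF u _ z \<delta>(1)])
      show "compact (F \<inter> closure V)" using F(1) by (intro compact_Int_closed) auto
      fix t y assume t: "0 < t" "t < \<delta>" and y: "y \<in> F \<inter> closure V"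
      have "y + t *\<^sub>R e \<in> cball y \<delta>" using t e by (simp add: dist_norm)
      then have b: "y + t *\<^sub>R e \<in> ball z r" using \<delta>(2) y by blast
      have "P (y + t *\<^sub>R e) = P y" by (simp add: P_def inner_add_left ee algebra_simps)
      moreover have "g (P y) \<le> y \<bullet> e" using y F(2) by (intro below) auto
      ultimately have "(y + t *\<^sub>R e) \<bullet> e > g (P (y + t *\<^sub>R e))" using t by (simp add: inner_add_left ee)
      then show "y + t *\<^sub>R e \<in> V" using b eq by (auto simp: P_def)
    qed
  qed
  with r show ?thesis by blast
qed

text \<open>
  The closure of \<open>V\<close> is compact, hence covered by finitely many of the balls of \<open>localisable_ball\<close>.
\<close>

theorem lipschitz_domain_H0:
  assumes lip: "lipschitz_domain V" and u: "u \<in> HF \<alpha>" and z: "AE y in lborel. y \<notin> closure V \<longrightarrow> u y = 0"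
  shows "u \<in> H0_frac \<alpha> V"
proof -
  have "\<forall>z\<in>closure V. \<exists>r>0. localisable (ball z r)" using localisable_ball[OF lip] by blast
  then obtain r where r: "\<And>z. z \<in> closure V \<Longrightarrow> r z > 0 \<and> localisable (ball z (r z))" by metis
  have cV: "compact (closure V)" using V(2) by (simp add: compact_closure)
  obtain D where D: "D \<subseteq> closure V" "finite D" "closure V \<subseteq> (\<Union>z\<in>D. ball z (r z))"
  proof (rule compactE_image[OF cV, of "closure V" "\<lambda>z. ball z (r z)"])
    show "closure V \<subseteq> (\<Union>z\<in>closure V. ball z (r z))" using r by force
  qed auto
  have loc: "localisable (\<Union>z\<in>D. ball z (r z))"
    using D(2,1)
  proof (induction D)
    case empty
    have "localisable {}"
      unfolding localisable_def
    proof (intro allI impI)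
      fix u F assume u: "u \<in> HF \<alpha>" "F \<subseteq> {}" "AE y in lborel. y \<notin> F \<inter> closure V \<longrightarrow> u y = 0"
      show "u \<in> H0_frac \<alpha> V"
        by (rule H0_compact_support[OF u(1), of "{}"]) (use u in auto)
    qed
    then show ?case by simp
  next
    case (insert z D)
    have "localisable (ball z (r z) \<union> (\<Union>z\<in>D. ball z (r z)))"
      by (rule localisable_Un) (use insert r in auto)
    then show ?case by simp
  qed
  show ?thesis
    by (rule loc[unfolded localisable_def, rule_format, OF u cV D(3)]) (use z in simp)
qed

end

section \<open>The Dirichlet operator\<close>

abbreviation ip :: "('a::euclidean_space \<Rightarrow> real) \<Rightarrow> ('a \<Rightarrow> real) \<Rightarrow> real" where
  "ip u v \<equiv> LINT x|lborel. u x * v x"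

lemma L2_inner_eq:
  fixes u v :: "'a::euclidean_space \<Rightarrow> real"
  assumes V: "V \<in> sets borel" and u: "u \<in> borel_measurable borel" and v: "v \<in> borel_measurable borel"
    and z: "AE x in lborel. x \<notin> V \<longrightarrow> u x * v x = 0"
  shows "L2_inner V u v = ip u v"
  unfolding L2_inner_def set_lebesgue_integral_def
proof (rule integral_cong_AE)
  note V[measurable] u[measurable] v[measurable]
  show "(\<lambda>x. indicat_real V x *\<^sub>R (u x * v x)) \<in> borel_measurable lborel" by measurable
  show "(\<lambda>x. u x * v x) \<in> borel_measurable lborel" by measurable
  show "AE x in lborel. indicat_real V x *\<^sub>R (u x * v x) = u x * v x"
    using z by eventually_elim (auto simp: indicator_def)
qed

lemma L2_inner_on:
  assumes V: "V \<in> sets borel" and u: "u \<in> L2_space" and v: "v \<in> L2_on V"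
  shows "L2_inner V u v = ip u v" "L2_inner V v u = ip v u"
  using assms by (auto intro!: L2_inner_eq simp: L2_on_def intro: L2_spaceD elim: eventually_mono)

lemma HF_L2: "u \<in> HF \<alpha> \<Longrightarrow> u \<in> L2_space"
  by (intro L2_bd_L2 HF_L2_bd)

lemma ip_l2sq: "u \<in> L2_space \<Longrightarrow> ennreal (ip u u) = l2sq u"
  using integral_square_eq_l2sq(1)[of u] by (simp add: power2_eq_square)

lemma ip_nonneg: "0 \<le> ip u u"
  by (intro Bochner_Integration.integral_nonneg) simp

lemma Hn_eq:
  assumes "u \<in> HF \<alpha>"
  shows "Hn \<alpha> u = ennreal (eform \<alpha> u u + ip u u)"
  using eform_energy[OF assms] ip_l2sq[OF HF_L2[OF assms]] ip_nonneg[of u]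
  by (simp add: Hn_def)

lemma Hn_tendsto_zero_iff:
  assumes "\<And>n. d n \<in> HF \<alpha>"
  shows "(\<lambda>n. Hn \<alpha> (d n)) \<longlonglongrightarrow> 0 \<longleftrightarrow> (\<lambda>n. eform \<alpha> (d n) (d n) + ip (d n) (d n)) \<longlonglongrightarrow> 0"
proof -
  have "\<forall>\<^sub>F n in sequentially. 0 \<le> eform \<alpha> (d n) (d n) + ip (d n) (d n)"
    by (intro always_eventually allI add_nonneg_nonneg ip_nonneg eform_energy(3) assms)
  from tendsto_ennreal_iff[OF this order_refl] show ?thesis
    unfolding Hn_eq[OF assms] by simp
qed

lemma ip_zero_imp_AE:
  assumes "u \<in> L2_space" "ip u u = 0"
  shows "AE x in lborel. u x = 0"
  using ip_l2sq[OF assms(1)] assms(2) l2sq_eq_0_iff[of u] L2_spaceD(1)[OF assms(1)] by simp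

lemma ip_cong_AE:
  assumes "AE x in lborel. u x = u' x" "AE x in lborel. v x = v' x"
    "u \<in> borel_measurable borel" "u' \<in> borel_measurable borel" "v \<in> borel_measurable borel" "v' \<in> borel_measurable borel"
  shows "ip u v = ip u' v'"
proof (rule integral_cong_AE)
  note assms(3-6)[measurable]
  show "(\<lambda>x. u x * v x) \<in> borel_measurable lborel" "(\<lambda>x. u' x * v' x) \<in> borel_measurable lborel" by measurable
  show "AE x in lborel. u x * v x = u' x * v' x" using assms(1,2) by eventually_elim simp
qed

lemma eform_AE_zero:
  fixes u v :: "'a::euclidean_space \<Rightarrow> real"
  assumes u: "u \<in> HF \<alpha>" and v: "v \<in> HF \<alpha>" and z: "AE x in lborel. u x = 0"
  shows "eform \<alpha> u v = 0"
proof -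
  interpret semi_inner "HF \<alpha>" "eform \<alpha>" by (rule eform_semi_inner)
  have "energy \<alpha> u = energy \<alpha> (\<lambda>x::'a. 0 :: real)"
    by (rule energy_cong_AE[OF z]) (use HF_L2[OF u] in \<open>auto intro: L2_spaceD\<close>)
  then have "eform \<alpha> u u = 0" using eform_energy(2)[OF u] by (simp add: energy_def fourier_L1_def)
  then show ?thesis using Cauchy_Schwarz[OF u v] by simp
qed

context
  fixes \<alpha> :: real and V :: "'a::euclidean_space set"
  assumes \<alpha>: "0 < \<alpha>" "\<alpha> < 1" and V: "open V" "bounded V"
begin

abbreviation (input) "H0 \<equiv> H0_frac \<alpha> V"

lemma Vb: "V \<in> sets borel" using V by simp

lemma H0_HF: "u \<in> H0 \<Longrightarrow> u \<in> HF \<alpha>" and H0_on: "u \<in> H0 \<Longrightarrow> u \<in> L2_on V" and H0_L2: "u \<in> H0 \<Longrightarrow> u \<in> L2_space"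
  using H0_D[OF \<alpha> V] L2_on_L2 by blast+

lemma form_semi_inner: "t \<ge> 0 \<Longrightarrow> semi_inner (HF \<alpha>) (\<lambda>u v. eform \<alpha> u v + t * ip u v)"
  by (intro semi_inner_sum eform_semi_inner semi_inner_subset[OF integral_mult_semi_inner] HF_lincomb) (auto intro: HF_L2)

text \<open>
  For \<open>t > 0\<close> the form \<open>\<E> + t (\<cdot>,\<cdot>)\<close> is equivalent to the \<open>H\<^sup>\<alpha>\<close>-norm, under which \<open>H0\<close> is complete.
\<close>

theorem resolvent:
  fixes f :: "'a \<Rightarrow> real"
  assumes t: "t > 0" and f: "f \<in> L2_space"
  obtains w where "w \<in> H0" "\<And>v. v \<in> H0 \<Longrightarrow> eform \<alpha> w v + t * ip w v = t * ip f v"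
proof -
  let ?B = "\<lambda>u v. eform \<alpha> u v + t * ip u v"
  interpret B: semi_inner "HF \<alpha>" ?B using t by (intro form_semi_inner) simp
  interpret I: semi_inner L2_space "ip :: ('a \<Rightarrow> real) \<Rightarrow> _" by (rule integral_mult_semi_inner)
  show thesis
  proof (rule B.riesz[of H0 "\<lambda>x. 0" "\<lambda>v. t * ip f v" "t * sqrt (ip f f) * sqrt (1 / t)"])
    show "H0 \<subseteq> HF \<alpha>" using H0_HF by blast
    show "(\<lambda>x. 0) \<in> H0" by (rule H0_zero[OF \<alpha> V])
    show "(\<lambda>x. a * u x + b * v x) \<in> H0" if "u \<in> H0" "v \<in> H0" for u v a b
      using that by (rule H0_lincomb[OF \<alpha> V])
    show "t * ip f (\<lambda>x. a * u x + b * v x) = a * (t * ip f u) + b * (t * ip f v)" if "u \<in> H0" "v \<in> H0" for u v a b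
      using I.bilin[OF H0_L2[OF that(1)] H0_L2[OF that(2)] f, of a b] by (simp add: mult.commute[of _ "f _"] algebra_simps)
    show "\<bar>t * ip f v\<bar> \<le> t * sqrt (ip f f) * sqrt (1 / t) * sqrt (?B v v)" if v: "v \<in> H0" for v
    proof -
      have "t * ip v v \<le> ?B v v" using eform_energy(3)[OF H0_HF[OF v]] by simp
      then have "ip v v \<le> 1 / t * ?B v v" using t by (simp add: field_simps)
      then have "sqrt (ip v v) \<le> sqrt (1 / t) * sqrt (?B v v)"
        by (metis real_sqrt_le_mono real_sqrt_mult)
      then have "sqrt (ip f f) * sqrt (ip v v) \<le> sqrt (ip f f) * (sqrt (1 / t) * sqrt (?B v v))"
        by (intro mult_left_mono) (simp_all add: ip_nonneg)
      then have "\<bar>ip f v\<bar> \<le> sqrt (ip f f) * (sqrt (1 / t) * sqrt (?B v v))"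
        using I.abs_le[OF f H0_L2[OF v]] by linarith
      then have "t * \<bar>ip f v\<bar> \<le> t * (sqrt (ip f f) * (sqrt (1 / t) * sqrt (?B v v)))"
        using t by (intro mult_left_mono) auto
      then show ?thesis using t by (simp only: abs_mult mult.assoc abs_of_pos)
    qed
    fix w :: "nat \<Rightarrow> 'a \<Rightarrow> real" assume w: "\<And>n. w n \<in> H0"
      and c: "\<And>e. e > 0 \<Longrightarrow> \<exists>N. \<forall>m\<ge>N. \<forall>n\<ge>N. ?B (\<lambda>x. w m x - w n x) (\<lambda>x. w m x - w n x) < e"
    \<comment> \<open>\<open>k\<close> and \<open>max 1 t\<close> are the constants of the equivalence of \<open>?B\<close> with the \<open>H\<^sup>\<alpha>\<close>-norm.\<close>
    define k where "k = min 1 t"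
    have k: "k > 0" "k \<le> 1" "k \<le> t" using t by (auto simp: k_def)
    have d: "(\<lambda>x. u x - v x) \<in> HF \<alpha>" if "u \<in> H0" "v \<in> H0" for u v
      using that by (intro HF_diff[OF \<alpha>] H0_HF)
    obtain u where u: "u \<in> H0" "(\<lambda>n. Hn \<alpha> (\<lambda>x. w n x - u x)) \<longlonglongrightarrow> 0"
    proof (rule H0_complete[OF \<alpha> V w])
      fix e :: real assume e: "e > 0"
      then have "k * e > 0" using k by simp
      then obtain N where N: "\<And>m n. m \<ge> N \<Longrightarrow> n \<ge> N \<Longrightarrow> ?B (\<lambda>x. w m x - w n x) (\<lambda>x. w m x - w n x) < k * e"
        using c by blast
      show "\<exists>N. \<forall>m\<ge>N. \<forall>n\<ge>N. Hn \<alpha> (\<lambda>x. w m x - w n x) < ennreal e"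
      proof (intro exI[of _ N] allI impI)
        fix m n assume mn: "m \<ge> N" "n \<ge> N"
        let ?d = "\<lambda>x. w m x - w n x"
        have "k * (eform \<alpha> ?d ?d + ip ?d ?d) \<le> 1 * eform \<alpha> ?d ?d + t * ip ?d ?d"
          unfolding distrib_left using k eform_energy(3)[OF d[OF w[of m] w[of n]]] ip_nonneg[of ?d]
          by (intro add_mono mult_right_mono) auto
        also have "\<dots> < k * e" using N[OF mn] by simp
        finally have "eform \<alpha> ?d ?d + ip ?d ?d < e" using k by simp
        then show "Hn \<alpha> ?d < ennreal e" unfolding Hn_eq[OF d[OF w w]] using e by (rule ennreal_lessI[rotated])
      qed
    qed blast
    have "(\<lambda>n. eform \<alpha> (\<lambda>x. w n x - u x) (\<lambda>x. w n x - u x) + ip (\<lambda>x. w n x - u x) (\<lambda>x. w n x - u x)) \<longlonglongrightarrow> 0"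
      using u(2) by (subst (asm) Hn_tendsto_zero_iff) (rule d[OF w u(1)])
    then have z: "(\<lambda>n. max 1 t * (eform \<alpha> (\<lambda>x. w n x - u x) (\<lambda>x. w n x - u x) + ip (\<lambda>x. w n x - u x) (\<lambda>x. w n x - u x))) \<longlonglongrightarrow> 0"
      by (rule tendsto_mult_right_zero)
    have "(\<lambda>n. ?B (\<lambda>x. w n x - u x) (\<lambda>x. w n x - u x)) \<longlonglongrightarrow> 0"
    proof (rule Lim_null_comparison[OF always_eventually z], rule allI)
      fix n
      let ?d = "\<lambda>x. w n x - u x"
      have e0: "0 \<le> eform \<alpha> ?d ?d" "0 \<le> ip ?d ?d" by (intro ip_nonneg eform_energy(3) d w u)+
      have "norm (?B ?d ?d) = 1 * eform \<alpha> ?d ?d + t * ip ?d ?d" using e0 t by simp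
      also have "\<dots> \<le> max 1 t * eform \<alpha> ?d ?d + max 1 t * ip ?d ?d"
        using e0 by (intro add_mono mult_right_mono) auto
      finally show "norm (?B ?d ?d) \<le> max 1 t * (eform \<alpha> ?d ?d + ip ?d ?d)" by (simp add: distrib_left)
    qed
    with u(1) show "\<exists>v\<in>H0. (\<lambda>n. ?B (\<lambda>x. w n x - v x) (\<lambda>x. w n x - v x)) \<longlonglongrightarrow> 0" by blast
  next
    fix w assume "w \<in> H0" "\<And>v. v \<in> H0 \<Longrightarrow> ?B w v = t * ip f v"
    then show thesis by (rule that)
  qed
qed

text \<open>
  Testing the equation with \<open>u\<close> and \<open>w\<close> bounds the distance by \<open>1/t\<close> times the energy of \<open>u\<close>, so resolvents approximate the
  identity for large \<open>t\<close>; this makes the operator domain dense.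
\<close>

lemma resolvent_close:
  assumes t: "t > 0" and u: "u \<in> H0" and w: "w \<in> H0" "\<And>v. v \<in> H0 \<Longrightarrow> eform \<alpha> w v + t * ip w v = t * ip u v"
  shows "t * ip (\<lambda>x. u x - w x) (\<lambda>x. u x - w x) \<le> eform \<alpha> u u"
proof -
  interpret E: semi_inner "HF \<alpha>" "eform \<alpha>" by (rule eform_semi_inner)
  interpret I: semi_inner L2_space "ip :: ('a \<Rightarrow> real) \<Rightarrow> _" by (rule integral_mult_semi_inner)
  note uw = H0_L2[OF u] H0_L2[OF w(1)] H0_HF[OF u] H0_HF[OF w(1)]
  have "t * ip (\<lambda>x. u x - w x) (\<lambda>x. u x - w x) = t * ip u u - t * ip w u - (t * ip u w - t * ip w w)"
  proof -
    have *: "t * p = t * a - t * b' - (t * b - t * c)" if "p = a - 2 * b + c" "b = b'" for p a b b' c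
      unfolding that(1) that(2)[symmetric] by (simp add: algebra_simps)
    show ?thesis by (rule *[OF I.diff_quad[OF uw(1,2)] I.sym[OF uw(1,2)]])
  qed
  also have "\<dots> = eform \<alpha> w u - eform \<alpha> w w"
    using w(2)[OF u] w(2)[OF w(1)] by simp
  also have "\<dots> \<le> eform \<alpha> u u"
    using E.nonneg[OF E.diff_closed[OF uw(3,4)]] E.diff_quad[OF uw(3,4)] E.sym[OF uw(3,4)] E.nonneg[OF uw(3)] E.nonneg[OF uw(4)] by simp
  finally show ?thesis .
qed

definition dirichlet_graph :: "(('a \<Rightarrow> real) \<times> ('a \<Rightarrow> real)) set" where
  "dirichlet_graph = {(u, f). u \<in> H0 \<and> f \<in> L2_on V \<and> (\<forall>v\<in>H0. eform \<alpha> u v = - ip f v)}"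

lemma dirichlet_graph_symmetric:
  assumes "(u, f) \<in> dirichlet_graph" "(v, g) \<in> dirichlet_graph"
  shows "ip f v = ip u g"
proof -
  interpret E: semi_inner "HF \<alpha>" "eform \<alpha>" by (rule eform_semi_inner)
  have "- ip f v = eform \<alpha> u v" "eform \<alpha> v u = - ip g u" "u \<in> H0" "v \<in> H0"
    using assms by (auto simp: dirichlet_graph_def)
  then show ?thesis using E.sym[OF H0_HF H0_HF, of u v] by (simp add: mult.commute)
qed

lemma resolvent_graph:
  assumes f: "f \<in> L2_on V"
  obtains w where "(w, \<lambda>x. w x - f x) \<in> dirichlet_graph"
proof -
  interpret I: semi_inner L2_space "ip :: ('a \<Rightarrow> real) \<Rightarrow> _" by (rule integral_mult_semi_inner)
  obtain w where w: "w \<in> H0" "\<And>v. v \<in> H0 \<Longrightarrow> eform \<alpha> w v + 1 * ip w v = 1 * ip f v"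
    using resolvent[of 1 f] L2_on_L2[OF f] by auto
  have "eform \<alpha> w v = - ip (\<lambda>x. w x - f x) v" if "v \<in> H0" for v
    using w(2)[OF that] I.diff_left[OF H0_L2[OF w(1)] L2_on_L2[OF f] H0_L2[OF that]] by simp
  then have "(w, \<lambda>x. w x - f x) \<in> dirichlet_graph"
    using w(1) f H0_on by (auto simp: dirichlet_graph_def intro: L2_on_diff)
  then show thesis by (rule that)
qed

text \<open>
  Let \<open>w\<close> solve \<open>w - \<Delta>w = v - g\<close>. Then \<open>v - w\<close> is orthogonal to the range of \<open>1 - \<Delta>\<close>, which is everything, so \<open>v = w\<close>.
\<close>

lemma dirichlet_graph_adjoint:
  assumes v: "v \<in> L2_on V" and g: "g \<in> L2_on V" and adj: "\<And>u f. (u, f) \<in> dirichlet_graph \<Longrightarrow> ip f v = ip u g"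
  shows "(v, g) \<in> dirichlet_graph"
proof -
  interpret I: semi_inner L2_space "ip :: ('a \<Rightarrow> real) \<Rightarrow> _" by (rule integral_mult_semi_inner)
  note L = L2_on_L2[OF v] L2_on_L2[OF g]
  obtain w where w: "(w, \<lambda>x. w x - (v x - g x)) \<in> dirichlet_graph"
    using resolvent_graph[OF L2_on_diff[OF v g]] by blast
  have wH: "w \<in> H0" using w by (simp add: dirichlet_graph_def)
  note wL = H0_L2[OF wH]
  obtain u where u: "(u, \<lambda>x. u x - (v x - w x)) \<in> dirichlet_graph"
    using resolvent_graph[OF L2_on_diff[OF v H0_on[OF wH]]] by blast
  have uL: "u \<in> L2_space" using u by (auto simp: dirichlet_graph_def intro: H0_L2)
  have dL: "(\<lambda>x. v x - w x) \<in> L2_space" "(\<lambda>x. v x - g x) \<in> L2_space" "(\<lambda>x. u x - (v x - w x)) \<in> L2_space"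
    using L wL uL by (auto intro: L2_space_diff)
  have 1: "ip (\<lambda>x. u x - (v x - w x)) v = ip u g" by (rule adj[OF u])
  have 2: "ip (\<lambda>x. u x - (v x - w x)) w = ip u (\<lambda>x. w x - (v x - g x))"
    by (rule dirichlet_graph_symmetric[OF u w])
  have "ip (\<lambda>x. v x - w x) (\<lambda>x. v x - w x) = ip (\<lambda>x. v x - w x) v - ip (\<lambda>x. v x - w x) w"
    using I.diff_left[OF L(1) wL dL(1)] I.sym[OF dL(1) L(1)] I.sym[OF dL(1) wL] by simp
  also have "ip (\<lambda>x. v x - w x) v = ip u v - ip u g"
    using 1 I.diff_left[OF uL dL(1) L(1)] by simp
  also have "ip (\<lambda>x. v x - w x) w = ip u w - ip u (\<lambda>x. w x - (v x - g x))"
    using 2 I.diff_left[OF uL dL(1) wL] by simp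
  also have "ip u (\<lambda>x. w x - (v x - g x)) = ip u w - (ip u v - ip u g)"
    using I.sym[OF uL L2_space_diff[OF wL dL(2)]] I.diff_left[OF wL dL(2) uL] I.diff_left[OF L uL]
      I.sym[OF uL wL] I.sym[OF uL L(1)] I.sym[OF uL L(2)] by simp
  finally have "ip (\<lambda>x. v x - w x) (\<lambda>x. v x - w x) = 0" by simp
  then have eq: "AE x in lborel. v x = w x"
    using ip_zero_imp_AE[OF dL(1)] by auto
  have wv: "AE x in lborel. w x = v x" using eq by eventually_elim simp
  have vH: "v \<in> H0" by (rule H0_cong_AE[OF \<alpha> V wH wv]) (use L in \<open>auto intro: L2_spaceD\<close>)
  have "eform \<alpha> v z = - ip g z" if z: "z \<in> H0" for z
  proof -
    interpret E: semi_inner "HF \<alpha>" "eform \<alpha>" by (rule eform_semi_inner)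
    have "eform \<alpha> (\<lambda>x. v x - w x) z = 0"
      by (rule eform_AE_zero[OF HF_diff[OF \<alpha> H0_HF[OF vH] H0_HF[OF wH]] H0_HF[OF z]]) (use eq in simp)
    then have "eform \<alpha> v z = eform \<alpha> w z"
      using E.diff_left[OF H0_HF[OF vH] H0_HF[OF wH] H0_HF[OF z]] by simp
    also have "\<dots> = - ip (\<lambda>x. w x - (v x - g x)) z" using w z by (simp add: dirichlet_graph_def)
    also have "ip (\<lambda>x. w x - (v x - g x)) z = ip g z"
    proof (rule ip_cong_AE)
      have [measurable]: "v \<in> borel_measurable borel" "w \<in> borel_measurable borel" "g \<in> borel_measurable borel" "z \<in> borel_measurable borel"
        using L wL H0_L2[OF z] by (auto intro: L2_spaceD)
      show "AE x in lborel. w x - (v x - g x) = g x" using eq by eventually_elim simp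
      show "(\<lambda>x. w x - (v x - g x)) \<in> borel_measurable borel" "g \<in> borel_measurable borel" "z \<in> borel_measurable borel" "z \<in> borel_measurable borel"
        by measurable
    qed simp
    finally show ?thesis .
  qed
  then show ?thesis using vH g by (simp add: dirichlet_graph_def)
qed

lemma dirichlet_graph_dense:
  assumes u: "u \<in> L2_on V" and e: "e > 0"
  shows "\<exists>w\<in>Domain dirichlet_graph. ip (\<lambda>x. u x - w x) (\<lambda>x. u x - w x) < e"
proof -
  interpret I: semi_inner L2_space "ip :: ('a \<Rightarrow> real) \<Rightarrow> _" by (rule integral_mult_semi_inner)
  have e4: "e / 4 > 0" using e by simp
  obtain \<phi> where \<phi>: "\<phi> \<in> test_functions V" "l2sq (\<lambda>x. u x - \<phi> x) < ennreal (e / 4)"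
    using test_functions_dense[OF \<alpha> V u e4] by blast
  have pH: "\<phi> \<in> H0" by (rule test_functions_H0[OF \<alpha> V \<phi>(1)])
  note L = L2_on_L2[OF u] H0_L2[OF pH]
  have 1: "ip (\<lambda>x. u x - \<phi> x) (\<lambda>x. u x - \<phi> x) < e / 4"
    using \<phi>(2) unfolding ip_l2sq[OF L2_space_diff[OF L], symmetric] by (simp add: ennreal_less_iff ip_nonneg)
  \<comment> \<open>Large enough for \<open>resolvent_close\<close> to give a squared distance below \<open>e / 4\<close>.\<close>
  define t where "t = 4 * (eform \<alpha> \<phi> \<phi> + 1) / e"
  have E0: "0 \<le> eform \<alpha> \<phi> \<phi>" by (rule eform_energy(3)[OF H0_HF[OF pH]])
  have t: "t > 0" using e E0 by (simp add: t_def)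
  obtain w where w: "w \<in> H0" "\<And>v. v \<in> H0 \<Longrightarrow> eform \<alpha> w v + t * ip w v = t * ip \<phi> v"
    using resolvent[OF t L(2)] by blast
  note wL = H0_L2[OF w(1)]
  have "t * ip (\<lambda>x. \<phi> x - w x) (\<lambda>x. \<phi> x - w x) \<le> eform \<alpha> \<phi> \<phi>"
    by (rule resolvent_close[OF t pH w])
  also have "\<dots> < t * (e / 4)" using e by (simp add: t_def)
  finally have 2: "ip (\<lambda>x. \<phi> x - w x) (\<lambda>x. \<phi> x - w x) < e / 4" using t by simp
  have "(w, \<lambda>x. t * (w x - \<phi> x)) \<in> dirichlet_graph"
  proof -
    have f: "(\<lambda>x. t * w x + (- t) * \<phi> x) \<in> L2_on V" by (intro L2_on_lincomb H0_on w pH)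
    have "eform \<alpha> w v = - ip (\<lambda>x. t * w x + (- t) * \<phi> x) v" if "v \<in> H0" for v
      using w(2)[OF that] I.bilin[OF wL L(2) H0_L2[OF that], of t "- t"] by simp
    then show ?thesis using f w(1) by (simp add: dirichlet_graph_def algebra_simps)
  qed
  moreover have "ip (\<lambda>x. u x - w x) (\<lambda>x. u x - w x) < e"
  proof -
    let ?a = "\<lambda>x. u x - \<phi> x" and ?b = "\<lambda>x. \<phi> x - w x"
    have ab: "?a \<in> L2_space" "?b \<in> L2_space" using L wL by (auto intro: L2_space_diff)
    have "ip (\<lambda>x. 1 * ?a x + 1 * ?b x) (\<lambda>x. 1 * ?a x + 1 * ?b x) = ip ?a ?a + 2 * ip ?a ?b + ip ?b ?b"
      using I.quad[OF ab, of 1 1] by simp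
    also have "2 * ip ?a ?b \<le> ip ?a ?a + ip ?b ?b"
      using I.nonneg[OF I.diff_closed[OF ab]] I.diff_quad[OF ab] by linarith
    finally show ?thesis using 1 2 by simp
  qed
  ultimately show ?thesis by blast
qed

text \<open>The form operator is the only self-adjoint operator associated with the form: a self-adjoint
  operator has no proper symmetric extension.\<close>

theorem dirichlet_frac_laplacian_eq: "dirichlet_frac_laplacian \<alpha> V = dirichlet_graph"
  unfolding dirichlet_frac_laplacian_def
proof (rule the_equality)
  note Ion = L2_inner_on[OF Vb]
  have on: "u \<in> L2_on V" "f \<in> L2_on V" "u \<in> L2_space" "f \<in> L2_space" if "(u, f) \<in> dirichlet_graph" for u f
    using that by (auto simp: dirichlet_graph_def intro: H0_on H0_L2 L2_on_L2)
  have form: "(frac_form \<alpha> u v = complex_of_real (L2_inner V (\<lambda>x. - f x) v)) \<longleftrightarrow> eform \<alpha> u v = - ip f v"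
    if "u \<in> H0" "f \<in> L2_on V" "v \<in> H0" for u f v
  proof -
    have "L2_inner V (\<lambda>x. - f x) v = - ip f v"
      using Ion(1)[OF _ H0_on[OF that(3)], of "\<lambda>x. - f x"] L2_space_cmult[OF L2_on_L2[OF that(2)], of "-1"] by simp
    then show ?thesis
      unfolding frac_form_real[OF HF_L2_bd[OF H0_HF[OF that(1)]] HF_L2_bd[OF H0_HF[OF that(3)]]] by (simp flip: of_real_minus)
  qed
  show "self_adjoint_graph V dirichlet_graph \<and> Domain dirichlet_graph \<subseteq> H0 \<and>
    (\<forall>(u, f)\<in>dirichlet_graph. \<forall>v\<in>H0. frac_form \<alpha> u v = complex_of_real (L2_inner V (\<lambda>x. - f x) v))"
  proof (intro conjI)
    show "Domain dirichlet_graph \<subseteq> H0" by (auto simp: dirichlet_graph_def)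
    show "\<forall>(u, f)\<in>dirichlet_graph. \<forall>v\<in>H0. frac_form \<alpha> u v = complex_of_real (L2_inner V (\<lambda>x. - f x) v)"
      using form by (auto simp: dirichlet_graph_def)
    show "self_adjoint_graph V dirichlet_graph"
      unfolding self_adjoint_graph_def
    proof (intro conjI ballI allI impI)
      show "dirichlet_graph \<subseteq> L2_on V \<times> L2_on V" using on by auto
      show "\<exists>w\<in>Domain dirichlet_graph. L2_inner V (\<lambda>x. u x - w x) (\<lambda>x. u x - w x) < \<epsilon>" if u: "u \<in> L2_on V" and "\<epsilon> > 0" for u \<epsilon>
      proof -
        obtain w where w: "w \<in> Domain dirichlet_graph" "ip (\<lambda>x. u x - w x) (\<lambda>x. u x - w x) < \<epsilon>"
          using dirichlet_graph_dense[OF u \<open>\<epsilon> > 0\<close>] by blast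
        have "(\<lambda>x. u x - w x) \<in> L2_on V" using w(1) u on by (auto intro: L2_on_diff)
        then have "L2_inner V (\<lambda>x. u x - w x) (\<lambda>x. u x - w x) = ip (\<lambda>x. u x - w x) (\<lambda>x. u x - w x)"
          by (intro Ion L2_on_L2)
        with w(2) show ?thesis by (intro bexI[OF _ w(1)]) simp
      qed
      show "dirichlet_graph = {(v, g). v \<in> L2_on V \<and> g \<in> L2_on V \<and> (\<forall>(u, f)\<in>dirichlet_graph. L2_inner V f v = L2_inner V u g)}"
      proof (intro set_eqI iffI; clarify)
        fix v g assume vg: "(v, g) \<in> dirichlet_graph"
        show "v \<in> L2_on V \<and> g \<in> L2_on V \<and> (\<forall>(u, f)\<in>dirichlet_graph. L2_inner V f v = L2_inner V u g)"
          using on[OF vg] on dirichlet_graph_symmetric[OF _ vg] by (auto simp: Ion)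
      next
        fix v g assume v: "v \<in> L2_on V" and g: "g \<in> L2_on V" and *: "\<forall>(u, f)\<in>dirichlet_graph. L2_inner V f v = L2_inner V u g"
        show "(v, g) \<in> dirichlet_graph"
        proof (rule dirichlet_graph_adjoint[OF v g])
          fix u f assume uf: "(u, f) \<in> dirichlet_graph"
          then have "L2_inner V f v = L2_inner V u g" using * by auto
          then show "ip f v = ip u g" using on[OF uf] v g by (simp add: Ion)
        qed
      qed
    qed
  qed
  fix A assume A: "self_adjoint_graph V A \<and> Domain A \<subseteq> H0 \<and>
    (\<forall>(u, f)\<in>A. \<forall>v\<in>H0. frac_form \<alpha> u v = complex_of_real (L2_inner V (\<lambda>x. - f x) v))"
  then have adj: "A = {(v, g). v \<in> L2_on V \<and> g \<in> L2_on V \<and> (\<forall>(u, f)\<in>A. L2_inner V f v = L2_inner V u g)}"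
    and AL: "A \<subseteq> L2_on V \<times> L2_on V" by (auto simp: self_adjoint_graph_def)
  have sub: "A \<subseteq> dirichlet_graph"
  proof (clarify)
    fix u f assume uf: "(u, f) \<in> A"
    have "u \<in> H0" "f \<in> L2_on V" using uf A AL by auto
    moreover have "\<forall>v\<in>H0. frac_form \<alpha> u v = complex_of_real (L2_inner V (\<lambda>x. - f x) v)" using uf A by auto
    ultimately show "(u, f) \<in> dirichlet_graph" using form by (simp add: dirichlet_graph_def)
  qed
  have "dirichlet_graph \<subseteq> A"
  proof (clarify)
    fix v g assume vg: "(v, g) \<in> dirichlet_graph"
    have "L2_inner V f v = L2_inner V u g" if uf: "(u, f) \<in> A" for u f
      using dirichlet_graph_symmetric[OF _ vg] sub uf on[OF vg] on[of u f] by (auto simp: Ion)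
    then show "(v, g) \<in> A" by (subst adj) (use on[OF vg] in auto)
  qed
  with sub show "A = dirichlet_graph" by blast
qed

end

section \<open>Uniqueness of the ground state\<close>

text \<open>
  Equality in \<open>energy \<bar>w\<bar> \<le> energy w\<close> forces \<open>w x * w y \<ge> 0\<close> for almost all pairs, since almost
  every displacement \<open>y - x\<close> is charged by the jumps.
\<close>

lemma energy_abs_eq_imp_sign:
  fixes w :: "'a::euclidean_space \<Rightarrow> real"
  assumes \<alpha>: "0 < \<alpha>" "\<alpha> < 1" and w: "w \<in> HF \<alpha>" and eq: "energy \<alpha> (\<lambda>x. \<bar>w x\<bar>) = energy \<alpha> w"
  shows "(AE x in lborel. 0 \<le> w x) \<or> (AE x in lborel. w x \<le> 0)"
proof -
  have wb: "w \<in> L2_bd" by (rule HF_L2_bd[OF w])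
  have ab: "(\<lambda>x. \<bar>w x\<bar>) \<in> L2_bd" by (rule L2_bd_abs[OF \<alpha> wb])
  have [measurable]: "w \<in> borel_measurable borel" using wb by (intro L2_spaceD L2_bd_L2)
  let ?a = "\<lambda>h. l2sq (\<lambda>x. \<bar>w (x + h)\<bar> - \<bar>w x\<bar>)" and ?b = "\<lambda>h. l2sq (\<lambda>x. w (x + h) - w x)"
  have le: "?a h \<le> ?b h" for h by (rule l2sq_mono_AE) (auto intro: abs_triangle_ineq3)
  have bfin: "?b h < \<infinity>" for h
    using L2_space_diff[OF L2_space_translate[OF HF_L2[OF w]] HF_L2[OF w]] by (rule L2_spaceD)
  have am[measurable]: "?a \<in> borel_measurable borel" "?b \<in> borel_measurable borel" by measurable
  have int: "(\<integral>\<^sup>+h. ?a h \<partial>jump_measure \<alpha>) = (\<integral>\<^sup>+h. ?b h \<partial>jump_measure \<alpha>)"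
    unfolding jump_energy[OF wb \<alpha>(1)] jump_energy[OF ab \<alpha>(1)] eq ..
  have fin: "(\<integral>\<^sup>+h. ?a h \<partial>jump_measure \<alpha>) < \<infinity>"
    unfolding int jump_energy[OF wb \<alpha>(1)] using w jump_const_finite[OF \<alpha>] by (auto simp: HF_def ennreal_mult_less_top)
  have "(\<integral>\<^sup>+h. ?b h - ?a h \<partial>jump_measure \<alpha>) = (\<integral>\<^sup>+h. ?b h \<partial>jump_measure \<alpha>) - (\<integral>\<^sup>+h. ?a h \<partial>jump_measure \<alpha>)"
    by (rule nn_integral_diff) (use le fin in auto)
  also have "\<dots> = 0" unfolding int using fin int by simp
  finally have "(\<integral>\<^sup>+h. ?b h - ?a h \<partial>jump_measure \<alpha>) = 0" .
  then have "(\<integral>\<^sup>+p. jump_weight \<alpha> p * (?b (fst p *\<^sub>R snd p) - ?a (fst p *\<^sub>R snd p)) \<partial>lborel) = 0"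
    by (subst (asm) nn_integral_jump_pair) auto
  then have "AE p in lborel. jump_weight \<alpha> p * (?b (fst p *\<^sub>R snd p) - ?a (fst p *\<^sub>R snd p)) = 0"
    by (subst (asm) nn_integral_0_iff_AE) auto
  then have "AE p in (lborel :: real measure) \<Otimes>\<^sub>M (lborel :: 'a measure). fst p > 0 \<longrightarrow> ?b (fst p *\<^sub>R snd p) \<le> ?a (fst p *\<^sub>R snd p)"
    unfolding lborel_prod
  proof eventually_elim
    case (elim p)
    show ?case
    proof
      assume "fst p > 0"
      then have "jump_weight \<alpha> p > 0"
        by (simp add: jump_weight_def gauss_pos)
      then have "?b (fst p *\<^sub>R snd p) - ?a (fst p *\<^sub>R snd p) = 0" using elim by auto
      then show "?b (fst p *\<^sub>R snd p) \<le> ?a (fst p *\<^sub>R snd p)"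
        using bfin[of "fst p *\<^sub>R snd p"] by (auto simp: diff_eq_0_iff_ennreal)
    qed
  qed
  then have "AE \<sigma> in lborel. AE z in lborel. (\<sigma>::real) > 0 \<longrightarrow> ?b (\<sigma> *\<^sub>R z) \<le> ?a (\<sigma> *\<^sub>R z)"
    by (drule_tac lborel_pair.AE_pair) simp
  \<comment> \<open>One good scale suffices: dilation by it carries almost all \<open>z\<close> to almost all \<open>h\<close>.\<close>
  then obtain \<sigma> :: real where \<sigma>: "\<sigma> > 0" "AE z in lborel. ?b (\<sigma> *\<^sub>R z) \<le> ?a (\<sigma> *\<^sub>R z)"
  proof -
    assume ae: "AE \<sigma> in lborel. AE z in lborel. (\<sigma>::real) > 0 \<longrightarrow> ?b (\<sigma> *\<^sub>R z) \<le> ?a (\<sigma> *\<^sub>R z)"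
    have "\<exists>\<sigma>>0. AE z in lborel. ?b (\<sigma> *\<^sub>R z) \<le> ?a (\<sigma> *\<^sub>R z)"
    proof (rule ccontr)
      assume no: "\<not> ?thesis"
      from ae have "AE \<sigma> in lborel. \<sigma> \<notin> {0<..<(1::real)}"
      proof eventually_elim
        case (elim \<sigma>)
        then show ?case using no by (cases "\<sigma> > 0") auto
      qed
      from open_AE_imp_empty[OF _ this] show False by simp
    qed
    then show thesis using that by blast
  qed
  have "AE h in lborel. ?b (\<sigma> *\<^sub>R (0 + (1 / \<sigma>) *\<^sub>R h)) \<le> ?a (\<sigma> *\<^sub>R (0 + (1 / \<sigma>) *\<^sub>R h))"
    by (rule AE_affine[OF \<sigma>(2)]) (use \<sigma> in simp)
  then have "AE h in lborel. ?b h \<le> ?a h" using \<sigma>(1) by simp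
  then have "AE h in lborel. AE x in lborel. 0 \<le> w (x + h) * w x"
  proof eventually_elim
    case (elim h)
    let ?f = "\<lambda>x. ennreal ((norm (\<bar>w (x + h)\<bar> - \<bar>w x\<bar>))\<^sup>2)" and ?g = "\<lambda>x. ennreal ((norm (w (x + h) - w x))\<^sup>2)"
    have pt: "(\<bar>w (x + h)\<bar> - \<bar>w x\<bar>)\<^sup>2 \<le> (w (x + h) - w x)\<^sup>2" for x
      using abs_triangle_ineq3[of "w (x + h)" "w x"] by (metis abs_ge_zero power2_abs power_mono)
    have eqh: "?a h = ?b h" using elim le[of h] by simp
    have "(\<integral>\<^sup>+x. ?g x - ?f x \<partial>lborel) = ?b h - ?a h"
      unfolding l2sq_def
    proof (rule nn_integral_diff)
      show "(\<integral>\<^sup>+x. ?f x \<partial>lborel) \<noteq> \<infinity>" using bfin[of h] eqh by (simp add: l2sq_def)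
      show "AE x in lborel. ?f x \<le> ?g x" using pt by (intro AE_I2 ennreal_leI) simp
    qed auto
    also have "\<dots> = 0" unfolding eqh using bfin[of h] by simp
    finally have "AE x in lborel. ?g x - ?f x = 0" by (subst (asm) nn_integral_0_iff_AE) auto
    then show ?case
    proof eventually_elim
      case (elim x)
      then have "?g x \<le> ?f x" by (auto simp: diff_eq_0_iff_ennreal)
      then have "(w (x + h) - w x)\<^sup>2 \<le> (\<bar>w (x + h)\<bar> - \<bar>w x\<bar>)\<^sup>2" by simp
      then have "\<bar>w (x + h) * w x\<bar> \<le> w (x + h) * w x" by (simp add: power2_diff abs_mult)
      then show ?case by simp
    qed
  qed
  moreover have "{p \<in> space (lborel \<Otimes>\<^sub>M lborel). 0 \<le> w (fst p + snd p) * w (fst p)} \<in> sets (lborel \<Otimes>\<^sub>M lborel)"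
    by measurable
  ultimately have "AE x in lborel. AE h in lborel. 0 \<le> w (x + h) * w x"
    by (subst lborel_pair.AE_commute)
  then have pairs: "AE x in lborel. AE y in lborel. 0 \<le> w y * w x"
  proof eventually_elim
    case (elim x)
    have "AE y in lborel. 0 \<le> w (x + (- x + 1 *\<^sub>R y)) * w x" by (rule AE_affine[OF elim]) simp
    then show ?case by simp
  qed
  show ?thesis
  proof (cases "AE x in lborel. w x \<le> 0")
    case False
    have "\<exists>x. w x > 0 \<and> (AE y in lborel. 0 \<le> w y * w x)"
    proof (rule ccontr)
      assume no: "\<not> ?thesis"
      from pairs have "AE x in lborel. w x \<le> 0"
      proof eventually_elim
        case (elim x)
        then show ?case using no by (meson not_le)
      qed
      with False show False by simp
    qed
    then obtain x where x: "w x > 0" "AE y in lborel. 0 \<le> w y * w x" by blast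
    from x(2) have "AE y in lborel. 0 \<le> w y"
      by eventually_elim (use x(1) in \<open>auto simp: zero_le_mult_iff\<close>)
    then show ?thesis by simp
  qed simp
qed

definition pot :: "'a::euclidean_space set \<Rightarrow> ('a \<Rightarrow> real) \<Rightarrow> ('a \<Rightarrow> real) \<Rightarrow> ('a \<Rightarrow> real) \<Rightarrow> real" where
  "pot V q u v = L2_inner V (\<lambda>x. q x * u x) v"

definition rayleigh :: "real \<Rightarrow> 'a::euclidean_space set \<Rightarrow> ('a \<Rightarrow> real) \<Rightarrow> ('a \<Rightarrow> real) \<Rightarrow> real" where
  "rayleigh \<alpha> V q u = eform \<alpha> u u + pot V q u u"

lemma pot_eq: "pot V q u v = (LINT x|lborel. (indicator V x * q x) * (u x * v x))"
  unfolding pot_def L2_inner_def set_lebesgue_integral_def by (simp add: mult_ac)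

lemma potential_measurable:
  assumes q: "bounded_borel_nonneg_on V q" and V: "V \<in> sets borel"
  shows "(\<lambda>x. indicator V x * q x) \<in> borel_measurable borel"
proof -
  have "(\<lambda>x. indicator V x *\<^sub>R q x) \<in> borel_measurable borel"
    using q V by (subst borel_measurable_restrict_space_iff[symmetric]) (auto simp: bounded_borel_nonneg_on_def)
  then show ?thesis by simp
qed

lemma potential_nonneg:
  assumes "bounded_borel_nonneg_on V q"
  shows "0 \<le> indicator V x * q x"
  using assms by (auto simp: bounded_borel_nonneg_on_def indicator_def)

lemma potential_bounded:
  assumes q: "bounded_borel_nonneg_on V q"
  shows "\<exists>M\<ge>0. \<forall>x. indicator V x * q x \<le> M"
proof -
  obtain M where M: "\<forall>y\<in>q ` V. norm y \<le> M"
    using q unfolding bounded_borel_nonneg_on_def bounded_iff by blast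
  have "indicator V x * q x \<le> max M 0" for x using M by (auto simp: indicator_def le_max_iff_disj abs_le_iff)
  then show ?thesis by (intro exI[of _ "max M 0"]) auto
qed

lemma pot_integrable:
  assumes q: "bounded_borel_nonneg_on V q" "V \<in> sets borel" and u: "u \<in> L2_space" "v \<in> L2_space"
  shows "integrable lborel (\<lambda>x. (indicator V x * q x) * (u x * v x))"
proof -
  note [measurable] = potential_measurable[OF q]
  have nn: "0 \<le> indicator V x * q x" for x by (rule potential_nonneg[OF q(1)])
  obtain M where M: "M \<ge> 0" "\<And>x. indicator V x * q x \<le> M"
    using potential_bounded[OF q(1)] by blast
  have [measurable]: "u \<in> borel_measurable borel" "v \<in> borel_measurable borel" using u by (auto intro: L2_spaceD)
  have "integrable lborel (\<lambda>x. M * (u x * v x))" using L2_integrable_mult[OF u] by simp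
  then show ?thesis
  proof (rule Bochner_Integration.integrable_bound)
    show "AE x in lborel. norm (indicator V x * q x * (u x * v x)) \<le> norm (M * (u x * v x))"
    proof (rule AE_I2)
      fix x
      have "\<bar>indicator V x * q x\<bar> * \<bar>u x * v x\<bar> \<le> \<bar>M\<bar> * \<bar>u x * v x\<bar>"
        using M(1) nn[of x] M(2)[of x] by (intro mult_right_mono) auto
      then show "norm (indicator V x * q x * (u x * v x)) \<le> norm (M * (u x * v x))"
        by (simp add: abs_mult)
    qed
  qed measurable
qed

lemma pot_semi_inner:
  fixes q :: "'a::euclidean_space \<Rightarrow> real"
  assumes q: "bounded_borel_nonneg_on V q" "V \<in> sets borel"
  shows "semi_inner L2_space (pot V q)"
proof
  fix u v w :: "'a \<Rightarrow> real" and a b :: real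
  assume u: "u \<in> L2_space"
  have nn: "0 \<le> indicator V x * q x" for x by (rule potential_nonneg[OF q(1)])
  show "0 \<le> pot V q u u" unfolding pot_eq using nn by (intro Bochner_Integration.integral_nonneg) simp
  assume v: "v \<in> L2_space"
  show "(\<lambda>x. a * u x + b * v x) \<in> L2_space" using u v by (rule L2_space_lincomb)
  show "pot V q u v = pot V q v u" unfolding pot_eq by (simp add: mult_ac)
  assume w: "w \<in> L2_space"
  have "pot V q (\<lambda>x. a * u x + b * v x) w = (LINT x|lborel. a * ((indicator V x * q x) * (u x * w x)) + b * ((indicator V x * q x) * (v x * w x)))"
    unfolding pot_eq by (simp add: algebra_simps)
  also have "\<dots> = a * pot V q u w + b * pot V q v w"
    unfolding pot_eq using pot_integrable[OF q u w] pot_integrable[OF q v w] by simp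
  finally show "pot V q (\<lambda>x. a * u x + b * v x) w = a * pot V q u w + b * pot V q v w" .
qed

lemma pot_le_ip:
  assumes q: "bounded_borel_nonneg_on V q" "V \<in> sets borel"
  shows "\<exists>M\<ge>0. \<forall>u\<in>L2_space. pot V q u u \<le> M * ip u u"
proof -
  obtain M where M: "M \<ge> 0" "\<And>x. indicator V x * q x \<le> M"
    using potential_bounded[OF q(1)] by blast
  have "pot V q u u \<le> M * ip u u" if u: "u \<in> L2_space" for u
  proof -
    have "pot V q u u \<le> (LINT x|lborel. M * (u x * u x))"
      unfolding pot_eq using pot_integrable[OF q u u] L2_integrable_mult[OF u u] M(2)
      by (intro integral_mono) (auto intro: mult_right_mono)
    then show ?thesis by simp
  qed
  with M(1) show ?thesis by blast
qed

lemma pot_tendsto: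
  assumes q: "bounded_borel_nonneg_on V q" "V \<in> sets borel" and f: "\<And>n. f n \<in> L2_space" and u: "u \<in> L2_space"
    and lim: "(\<lambda>n. l2sq (\<lambda>x. f n x - u x)) \<longlonglongrightarrow> 0"
  shows "(\<lambda>n. pot V q (f n) (f n)) \<longlonglongrightarrow> pot V q u u"
proof -
  interpret semi_inner L2_space "pot V q" by (rule pot_semi_inner[OF q])
  obtain M where M: "M \<ge> 0" "\<And>u. u \<in> L2_space \<Longrightarrow> pot V q u u \<le> M * ip u u"
    using pot_le_ip[OF q] by blast
  note d = L2_space_diff[OF f u]
  have "(\<lambda>n. enn2real (l2sq (\<lambda>x. f n x - u x))) \<longlonglongrightarrow> 0"
    by (rule tendsto_enn2real) (use lim in simp_all)
  then have "(\<lambda>n. ip (\<lambda>x. f n x - u x) (\<lambda>x. f n x - u x)) \<longlonglongrightarrow> 0"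
    using integral_square_eq_l2sq(2)[OF d] by (simp add: power2_eq_square)
  then have z: "(\<lambda>n. M * ip (\<lambda>x. f n x - u x) (\<lambda>x. f n x - u x)) \<longlonglongrightarrow> 0"
    by (rule tendsto_mult_right_zero)
  have "(\<lambda>n. pot V q (\<lambda>x. f n x - u x) (\<lambda>x. f n x - u x)) \<longlonglongrightarrow> 0"
  proof (rule Lim_null_comparison[OF always_eventually z], rule allI)
    fix n
    show "norm (pot V q (\<lambda>x. f n x - u x) (\<lambda>x. f n x - u x)) \<le> M * ip (\<lambda>x. f n x - u x) (\<lambda>x. f n x - u x)"
      using M(2)[OF d[of n]] nonneg[OF d[of n]] by simp
  qed
  then show ?thesis by (intro tendsto_quad f u)
qed

context
  fixes \<alpha> :: real and V :: "'a::euclidean_space set" and q :: "'a \<Rightarrow> real"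
  assumes \<alpha>: "0 < \<alpha>" "\<alpha> < 1" and V: "open V" "bounded V" and q: "bounded_borel_nonneg_on V q"
begin

abbreviation (input) "H \<equiv> H0_frac \<alpha> V"
abbreviation (input) "pev \<equiv> principal_eigenvalue \<alpha> V q"

lemma Vborel: "V \<in> sets borel" using V by simp

lemmas H_HF = H0_HF[OF \<alpha> V] and H_on = H0_on[OF \<alpha> V] and H_L2 = H0_L2[OF \<alpha> V]

lemma eigenfunction_weak:
  assumes eig: "eigenfunction \<alpha> V q \<mu> u"
  shows "u \<in> H" "\<And>v. v \<in> H \<Longrightarrow> eform \<alpha> u v + pot V q u v = \<mu> * ip u v"
proof -
  obtain f where uf: "(u, f) \<in> dirichlet_graph \<alpha> V" and eq: "AE x in lborel. x \<in> V \<longrightarrow> - f x + q x * u x = \<mu> * u x"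
    using eig unfolding eigenfunction_def dirichlet_frac_laplacian_eq[OF \<alpha> V] by blast
  have u: "u \<in> H" and f: "f \<in> L2_on V" and E: "\<And>v. v \<in> H \<Longrightarrow> eform \<alpha> u v = - ip f v"
    using uf by (auto simp: dirichlet_graph_def[OF \<alpha> V])
  show "u \<in> H" by (rule u)
  fix v assume v: "v \<in> H"
  interpret I: semi_inner L2_space "ip :: ('a \<Rightarrow> real) \<Rightarrow> _" by (rule integral_mult_semi_inner)
  have [measurable]: "(\<lambda>x. indicator V x * q x) \<in> borel_measurable borel"
    by (rule potential_measurable[OF q Vborel])
  note L = H_L2[OF u] L2_on_L2[OF f] H_L2[OF v]
  have [measurable]: "u \<in> borel_measurable borel" "f \<in> borel_measurable borel" "v \<in> borel_measurable borel" using L by (auto intro: L2_spaceD)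
  have "pot V q u v = ip (\<lambda>x. \<mu> * u x + 1 * f x) v"
    unfolding pot_eq
  proof (rule integral_cong_AE)
    show "(\<lambda>x. indicator V x * q x * (u x * v x)) \<in> borel_measurable lborel" "(\<lambda>x. (\<mu> * u x + 1 * f x) * v x) \<in> borel_measurable lborel"
      by measurable
    have "AE x in lborel. x \<notin> V \<longrightarrow> v x = 0" using H_on[OF v] by (simp add: L2_on_def)
    then show "AE x in lborel. indicator V x * q x * (u x * v x) = (\<mu> * u x + 1 * f x) * v x"
      using eq
    proof eventually_elim
      case (elim x)
      show ?case
      proof (cases "x \<in> V")
        case True
        then have "q x * u x = \<mu> * u x + f x" using elim by simp
        then show ?thesis using True by (simp add: mult.assoc[symmetric])
      qed (use elim in simp)
    qed
  qed
  also have "\<dots> = \<mu> * ip u v + ip f v" using I.bilin[OF L, of \<mu> 1] by simp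
  finally show "eform \<alpha> u v + pot V q u v = \<mu> * ip u v" using E[OF v] by simp
qed

lemma ev_eq: "pev = Inf {rayleigh \<alpha> V q u | u. u \<in> H \<and> ip u u = 1}"
proof -
  have "L2_inner V u u = ip u u" if "u \<in> H" for u
    using L2_inner_on[OF Vborel H_L2[OF that] H_on[OF that]] by simp
  then have "{Re (frac_form \<alpha> u u) + L2_inner V (\<lambda>x. q x * u x) u | u. u \<in> H \<and> L2_inner V u u = 1} = {rayleigh \<alpha> V q u | u. u \<in> H \<and> ip u u = 1}"
    unfolding rayleigh_def eform_def pot_def by (intro Collect_cong) metis
  then show ?thesis unfolding principal_eigenvalue_def by simp
qed

lemma rayleigh_nonneg: "u \<in> H \<Longrightarrow> 0 \<le> rayleigh \<alpha> V q u"
  unfolding rayleigh_def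
  using eform_energy(3)[OF H_HF] semi_inner.nonneg[OF pot_semi_inner[OF q Vborel] H_L2] by fastforce

lemma ev_le: "u \<in> H \<Longrightarrow> ip u u = 1 \<Longrightarrow> pev \<le> rayleigh \<alpha> V q u"
  unfolding ev_eq by (rule cInf_lower) (auto intro!: bdd_belowI[of _ 0] rayleigh_nonneg)

text \<open>
  Test functions approximate the indicator of \<open>V\<close>, so one of them is not null. In particular the infimum that defines the
  eigenvalue runs over a nonempty set.
\<close>

lemma normalised_exists:
  assumes "V \<noteq> {}"
  obtains u where "u \<in> H" "ip u u = 1"
proof -
  have [measurable]: "V \<in> sets borel" by (rule Vborel)
  define u where "u = (indicator V :: 'a \<Rightarrow> real)"
  have "ennreal ((norm (u x))\<^sup>2) = indicator V x" for x by (simp add: u_def indicator_def)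
  then have l: "l2sq u = emeasure lborel V" unfolding l2sq_def by simp
  have fin: "emeasure lborel V < \<infinity>"
    using bounded_subset_ballD[OF V(2), of 0] emeasure_mono[of V "ball 0 _" lborel] emeasure_lborel_ball_finite
    by (metis borel_open infinity_ennreal_def open_ball order_le_less_trans sets_lborel)
  have uV: "u \<in> L2_on V" using fin l[symmetric] by (auto simp: u_def L2_on_def L2_space_iff)
  have "emeasure lborel V \<noteq> 0"
  proof
    assume "emeasure lborel V = 0"
    then have "AE x in lborel. x \<notin> V" by (intro AE_not_in) (auto simp: null_sets_def)
    then show False using open_AE_imp_empty[OF V(1)] assms by blast
  qed
  then obtain e where e: "e > 0" "ennreal e < emeasure lborel V" using ennreal_dense_pos by (metis not_gr_zero)
  obtain \<phi> where \<phi>: "\<phi> \<in> test_functions V" "l2sq (\<lambda>x. u x - \<phi> x) < ennreal e"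
    using test_functions_dense[OF \<alpha> V uV e(1)] by blast
  have p: "\<phi> \<in> H" by (rule test_functions_H0[OF \<alpha> V \<phi>(1)])
  have "ip \<phi> \<phi> \<noteq> 0"
  proof
    assume "ip \<phi> \<phi> = 0"
    then have "AE x in lborel. \<phi> x = 0" by (rule ip_zero_imp_AE[OF H_L2[OF p]])
    then have "l2sq (\<lambda>x. u x - \<phi> x) = l2sq u" by (intro l2sq_cong_AE) auto
    with \<phi>(2) e(2) l show False by simp
  qed
  then have pos: "ip \<phi> \<phi> > 0" using ip_nonneg[of \<phi>] by linarith
  interpret I: semi_inner L2_space "ip :: ('a \<Rightarrow> real) \<Rightarrow> _" by (rule integral_mult_semi_inner)
  let ?s = "1 / sqrt (ip \<phi> \<phi>)"
  have "(\<lambda>x. ?s * \<phi> x) \<in> H" using H0_lincomb[OF \<alpha> V p p, of ?s 0] by simp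
  moreover have "ip (\<lambda>x. ?s * \<phi> x) (\<lambda>x. ?s * \<phi> x) = 1"
    using I.scale_quad[OF H_L2[OF p], of ?s] pos by (simp add: power_divide)
  ultimately show thesis by (rule that)
qed

lemma ev_greatest:
  assumes "V \<noteq> {}" "\<And>u. u \<in> H \<Longrightarrow> ip u u = 1 \<Longrightarrow> m \<le> rayleigh \<alpha> V q u"
  shows "m \<le> pev"
  unfolding ev_eq using normalised_exists[OF assms(1)] assms(2) by (intro cInf_greatest) blast+

lemma ev_approx:
  assumes "V \<noteq> {}" "e > 0"
  obtains u where "u \<in> H" "ip u u = 1" "rayleigh \<alpha> V q u < pev + e"
proof -
  have "\<exists>y\<in>{rayleigh \<alpha> V q u | u. u \<in> H \<and> ip u u = 1}. y < pev + e"
  proof (rule cInf_lessD)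
    show "{rayleigh \<alpha> V q u | u. u \<in> H \<and> ip u u = 1} \<noteq> {}" using normalised_exists[OF assms(1)] by blast
    show "Inf {rayleigh \<alpha> V q u | u. u \<in> H \<and> ip u u = 1} < pev + e" using assms(2) unfolding ev_eq by simp
  qed
  then show thesis using that by blast
qed

lemma rayleigh_scale:
  assumes u: "u \<in> H"
  shows "rayleigh \<alpha> V q (\<lambda>x. s * u x) = s\<^sup>2 * rayleigh \<alpha> V q u"
  unfolding rayleigh_def
  using semi_inner.scale_quad[OF eform_semi_inner H_HF[OF u], of s] semi_inner.scale_quad[OF pot_semi_inner[OF q Vborel] H_L2[OF u], of s]
  by (simp add: distrib_left)

lemma ev_le_scaled:
  assumes u: "u \<in> H"
  shows "pev * ip u u \<le> rayleigh \<alpha> V q u"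
proof (cases "ip u u = 0")
  case True
  then show ?thesis using rayleigh_nonneg[OF u] by simp
next
  case False
  then have pos: "ip u u > 0" using ip_nonneg[of u] by linarith
  interpret I: semi_inner L2_space "ip :: ('a \<Rightarrow> real) \<Rightarrow> _" by (rule integral_mult_semi_inner)
  let ?s = "1 / sqrt (ip u u)"
  have s2: "?s\<^sup>2 = 1 / ip u u" using pos by (simp add: power_divide)
  have "(\<lambda>x. ?s * u x) \<in> H" using H0_lincomb[OF \<alpha> V u u, of ?s 0] by simp
  moreover have "ip (\<lambda>x. ?s * u x) (\<lambda>x. ?s * u x) = 1"
    using I.scale_quad[OF H_L2[OF u], of ?s] pos by (simp add: power_divide)
  ultimately have "pev \<le> rayleigh \<alpha> V q (\<lambda>x. ?s * u x)" by (rule ev_le)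
  also have "\<dots> = 1 / ip u u * rayleigh \<alpha> V q u" using rayleigh_scale[OF u, of ?s] unfolding s2 .
  finally show ?thesis using pos by (simp add: field_simps)
qed

text \<open>Minimisers of the Rayleigh quotient are the null vectors of this positive semidefinite form.\<close>

definition shifted_form :: "('a \<Rightarrow> real) \<Rightarrow> ('a \<Rightarrow> real) \<Rightarrow> real" where
  "shifted_form u v = eform \<alpha> u v + pot V q u v - pev * ip u v"

lemma shifted_semi_inner: "semi_inner H shifted_form"
proof -
  interpret E: semi_inner "HF \<alpha> :: ('a \<Rightarrow> real) set" "eform \<alpha>" by (rule eform_semi_inner)
  interpret P: semi_inner L2_space "pot V q" by (rule pot_semi_inner[OF q Vborel])
  interpret I: semi_inner L2_space "ip :: ('a \<Rightarrow> real) \<Rightarrow> _" by (rule integral_mult_semi_inner)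
  show ?thesis
  proof
    fix u v w :: "'a \<Rightarrow> real" and a b :: real
    assume u: "u \<in> H"
    show "0 \<le> shifted_form u u" using ev_le_scaled[OF u] by (simp add: shifted_form_def rayleigh_def)
    assume v: "v \<in> H"
    show "(\<lambda>x. a * u x + b * v x) \<in> H" by (rule H0_lincomb[OF \<alpha> V u v])
    show "shifted_form u v = shifted_form v u"
      unfolding shifted_form_def E.sym[OF H_HF[OF u] H_HF[OF v]] P.sym[OF H_L2[OF u] H_L2[OF v]] I.sym[OF H_L2[OF u] H_L2[OF v]] ..
    assume w: "w \<in> H"
    show "shifted_form (\<lambda>x. a * u x + b * v x) w = a * shifted_form u w + b * shifted_form v w"
      unfolding shifted_form_def E.bilin[OF H_HF[OF u] H_HF[OF v] H_HF[OF w]] P.bilin[OF H_L2[OF u] H_L2[OF v] H_L2[OF w]]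
        I.bilin[OF H_L2[OF u] H_L2[OF v] H_L2[OF w]]
      by (simp add: algebra_simps del: integral_mult_right_zero integral_mult_left_zero)
  qed
qed

text \<open>
  Subtract from \<open>u\<close> its projection on \<open>\<psi>\<close>. The rest \<open>w\<close> is a null vector of \<open>shifted_form\<close> and orthogonal to \<open>\<psi>\<close>. As
  \<open>\<bar>w\<bar>\<close> has no larger energy and is admissible, its energy equals that of \<open>w\<close>, so \<open>w\<close> has one sign; being orthogonal to
  the positive \<open>\<psi>\<close>, it vanishes.
\<close>

theorem ground_state_unique:
  assumes lip: "lipschitz_domain V" and u: "u \<in> H" "ip u u = 1" "rayleigh \<alpha> V q u = pev" "AE x in lborel. 0 \<le> u x"
    and \<psi>: "is_principal_eigenfunction \<alpha> V q \<psi>"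
  shows "AE x in lborel. u x = \<psi> x"
proof -
  interpret T: semi_inner H shifted_form by (rule shifted_semi_inner)
  interpret I: semi_inner L2_space "ip :: ('a \<Rightarrow> real) \<Rightarrow> _" by (rule integral_mult_semi_inner)
  have eig: "eigenfunction \<alpha> V q pev \<psi>" and pos: "\<And>x. x \<in> V \<Longrightarrow> \<psi> x > 0" and zero: "\<And>x. x \<notin> V \<Longrightarrow> \<psi> x = 0" and "L2_inner V \<psi> \<psi> = 1"
    using \<psi> by (auto simp: is_principal_eigenfunction_def)
  note weak = eigenfunction_weak[OF eig]
  note \<psi>H = weak(1)
  have \<psi>1: "ip \<psi> \<psi> = 1" using L2_inner_on(1)[OF Vborel H_L2[OF \<psi>H] H_on[OF \<psi>H]] \<open>L2_inner V \<psi> \<psi> = 1\<close> by simp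
  have T\<psi>: "shifted_form \<psi> \<psi> = 0" using weak(2)[OF \<psi>H] by (simp add: shifted_form_def)
  have Tu: "shifted_form u u = 0" using u(2,3) by (simp add: shifted_form_def rayleigh_def)
  have Tu\<psi>: "shifted_form u \<psi> = 0" using T.Cauchy_Schwarz[OF u(1) \<psi>H] Tu by simp
  define s where "s = ip u \<psi>"
  define w where "w x = 1 * u x + (- s) * \<psi> x" for x
  have wH: "w \<in> H" unfolding w_def by (rule H0_lincomb[OF \<alpha> V u(1) \<psi>H])
  have [measurable]: "w \<in> borel_measurable borel" "\<psi> \<in> borel_measurable borel" "u \<in> borel_measurable borel"
    using H_L2[OF wH] H_L2[OF \<psi>H] H_L2[OF u(1)] by (auto intro: L2_spaceD)
  have Tw: "shifted_form w w = 0"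
    unfolding w_def using T.quad[OF u(1) \<psi>H, of 1 "- s"] Tu T\<psi> Tu\<psi> by simp
  have w\<psi>: "ip w \<psi> = 0"
    unfolding w_def using I.bilin[OF H_L2[OF u(1)] H_L2[OF \<psi>H] H_L2[OF \<psi>H], of 1 "- s"] \<psi>1 by (simp add: s_def)
  let ?a = "\<lambda>x. \<bar>w x\<bar>"
  have aB: "?a \<in> L2_bd" by (rule L2_bd_abs[OF \<alpha> HF_L2_bd[OF H_HF[OF wH]]])
  have ale: "energy \<alpha> ?a \<le> energy \<alpha> w" by (rule energy_abs_le[OF \<alpha> HF_L2_bd[OF H_HF[OF wH]]])
  then have aHF: "?a \<in> HF \<alpha>" using aB H_HF[OF wH] by (auto simp: HF_def)
  have off: "AE x in lborel. x \<notin> V \<longrightarrow> w x = 0" using H_on[OF wH] by (simp add: L2_on_def)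
  have aH: "?a \<in> H"
  proof (rule lipschitz_domain_H0[OF \<alpha> V lip aHF])
    show "AE y in lborel. y \<notin> closure V \<longrightarrow> \<bar>w y\<bar> = 0"
      using off by eventually_elim (use closure_subset[of V] in auto)
  qed
  have "0 \<le> shifted_form ?a ?a" by (rule T.nonneg[OF aH])
  moreover have "pot V q ?a ?a = pot V q w w" "ip ?a ?a = ip w w" by (simp_all add: pot_eq)
  ultimately have "eform \<alpha> w w \<le> eform \<alpha> ?a ?a" using Tw by (simp add: shifted_form_def)
  then have "energy \<alpha> w \<le> energy \<alpha> ?a"
    using eform_energy(1)[OF aHF] eform_energy(1)[OF H_HF[OF wH]] by (metis ennreal_leI)
  then have "energy \<alpha> ?a = energy \<alpha> w" using ale by simp
  then have sign: "(AE x in lborel. 0 \<le> w x) \<or> (AE x in lborel. w x \<le> 0)"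
    by (rule energy_abs_eq_imp_sign[OF \<alpha> H_HF[OF wH]])
  have \<psi>0: "0 \<le> \<psi> x" for x using pos[of x] zero[of x] by (cases "x \<in> V") auto
  have int: "integrable lborel (\<lambda>x. w x * \<psi> x)" by (rule L2_integrable_mult[OF H_L2[OF wH] H_L2[OF \<psi>H]])
  have "AE x in lborel. w x * \<psi> x = 0"
    using sign
  proof
    assume s: "AE x in lborel. 0 \<le> w x"
    have "AE x in lborel. 0 \<le> w x * \<psi> x" using s by eventually_elim (use \<psi>0 in auto)
    then show ?thesis using integral_nonneg_eq_0_iff_AE[OF int] w\<psi> by simp
  next
    assume s: "AE x in lborel. w x \<le> 0"
    have "AE x in lborel. 0 \<le> - (w x * \<psi> x)" using s by eventually_elim (use \<psi>0 in \<open>auto simp: mult_nonpos_nonneg\<close>)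
    moreover have "integrable lborel (\<lambda>x. - (w x * \<psi> x))" using int by simp
    ultimately have "AE x in lborel. - (w x * \<psi> x) = 0"
      using w\<psi> by (subst integral_nonneg_eq_0_iff_AE[symmetric]) auto
    then show ?thesis by simp
  qed
  with off have w0: "AE x in lborel. w x = 0"
    by eventually_elim (use pos in force)
  then have us: "AE x in lborel. u x = s * \<psi> x" by eventually_elim (simp add: w_def)
  have "ip u u = ip (\<lambda>x. s * \<psi> x) (\<lambda>x. s * \<psi> x)"
    by (rule ip_cong_AE[OF us us]) auto
  then have "s\<^sup>2 = 1" using u(2) I.scale_quad[OF H_L2[OF \<psi>H], of s] \<psi>1 by simp
  moreover have "0 \<le> s"
    unfolding s_def by (rule integral_nonneg_AE) (use u(4) \<psi>0 in auto)
  ultimately have "s = 1" by (simp add: power2_eq_1_iff)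
  with us show ?thesis by simp
qed

end

section \<open>Capacity and quasi-everywhere convergence\<close>

lemma square_le_suminf:
  fixes a :: "nat \<Rightarrow> real"
  assumes "(\<Sum>n. ennreal ((a n)\<^sup>2)) < \<infinity>"
  shows "\<bar>a n\<bar> \<le> sqrt (enn2real (\<Sum>n. ennreal ((a n)\<^sup>2)))"
proof -
  define T where "T = (\<Sum>n. ennreal ((a n)\<^sup>2))"
  have "sum (\<lambda>n. ennreal ((a n)\<^sup>2)) {n} \<le> T"
    unfolding T_def by (rule sum_le_suminf) (rule summableI, rule finite.intros, rule finite.intros, rule zero_le)
  then have "ennreal ((a n)\<^sup>2) \<le> T" by (simp only: sum.insert finite.emptyI empty_iff not_False_eq_True sum.empty add_0_right)
  also have "T = ennreal (enn2real T)"
    by (rule ennreal_enn2real[symmetric]) (use assms in \<open>simp add: T_def\<close>)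
  finally have "(a n)\<^sup>2 \<le> enn2real T" by (simp add: ennreal_le_iff)
  then show ?thesis unfolding T_def[symmetric] by (intro real_le_rsqrt) simp
qed

lemma enn2real_SUP:
  fixes a :: "nat \<Rightarrow> real"
  assumes "\<And>n. 0 \<le> a n" "\<And>n. a n \<le> M"
  shows "a n \<le> enn2real (SUP n. ennreal (a n))" "enn2real (SUP n. ennreal (a n)) \<le> M"
proof -
  have le: "(SUP n. ennreal (a n)) \<le> ennreal M" by (intro SUP_least ennreal_leI assms)
  then have "ennreal (enn2real (SUP n. ennreal (a n))) = (SUP n. ennreal (a n))"
    by (intro ennreal_enn2real order_le_less_trans[OF le]) simp
  then have "ennreal (a n) \<le> ennreal (enn2real (SUP n. ennreal (a n)))" by (metis SUP_upper UNIV_I)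
  then show "a n \<le> enn2real (SUP n. ennreal (a n))" by simp
  show "enn2real (SUP n. ennreal (a n)) \<le> M"
    using le order_trans[OF assms(1)[of 0] assms(2)[of 0]] by (rule enn2real_leI[rotated])
qed

text \<open>
  Countable subadditivity of capacity comes from this supremum: \<open>(sup f)(x) - (sup f)(y)\<close> is bounded by
  the \<open>\<ell>\<^sup>2\<close>-norm of the differences \<open>f n x - f n y\<close>, so the squared norms add up.
\<close>

lemma sup_HF:
  fixes f :: "nat \<Rightarrow> 'a::euclidean_space \<Rightarrow> real"
  assumes \<alpha>: "0 < \<alpha>" "\<alpha> < 1" and f: "\<And>n. f n \<in> HF \<alpha>" and nn: "\<And>n x. 0 \<le> f n x"
    and R: "R > 0" "\<And>n. AE x in lborel. x \<notin> ball 0 R \<longrightarrow> f n x = 0"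
    and fin: "(\<Sum>n. Hn \<alpha> (f n)) < \<infinity>"
  shows "\<exists>g\<in>HF \<alpha>. Hn \<alpha> g \<le> (\<Sum>n. Hn \<alpha> (f n)) \<and> (AE x in lborel. \<forall>n. f n x \<le> g x)"
proof -
  have [measurable]: "f n \<in> borel_measurable borel" for n using HF_L2[OF f] by (rule L2_spaceD)
  define Q where "Q x = (\<Sum>n. ennreal ((f n x)\<^sup>2))" for x
  define g where "g x = enn2real (SUP n. ennreal (f n x))" for x
  have [measurable]: "g \<in> borel_measurable borel" "Q \<in> borel_measurable borel" unfolding g_def Q_def by measurable
  have split: "(\<Sum>n. Hn \<alpha> (f n)) = (\<Sum>n. energy \<alpha> (f n)) + (\<Sum>n. l2sq (f n))"
    unfolding Hn_def by (rule suminf_add[symmetric]) auto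
  have "(\<integral>\<^sup>+x. Q x \<partial>lborel) = (\<Sum>n. \<integral>\<^sup>+x. ennreal ((f n x)\<^sup>2) \<partial>lborel)"
    unfolding Q_def by (rule nn_integral_suminf) measurable
  also have "\<dots> = (\<Sum>n. l2sq (f n))" by (simp only: l2sq_def real_norm_def power2_abs)
  finally have "(\<integral>\<^sup>+x. Q x \<partial>lborel) = (\<Sum>n. l2sq (f n))" .
  then have IQ: "(\<integral>\<^sup>+x. Q x \<partial>lborel) = (\<Sum>n. l2sq (f n))" "(\<integral>\<^sup>+x. Q x \<partial>lborel) \<noteq> \<infinity>"
    using fin unfolding split by auto
  have Qfin: "AE x in lborel. Q x < \<infinity>"
    using nn_integral_PInf_AE[OF _ IQ(2)] by (simp add: less_top)
  have bound: "f n x \<le> sqrt (enn2real (Q x))" if "Q x < \<infinity>" for n x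
    using square_le_suminf[of "\<lambda>n. f n x" n] that unfolding Q_def by (simp add: abs_le_iff)
  have up: "f n x \<le> g x" if "Q x < \<infinity>" for n x
    unfolding g_def using nn bound[OF that] by (rule enn2real_SUP)
  have g0: "0 \<le> g x" for x by (simp add: g_def)
  have low: "g x \<le> M" if "\<And>n. f n x \<le> M" for x M
    unfolding g_def using nn that by (rule enn2real_SUP)
  have gQ: "ennreal ((g x)\<^sup>2) \<le> Q x" if "Q x < \<infinity>" for x
  proof -
    have "(g x)\<^sup>2 \<le> (sqrt (enn2real (Q x)))\<^sup>2" by (intro power_mono low bound that g0)
    then have "ennreal ((g x)\<^sup>2) \<le> ennreal (enn2real (Q x))" by (intro ennreal_leI) simp
    also have "\<dots> = Q x" by (rule ennreal_enn2real) (use that in simp)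
    finally show ?thesis .
  qed
  have diff: "ennreal ((g x - g y)\<^sup>2) \<le> (\<Sum>n. ennreal ((f n x - f n y)\<^sup>2))" if "Q x < \<infinity>" "Q y < \<infinity>" for x y
  proof (cases "(\<Sum>n. ennreal ((f n x - f n y)\<^sup>2)) < \<infinity>")
    case True
    let ?t = "sqrt (enn2real (\<Sum>n. ennreal ((f n x - f n y)\<^sup>2)))"
    have t: "\<bar>f n x - f n y\<bar> \<le> ?t" for n by (rule square_le_suminf[OF True])
    have "g x \<le> g y + ?t"
    proof (rule low)
      fix n show "f n x \<le> g y + ?t" using t[of n] up[OF that(2), of n] by linarith
    qed
    moreover have "g y \<le> g x + ?t"
    proof (rule low)
      fix n show "f n y \<le> g x + ?t" using t[of n] up[OF that(1), of n] by linarith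
    qed
    ultimately have "\<bar>g x - g y\<bar> \<le> ?t" by linarith
    then have "(g x - g y)\<^sup>2 \<le> ?t\<^sup>2" by (metis abs_ge_zero power2_abs power_mono)
    then have "ennreal ((g x - g y)\<^sup>2) \<le> ennreal (enn2real (\<Sum>n. ennreal ((f n x - f n y)\<^sup>2)))"
      by (intro ennreal_leI) simp
    also have "\<dots> = (\<Sum>n. ennreal ((f n x - f n y)\<^sup>2))"
      by (rule ennreal_enn2real) (use True in \<open>simp only: infinity_ennreal_def\<close>)
    finally show ?thesis .
  qed (simp add: less_top[symmetric])
  have lg: "l2sq g \<le> (\<Sum>n. l2sq (f n))"
    unfolding l2sq_def[of g] IQ(1)[symmetric]
    by (rule nn_integral_mono_AE) (use Qfin in eventually_elim, use gQ in simp)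
  have gL2: "g \<in> L2_space"
    using lg fin unfolding split by (auto simp: L2_space_iff intro: order_le_less_trans)
  have "AE x in lborel. \<forall>n. x \<notin> ball 0 R \<longrightarrow> f n x = 0" unfolding AE_all_countable using R(2) by blast
  then have "AE x in lborel. x \<notin> ball 0 R \<longrightarrow> g x = 0" by eventually_elim (auto simp: g_def)
  with gL2 R(1) have gbd: "g \<in> L2_bd" unfolding L2_bd_def by blast
  have lh: "l2sq (\<lambda>x. g (x + h) - g x) \<le> (\<Sum>n. l2sq (\<lambda>x. f n (x + h) - f n x))" for h
  proof -
    have "AE x in lborel. Q (h + 1 *\<^sub>R x) < \<infinity>" by (rule AE_affine[OF Qfin]) simp
    with Qfin have "AE x in lborel. ennreal ((norm (g (x + h) - g x))\<^sup>2) \<le> (\<Sum>n. ennreal ((f n (x + h) - f n x)\<^sup>2))"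
    proof eventually_elim
      case (elim x)
      have "Q (x + h) < \<infinity>" using elim(2) by (simp add: add.commute)
      from diff[OF this elim(1)] show ?case by (simp only: real_norm_def power2_abs)
    qed
    then have "l2sq (\<lambda>x. g (x + h) - g x) \<le> (\<integral>\<^sup>+x. (\<Sum>n. ennreal ((f n (x + h) - f n x)\<^sup>2)) \<partial>lborel)"
      unfolding l2sq_def by (rule nn_integral_mono_AE)
    also have "\<dots> = (\<Sum>n. \<integral>\<^sup>+x. ennreal ((f n (x + h) - f n x)\<^sup>2) \<partial>lborel)"
      by (rule nn_integral_suminf) measurable
    also have "\<dots> = (\<Sum>n. l2sq (\<lambda>x. f n (x + h) - f n x))"
      by (simp only: l2sq_def real_norm_def power2_abs)
    finally show ?thesis .
  qed
  have "jump_const \<alpha> * energy \<alpha> g = (\<integral>\<^sup>+h. l2sq (\<lambda>x. g (x + h) - g x) \<partial>jump_measure \<alpha>)"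
    by (rule jump_energy[OF gbd \<alpha>(1), symmetric])
  also have "\<dots> \<le> (\<integral>\<^sup>+h. (\<Sum>n. l2sq (\<lambda>x. f n (x + h) - f n x)) \<partial>jump_measure \<alpha>)"
    by (intro nn_integral_mono lh)
  also have "\<dots> = (\<Sum>n. \<integral>\<^sup>+h. l2sq (\<lambda>x. f n (x + h) - f n x) \<partial>jump_measure \<alpha>)"
    by (rule nn_integral_suminf) measurable
  also have "\<dots> = jump_const \<alpha> * (\<Sum>n. energy \<alpha> (f n))"
    unfolding jump_energy[OF HF_L2_bd[OF f] \<alpha>(1)] by simp
  finally have eg: "energy \<alpha> g \<le> (\<Sum>n. energy \<alpha> (f n))" by (simp add: jump_const_cancel[OF \<alpha>])
  have "energy \<alpha> g < \<infinity>" using eg fin unfolding split by (auto intro: order_le_less_trans)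
  then have "g \<in> HF \<alpha>" using gbd by (simp add: HF_def)
  moreover have "Hn \<alpha> g \<le> (\<Sum>n. Hn \<alpha> (f n))" unfolding split unfolding Hn_def by (intro add_mono eg lg)
  moreover have "AE x in lborel. \<forall>n. f n x \<le> g x" using Qfin by eventually_elim (use up in auto)
  ultimately show ?thesis by blast
qed

lemma Hn_scaled_abs_le:
  fixes u :: "'a::euclidean_space \<Rightarrow> real"
  assumes \<alpha>: "0 < \<alpha>" "\<alpha> < 1" and u: "u \<in> HF \<alpha>"
  shows "(\<lambda>x. t * \<bar>u x\<bar>) \<in> HF \<alpha>" "Hn \<alpha> (\<lambda>x. t * \<bar>u x\<bar>) \<le> ennreal (t\<^sup>2) * Hn \<alpha> u"
proof -
  have a: "(\<lambda>x. \<bar>u x\<bar>) \<in> HF \<alpha>"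
    using L2_bd_abs[OF \<alpha> HF_L2_bd[OF u]] energy_abs_le[OF \<alpha> HF_L2_bd[OF u]] u by (auto simp: HF_def)
  show s: "(\<lambda>x. t * \<bar>u x\<bar>) \<in> HF \<alpha>" using HF_lincomb[OF a a, of t 0] by simp
  have "Hn \<alpha> (\<lambda>x. t * \<bar>u x\<bar>) = ennreal (t\<^sup>2 * (eform \<alpha> (\<lambda>x. \<bar>u x\<bar>) (\<lambda>x. \<bar>u x\<bar>) + ip (\<lambda>x. \<bar>u x\<bar>) (\<lambda>x. \<bar>u x\<bar>)))"
    unfolding Hn_eq[OF s]
    using semi_inner.scale_quad[OF eform_semi_inner a, of t] semi_inner.scale_quad[OF integral_mult_semi_inner HF_L2[OF a], of t]
    by (simp add: distrib_left)
  also have "\<dots> = ennreal (t\<^sup>2) * Hn \<alpha> (\<lambda>x. \<bar>u x\<bar>)"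
    unfolding Hn_eq[OF a] using eform_energy(3)[OF a] ip_nonneg by (intro ennreal_mult) (auto intro: add_nonneg_nonneg)
  also have "\<dots> \<le> ennreal (t\<^sup>2) * Hn \<alpha> u"
    using energy_abs_le[OF \<alpha> HF_L2_bd[OF u]] unfolding Hn_def by (intro mult_left_mono add_mono) (auto simp: l2sq_def)
  finally show "Hn \<alpha> (\<lambda>x. t * \<bar>u x\<bar>) \<le> ennreal (t\<^sup>2) * Hn \<alpha> u" .
qed

text \<open>
  The set where \<open>\<bar>v n\<bar>\<close> exceeds \<open>2\<^sup>-\<^sup>n\<close> for some \<open>n \<ge> m\<close> is open, and the supremum of the functions
  \<open>2\<^sup>n \<bar>v n\<bar>\<close>, \<open>n \<ge> m\<close>, is at least 1 on it; its squared norm is at most \<open>\<Sum>n\<ge>m. 4\<^sup>n 8\<^sup>-\<^sup>n\<close>.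
\<close>

lemma quasi_everywhere_tendsto_zero:
  fixes v :: "nat \<Rightarrow> 'a::euclidean_space \<Rightarrow> real"
  assumes \<alpha>: "0 < \<alpha>" "\<alpha> < 1" and v: "\<And>n. v n \<in> HF \<alpha>" and U: "open U" and cont: "\<And>n. continuous_on U (v n)"
    and R: "R > 0" "\<And>n. AE x in lborel. x \<notin> ball 0 R \<longrightarrow> v n x = 0"
    and small: "\<And>n. Hn \<alpha> (v n) \<le> ennreal ((1 / 8) ^ n)"
  shows "quasi_everywhere \<alpha> U (\<lambda>x. (\<lambda>n. v n x) \<longlonglongrightarrow> 0)"
proof -
  define W where "W m = (\<Union>n. U \<inter> (\<lambda>x. \<bar>v (n + m) x\<bar>) -` {(1 / 2) ^ (n + m)<..})" for m
  have Wo: "open (W m)" for m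
    unfolding W_def by (intro open_UN ballI continuous_open_preimage U continuous_intros cont open_greaterThan)
  have cap: "Cap_open \<alpha> (W m) \<le> ennreal (2 * (1 / 2) ^ m)" for m
  proof -
    define f where "f n x = 2 ^ (n + m) * \<bar>v (n + m) x\<bar>" for n x
    have fH: "f n \<in> HF \<alpha>" for n unfolding f_def by (rule Hn_scaled_abs_le[OF \<alpha> v])
    have "Hn \<alpha> (f n) \<le> ennreal ((1 / 2) ^ m * (1 / 2) ^ n)" for n
    proof -
      have "Hn \<alpha> (f n) \<le> ennreal ((2 ^ (n + m))\<^sup>2) * Hn \<alpha> (v (n + m))"
        unfolding f_def by (rule Hn_scaled_abs_le[OF \<alpha> v])
      also have "\<dots> \<le> ennreal ((2 ^ (n + m))\<^sup>2) * ennreal ((1 / 8) ^ (n + m))" by (intro mult_left_mono small) simp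
      also have "\<dots> = ennreal ((2 ^ (n + m))\<^sup>2 * (1 / 8) ^ (n + m))" by (simp add: ennreal_mult)
      also have "(2 ^ (n + m))\<^sup>2 * (1 / 8) ^ (n + m) = ((2\<^sup>2 * (1 / 8)) ^ (n + m) :: real)"
        unfolding power_mult_distrib power_mult[symmetric] mult.commute[of 2] ..
      also have "\<dots> = (1 / 2) ^ m * (1 / 2) ^ n" by (simp add: power_add)
      finally show ?thesis .
    qed
    then have "(\<Sum>n. Hn \<alpha> (f n)) \<le> (\<Sum>n. ennreal ((1 / 2) ^ m * (1 / 2) ^ n))" by (intro suminf_le) auto
    also have "\<dots> = ennreal (2 * (1 / 2) ^ m)"
    proof (rule suminf_ennreal_eq)
      show "(\<lambda>n. (1 / 2) ^ m * (1 / 2) ^ n :: real) sums (2 * (1 / 2) ^ m)"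
        using sums_mult[OF geometric_sums[of "1 / 2 :: real"], of "(1 / 2) ^ m"] by (simp add: mult.commute)
    qed simp
    finally have S: "(\<Sum>n. Hn \<alpha> (f n)) \<le> ennreal (2 * (1 / 2) ^ m)" .
    have "AE x in lborel. x \<notin> ball 0 R \<longrightarrow> f n x = 0" for n
      using R(2)[of "n + m"] by eventually_elim (simp add: f_def)
    then have "\<exists>g\<in>HF \<alpha>. Hn \<alpha> g \<le> (\<Sum>n. Hn \<alpha> (f n)) \<and> (AE x in lborel. \<forall>n. f n x \<le> g x)"
      using S by (intro sup_HF[OF \<alpha> fH _ R(1)]) (auto simp: f_def intro: order_le_less_trans)
    then obtain g where g: "g \<in> HF \<alpha>" "Hn \<alpha> g \<le> (\<Sum>n. Hn \<alpha> (f n))" "AE x in lborel. \<forall>n. f n x \<le> g x" by blast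
    have "AE x in lborel. x \<in> W m \<longrightarrow> g x \<ge> 1"
      using g(3)
    proof eventually_elim
      case (elim x)
      show ?case
      proof
        assume "x \<in> W m"
        then obtain n where "(1 / 2) ^ (n + m) < \<bar>v (n + m) x\<bar>" by (auto simp: W_def)
        then have "2 ^ (n + m) * (1 / 2) ^ (n + m) \<le> f n x" unfolding f_def by (intro mult_left_mono) auto
        then have "1 \<le> f n x" by (simp add: power_mult_distrib[symmetric])
        then show "1 \<le> g x" using elim by (meson order_trans)
      qed
    qed
    then have "Cap_open \<alpha> (W m) \<le> ennreal (H_frac_normsq \<alpha> g)"
      unfolding Cap_open_def using g(1) HF_iff_H_frac[OF HF_L2_bd[OF g(1)]] by (intro INF_lower) simp
    then show ?thesis unfolding H_frac_normsq_eq(1)[OF g(1)] using g(2) S by order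
  qed
  \<comment> \<open>The exceptional set: the points where \<open>\<bar>v n x\<bar> > 2\<^sup>-\<^sup>n\<close> for infinitely many \<open>n\<close>.\<close>
  define N where "N = (\<Inter>m. W m)"
  have "Cap \<alpha> N \<le> ennreal (2 * (1 / 2) ^ m)" for m
  proof -
    have "Cap \<alpha> N \<le> Cap_open \<alpha> (W m)" unfolding Cap_def N_def using Wo by (intro INF_lower) auto
    with cap[of m] show ?thesis by order
  qed
  moreover have "(\<lambda>m. ennreal (2 * (1 / 2) ^ m)) \<longlonglongrightarrow> ennreal (2 * 0)"
    by (intro tendsto_ennrealI tendsto_mult_left LIMSEQ_power_zero) simp
  ultimately have "Cap \<alpha> N \<le> ennreal (2 * 0)" by (intro LIMSEQ_le_const) auto
  then have "Cap \<alpha> N = 0" by simp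
  moreover have "(\<lambda>n. v n x) \<longlonglongrightarrow> 0" if x: "x \<in> U - N" for x
  proof -
    obtain m where m: "x \<notin> W m" using x by (auto simp: N_def)
    have "\<forall>n\<ge>m. norm (v n x) \<le> (1 / 2) ^ n"
    proof (intro allI impI)
      fix n assume "m \<le> n"
      then show "norm (v n x) \<le> (1 / 2) ^ n" using m x by (auto simp: W_def not_less dest!: spec[of _ "n - m"])
    qed
    then have "eventually (\<lambda>n. norm (v n x) \<le> (1 / 2) ^ n) sequentially" by (auto simp: eventually_sequentially)
    then show ?thesis by (rule Lim_null_comparison) (simp add: LIMSEQ_power_zero)
  qed
  ultimately show ?thesis unfolding quasi_everywhere_def by blast
qed

text \<open>
  The parallelogram law bounds \<open>\<E>(U n - w, U n - w)\<close> by the excess of \<open>\<E>(U n, U n)\<close> once lower semicontinuity is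
  applied to the midpoints \<open>(U n + w) / 2\<close>.
\<close>

lemma energy_strong_convergence:
  fixes U :: "nat \<Rightarrow> 'a::euclidean_space \<Rightarrow> real"
  assumes \<alpha>: "0 < \<alpha>" "\<alpha> < 1" and U: "\<And>n. U n \<in> HF \<alpha>" and w: "w \<in> HF \<alpha>"
    and lim: "(\<lambda>n. l2sq (\<lambda>x. U n x - w x)) \<longlonglongrightarrow> 0"
    and le: "\<And>n. eform \<alpha> (U n) (U n) \<le> a n" and a: "a \<longlonglongrightarrow> eform \<alpha> w w"
  shows "(\<lambda>n. Hn \<alpha> (\<lambda>x. U n x - w x)) \<longlonglongrightarrow> 0"
proof -
  interpret E: semi_inner "HF \<alpha> :: ('a \<Rightarrow> real) set" "eform \<alpha>" by (rule eform_semi_inner)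
  let ?d = "\<lambda>n x. U n x - w x"
  have d: "?d n \<in> HF \<alpha>" for n by (rule E.diff_closed[OF U w])
  have "(\<lambda>n. eform \<alpha> (?d n) (?d n)) \<longlonglongrightarrow> 0"
  proof (rule ccontr)
    assume "\<not> ?thesis"
    then obtain e where e: "e > 0" "\<not> eventually (\<lambda>n. dist (eform \<alpha> (?d n) (?d n)) 0 < e) sequentially"
      by (auto simp: tendsto_iff)
    obtain s :: "nat \<Rightarrow> nat" where s: "strict_mono s" "\<And>n. \<not> dist (eform \<alpha> (?d (s n)) (?d (s n))) 0 < e"
      using not_eventually_sequentiallyD[OF e(2)] by blast
    define z where "z n x = (1 / 2) * U (s n) x + (1 / 2) * w x" for n x
    have z: "z n \<in> HF \<alpha>" for n unfolding z_def by (rule E.lincomb[OF U w])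
    have ez: "eform \<alpha> (z n) (z n) \<le> a (s n) / 2 + eform \<alpha> w w / 2 - e / 4" for n
    proof -
      have "e \<le> eform \<alpha> (?d (s n)) (?d (s n))" using s(2)[of n] E.nonneg[OF d[of "s n"]] by (simp add: dist_real_def)
      moreover have "eform \<alpha> (?d (s n)) (?d (s n)) = eform \<alpha> (U (s n)) (U (s n)) - 2 * eform \<alpha> (U (s n)) w + eform \<alpha> w w"
        by (rule E.diff_quad[OF U w])
      moreover have "eform \<alpha> (z n) (z n) = eform \<alpha> (U (s n)) (U (s n)) / 4 + eform \<alpha> (U (s n)) w / 2 + eform \<alpha> w w / 4"
        unfolding z_def E.quad[OF U w] by (simp add: power2_eq_square)
      ultimately show ?thesis using le[of "s n"] by linarith
    qed
    have "(\<lambda>n. a (s n)) \<longlonglongrightarrow> eform \<alpha> w w" using LIMSEQ_subseq_LIMSEQ[OF a s(1)] by (simp add: o_def)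
    then have la: "(\<lambda>n. a (s n) / 2 + eform \<alpha> w w / 2 - e / 4) \<longlonglongrightarrow> eform \<alpha> w w / 2 + eform \<alpha> w w / 2 - e / 4"
      by (intro tendsto_intros) auto
    have "energy \<alpha> w \<le> ennreal (eform \<alpha> w w / 2 + eform \<alpha> w w / 2 - e / 4)"
    proof (rule energy_lower_semicontinuous[OF \<alpha> HF_L2_bd[OF z] HF_L2_bd[OF w]])
      have [measurable]: "U n \<in> borel_measurable borel" "w \<in> borel_measurable borel" for n
        using HF_L2[OF U] HF_L2[OF w] by (auto intro: L2_spaceD)
      have "l2sq (\<lambda>x. z n x - w x) \<le> l2sq (?d (s n))" for n
        by (rule l2sq_mono_AE) (auto simp: z_def field_simps abs_mult)
      then show "(\<lambda>n. l2sq (\<lambda>x. z n x - w x)) \<longlonglongrightarrow> 0"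
        by (rule ennreal_squeeze_zero) (use LIMSEQ_subseq_LIMSEQ[OF lim s(1)] in \<open>simp add: o_def\<close>)
      show "energy \<alpha> (z n) \<le> ennreal (a (s n) / 2 + eform \<alpha> w w / 2 - e / 4)" for n
        unfolding eform_energy(1)[OF z, symmetric] by (rule ennreal_leI[OF ez])
      show "(\<lambda>n. ennreal (a (s n) / 2 + eform \<alpha> w w / 2 - e / 4)) \<longlonglongrightarrow> ennreal (eform \<alpha> w w / 2 + eform \<alpha> w w / 2 - e / 4)"
        by (rule tendsto_ennrealI[OF la])
    qed
    moreover have "0 \<le> eform \<alpha> w w / 2 + eform \<alpha> w w / 2 - e / 4"
      by (rule LIMSEQ_le_const[OF la]) (use order_trans[OF E.nonneg[OF z] ez] in auto)
    ultimately have "eform \<alpha> w w \<le> eform \<alpha> w w / 2 + eform \<alpha> w w / 2 - e / 4"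
      unfolding eform_energy(1)[OF w, symmetric] by simp
    then show False using e(1) by simp
  qed
  then have "(\<lambda>n. energy \<alpha> (?d n)) \<longlonglongrightarrow> ennreal 0"
    unfolding eform_energy(1)[OF d, symmetric] by (rule tendsto_ennrealI)
  then have "(\<lambda>n. energy \<alpha> (?d n) + l2sq (?d n)) \<longlonglongrightarrow> ennreal 0 + 0" by (intro tendsto_add lim)
  then show ?thesis by (simp add: Hn_def)
qed

lemma fast_subsequence:
  fixes X :: "nat \<Rightarrow> ennreal"
  assumes X: "X \<longlonglongrightarrow> 0" and e: "\<And>n. 0 < e n"
  shows "\<exists>t::nat \<Rightarrow> nat. strict_mono t \<and> (\<forall>n. X (t n) \<le> ennreal (e n))"
proof -
  have "\<exists>N. \<forall>k\<ge>N. X k < ennreal (e n)" for n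
    using order_tendstoD(2)[OF X, of "ennreal (e n)"] e[of n] by (auto simp: eventually_sequentially)
  then obtain N where N: "\<And>n k. N n \<le> k \<Longrightarrow> X k < ennreal (e n)" by metis
  \<comment> \<open>The partial sums dominate each \<open>N n\<close> and increase; adding \<open>n\<close> makes them strictly increasing.\<close>
  define t where "t n = n + (\<Sum>i\<le>n. N i)" for n
  have "strict_mono t" unfolding strict_mono_Suc_iff by (simp add: t_def)
  moreover have "N n \<le> t n" for n
  proof -
    have "N n \<le> (\<Sum>i\<le>n. N i)" by (rule member_le_sum) auto
    then show ?thesis by (simp add: t_def)
  qed
  then have "X (t n) \<le> ennreal (e n)" for n using N[of n "t n"] by (simp add: less_imp_le)
  ultimately show ?thesis by blast
qed

section \<open>Potentials blowing up off a subdomain\<close>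

lemma bounded_borel_nonneg_on_subset:
  assumes "bounded_borel_nonneg_on V f" "W \<subseteq> V"
  shows "bounded_borel_nonneg_on W f"
proof -
  have "f \<in> borel_measurable (restrict_space borel W)"
    using assms(1) by (intro measurable_restrict_mono[OF _ assms(2)]) (simp add: bounded_borel_nonneg_on_def)
  moreover have "bounded (f ` W)"
    using assms(1) by (intro bounded_subset[OF _ image_mono[OF assms(2)]]) (simp add: bounded_borel_nonneg_on_def)
  ultimately show ?thesis using assms unfolding bounded_borel_nonneg_on_def by blast
qed

lemma bounded_borel_nonneg_on_add:
  assumes "bounded_borel_nonneg_on V f" "bounded_borel_nonneg_on V g"
  shows "bounded_borel_nonneg_on V (\<lambda>x. f x + g x)"
  using assms bounded_plus_comp[of f V g] unfolding bounded_borel_nonneg_on_def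
  by (intro conjI ballI borel_measurable_add add_nonneg_nonneg) blast+

lemma bounded_borel_nonneg_on_1: "bounded_borel_nonneg_on V (\<lambda>x. 1)"
  by (auto simp: bounded_borel_nonneg_on_def image_constant_conv)

lemma ip_eq_pot: "ip u v = pot UNIV (\<lambda>x. 1) u v"
  by (simp add: pot_eq)

lemma pot_add:
  assumes "bounded_borel_nonneg_on V f" "bounded_borel_nonneg_on V g" "V \<in> sets borel" "u \<in> L2_space"
  shows "pot V (\<lambda>x. f x + g x) u u = pot V f u u + pot V g u u"
  unfolding pot_eq using pot_integrable[OF assms(1,3,4,4)] pot_integrable[OF assms(2,3,4,4)]
  by (simp add: distrib_left distrib_right)

lemma pot_mono:
  assumes "bounded_borel_nonneg_on V f" "bounded_borel_nonneg_on W g" "V \<in> sets borel" "W \<in> sets borel" "u \<in> L2_space"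
    and le: "\<And>x. indicator V x * f x \<le> indicator W x * g x"
  shows "pot V f u u \<le> pot W g u u"
  unfolding pot_eq using pot_integrable[OF assms(1,3,5,5)] pot_integrable[OF assms(2,4,5,5)] le
  by (intro integral_mono mult_right_mono) auto

context
  fixes \<alpha> :: real and D D\<^sub>0 :: "'a::euclidean_space set" and c :: "'a \<Rightarrow> real" and q :: "nat \<Rightarrow> 'a \<Rightarrow> real"
  assumes \<alpha>: "0 < \<alpha>" "\<alpha> < 1" and D: "open D" "bounded D"
    and lip: "lipschitz_domain D\<^sub>0" and clD: "closure D\<^sub>0 \<subseteq> D"
    and c: "bounded_borel_nonneg_on D c" and q: "\<And>k. bounded_borel_nonneg_on D (q k)"
    and inc: "\<And>x. x \<in> D \<Longrightarrow> incseq (\<lambda>k. q k x)"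
    and supp: "\<And>k. support_in D (q k) \<subseteq> D - closure D\<^sub>0"
    and blowup: "\<And>K. compact K \<Longrightarrow> K \<noteq> {} \<Longrightarrow> K \<subseteq> D - closure D\<^sub>0 \<Longrightarrow> filterlim (\<lambda>k. INF x\<in>K. q k x) at_top sequentially"
begin

abbreviation (input) "\<mu>k \<equiv> \<lambda>k. principal_eigenvalue \<alpha> D (\<lambda>x. c x + q k x)"
abbreviation (input) "\<mu>0 \<equiv> principal_eigenvalue \<alpha> D\<^sub>0 c"

lemma D0_sub: "D\<^sub>0 \<subseteq> D" using clD closure_subset by blast
lemma D0: "open D\<^sub>0" "bounded D\<^sub>0" and D0_ne: "D\<^sub>0 \<noteq> {}"
  using lip bounded_subset[OF D(2) D0_sub] by (auto simp: lipschitz_domain_def)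
lemma D_ne: "D \<noteq> {}" using D0_ne D0_sub by blast
lemma borel_sets: "D \<in> sets borel" "D\<^sub>0 \<in> sets borel" using D(1) D0(1) by auto

lemma cq: "bounded_borel_nonneg_on D (\<lambda>x. c x + q k x)" by (rule bounded_borel_nonneg_on_add[OF c q])
lemma c0: "bounded_borel_nonneg_on D\<^sub>0 c" by (rule bounded_borel_nonneg_on_subset[OF c D0_sub])

lemma q_zero: "x \<in> D\<^sub>0 \<Longrightarrow> q k x = 0"
  using supp[of k] closure_subset[of "{x \<in> D. q k x \<noteq> 0}"] closure_subset[of D\<^sub>0] D0_sub
  unfolding support_in_def by blast

lemma H0_sub: "H0_frac \<alpha> D\<^sub>0 \<subseteq> H0_frac \<alpha> D"
  using test_functions_mono[OF D0_sub] unfolding H0_frac_def by blast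

lemma pot_restrict:
  assumes u: "u \<in> L2_on D\<^sub>0" and f: "\<And>x. x \<in> D\<^sub>0 \<Longrightarrow> f x = c x" "bounded_borel_nonneg_on D f"
  shows "pot D f u u = pot D\<^sub>0 c u u"
  unfolding pot_eq
proof (rule integral_cong_AE)
  have "AE x in lborel. x \<notin> D\<^sub>0 \<longrightarrow> u x = 0" using u by (simp add: L2_on_def)
  then show "AE x in lborel. indicator D x * f x * (u x * u x) = indicator D\<^sub>0 x * c x * (u x * u x)"
    by eventually_elim (use f(1) D0_sub in \<open>auto simp: indicator_def\<close>)
qed (intro borel_measurable_integrable pot_integrable f(2) c0 borel_sets L2_on_L2[OF u])+

lemma rayleigh_restrict: "u \<in> H0_frac \<alpha> D\<^sub>0 \<Longrightarrow> rayleigh \<alpha> D (\<lambda>x. c x + q k x) u = rayleigh \<alpha> D\<^sub>0 c u"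
  unfolding rayleigh_def using pot_restrict[OF H0_on[OF \<alpha> D0] _ cq] q_zero by simp

lemma eigenvalue_incseq: "incseq (\<lambda>k. \<mu>k k)"
proof (rule monoI)
  fix j k :: nat assume jk: "j \<le> k"
  show "\<mu>k j \<le> \<mu>k k"
  proof (rule ev_greatest[OF \<alpha> D cq D_ne])
    fix u assume u: "u \<in> H0_frac \<alpha> D" "ip u u = 1"
    have "\<mu>k j \<le> rayleigh \<alpha> D (\<lambda>x. c x + q j x) u" by (rule ev_le[OF \<alpha> D cq u])
    also have "\<dots> \<le> rayleigh \<alpha> D (\<lambda>x. c x + q k x) u"
      unfolding rayleigh_def using incseqD[OF inc jk]
      by (intro add_left_mono pot_mono cq borel_sets H0_L2[OF \<alpha> D u(1)]) (auto simp: indicator_def)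
    finally show "\<mu>k j \<le> rayleigh \<alpha> D (\<lambda>x. c x + q k x) u" .
  qed
qed

lemma eigenvalue_upper_bound: "\<mu>k k \<le> \<mu>0"
proof (rule ev_greatest[OF \<alpha> D0 c0 D0_ne])
  fix u assume u: "u \<in> H0_frac \<alpha> D\<^sub>0" "ip u u = 1"
  have "\<mu>k k \<le> rayleigh \<alpha> D (\<lambda>x. c x + q k x) u" by (rule ev_le[OF \<alpha> D cq]) (use u H0_sub in auto)
  then show "\<mu>k k \<le> rayleigh \<alpha> D\<^sub>0 c u" by (simp only: rayleigh_restrict[OF u(1)])
qed

text \<open>
  On a compact set \<open>K\<close> off \<open>closure D\<^sub>0\<close> the mass of \<open>u k\<close> is at most \<open>C / inf\<^sub>K q\<^sub>k\<close>, so the limit has no mass there.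
\<close>

lemma limit_vanishes_off_closure:
  assumes u: "\<And>k. u k \<in> L2_space" and bd: "\<And>k. pot D (q k) (u k) (u k) \<le> C" and r: "strict_mono (r :: nat \<Rightarrow> nat)"
    and w: "w \<in> L2_space" and lim: "(\<lambda>n. l2sq (\<lambda>x. u (r n) x - w x)) \<longlonglongrightarrow> 0"
  shows "AE x in lborel. x \<in> D - closure D\<^sub>0 \<longrightarrow> w x = 0"
proof -
  have compact_zero: "AE x in lborel. x \<in> K \<longrightarrow> w x = 0" if K: "compact K" "K \<subseteq> D - closure D\<^sub>0" for K
  proof (cases "K = {}")
    case False
    have Kb: "K \<in> sets borel" using K(1) by (simp add: borel_compact)
    note one = bounded_borel_nonneg_on_1[of K]
    define m where "m k = (INF x\<in>K. q k x)" for k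
    have mle: "m k \<le> q k x" if "x \<in> K" for k x
      unfolding m_def using that K(2) q[of k]
      by (intro cINF_lower bdd_belowI2[where m = 0]) (auto simp: bounded_borel_nonneg_on_def)
    have m0: "0 \<le> m k" for k
      unfolding m_def using K(2) q[of k] False by (intro cINF_greatest) (auto simp: bounded_borel_nonneg_on_def)
    have mass: "m k * pot K (\<lambda>x. 1) (u k) (u k) \<le> C" for k
    proof -
      have int: "integrable lborel (\<lambda>x. m k * ((indicator K x * 1) * (u k x * u k x)))"
        using pot_integrable[OF one Kb u u] by simp
      have "m k * pot K (\<lambda>x. 1) (u k) (u k) = (LINT x|lborel. m k * ((indicator K x * 1) * (u k x * u k x)))"
        unfolding pot_eq by simp
      also have "\<dots> \<le> pot D (q k) (u k) (u k)"
        unfolding pot_eq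
      proof (rule integral_mono[OF int pot_integrable[OF q borel_sets(1) u u]])
        fix x
        have "m k * (indicator K x * 1) \<le> indicator D x * q k x"
          using mle[of x k] K(2) potential_nonneg[OF q[of k], of x] by (cases "x \<in> K") auto
        then have "m k * (indicator K x * 1) * (u k x * u k x) \<le> indicator D x * q k x * (u k x * u k x)"
          by (rule mult_right_mono) simp
        then show "m k * ((indicator K x * 1) * (u k x * u k x)) \<le> indicator D x * q k x * (u k x * u k x)"
          by (simp only: mult.assoc)
      qed
      finally show ?thesis using bd[of k] by simp
    qed
    have lp: "(\<lambda>n. pot K (\<lambda>x. 1) (u (r n)) (u (r n))) \<longlonglongrightarrow> pot K (\<lambda>x. 1) w w"
      by (rule pot_tendsto[OF one Kb u w lim])
    have lm: "filterlim (\<lambda>n. m (r n)) at_top sequentially"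
      using filterlim_compose[OF blowup[OF K(1) False K(2)] filterlim_subseq[OF r]] unfolding m_def .
    have "pot K (\<lambda>x. 1) w w \<le> 0"
    proof (rule ccontr)
      assume "\<not> ?thesis"
      then have "filterlim (\<lambda>n. pot K (\<lambda>x. 1) (u (r n)) (u (r n)) * m (r n)) at_top sequentially"
        by (intro filterlim_tendsto_pos_mult_at_top[OF lp _ lm]) simp
      then have "eventually (\<lambda>n. C < pot K (\<lambda>x. 1) (u (r n)) (u (r n)) * m (r n)) sequentially"
        by (simp add: filterlim_at_top_dense)
      then obtain n where "C < pot K (\<lambda>x. 1) (u (r n)) (u (r n)) * m (r n)"
        unfolding eventually_sequentially by blast
      with mass[of "r n"] show False by (simp add: mult.commute)
    qed
    then have "pot K (\<lambda>x. 1) w w = 0"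
      using semi_inner.nonneg[OF pot_semi_inner[OF one Kb] w] by linarith
    then have "(LINT x|lborel. (indicator K x * 1) * (w x * w x)) = 0" unfolding pot_eq .
    then have "AE x in lborel. (indicator K x * 1) * (w x * w x) = 0"
      using integral_nonneg_eq_0_iff_AE[OF pot_integrable[OF one Kb w w]] by simp
    then show ?thesis by eventually_elim (auto simp: indicator_def)
  qed simp
  have "open (D - closure D\<^sub>0)" using D(1) by auto
  then obtain K :: "nat \<Rightarrow> 'a set" where K: "\<And>n. compact (K n)" "\<And>n. K n \<subseteq> D - closure D\<^sub>0" "(\<Union>n. K n) = D - closure D\<^sub>0"
  proof (rule open_Union_compact_subsets)
    fix C :: "nat \<Rightarrow> 'a set"
    assume C: "\<And>n. compact (C n)" "\<And>n. C n \<subseteq> D - closure D\<^sub>0" "(\<Union>n. C n) = D - closure D\<^sub>0"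
    show thesis by (rule that[OF C])
  qed
  have "AE x in lborel. \<forall>n::nat. x \<in> K n \<longrightarrow> w x = 0"
    unfolding AE_all_countable by (intro allI compact_zero K)
  then show ?thesis unfolding K(3)[symmetric] by eventually_elim simp
qed

text \<open>
  Lower semicontinuity bounds the energy of the limit by \<open>l\<close> minus the limit of the potential terms for \<open>c\<close>; the terms for
  \<open>q k\<close> only help. If moreover \<open>l \<le> \<mu>0\<close>, then \<open>w\<close> cannot do better, so no energy is lost and the convergence is strong.
\<close>

lemma minimising_compactness:
  assumes u: "\<And>k. u k \<in> H0_frac \<alpha> D" "\<And>k. ip (u k) (u k) = 1" "\<And>k. rayleigh \<alpha> D (\<lambda>x. c x + q k x) (u k) \<le> L k"
    and L: "L \<longlonglongrightarrow> l"
  shows "\<exists>r w. strict_mono (r :: nat \<Rightarrow> nat) \<and> w \<in> H0_frac \<alpha> D\<^sub>0 \<and> ip w w = 1 \<and> rayleigh \<alpha> D\<^sub>0 c w \<le> l \<and>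
    (\<lambda>n. l2sq (\<lambda>x. u (r n) x - w x)) \<longlonglongrightarrow> 0 \<and> (\<mu>0 \<ge> l \<longrightarrow> (\<lambda>n. Hn \<alpha> (\<lambda>x. u (r n) x - w x)) \<longlonglongrightarrow> 0)"
proof -
  note uHF = H0_HF[OF \<alpha> D u(1)] and uL2 = H0_L2[OF \<alpha> D u(1)]
  interpret E: semi_inner "HF \<alpha> :: ('a \<Rightarrow> real) set" "eform \<alpha>" by (rule eform_semi_inner)
  have potnn: "0 \<le> pot D f v v" if "bounded_borel_nonneg_on D f" "v \<in> L2_space" for f v
    by (rule semi_inner.nonneg[OF pot_semi_inner[OF that(1) borel_sets(1)] that(2)])
  have split: "eform \<alpha> (u k) (u k) + pot D c (u k) (u k) + pot D (q k) (u k) (u k) \<le> L k" for k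
    using u(3)[of k] pot_add[OF c q[of k] borel_sets(1) uL2[of k]] by (simp add: rayleigh_def)
  obtain B where "\<And>k. norm (L k) \<le> B" using convergent_imp_Bseq[OF convergentI[OF L]] by (auto simp: Bseq_def)
  then have B: "L k \<le> max B 1" for k by (metis abs_le_iff le_max_iff_disj real_norm_def)
  obtain r w where r: "strict_mono r" and wD: "w \<in> L2_on D" and lim: "(\<lambda>n. l2sq (\<lambda>x. u (r n) x - w x)) \<longlonglongrightarrow> 0"
  proof (rule rellich[OF \<alpha> D H0_on[OF \<alpha> D u(1)]])
    fix n
    have "eform \<alpha> (u n) (u n) \<le> max B 1"
      using split[of n] B[of n] potnn[OF c uL2[of n]] potnn[OF q[of n] uL2[of n]] by linarith
    then show "energy \<alpha> (u n) \<le> ennreal (max B 1)" unfolding eform_energy(1)[OF uHF, symmetric] by (rule ennreal_leI)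
    show "l2sq (u n) \<le> ennreal (max B 1)" unfolding ip_l2sq[OF uL2, symmetric] u(2) by (intro ennreal_leI) simp
  qed (rule that)
  have wL2: "w \<in> L2_space" by (rule L2_on_L2[OF wD])
  have "(\<lambda>n. ip (u (r n)) (u (r n))) \<longlonglongrightarrow> ip w w"
    unfolding ip_eq_pot by (rule pot_tendsto[OF bounded_borel_nonneg_on_1 _ uL2 wL2 lim]) simp
  then have w1: "ip w w = 1" unfolding u(2) by (simp add: LIMSEQ_const_iff)
  let ?p = "pot D c w w" and ?a = "\<lambda>n. L (r n) - pot D c (u (r n)) (u (r n))"
  have lp: "(\<lambda>n. pot D c (u (r n)) (u (r n))) \<longlonglongrightarrow> ?p" by (rule pot_tendsto[OF c borel_sets(1) uL2 wL2 lim])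
  have la: "?a \<longlonglongrightarrow> l - ?p" by (intro tendsto_diff lp LIMSEQ_subseq_LIMSEQ[OF L r, unfolded o_def])
  have ea: "eform \<alpha> (u k) (u k) \<le> L k - pot D c (u k) (u k)" for k
    using split[of k] potnn[OF q[of k] uL2[of k]] by simp
  have wbd: "w \<in> L2_bd" by (rule L2_on_bd[OF D(2) wD])
  have ew: "energy \<alpha> w \<le> ennreal (l - ?p)"
  proof (rule energy_lower_semicontinuous[OF \<alpha> HF_L2_bd[OF uHF] wbd lim])
    show "energy \<alpha> (u (r n)) \<le> ennreal (?a n)" for n
      unfolding eform_energy(1)[OF uHF, symmetric] by (rule ennreal_leI[OF ea])
    show "(\<lambda>n. ennreal (?a n)) \<longlonglongrightarrow> ennreal (l - ?p)" by (rule tendsto_ennrealI[OF la])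
  qed
  have wHF: "w \<in> HF \<alpha>" using wbd ew by (auto simp: HF_def intro: order_le_less_trans)
  have "0 \<le> l - ?p" by (rule LIMSEQ_le_const[OF la]) (use order_trans[OF E.nonneg[OF uHF] ea] in blast)
  then have ewl: "eform \<alpha> w w \<le> l - ?p" using ew unfolding eform_energy(1)[OF wHF, symmetric] by simp
  have "AE x in lborel. x \<in> D - closure D\<^sub>0 \<longrightarrow> w x = 0"
  proof (rule limit_vanishes_off_closure[OF uL2 _ r wL2 lim])
    show "pot D (q k) (u k) (u k) \<le> max B 1" for k
      using split[of k] B[of k] potnn[OF c uL2, of k] E.nonneg[OF uHF, of k] by linarith
  qed
  moreover have "AE x in lborel. x \<notin> D \<longrightarrow> w x = 0" using wD by (simp add: L2_on_def)
  ultimately have "AE x in lborel. x \<notin> closure D\<^sub>0 \<longrightarrow> w x = 0" by eventually_elim auto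
  then have wH: "w \<in> H0_frac \<alpha> D\<^sub>0" by (rule lipschitz_domain_H0[OF \<alpha> D0 lip wHF])
  have p0: "?p = pot D\<^sub>0 c w w" by (rule pot_restrict[OF H0_on[OF \<alpha> D0 wH] _ c]) simp
  have ray: "rayleigh \<alpha> D\<^sub>0 c w \<le> l" using ewl unfolding rayleigh_def p0 by simp
  have "(\<lambda>n. Hn \<alpha> (\<lambda>x. u (r n) x - w x)) \<longlonglongrightarrow> 0" if "l \<le> \<mu>0"
  proof -
    have "\<mu>0 \<le> rayleigh \<alpha> D\<^sub>0 c w" by (rule ev_le[OF \<alpha> D0 c0 wH w1])
    then have "eform \<alpha> w w = l - ?p" using that ewl unfolding rayleigh_def p0 by simp
    with la show ?thesis by (intro energy_strong_convergence[OF \<alpha> uHF wHF lim ea]) simp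
  qed
  with r wH w1 ray lim show ?thesis by blast
qed

text \<open>
  Near-minimisers for \<open>\<mu>k\<close> have a limit that competes for \<open>\<mu>0\<close> with a Rayleigh quotient at most \<open>lim \<mu>k\<close>.
\<close>

lemma eigenvalue_limit: "(\<lambda>k. \<mu>k k) \<longlonglongrightarrow> \<mu>0"
proof -
  obtain l where l: "(\<lambda>k. \<mu>k k) \<longlonglongrightarrow> l"
    using incseq_convergent[OF eigenvalue_incseq] eigenvalue_upper_bound by blast
  have "\<exists>u. u \<in> H0_frac \<alpha> D \<and> ip u u = 1 \<and> rayleigh \<alpha> D (\<lambda>x. c x + q k x) u < \<mu>k k + inverse (real (Suc k))" for k
    using ev_approx[OF \<alpha> D cq D_ne, of "inverse (real (Suc k))" k] by (metis inverse_positive_iff_positive of_nat_0_less_iff zero_less_Suc)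
  then obtain u where u: "\<And>k. u k \<in> H0_frac \<alpha> D" "\<And>k. ip (u k) (u k) = 1"
      "\<And>k. rayleigh \<alpha> D (\<lambda>x. c x + q k x) (u k) < \<mu>k k + inverse (real (Suc k))"
    by metis
  have L: "(\<lambda>k. \<mu>k k + inverse (real (Suc k))) \<longlonglongrightarrow> l" using tendsto_add[OF l LIMSEQ_inverse_real_of_nat] by simp
  obtain w where "w \<in> H0_frac \<alpha> D\<^sub>0" "ip w w = 1" "rayleigh \<alpha> D\<^sub>0 c w \<le> l"
    using minimising_compactness[OF u(1,2) less_imp_le[OF u(3)] L] by blast
  then have "\<mu>0 \<le> l" using ev_le[OF \<alpha> D0 c0] by (metis order_trans)
  moreover have "l \<le> \<mu>0" by (rule LIMSEQ_le_const2[OF l]) (use eigenvalue_upper_bound in blast)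
  ultimately show ?thesis using l by simp
qed

text \<open>
  A limit of positive eigenfunctions is a nonnegative minimiser, hence \<open>\<psi>\<close>. The convergence holds in \<open>H\<^sup>\<alpha>\<close> and so, along a fast
  subsequence, quasi-everywhere.
\<close>

lemma eigenfunction_quasi_everywhere:
  assumes \<psi>k: "\<And>k. is_principal_eigenfunction \<alpha> D (\<lambda>x. c x + q k x) (\<psi>k k)"
    and \<psi>: "is_principal_eigenfunction \<alpha> D\<^sub>0 c \<psi>"
  shows "\<exists>s :: nat \<Rightarrow> nat. strict_mono s \<and> quasi_everywhere \<alpha> D\<^sub>0 (\<lambda>x. (\<lambda>n. \<psi>k (s n) x) \<longlonglongrightarrow> \<psi> x)"
proof -
  have eig: "eigenfunction \<alpha> D (\<lambda>x. c x + q k x) (\<mu>k k) (\<psi>k k)" and contk: "continuous_on D (\<psi>k k)"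
    and posk: "\<And>x. x \<in> D \<Longrightarrow> \<psi>k k x > 0" and zerok: "\<And>x. x \<notin> D \<Longrightarrow> \<psi>k k x = 0" and normk: "L2_inner D (\<psi>k k) (\<psi>k k) = 1" for k
    using \<psi>k[of k] by (auto simp: is_principal_eigenfunction_def)
  have eig0: "eigenfunction \<alpha> D\<^sub>0 c \<mu>0 \<psi>" and cont0: "continuous_on D\<^sub>0 \<psi>" and zero0: "\<And>x. x \<notin> D\<^sub>0 \<Longrightarrow> \<psi> x = 0"
    using \<psi> by (auto simp: is_principal_eigenfunction_def)
  note weak = eigenfunction_weak[OF \<alpha> D cq eig]
  have \<psi>H: "\<psi>k k \<in> H0_frac \<alpha> D" for k by (rule weak(1))
  have \<psi>0H: "\<psi> \<in> H0_frac \<alpha> D\<^sub>0" by (rule eigenfunction_weak(1)[OF \<alpha> D0 c0 eig0])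
  have \<psi>1: "ip (\<psi>k k) (\<psi>k k) = 1" for k
    using L2_inner_on(1)[OF borel_sets(1) H0_L2[OF \<alpha> D \<psi>H] H0_on[OF \<alpha> D \<psi>H], of k k] normk[of k] by simp
  have ray: "rayleigh \<alpha> D (\<lambda>x. c x + q k x) (\<psi>k k) \<le> \<mu>k k" for k
    using weak(2)[OF \<psi>H, of k k] \<psi>1[of k] by (simp add: rayleigh_def)
  obtain r :: "nat \<Rightarrow> nat" and w where r: "strict_mono r" and w: "w \<in> H0_frac \<alpha> D\<^sub>0" "ip w w = 1" "rayleigh \<alpha> D\<^sub>0 c w \<le> \<mu>0"
    and lim: "(\<lambda>n. l2sq (\<lambda>x. \<psi>k (r n) x - w x)) \<longlonglongrightarrow> 0" "(\<lambda>n. Hn \<alpha> (\<lambda>x. \<psi>k (r n) x - w x)) \<longlonglongrightarrow> 0"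
    using minimising_compactness[OF \<psi>H \<psi>1 ray eigenvalue_limit] by blast
  have [measurable]: "w \<in> borel_measurable borel" "\<psi> \<in> borel_measurable borel" "\<psi>k k \<in> borel_measurable borel" for k
    using H0_L2[OF \<alpha> D0 w(1)] H0_L2[OF \<alpha> D0 \<psi>0H] H0_L2[OF \<alpha> D \<psi>H] by (auto intro: L2_spaceD)
  have nonneg: "0 \<le> \<psi>k k x" for k x using posk[of x k] zerok[of x k] by (cases "x \<in> D") auto
  \<comment> \<open>The negative part of \<open>w\<close> is at most its distance to a nonnegative function.\<close>
  have "l2sq (\<lambda>x. min (w x) 0) \<le> l2sq (\<lambda>x. \<psi>k (r n) x - w x)" for n
  proof (rule l2sq_mono_AE, rule AE_I2)
    show "norm (min (w x) 0) \<le> norm (\<psi>k (r n) x - w x)" for x using nonneg[of "r n" x] by (auto simp: min_def)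
  qed
  then have "l2sq (\<lambda>x. min (w x) 0) \<le> 0" by (intro LIMSEQ_le_const[OF lim(1)]) auto
  then have "AE x in lborel. min (w x) 0 = 0" by (subst l2sq_eq_0_iff[symmetric]) auto
  then have w0: "AE x in lborel. 0 \<le> w x" by eventually_elim (auto simp: min_def split: if_splits)
  have "rayleigh \<alpha> D\<^sub>0 c w = \<mu>0" using w(3) ev_le[OF \<alpha> D0 c0 w(1,2)] by simp
  then have w\<psi>: "AE x in lborel. w x = \<psi> x" by (intro ground_state_unique[OF \<alpha> D0 c0 lip w(1,2) _ w0 \<psi>])
  have cong: "Hn \<alpha> (\<lambda>x. \<psi>k k x - w x) = Hn \<alpha> (\<lambda>x. \<psi>k k x - \<psi> x)" for k
  proof -
    have ae: "AE x in lborel. \<psi>k k x - w x = \<psi>k k x - \<psi> x" using w\<psi> by eventually_elim simp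
    show ?thesis unfolding Hn_def l2sq_cong_AE[OF ae] by (subst energy_cong_AE[OF ae]) auto
  qed
  have lim\<psi>: "(\<lambda>n. Hn \<alpha> (\<lambda>x. \<psi>k (r n) x - \<psi> x)) \<longlonglongrightarrow> 0" using lim(2) unfolding cong .
  obtain t :: "nat \<Rightarrow> nat" where t: "strict_mono t" "\<And>n. Hn \<alpha> (\<lambda>x. \<psi>k (r (t n)) x - \<psi> x) \<le> ennreal ((1 / 8) ^ n)"
    using fast_subsequence[OF lim\<psi>, of "\<lambda>n. (1 / 8) ^ n"] by auto
  obtain R where R: "R > 0" "D \<subseteq> ball 0 R" using bounded_subset_ballD[OF D(2)] by blast
  have "quasi_everywhere \<alpha> D\<^sub>0 (\<lambda>x. (\<lambda>n. \<psi>k (r (t n)) x - \<psi> x) \<longlonglongrightarrow> 0)"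
  proof (rule quasi_everywhere_tendsto_zero[OF \<alpha> _ D0(1) _ R(1) _ t(2)])
    fix n
    show "(\<lambda>x. \<psi>k (r (t n)) x - \<psi> x) \<in> HF \<alpha>" by (intro HF_diff[OF \<alpha>] H0_HF[OF \<alpha> D \<psi>H] H0_HF[OF \<alpha> D0 \<psi>0H])
    show "continuous_on D\<^sub>0 (\<lambda>x. \<psi>k (r (t n)) x - \<psi> x)"
      by (intro continuous_on_diff cont0 continuous_on_subset[OF contk D0_sub])
    show "AE x in lborel. x \<notin> ball 0 R \<longrightarrow> \<psi>k (r (t n)) x - \<psi> x = 0"
      using zerok zero0 R(2) D0_sub by (intro AE_I2) (metis diff_self subsetD)
  qed
  then have "quasi_everywhere \<alpha> D\<^sub>0 (\<lambda>x. (\<lambda>n. \<psi>k (r (t n)) x) \<longlonglongrightarrow> \<psi> x)"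
    by (simp only: quasi_everywhere_def LIM_zero_iff)
  moreover have "strict_mono (\<lambda>n. r (t n))" using strict_mono_o[OF r t(1)] by (simp add: o_def)
  ultimately show ?thesis by blast
qed

end

theorem theorem3p1:
  fixes \<alpha> :: real
    and D D\<^sub>0 :: "'a::euclidean_space set"
    and b c :: "'a \<Rightarrow> real"
    and q :: "nat \<Rightarrow> 'a \<Rightarrow> real"
  assumes "DIM('a) \<ge> 2" and "0 < \<alpha>" and "\<alpha> < 1"
    and "bounded D" and "lipschitz_domain D"
    and "bounded_borel_nonneg_on D b"
    and "(LINT x:D|lborel. b x) > 0"
    and "lipschitz_domain D\<^sub>0" and "D\<^sub>0 \<subseteq> D"
    and "{x \<in> D. b x = 0} = closure D\<^sub>0"
    and "\<And>K. compact K \<Longrightarrow> K \<noteq> {} \<Longrightarrow> K \<subseteq> D - closure D\<^sub>0 \<Longrightarrow> (INF x\<in>K. b x) > 0"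
    and "bounded_borel_nonneg_on D c"
    and "\<And>k. bounded_borel_nonneg_on D (q k)"
    and "\<And>x. x \<in> D \<Longrightarrow> incseq (\<lambda>k. q k x)"
    and "\<And>k. support_in D (q k) \<subseteq> D - closure D\<^sub>0"
    and "\<And>K. compact K \<Longrightarrow> K \<noteq> {} \<Longrightarrow> K \<subseteq> D - closure D\<^sub>0 \<Longrightarrow>
           incseq (\<lambda>k. INF x\<in>K. q k x) \<and> filterlim (\<lambda>k. INF x\<in>K. q k x) at_top sequentially"
  shows "incseq (\<lambda>k. principal_eigenvalue \<alpha> D (\<lambda>x. c x + q k x)) \<and>
         (\<lambda>k. principal_eigenvalue \<alpha> D (\<lambda>x. c x + q k x)) \<longlonglongrightarrow> principal_eigenvalue \<alpha> D\<^sub>0 c \<and>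
         (\<forall>\<psi>\<^sub>k \<psi>. (\<forall>k. is_principal_eigenfunction \<alpha> D (\<lambda>x. c x + q k x) (\<psi>\<^sub>k k)) \<longrightarrow>
            is_principal_eigenfunction \<alpha> D\<^sub>0 c \<psi> \<longrightarrow>
            (\<exists>s :: nat \<Rightarrow> nat. strict_mono s \<and>
               quasi_everywhere \<alpha> D\<^sub>0 (\<lambda>x. (\<lambda>n. \<psi>\<^sub>k (s n) x) \<longlonglongrightarrow> \<psi> x)))"
proof -
  have D: "open D" using assms(5) by (simp add: lipschitz_domain_def)
  have cl: "closure D\<^sub>0 \<subseteq> D" using assms(10) by blast
  note hyp = assms(2,3) D assms(4,8) cl assms(12,13,14,15) conjunct2[OF assms(16)]
  show ?thesis
    using eigenvalue_incseq[of \<alpha> D D\<^sub>0 c q, OF hyp] eigenvalue_limit[of \<alpha> D D\<^sub>0 c q, OF hyp]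
      eigenfunction_quasi_everywhere[of \<alpha> D D\<^sub>0 c q, OF hyp]
    by blast
qed

end
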